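(* Suppose $g$ and $\tilde g$ are c-projectively equivalent Kähler-Einstein metrics of arbitrary signature on a closed connected complex manifold $(M,J)$ of real dimension $2n\ge 4$. Then $g$ and $\tilde g$ are affinely equivalent unless $(M,g,J)$ is $(\mathbb{C}P(n),\mathrm{const}\cdot g_{FS},J_{standard})$.
   Context: All manifolds, metrics and tensor fields are smooth; closed means compact without boundary. A pseudo-Riemannian metric $g$ on a complex manifold $(M,J)$ is Kähler (with respect to $J$) if $g(J\cdot,J\cdot)=g$ and $\nabla J=0$, where $\nabla$ is the Levi-Civita connection of $g$. It is Kähler-Einstein if moreover $\mathrm{Ric}(g)=\tfrac{\mathrm{Scal}(g)}{2n}g$ with $\mathrm{Scal}(g)$ constant. A regular curve $\gamma$ is $J$-planar for $(g,J)$ if $(\nabla_{\dot\gamma}\dot\gamma)\wedge\dot\gamma\wedge J\dot\gamma=0$ at each point of the curve. Two metrics on $(M,J)$ that are Kähler with respect to $J$ are c-projectively equivalent if their $J$-planar curves coincide; they are affinely equivalent if their Levi-Civita connections coincide. $g_{FS}$ is the Fubini-Study metric and $J_{standard}$ the standard complex structure on $\mathbb{C}P(n)$; $\mathrm{const}$ is a nonzero real constant, and "is" means isomorphic as a Kähler manifold (via a diffeomorphism preserving metric and complex structure). *)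

theory Defs
  imports "HOL-Analysis.Analysis"
begin

section \<open>Smooth maps and complex manifolds\<close>

text \<open>\<^term>\<open>Ck_on k f S\<close> is meant for open \<^term>\<open>S\<close>: all iterated directional derivatives of
  order at most \<^term>\<open>k\<close> exist as Frechet derivatives and are continuous on \<^term>\<open>S\<close>.\<close>

primrec Ck_on ::
    "nat \<Rightarrow> ('a::euclidean_space \<Rightarrow> 'b::euclidean_space) \<Rightarrow> 'a set \<Rightarrow> bool" where
  "Ck_on 0 f S \<longleftrightarrow> continuous_on S f"
| "Ck_on (Suc k) f S \<longleftrightarrow>
     (\<forall>x\<in>S. f differentiable (at x)) \<and>
     (\<forall>v. Ck_on k (\<lambda>x. frechet_derivative f (at x) v) S)"

definition smooth_on ::
    "('a::euclidean_space \<Rightarrow> 'b::euclidean_space) \<Rightarrow> 'a set \<Rightarrow> bool" where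
  "smooth_on f S \<longleftrightarrow> (\<forall>k. Ck_on k f S)"

type_synonym ('m, 'n) chart = "'m set \<times> ('m \<Rightarrow> complex ^ 'n)"

record ('m, 'n::finite) charted =
  mtop :: "'m topology"
  atlas :: "('m, 'n) chart set"

definition chart_image :: "('m, 'n::finite) chart \<Rightarrow> (complex ^ 'n) set" where
  "chart_image c = snd c ` fst c"

definition chart_rep ::
    "('m \<Rightarrow> 'k) \<Rightarrow> ('m, 'n::finite) chart \<Rightarrow> ('k, 'l::finite) chart \<Rightarrow>
     complex ^ 'n \<Rightarrow> complex ^ 'l" where
  "chart_rep f c d = snd d \<circ> f \<circ> inv_into (fst c) (snd c)"

definition chart_rep_dom ::
    "('m \<Rightarrow> 'k) \<Rightarrow> ('m, 'n::finite) chart \<Rightarrow> ('k, 'l::finite) chart \<Rightarrow> (complex ^ 'n) set" where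
  "chart_rep_dom f c d = snd c ` (fst c \<inter> f -` fst d)"

text \<open>The complex structure is read in holomorphic charts, where its components are the constant
  endomorphism ``multiplication by \<^term>\<open>\<i>\<close>''. The real vector space \<^typ>\<open>complex ^ 'n\<close> has
  dimension \<open>2 * CARD('n)\<close>.\<close>

definition J :: "complex ^ 'n::finite \<Rightarrow> complex ^ 'n" where
  "J v = \<i> *s v"

definition J_linear_on ::
    "(complex ^ 'n::finite \<Rightarrow> complex ^ 'l::finite) \<Rightarrow> (complex ^ 'n) set \<Rightarrow> bool" where
  "J_linear_on f S \<longleftrightarrow>
     (\<forall>x\<in>S. \<forall>v. frechet_derivative f (at x) (J v) = J (frechet_derivative f (at x) v))"

definition complex_manifold :: "('m, 'n::finite) charted \<Rightarrow> bool" where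
  "complex_manifold M \<longleftrightarrow>
     Hausdorff_space (mtop M) \<and> second_countable (mtop M) \<and>
     topspace (mtop M) = (\<Union>c\<in>atlas M. fst c) \<and>
     (\<forall>c\<in>atlas M. openin (mtop M) (fst c) \<and> open (chart_image c) \<and>
        homeomorphic_map (subtopology (mtop M) (fst c)) (top_of_set (chart_image c)) (snd c)) \<and>
     (\<forall>c\<in>atlas M. \<forall>d\<in>atlas M.
        smooth_on (chart_rep id c d) (chart_rep_dom id c d) \<and>
        J_linear_on (chart_rep id c d) (chart_rep_dom id c d))"

definition smooth_map ::
    "('m, 'n::finite) charted \<Rightarrow> ('k, 'l::finite) charted \<Rightarrow> ('m \<Rightarrow> 'k) \<Rightarrow> bool" where
  "smooth_map M N f \<longleftrightarrow>
     continuous_map (mtop M) (mtop N) f \<and>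
     (\<forall>c\<in>atlas M. \<forall>d\<in>atlas N. smooth_on (chart_rep f c d) (chart_rep_dom f c d))"


section \<open>Pseudo-Riemannian metrics and the Levi-Civita connection\<close>

text \<open>A metric is given by its components: \<open>g c x u v\<close> is the value at the point with
  \<open>c\<close>-coordinates \<open>x\<close> on the tangent vectors with \<open>c\<close>-components \<open>u\<close> and \<open>v\<close>.\<close>

type_synonym 'n local_metric = "complex ^ 'n \<Rightarrow> complex ^ 'n \<Rightarrow> complex ^ 'n \<Rightarrow> real"
type_synonym ('m, 'n) metric = "('m, 'n) chart \<Rightarrow> 'n local_metric"

definition isometric ::
    "('m \<Rightarrow> 'k) \<Rightarrow> ('m, 'n::finite) charted \<Rightarrow> ('m, 'n) metric \<Rightarrow>
     ('k, 'l::finite) charted \<Rightarrow> ('k, 'l) metric \<Rightarrow> bool" where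
  "isometric f M g N h \<longleftrightarrow>
     (\<forall>c\<in>atlas M. \<forall>d\<in>atlas N. \<forall>x\<in>chart_rep_dom f c d. \<forall>u v.
        h d (chart_rep f c d x)
            (frechet_derivative (chart_rep f c d) (at x) u)
            (frechet_derivative (chart_rep f c d) (at x) v) = g c x u v)"

text \<open>Preservation by the identity map is the transformation law of a \<open>(0,2)\<close>-tensor.\<close>

definition pseudo_riemannian :: "('m, 'n::finite) charted \<Rightarrow> ('m, 'n) metric \<Rightarrow> bool" where
  "pseudo_riemannian M g \<longleftrightarrow>
     isometric id M g M g \<and>
     (\<forall>c\<in>atlas M.
        (\<forall>u v. smooth_on (\<lambda>x. g c x u v) (chart_image c)) \<and>
        (\<forall>x\<in>chart_image c.
           bilinear (g c x) \<and>
           (\<forall>u v. g c x u v = g c x v u) \<and>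
           (\<forall>u. (\<forall>v. g c x u v = 0) \<longrightarrow> u = 0)))"

text \<open>\<open>christoffel G x u v\<close> has the components \<open>\<Gamma>\<^sup>k\<^sub>i\<^sub>j u\<^sup>i v\<^sup>j\<close>, so that \<open>\<nabla>\<^sub>u v = \<partial>\<^sub>u v + \<Gamma>(u, v)\<close>; the
  conditions express that \<open>\<nabla>\<close> is torsion-free and that \<open>\<nabla>G = 0\<close>.\<close>

definition is_christoffel ::
    "'n::finite local_metric \<Rightarrow> complex ^ 'n \<Rightarrow> (complex ^ 'n \<Rightarrow> complex ^ 'n \<Rightarrow> complex ^ 'n) \<Rightarrow> bool"
  where
  "is_christoffel G x \<Gamma> \<longleftrightarrow>
     bilinear \<Gamma> \<and>
     (\<forall>u v. \<Gamma> u v = \<Gamma> v u) \<and>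
     (\<forall>u v w. frechet_derivative (\<lambda>y. G y u v) (at x) w = G x (\<Gamma> w u) v + G x u (\<Gamma> w v))"

definition christoffel ::
    "'n::finite local_metric \<Rightarrow> complex ^ 'n \<Rightarrow> complex ^ 'n \<Rightarrow> complex ^ 'n \<Rightarrow> complex ^ 'n" where
  "christoffel G x = (THE \<Gamma>. is_christoffel G x \<Gamma>)"

definition affinely_equivalent ::
    "('m, 'n::finite) charted \<Rightarrow> ('m, 'n) metric \<Rightarrow> ('m, 'n) metric \<Rightarrow> bool" where
  "affinely_equivalent M g h \<longleftrightarrow>
     (\<forall>c\<in>atlas M. \<forall>x\<in>chart_image c. christoffel (g c) x = christoffel (h c) x)"


section \<open>Kaehler and Kaehler-Einstein metrics\<close>

text \<open>Since the components of \<^const>\<open>J\<close> are constant, \<open>(\<nabla>\<^sub>u J) v = \<Gamma>(u, J v) - J \<Gamma>(u, v)\<close>.\<close>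

definition kaehler :: "('m, 'n::finite) charted \<Rightarrow> ('m, 'n) metric \<Rightarrow> bool" where
  "kaehler M g \<longleftrightarrow>
     pseudo_riemannian M g \<and>
     (\<forall>c\<in>atlas M. \<forall>x\<in>chart_image c. \<forall>u v.
        g c x (J u) (J v) = g c x u v \<and>
        christoffel (g c) x u (J v) - J (christoffel (g c) x u v) = 0)"

definition riemann ::
    "'n::finite local_metric \<Rightarrow> complex ^ 'n \<Rightarrow>
     complex ^ 'n \<Rightarrow> complex ^ 'n \<Rightarrow> complex ^ 'n \<Rightarrow> complex ^ 'n" where
  "riemann G x u v w =
     frechet_derivative (\<lambda>y. christoffel G y v w) (at x) u
     - frechet_derivative (\<lambda>y. christoffel G y u w) (at x) v
     + christoffel G x u (christoffel G x v w)
     - christoffel G x v (christoffel G x u w)"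

definition real_trace :: "('a::euclidean_space \<Rightarrow> 'a) \<Rightarrow> real" where
  "real_trace f = (\<Sum>b\<in>Basis. f b \<bullet> b)"

definition ricci :: "'n::finite local_metric \<Rightarrow> 'n local_metric" where
  "ricci G x v w = real_trace (\<lambda>u. riemann G x u v w)"

definition scal :: "'n::finite local_metric \<Rightarrow> complex ^ 'n \<Rightarrow> real" where
  "scal G x = real_trace (THE A. \<forall>v w. G x (A v) w = ricci G x v w)"

definition kaehler_einstein :: "('m, 'n::finite) charted \<Rightarrow> ('m, 'n) metric \<Rightarrow> bool" where
  "kaehler_einstein M g \<longleftrightarrow>
     kaehler M g \<and>
     (\<forall>c\<in>atlas M. \<forall>x\<in>chart_image c. \<forall>u v.
        ricci (g c) x u v = scal (g c) x / real (2 * CARD('n)) * g c x u v) \<and>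
     (\<exists>s. \<forall>c\<in>atlas M. \<forall>x\<in>chart_image c. scal (g c) x = s)"


section \<open>J-planar curves and c-projective equivalence\<close>

definition regular_curve :: "('m, 'n::finite) charted \<Rightarrow> real set \<Rightarrow> (real \<Rightarrow> 'm) \<Rightarrow> bool" where
  "regular_curve M I \<gamma> \<longleftrightarrow>
     open I \<and> is_interval I \<and> continuous_map (top_of_set I) (mtop M) \<gamma> \<and>
     (\<forall>c\<in>atlas M.
        smooth_on (snd c \<circ> \<gamma>) (I \<inter> \<gamma> -` fst c) \<and>
        (\<forall>t\<in>I \<inter> \<gamma> -` fst c. vector_derivative (snd c \<circ> \<gamma>) (at t) \<noteq> 0))"

text \<open>Components of the trivector \<open>u \<and> v \<and> w\<close> with respect to basis vectors \<open>i\<close>, \<open>j\<close>, \<open>k\<close>.\<close>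

definition wedge3 :: "'a::euclidean_space \<Rightarrow> 'a \<Rightarrow> 'a \<Rightarrow> 'a \<Rightarrow> 'a \<Rightarrow> 'a \<Rightarrow> real" where
  "wedge3 u v w i j k =
     det (vector [vector [u \<bullet> i, u \<bullet> j, u \<bullet> k],
                  vector [v \<bullet> i, v \<bullet> j, v \<bullet> k],
                  vector [w \<bullet> i, w \<bullet> j, w \<bullet> k]] :: real ^ 3 ^ 3)"

definition velocity :: "(real \<Rightarrow> complex ^ 'n::finite) \<Rightarrow> real \<Rightarrow> complex ^ 'n" where
  "velocity x t = vector_derivative x (at t)"

definition acceleration ::
    "'n::finite local_metric \<Rightarrow> (real \<Rightarrow> complex ^ 'n) \<Rightarrow> real \<Rightarrow> complex ^ 'n" where
  "acceleration G x t =
     vector_derivative (velocity x) (at t) + christoffel G (x t) (velocity x t) (velocity x t)"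

definition J_planar ::
    "('m, 'n::finite) charted \<Rightarrow> ('m, 'n) metric \<Rightarrow> real set \<Rightarrow> (real \<Rightarrow> 'm) \<Rightarrow> bool" where
  "J_planar M g I \<gamma> \<longleftrightarrow>
     regular_curve M I \<gamma> \<and>
     (\<forall>c\<in>atlas M. \<forall>t\<in>I \<inter> \<gamma> -` fst c. \<forall>i\<in>Basis. \<forall>j\<in>Basis. \<forall>k\<in>Basis.
        wedge3 (acceleration (g c) (snd c \<circ> \<gamma>) t)
               (velocity (snd c \<circ> \<gamma>) t)
               (J (velocity (snd c \<circ> \<gamma>) t)) i j k = 0)"

definition c_projectively_equivalent ::
    "('m, 'n::finite) charted \<Rightarrow> ('m, 'n) metric \<Rightarrow> ('m, 'n) metric \<Rightarrow> bool" where
  "c_projectively_equivalent M g h \<longleftrightarrow> (\<forall>I \<gamma>. J_planar M g I \<gamma> \<longleftrightarrow> J_planar M h I \<gamma>)"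


section \<open>Isomorphism of Kaehler manifolds\<close>

definition kaehler_isomorphic ::
    "('m, 'n::finite) charted \<Rightarrow> ('m, 'n) metric \<Rightarrow>
     ('k, 'n) charted \<Rightarrow> ('k, 'n) metric \<Rightarrow> bool" where
  "kaehler_isomorphic M g N h \<longleftrightarrow>
     (\<exists>f f'. homeomorphic_maps (mtop M) (mtop N) f f' \<and>
        smooth_map M N f \<and> smooth_map N M f' \<and>
        (\<forall>c\<in>atlas M. \<forall>d\<in>atlas N. J_linear_on (chart_rep f c d) (chart_rep_dom f c d)) \<and>
        isometric f M g N h)"


section \<open>Complex projective space with the Fubini-Study metric\<close>

text \<open>The homogeneous coordinates of \<open>\<complex>P(n)\<close> are indexed by \<^typ>\<open>'n option\<close>, which has
  \<open>CARD('n) + 1\<close> elements; points are the complex lines through the origin.\<close>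

definition cline :: "complex ^ 'n::finite \<Rightarrow> (complex ^ 'n) set" where
  "cline z = range (\<lambda>a. a *s z)"

text \<open>Quotient topology of the projection \<^const>\<open>cline\<close> from the nonzero vectors.\<close>

definition cp_topology :: "(complex ^ ('n::finite option)) set topology" where
  "cp_topology = topology (\<lambda>U. U \<subseteq> cline ` (- {0}) \<and> open {z. z \<noteq> 0 \<and> cline z \<in> U})"

text \<open>For each \<open>i\<close>, the map \<open>j \<mapsto> cp_index i j\<close> enumerates the coordinates different from \<open>i\<close>. The
  \<open>i\<close>-th affine chart sends the line through \<open>z\<close> to \<open>(z\<^sub>j / z\<^sub>i)\<close> for \<open>j \<noteq> i\<close>.\<close>

definition cp_index :: "'n option \<Rightarrow> 'n \<Rightarrow> 'n option" where
  "cp_index i j = (if Some j = i then None else Some j)"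

definition cp_chart ::
    "'n::finite option \<Rightarrow> ((complex ^ ('n option)) set, 'n) chart" where
  "cp_chart i =
     (cline ` {z. z $ i \<noteq> 0},
      \<lambda>L. let z = (THE z. z \<in> L \<and> z $ i = 1) in \<chi> j. z $ cp_index i j)"

definition CP :: "((complex ^ ('n::finite option)) set, 'n) charted" where
  "CP = \<lparr> mtop = cp_topology, atlas = range cp_chart \<rparr>"

definition herm :: "complex ^ 'n::finite \<Rightarrow> complex ^ 'n \<Rightarrow> complex" where
  "herm u v = (\<Sum>j\<in>UNIV. u $ j * cnj (v $ j))"

text \<open>In every affine chart the Fubini-Study metric is the real part of
  \<open>((1 + |x|\<^sup>2) |dx|\<^sup>2 - |<dx, x>|\<^sup>2) / (1 + |x|\<^sup>2)\<^sup>2\<close>.\<close>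

definition fubini_study :: "((complex ^ ('n::finite option)) set, 'n) metric" where
  "fubini_study c x u v =
     ((1 + (norm x)\<^sup>2) * Re (herm u v) - Re (herm u x * herm x v)) / (1 + (norm x)\<^sup>2)\<^sup>2"


section \<open>The definite descriptions above are well defined\<close>

lemma nondegenerate_riesz:
  fixes B :: "'a::euclidean_space \<Rightarrow> 'a \<Rightarrow> real"
  assumes "bilinear B" and nd: "\<And>u. (\<And>v. B u v = 0) \<Longrightarrow> u = 0" and "linear l"
  shows "\<exists>!z. \<forall>w. B z w = l w"
proof -
  define F where "F z = (\<Sum>b\<in>Basis. B z b *\<^sub>R b)" for z
  have linB: "linear (\<lambda>z. B z w)" "linear (B z)" for w z
    using assms(1) by (auto simp: bilinear_def)
  have lF: "linear F" unfolding F_def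
    by (intro linear_compose_sum ballI) (auto intro!: linearI simp: linear_add[OF linB(1)] linear_scale[OF linB(1)] scaleR_add_left)
  have exp: "f w = (\<Sum>b\<in>Basis. (w \<bullet> b) * f b)" if "linear f" for f :: "'a \<Rightarrow> real" and w
    by (subst euclidean_representation[symmetric, of w])
      (simp only: linear_sum[OF that] linear_scale[OF that] real_scaleR_def)
  have Fb: "F z \<bullet> b = B z b" if "b \<in> Basis" for z b
    unfolding F_def using that by (simp)
  have "inj F"
    unfolding linear_injective_0[OF lF]
  proof (intro allI impI)
    fix z assume "F z = 0"
    then have "B z b = 0" if "b \<in> Basis" for b using Fb[OF that, of z] by simp
    then have "B z w = 0" for w using exp[OF linB(2), of z w] by simp
    then show "z = 0" using nd by blast
  qed
  then have "surj F" using linear_injective_imp_surjective[OF lF] by simp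
  then obtain z where z: "F z = (\<Sum>b\<in>Basis. l b *\<^sub>R b)" by (metis surjD)
  have "B z b = l b" if "b \<in> Basis" for b
    using Fb[OF that, of z] z that by simp
  then have "B z w = l w" for w
    using exp[OF linB(2), of z w] exp[OF assms(3), of w] by simp
  moreover have "z' = z''" if "\<forall>w. B z' w = l w" "\<forall>w. B z'' w = l w" for z' z''
  proof -
    have "B (z' - z'') w = 0" for w
      using that linear_diff[OF linB(1)] by simp
    then show ?thesis using nd[of "z' - z''"] by simp
  qed
  ultimately show ?thesis by blast
qed

lemma christoffel_ex1:
  assumes "pseudo_riemannian M g" "c \<in> atlas M" "open (chart_image c)" "x \<in> chart_image c"
  shows "\<exists>!\<Gamma>. is_christoffel (g c) x \<Gamma>"
proof -
  let ?G = "g c"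
  have bil: "bilinear (?G y)" and sym: "?G y u v = ?G y v u"
    and nd: "(\<And>v. ?G y u v = 0) \<Longrightarrow> u = 0" if "y \<in> chart_image c" for y u v
    using assms(1,2) that unfolding pseudo_riemannian_def by blast+
  have diff: "(\<lambda>y. ?G y u v) differentiable (at x)" for u v
  proof -
    have "Ck_on (Suc 0) (\<lambda>x. g c x u v) (chart_image c)"
      using assms(1,2) unfolding pseudo_riemannian_def smooth_on_def by blast
    then show ?thesis using assms(4) by simp
  qed
  define D where "D u v w = frechet_derivative (\<lambda>y. ?G y u v) (at x) w" for u v w
  have hd: "((\<lambda>y. ?G y u v) has_derivative D u v) (at x)" for u v
    using diff[of u v] unfolding D_def[abs_def] by (simp add: frechet_derivative_works)
  have linD: "linear (D u v)" for u v
    using hd has_derivative_linear by blast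
  have tr: "(f has_derivative F) (at x) \<Longrightarrow> (\<And>y. y \<in> chart_image c \<Longrightarrow> f y = ?G y u v) \<Longrightarrow> D u v = F" for f F u v
  proof -
    assume 1: "(f has_derivative F) (at x)" and 2: "(\<And>y. y \<in> chart_image c \<Longrightarrow> f y = ?G y u v)"
    have "((\<lambda>y. ?G y u v) has_derivative F) (at x)"
      by (rule has_derivative_transform_within_open[OF 1 assms(3,4)]) (use 2 in auto)
    then show ?thesis using hd has_derivative_unique by blast
  qed
  have Dsym: "D u v = D v u" for u v
    by (rule tr[OF hd]) (rule sym)
  have Dadd: "D (u + u') v = (\<lambda>w. D u v w + D u' v w)" for u u' v
    by (rule tr[OF has_derivative_add[OF hd hd]]) (simp add: bilinear_ladd[OF bil])
  have Dsc: "D (r *\<^sub>R u) v = (\<lambda>w. r *\<^sub>R D u v w)" for r u v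
    by (rule tr[OF has_derivative_scaleR_right[OF hd]]) (simp add: bilinear_lmul[OF bil])
  have Dadd2: "D v (u + u') = (\<lambda>w. D v u w + D v u' w)" for u u' v
    using Dadd Dsym by metis
  have Dsc2: "D v (r *\<^sub>R u) = (\<lambda>w. r *\<^sub>R D v u w)" for r u v
    using Dsc Dsym by metis
  define K where "K u v w = (D v w u + D u w v - D u v w) / 2" for u v w
  have "linear (K u v)" for u v
    unfolding K_def
    by (rule linearI) (simp_all add: Dadd2 Dsc2 linear_add[OF linD] linear_scale[OF linD] field_simps)
  then have ex1: "\<exists>!z. \<forall>w. ?G x z w = K u v w" for u v
    using nondegenerate_riesz[OF bil[OF assms(4)], of "K u v" for u v] nd[OF assms(4)] by blast
  define S where "S u v = (THE z. \<forall>w. ?G x z w = K u v w)" for u v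
  have S: "?G x (S u v) w = K u v w" for u v w
    using theI'[OF ex1[of u v]] unfolding S_def by blast
  have Su: "z = S u v" if "\<And>w. ?G x z w = K u v w" for z u v
    using ex1[of u v] S that by blast
  note bx = bil[OF assms(4)]
  have Ssym: "S u v = S v u" for u v
    by (rule Su) (simp add: S K_def Dsym[of u v])
  have lin1: "linear (\<lambda>u. S u v)" for v
  proof (rule linearI)
    fix a b show "S (a + b) v = S a v + S b v"
      by (rule Su[symmetric])
        (simp add: S K_def Dadd bilinear_ladd[OF bx] linear_add[OF linD] field_simps)
    fix r show "S (r *\<^sub>R a) v = r *\<^sub>R S a v"
      by (rule Su[symmetric])
        (simp add: S K_def Dsc bilinear_lmul[OF bx] linear_scale[OF linD] field_simps)
  qed
  have lin2: "linear (S u)" for u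
  proof -
    have "S u = (\<lambda>v. S v u)" by (rule ext) (rule Ssym)
    then show ?thesis using lin1[of u] by simp
  qed
  have eq: "D u v w = ?G x (S w u) v + ?G x u (S w v)" for u v w
    using sym[OF assms(4), of u "S w v"] Dsym[of u v] Dsym[of w u] Dsym[of w v]
    by (simp add: S K_def field_simps)
  have "is_christoffel ?G x S"
    unfolding is_christoffel_def bilinear_def
    using lin1 lin2 Ssym
    by (auto simp: D_def[symmetric] eq)
  moreover have "\<Gamma> = S" if "is_christoffel ?G x \<Gamma>" for \<Gamma>
  proof (intro ext Su)
    fix u v w
    have A: "D a b e = ?G x (\<Gamma> e a) b + ?G x (\<Gamma> e b) a" for a b e
      using that sym[OF assms(4)] unfolding is_christoffel_def D_def by simp
    have B: "\<Gamma> a b = \<Gamma> b a" for a b using that unfolding is_christoffel_def by blast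
    show "?G x (\<Gamma> u v) w = K u v w"
      unfolding K_def A using B[of u v] B[of u w] B[of v w] by simp
  qed
  ultimately show ?thesis by blast
qed

lemma istopology_cp: "istopology (\<lambda>U. U \<subseteq> cline ` (- {0}) \<and> open {z::complex^('n::finite option). z \<noteq> 0 \<and> cline z \<in> U})"
  unfolding istopology_def
proof (intro conjI allI impI; (elim conjE)?)
  fix S T :: "(complex^('n option)) set set"
  assume a: "open {z. z \<noteq> 0 \<and> cline z \<in> S}" "open {z. z \<noteq> 0 \<and> cline z \<in> T}"
  have "{z. z \<noteq> 0 \<and> cline z \<in> S \<inter> T} = {z. z \<noteq> 0 \<and> cline z \<in> S} \<inter> {z. z \<noteq> 0 \<and> cline z \<in> T}" by auto
  with a show "open {z. z \<noteq> 0 \<and> cline z \<in> S \<inter> T}" by (simp add: open_Int)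
next
  fix K :: "(complex^('n option)) set set set"
  assume "\<forall>S\<in>K. S \<subseteq> cline ` (- {0}) \<and> open {z. z \<noteq> 0 \<and> cline z \<in> S}"
  moreover have "{z. z \<noteq> 0 \<and> cline z \<in> \<Union>K} = (\<Union>S\<in>K. {z. z \<noteq> 0 \<and> cline z \<in> S})" by auto
  ultimately show "open {z. z \<noteq> 0 \<and> cline z \<in> \<Union>K}" by auto
qed auto

lemma cp_chart_cline:
  assumes "z $ i \<noteq> 0"
  shows "snd (cp_chart i) (cline z) = (\<chi> j. z $ cp_index i j / z $ i)"
proof -
  have "(THE y. y \<in> cline z \<and> y $ i = 1) = inverse (z $ i) *s z"
    by (rule the_equality) (use assms in \<open>auto simp: cline_def field_simps\<close>)
  then show ?thesis by (simp add: cp_chart_def vec_eq_iff field_simps)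
qed

end

theory Submission
  imports Defs
begin

text \<open>Equality of the J-planar curves means that the Christoffel symbols differ by \<open>\<phi> u v + \<phi> v u\<close> for a
  complex linear form \<open>\<phi>\<close>, which is the logarithmic derivative of a global positive function \<open>f\<close>, the ratio
  of the volume forms to a power. For Einstein metrics, the derivatives \<open>th = - f \<phi>\<close> and \<open>S\<close> of \<open>f\<close> satisfy
  Tanno's equation \<open>\<nabla> S = - \<kappa> (th h + \<dots>)\<close>. Hence \<open>H = \<kappa> h (v, v) + |r|\<^sup>2\<close> and
  \<open>B = S (v, v) + \<kappa> f h (v, v) + 2 Re (cnj r th v) + f |r|\<^sup>2\<close> are parallel forms for a connection on the sum of
  the tangent bundle and \<open>\<complex>\<close>. At a maximum of \<open>f\<close>, \<open>B - f H = S \<le> 0\<close>, at a minimum \<open>B - f H \<ge> 0\<close>. Both bounds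
  hold everywhere by parallel transport, so that \<open>\<kappa> h \<ge> 0\<close>: either \<open>f\<close> is constant and \<open>th = 0\<close>, or \<open>\<kappa> h\<close>
  is positive definite. In the second case the curvature is compared with that of projective space. At an
  extremum of the holomorphic sectional curvature of the difference \<open>W\<close>, the derivatives along the gradient of
  \<open>f\<close> and along eigenvectors of \<open>S\<close> show \<open>th = 0\<close> and \<open>S = 0\<close>, hence \<open>B = f H\<close> and \<open>f\<close> would be constant,
  unless \<open>W = 0\<close>. If \<open>W = 0\<close>, then integrating a total differential equation gives a homogeneous local isometry
  \<open>G\<close> from the nonzero vectors of \<open>\<complex>\<^bsup>n+1\<^esup>\<close> onto the manifold. Points with equal image are related by a unitary
  map that preserves \<open>G\<close>, and comparing derivatives at an eigenvector shows that it is a scalar.\<close>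

text \<open>Two obstacles shape the proof. The signature is arbitrary, so nothing can be maximised
  over unit vectors until the extrema of the function \<open>f\<close> alone have produced a
  definite metric. And nothing is known about the fundamental group of the manifold, so the
  developing map runs in the other direction, from homogeneous coordinates into the manifold. There
  the Fubini-Study form is degenerate along lines, but continuation only has to cross convex balls
  and intersections of hyperplane complements. That the manifold is no proper quotient of projective
  space has a simple reason: a deck transformation would be unitary, hence have an eigenvector and
  fix a point of projective space. The Einstein conditions determine the mixed part of the
  derivative of \<open>\<phi>\<close>, which makes the derivative of \<open>S\<close> close up. The
  constant \<kappa> is Scal / (4 n (n + 1)), for which \<open>W\<close> is trace-free. Tensor
  identities are derived in holomorphic charts: second derivatives are commuted, and the result is
  split into its complex linear and antilinear parts.\<close>

type_synonym 'n V = "complex ^ 'n"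

abbreviation "fd F x == frechet_derivative F (at x)"
abbreviation "der F F' x == (F has_derivative F') (at x)"

lemmas der_cong = has_derivative_transform_within_open

section \<open>Calculus of smooth maps\<close>

lemma Ck_on_cong:
  assumes "open S" "!!x. x \<in> S ==> f x = g x" "Ck_on k f S"
  shows "Ck_on k g S"
  using assms
proof (induction k arbitrary: f g)
  case 0
  then show ?case by (simp cong: continuous_on_cong)
next
  case (Suc k)
  have hd: "der g (fd f x) x" if "x \<in> S" for x
    using Suc.prems that
    by (intro der_cong[of f _ x UNIV S g])
      (auto simp: frechet_derivative_works[symmetric])
  then have "fd f x = fd g x" if "x \<in> S" for x
    using that frechet_derivative_at by blast
  with Suc.IH[of "%x. fd f x v" "%x. fd g x v" for v]
  have "Ck_on k (%x. fd g x v) S" for v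
    using Suc.prems by (auto)
  then show ?case using hd by (auto simp: differentiable_def)
qed

lemma Ck_on_SucI:
  assumes "open S" "!!x. x \<in> S ==> der f (f' x) x" "!!v. Ck_on k (%x. f' x v) S"
  shows "Ck_on (Suc k) f S"
proof -
  have "fd f x = f' x" if "x \<in> S" for x
    using assms(2)[OF that] frechet_derivative_at by metis
  then have "Ck_on k (%x. fd f x v) S" for v
    by (intro Ck_on_cong[OF assms(1) _ assms(3)[of v]]) simp
  then show ?thesis using assms(2) by (auto simp: differentiable_def)
qed

lemma Ck_on_SucD:
  assumes "Ck_on (Suc k) f S" "x \<in> S"
  shows "der f (fd f x) x"
  using assms by (simp add: frechet_derivative_works)

lemma Ck_on_lower: "Ck_on (Suc k) f S ==> Ck_on k f S"
proof (induction k arbitrary: f)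
  case 0
  then show ?case
    by (auto intro!: continuous_at_imp_continuous_on differentiable_imp_continuous_within)
next
  case (Suc k)
  then show ?case using Ck_on.simps(2) by blast
qed

lemma Ck_on_subset: "Ck_on k f S ==> T <= S ==> Ck_on k f T"
proof (induction k arbitrary: f)
  case 0
  then show ?case by (auto intro: continuous_on_subset)
next
  case (Suc k)
  then show ?case by (auto simp: subset_iff)
qed

lemma Ck_on_local:
  assumes "!!x. x \<in> S ==> EX T. open T & x \<in> T & Ck_on k f T"
  shows "Ck_on k f S"
  using assms
proof (induction k arbitrary: f)
  case 0
  have "isCont f x" if "x \<in> S" for x
    using 0[OF that] by (auto simp: continuous_on_eq_continuous_at)
  then show ?case by (simp add: continuous_at_imp_continuous_on)
next
  case (Suc k)
  have "f differentiable at x" if "x \<in> S" for x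
    using Suc.prems[OF that] by auto
  moreover have "Ck_on k (%x. fd f x v) S" for v
    using Suc.prems by (intro Suc.IH) (metis Ck_on.simps(2))
  ultimately show ?case by simp
qed

lemma Ck_on_const: "Ck_on k (%x. c) S"
  by (induction k arbitrary: c) (auto simp: frechet_derivative_const)

lemma Ck_on_linear:
  assumes "bounded_linear L" "open S" "Ck_on k f S"
  shows "Ck_on k (%x. L (f x)) S"
  using assms(3)
proof (induction k arbitrary: f)
  case 0
  then show ?case by (simp add: bounded_linear.continuous_on[OF assms(1)])
next
  case (Suc k)
  show ?case
    by (rule Ck_on_SucI[OF assms(2) bounded_linear.has_derivative[OF assms(1) Ck_on_SucD[OF Suc.prems]]])
      (use Suc in auto)
qed

lemma Ck_on_add:
  assumes "open S" "Ck_on k f S" "Ck_on k g S"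
  shows "Ck_on k (%x. f x + g x) S"
  using assms(2,3)
proof (induction k arbitrary: f g)
  case 0
  then show ?case by (simp add: continuous_on_add)
next
  case (Suc k)
  show ?case
    by (rule Ck_on_SucI[OF assms(1) has_derivative_add[OF Ck_on_SucD[OF Suc.prems(1)] Ck_on_SucD[OF Suc.prems(2)]]])
      (use Suc in auto)
qed

lemma Ck_on_bilinear:
  assumes "bounded_bilinear B" "open S" "Ck_on k f S" "Ck_on k g S"
  shows "Ck_on k (%x. B (f x) (g x)) S"
  using assms(3,4)
proof (induction k arbitrary: f g)
  case 0
  then show ?case by (simp add: bounded_bilinear.continuous_on[OF assms(1)])
next
  case (Suc k)
  show ?case
    apply (rule Ck_on_SucI[OF assms(2) bounded_bilinear.FDERIV[OF assms(1) Ck_on_SucD[OF Suc.prems(1)] Ck_on_SucD[OF Suc.prems(2)]]])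
      apply assumption+
    by (intro Ck_on_add assms(2) Suc.IH Ck_on_lower[OF Suc.prems(1)] Ck_on_lower[OF Suc.prems(2)])
      (use Suc.prems in auto)
qed

lemma Ck_on_sum:
  assumes "open S" "!!i. i \<in> I ==> Ck_on k (f i) S"
  shows "Ck_on k (%x. \<Sum>i\<in>I. f i x) S"
  using assms(2)
  by (induction I rule: infinite_finite_induct) (auto intro: Ck_on_const Ck_on_add[OF assms(1)])

lemma Ck_on_id: "open S ==> Ck_on k (%x. x) S"
  by (cases k) (auto intro!: Ck_on_const simp: frechet_derivative_ident[unfolded id_def])

section \<open>Linear maps that depend on a parameter\<close>

lemma linear_expand:
  fixes L :: "'a::euclidean_space => 'b::real_vector"
  assumes "linear L" shows "L u = (\<Sum>b\<in>Basis. (u \<bullet> b) *\<^sub>R L b)"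
  by (subst euclidean_representation[of u, symmetric]) (simp add: linear_sum[OF assms] linear_scale[OF assms])

text \<open>Families of linear maps are handled through their values on fixed vectors; expanding the
  argument in the basis then permits a varying argument. This keeps derivatives out of spaces of
  linear maps.\<close>

lemma Ck_on_linear_arg:
  assumes "open S" "!!x. x \<in> S ==> linear (T x)" "!!u. Ck_on k (%x. T x u) S" "Ck_on k u S"
  shows "Ck_on k (%x. T x (u x)) S"
proof (rule Ck_on_cong[OF assms(1)])
  show "(\<Sum>b\<in>Basis. (u x \<bullet> b) *\<^sub>R T x b) = T x (u x)" if "x \<in> S" for x
    using linear_expand[OF assms(2)[OF that]] by metis
  show "Ck_on k (%x. \<Sum>b\<in>Basis. (u x \<bullet> b) *\<^sub>R T x b) S"
    by (intro Ck_on_sum Ck_on_bilinear[OF bounded_bilinear_scaleR] assms Ck_on_linear[OF bounded_linear_inner_left])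
qed

lemma Ck_on_compose:
  assumes "open S" "Ck_on k f T" "Ck_on k g S" "g ` S <= T"
  shows "Ck_on k (%x. f (g x)) S"
  using assms(2,3)
proof (induction k arbitrary: f)
  case 0
  then show ?case using continuous_on_compose2 assms(4) by fastforce
next
  case (Suc k)
  have gT: "g x \<in> T" if "x \<in> S" for x using that assms(4) by auto
  have hd: "der (%x. f (g x)) (%v. fd f (g x) (fd g x v)) x" if "x \<in> S" for x
    using has_derivative_compose[OF Ck_on_SucD[OF Suc.prems(2) that] Ck_on_SucD[OF Suc.prems(1) gT[OF that]]]
    by simp
  show ?case
  proof (rule Ck_on_SucI[OF assms(1) hd])
    fix v
    show "Ck_on k (%x. fd f (g x) (fd g x v)) S"
    proof (rule Ck_on_linear_arg[where T="%x. fd f (g x)", OF assms(1)])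
      show "linear (fd f (g x))" if "x \<in> S" for x
        by (rule has_derivative_linear[OF Ck_on_SucD[OF Suc.prems(1) gT[OF that]]])
      show "Ck_on k (%x. fd f (g x) u) S" for u
        using Suc.prems(1) by (intro Suc.IH Ck_on_lower[OF Suc.prems(2)]) simp
      show "Ck_on k (%x. fd g x v) S" using Suc.prems(2) by simp
    qed
  qed
qed

lemma der_linear_arg:
  fixes T :: "'a::real_normed_vector => 'b::euclidean_space => 'c::real_normed_vector"
  assumes "open S" "x \<in> S" and lin: "!!y. y \<in> S ==> linear (T y)"
    and T': "!!u. der (%y. T y u) (T' u) x" and u: "der u u' x"
  shows "der (%y. T y (u y)) (%w. T' (u x) w + T x (u' w)) x"
proof -
  have gen: "der (%y. T y (u y)) (%w. (\<Sum>b\<in>Basis. (u x \<bullet> b) *\<^sub>R T' b w) + T x (u' w)) x" if u: "der u u' x" for u u'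
  proof (rule der_cong[OF _ assms(1,2)])
    show "(\<Sum>b\<in>Basis. (u y \<bullet> b) *\<^sub>R T y b) = T y (u y)" if "y \<in> S" for y
      using linear_expand[OF lin[OF that]] by metis
    have "der (%y. \<Sum>b\<in>Basis. (u y \<bullet> b) *\<^sub>R T y b) (%w. \<Sum>b\<in>Basis. (u x \<bullet> b) *\<^sub>R T' b w + (u' w \<bullet> b) *\<^sub>R T x b) x"
      by (intro has_derivative_sum has_derivative_scaleR T' has_derivative_inner_left[OF u])
    then show "der (%y. \<Sum>b\<in>Basis. (u y \<bullet> b) *\<^sub>R T y b) (%w. (\<Sum>b\<in>Basis. (u x \<bullet> b) *\<^sub>R T' b w) + T x (u' w)) x"
      by (simp add: sum.distrib linear_expand[OF lin[OF assms(2)], symmetric])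
  qed
  \<comment> \<open>A constant argument identifies the sum over the basis with
    \<open>T' (u x)\<close>, by uniqueness of the derivative.\<close>
  have "der (%y. T y (u x)) (%w. (\<Sum>b\<in>Basis. (u x \<bullet> b) *\<^sub>R T' b w) + T x 0) x"
    using gen[of "%_. u x" "%_. 0"] by simp
  then have "T' (u x) = (%w. (\<Sum>b\<in>Basis. (u x \<bullet> b) *\<^sub>R T' b w))"
    using has_derivative_unique[OF T'] linear_0[OF lin[OF assms(2)]] by fastforce
  with gen[OF u] show ?thesis by metis
qed

lemma has_derivative_linear_param:
  fixes T :: "'a::real_normed_vector => 'b::real_normed_vector => 'c::real_normed_vector"
  assumes "open S" "x \<in> S" and lin: "!!y. y \<in> S ==> linear (T y)"
    and T': "!!u. der (%y. T y u) (T' u) x"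
  shows "linear (%u. T' u w)"
proof (rule linearI)
  fix a b :: 'b and r :: real
  have "der (%y. T y (a + b)) (%w. T' a w + T' b w) x"
    by (rule der_cong[OF has_derivative_add[OF T' T'] assms(1,2)])
       (simp add: linear_add[OF lin])
  from has_derivative_unique[OF this T'] show "T' (a + b) w = T' a w + T' b w" by metis
  have "der (%y. T y (r *\<^sub>R a)) (%w. r *\<^sub>R T' a w) x"
    by (rule der_cong[OF has_derivative_scaleR_right[OF T'] assms(1,2)])
       (simp add: linear_scale[OF lin])
  from has_derivative_unique[OF this T'] show "T' (r *\<^sub>R a) w = r *\<^sub>R T' a w" by metis
qed

text \<open>Continuity of \<open>p\<close> is enough, because \<open>q\<close> is bounded by a
  multiple of the distance. In the solution of linear systems \<open>p\<close> is a coordinate of a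
  solution so far known only to be continuous.\<close>

lemma has_derivative_vanishing_product:
  fixes q :: "'a::real_normed_vector => 'b::real_normed_vector"
  assumes p: "isCont p x" "p x = (0::real)" and q: "der q q' x" "q x = 0"
  shows "der (%y. p y *\<^sub>R q y) (%_. 0) x"
proof -
  obtain B where B: "B > 0" "!!h. norm (q' h) <= norm h * B"
    using bounded_linear.pos_bounded[OF has_derivative_bounded_linear[OF q(1)]] by auto
  let ?r = "%y. norm (q y - q x - q' (y - x)) / norm (y - x)"
  have lim: "((%y. \<bar>p y\<bar> * (?r y + B)) \<longlongrightarrow> \<bar>0\<bar> * (0 + B)) (at x)"
    by (intro tendsto_intros) (use p q(1) in "auto simp: isCont_def has_derivative_iff_norm")
  have le: "norm (p y *\<^sub>R q y) / norm (y - x) <= \<bar>p y\<bar> * (?r y + B)" if "y ~= x" for y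
  proof -
    have "norm (q y) <= norm (q y - q x - q' (y - x)) + B * norm (y - x)"
      using norm_triangle_ineq[of "q y - q x - q' (y - x)" "q' (y - x)"] B(2)[of "y - x"] q(2) by (simp add: mult.commute)
    from divide_right_mono[OF this norm_ge_zero[of "y - x"]] have "norm (q y) / norm (y - x) <= ?r y + B" using that by (simp add: add_divide_distrib)
    from mult_left_mono[OF this abs_ge_zero[of "p y"]] show ?thesis by simp
  qed
  have "((%y. norm (p y *\<^sub>R q y) / norm (y - x)) \<longlongrightarrow> 0) (at x)"
    by (rule tendsto_sandwich[OF _ _ tendsto_const lim[simplified]]) (use le in "auto simp: eventually_at_filter")
  then show ?thesis using p(2) by (simp add: has_derivative_iff_norm)
qed

text \<open>The injective map \<open>F x\<close> is bounded below by some \<open>c\<close>, and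
  nearby \<open>F y\<close> differ from it by less than \<open>c / 2\<close>, so they are bounded
  below by \<open>c / 2\<close>. The function \<open>N\<close> controls this difference.\<close>

lemma isCont_linear_solve:
  fixes F :: "'a::euclidean_space => 'b::euclidean_space => 'c::euclidean_space"
  assumes "open S" "x \<in> S" and lin: "!!y. y \<in> S ==> linear (F y)" and inj: "inj (F x)"
    and F: "!!u. isCont (%y. F y u) x" and l: "isCont l x"
    and z: "!!y. y \<in> S ==> F y (z y) = l y"
  shows "isCont z x"
proof -
  obtain c where c: "c > 0" "!!u. c * norm u <= norm (F x u)"
    using linear_inj_bounded_below_pos[OF lin[OF assms(2)] inj] by (auto simp: mult.commute)
  define N where "N y = (\<Sum>b\<in>Basis. norm (F y b - F x b))" for y
  have Nb: "norm (F y u - F x u) <= N y * norm u" if "y \<in> S" for y u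
  proof -
    have "F y u - F x u = (\<Sum>b\<in>Basis. (u \<bullet> b) *\<^sub>R (F y b - F x b))"
      using linear_expand[OF lin[OF that], of u] linear_expand[OF lin[OF assms(2)], of u]
      by (simp add: scaleR_diff_right sum_subtractf)
    also have "norm ... <= (\<Sum>b\<in>Basis. norm u * norm (F y b - F x b))"
      by (intro sum_norm_le) (simp add: Basis_le_norm mult_right_mono)
    finally show ?thesis by (simp add: N_def sum_distrib_left mult.commute sum_distrib_right)
  qed
  have "isCont N x" unfolding N_def by (intro continuous_intros F)
  moreover have "N x = 0" by (simp add: N_def)
  ultimately have ev1: "\<forall>\<^sub>F y in at x. N y < c / 2"
    using c order_tendstoD(2)[of N 0 "at x" "c / 2"] by (simp add: isCont_def)
  have ev2: "\<forall>\<^sub>F y in at x. y \<in> S" using assms(1,2) by (rule eventually_at_in_open')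
  have bd: "\<forall>\<^sub>F y in at x. norm (z y - z x) <= (2 / c) * norm (l y - F y (z x))"
    using ev1 ev2
  proof eventually_elim
    case (elim y)
    let ?d = "z y - z x"
    have "c * norm ?d <= norm (F x ?d)" by (rule c)
    also have "... <= norm (F y ?d) + norm (F y ?d - F x ?d)"
      by (metis norm_triangle_sub norm_minus_commute)
    also have "norm (F y ?d - F x ?d) <= c / 2 * norm ?d"
      using Nb[OF elim(2), of ?d] mult_right_mono[OF less_imp_le[OF elim(1)] norm_ge_zero[of ?d]] by linarith
    finally have "c / 2 * norm ?d <= norm (F y ?d)" by simp
    then show ?case using c elim z by (simp add: linear_diff[OF lin] field_simps)
  qed
  have "((%y. (2 / c) * norm (l y - F y (z x))) \<longlongrightarrow> (2 / c) * norm (l x - F x (z x))) (at x)"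
    using F l by (intro tendsto_intros) (auto simp: isCont_def)
  then have "((%y. (2 / c) * norm (l y - F y (z x))) \<longlongrightarrow> 0) (at x)"
    using z assms(2) by simp
  then have "((%y. z y - z x) \<longlongrightarrow> 0) (at x)"
    using bd by (rule Lim_null_comparison[rotated])
  then show ?thesis by (simp add: isCont_def LIM_zero_iff)
qed

text \<open>A left inverse \<open>G\<close> of \<open>F x\<close> turns the solution into an
  explicit differentiable expression minus \<open>r\<close>, and every summand of \<open>r\<close>
  is a product of two factors that vanish at \<open>x\<close>.\<close>

lemma has_derivative_linear_solve:
  fixes F :: "'a::euclidean_space => 'b::euclidean_space => 'c::euclidean_space"
  assumes "open S" "x \<in> S" and lin: "!!y. y \<in> S ==> linear (F y)" and inj: "inj (F x)"
    and F: "!!u. der (%y. F y u) (F' u) x" and l: "der l l' x"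
    and z: "!!y. y \<in> S ==> F y (z y) = l y"
  shows "EX z'. der z z' x & (ALL w. F x (z' w) = l' w - F' (z x) w)"
proof -
  have cz: "isCont z x"
    by (rule isCont_linear_solve[where F=F and l=l, OF assms(1,2)])
      (use lin inj z has_derivative_continuous[OF F] has_derivative_continuous[OF l] in auto)
  obtain G where G: "linear G" "G o F x = id"
    using linear_injective_left_inverse[OF lin[OF assms(2)] inj] by auto
  have blG: "bounded_linear G" using G(1) linear_conv_bounded_linear by blast
  have GF: "G (F x u) = u" for u using G(2) by (metis comp_apply id_apply)
  define r where "r y = (\<Sum>b\<in>Basis. ((z y - z x) \<bullet> b) *\<^sub>R (G (F y b - F x b)))" for y
  have r0: "der r (%w. \<Sum>b\<in>(Basis::'b set). 0) x" unfolding r_def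
  proof (intro has_derivative_sum has_derivative_vanishing_product)
    fix b :: 'b
    show "isCont (%y. (z y - z x) \<bullet> b) x" by (intro continuous_intros cz)
    show "der (%y. G (F y b - F x b)) (%w. G (F' b w - 0)) x"
      by (intro bounded_linear.has_derivative[OF blG] has_derivative_diff F has_derivative_const)
  qed (auto simp: linear_0[OF G(1)])
  have zeq: "z y = z x + G (l y - F y (z x)) - r y" if "y \<in> S" for y
  proof -
    let ?d = "z y - z x"
    have "r y = G (F y ?d - F x ?d)"
      unfolding r_def using linear_expand[OF lin[OF that], of ?d] linear_expand[OF lin[OF assms(2)], of ?d]
      by (simp add: scaleR_diff_right sum_subtractf linear_diff[OF G(1)] linear_sum[OF G(1)] linear_scale[OF G(1)])
    also have "... = G (l y - F y (z x)) - ?d"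
      using z[OF that] by (simp add: linear_diff[OF lin[OF that]] linear_diff[OF G(1)] GF)
    finally show ?thesis by simp
  qed
  have "der (%y. z x + G (l y - F y (z x)) - r y) (%w. 0 + G (l' w - F' (z x) w) - (\<Sum>b\<in>(Basis::'b set). 0)) x"
    by (intro has_derivative_add has_derivative_diff r0 has_derivative_const bounded_linear.has_derivative[OF blG] l F)
  then have hz: "der z (%w. G (l' w - F' (z x) w)) x"
    by (auto intro: der_cong[OF _ assms(1,2)] simp: zeq)
  have h1: "der (%y. F y (z y)) (%w. F' (z x) w + F x (G (l' w - F' (z x) w))) x"
    by (rule der_linear_arg[OF assms(1,2) lin F hz])
  have "der (%y. F y (z y)) l' x"
    by (rule der_cong[OF l assms(1,2)]) (simp add: z)
  from fun_cong[OF has_derivative_unique[OF h1 this]]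
  have "F x (G (l' w - F' (z x) w)) = l' w - F' (z x) w" for w
    by (simp add: eq_diff_eq add.commute)
  with hz show ?thesis by blast
qed

text \<open>The derivative of a solution solves a system with the same \<open>F\<close>, so
  induction applies. This replaces the inversion of matrices when indices are raised and when
  inverse functions are differentiated.\<close>

lemma Ck_on_linear_solve:
  fixes F :: "'a::euclidean_space => 'b::euclidean_space => 'c::euclidean_space"
  assumes "open S" and lin: "!!y. y \<in> S ==> linear (F y)" and inj: "!!y. y \<in> S ==> inj (F y)"
    and "!!u. Ck_on k (%y. F y u) S" "Ck_on k l S" "!!y. y \<in> S ==> F y (z y) = l y"
  shows "Ck_on k z S"
  using assms(4,5,6)
proof (induction k arbitrary: l z)
  case 0
  have "isCont z x" if "x \<in> S" for x
    by (rule isCont_linear_solve[where F=F and l=l, OF assms(1) that])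
      (use 0 that assms(1) lin inj in "auto simp: continuous_on_eq_continuous_at")
  then show ?case by (simp add: continuous_at_imp_continuous_on)
next
  case (Suc k)
  let ?F' = "%x u. fd (%y. F y u) x"
  have F': "der (%y. F y u) (?F' x u) x" if "x \<in> S" for x u
    by (rule Ck_on_SucD[OF Suc.prems(1) that])
  have "EX z'. der z z' x & (ALL w. F x (z' w) = fd l x w - ?F' x (z x) w)" if "x \<in> S" for x
    by (rule has_derivative_linear_solve[OF assms(1) that lin inj[OF that] F'[OF that] Ck_on_SucD[OF Suc.prems(2) that] Suc.prems(3)])
  then obtain z' where z': "!!x. x \<in> S ==> der z (z' x) x"
     "!!x w. x \<in> S ==> F x (z' x w) = fd l x w - ?F' x (z x) w" by metis
  have zk: "Ck_on k z S"
    by (rule Suc.IH[OF Ck_on_lower[OF Suc.prems(1)] Ck_on_lower[OF Suc.prems(2)] Suc.prems(3)])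
  have linF': "linear (%u. ?F' x u w)" if "x \<in> S" for x w
    by (rule has_derivative_linear_param[OF assms(1) that lin F'[OF that]])
  show ?case
  proof (rule Ck_on_SucI[OF assms(1) z'(1)])
    fix w
    have c1: "Ck_on k (%x. ?F' x (z x) w) S"
      by (rule Ck_on_linear_arg[where T="%x u. ?F' x u w", OF assms(1) linF' _ zk]) (use Suc.prems(1) in auto)
    have "Ck_on k (%x. fd l x w + (-1) *\<^sub>R ?F' x (z x) w) S"
      by (rule Ck_on_add[OF assms(1) _ Ck_on_linear[OF bounded_linear_scaleR_right assms(1) c1]])
        (use Suc.prems(2) in auto)
    then show "Ck_on k (%x. z' x w) S"
      by (intro Suc.IH[OF Ck_on_lower[OF Suc.prems(1)]]) (auto simp: z')
  qed
qed

text \<open>Bootstrapping: if \<open>y\<close> is of class k, so is \<open>w (x, y x)\<close>, which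
  is the derivative of \<open>y\<close>.\<close>

lemma Ck_on_total_differential:
  fixes y :: "'a::euclidean_space => 'b::euclidean_space"
  assumes "open S" "!!v. smooth_on (%p. w p v) T"
    "!!x. x \<in> S ==> (x, y x) \<in> T" "!!x. x \<in> S ==> der y (w (x, y x)) x"
  shows "Ck_on k y S"
proof (induction k)
  case 0
  have "isCont y x" if "x \<in> S" for x using assms(4)[OF that] by (rule has_derivative_continuous)
  then show ?case by (simp add: continuous_at_imp_continuous_on)
next
  case (Suc k)
  have "Ck_on k (%x. (x, y x)) S"
  proof -
    have "Ck_on k (%x. (x, 0) + (0, y x)) S"
      by (intro Ck_on_add assms(1) Ck_on_linear[OF _ assms(1) Ck_on_id] Ck_on_linear[OF _ assms(1) Suc])
        (auto intro!: bounded_linear_intros)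
    then show ?thesis by simp
  qed
  from Ck_on_compose[where g="%x. (x, y x)", OF assms(1) _ this]
  have "Ck_on k (%x. w (x, y x) v) S" for v
    using assms(2)[of v] assms(3) by (fastforce simp: smooth_on_def)
  then show ?case by (intro Ck_on_SucI[OF assms(1,4)]) simp_all
qed

text \<open>The second difference over a small parallelogram is evaluated by the mean value theorem
  in both orders, and continuity compares the two intermediate points with \<open>x\<close>.
  Components along \<open>b\<close> reduce this to real functions.\<close>

lemma second_derivative_symmetric:
  fixes f :: "'a::real_normed_vector => 'b::euclidean_space"
  assumes S: "open S" "x \<in> S" and f': "!!y. y \<in> S ==> der f (f' y) y"
    and f'': "!!v y. y \<in> S ==> der (%y. f' y v) (f'' y v) y" and cont: "!!v w. continuous_on S (%y. f'' y v w)"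
  shows "f'' x u v = f'' x v u"
proof -
  have key: "EX p:T. (f (x + r *\<^sub>R u + r *\<^sub>R v) - f (x + r *\<^sub>R u) - f (x + r *\<^sub>R v) + f x) \<bullet> b = r\<^sup>2 * (f'' p u v \<bullet> b)"
    if r: "0 < r" and T: "T <= S" and box: "!!s t. 0 <= s ==> s <= r ==> 0 <= t ==> t <= r ==> x + s *\<^sub>R u + t *\<^sub>R v \<in> T" for r b u v T
  proof -
    have in1: "x + s *\<^sub>R u + t *\<^sub>R v \<in> S" if "0 <= s" "s <= r" "0 <= t" "t <= r" for s t using box[OF that] T by blast
    have path: "der (%s. y + s *\<^sub>R w) (%h. h *\<^sub>R w) s" for y w :: 'a and s by (auto intro!: derivative_eq_intros)
    have lin: "linear (f' y)" "linear (f'' y w)" if "y \<in> S" for y w using f'[OF that] f''[OF that] has_derivative_linear by blast+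
    define g where "g s = (f (x + r *\<^sub>R v + s *\<^sub>R u) - f (x + s *\<^sub>R u)) \<bullet> b" for s
    let ?g' = "%s h. (f' (x + r *\<^sub>R v + s *\<^sub>R u) (h *\<^sub>R u) - f' (x + s *\<^sub>R u) (h *\<^sub>R u)) \<bullet> b"
    have in2: "x + r *\<^sub>R v + s *\<^sub>R u \<in> S" "x + s *\<^sub>R u \<in> S" if "0 <= s" "s <= r" for s
      using in1[OF that, of r] in1[OF that, of 0] r by (simp_all add: add_ac)
    have dg: "der g (?g' s) s" if "0 <= s" "s <= r" for s unfolding g_def
      by (intro has_derivative_inner_left has_derivative_diff has_derivative_compose[OF path f'[OF in2(1)[OF that]]] has_derivative_compose[OF path f'[OF in2(2)[OF that]]])
    obtain s where s: "0 < s" "s < r" "g r - g 0 = ?g' s (r - 0)"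
      by (rule mvt[of 0 r g ?g', OF r]) (auto intro!: continuous_at_imp_continuous_on has_derivative_continuous[OF dg] dg)
    let ?y = "%t. x + s *\<^sub>R u + t *\<^sub>R v"
    have in3: "?y t \<in> S" if "0 <= t" "t <= r" for t using in1[OF _ _ that, of s] s by simp
    have dk: "der (%t. f' (?y t) u \<bullet> b) (%h. f'' (?y t) u (h *\<^sub>R v) \<bullet> b) t" if "0 <= t" "t <= r" for t
      by (intro has_derivative_inner_left has_derivative_compose[OF path f''[OF in3[OF that]]])
    obtain t where t: "0 < t" "t < r" "f' (?y r) u \<bullet> b - f' (?y 0) u \<bullet> b = f'' (?y t) u ((r - 0) *\<^sub>R v) \<bullet> b"
      by (rule mvt[of 0 r _ "%t h. f'' (?y t) u (h *\<^sub>R v) \<bullet> b", OF r]) (auto intro!: continuous_at_imp_continuous_on has_derivative_continuous[OF dk] dk)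
    have "g r - g 0 = r * (f' (?y r) u \<bullet> b - f' (?y 0) u \<bullet> b)"
      using s in2[of s] by (simp add: linear_scale[OF lin(1)] inner_diff_left algebra_simps)
    also have "... = r\<^sup>2 * (f'' (?y t) u v \<bullet> b)" using t in3[of t] by (simp add: linear_scale[OF lin(2)] power2_eq_square)
    finally show ?thesis using box[of s t] s t by (intro bexI[of _ "?y t"]) (simp_all add: g_def inner_diff_left inner_add_left add_ac)
  qed
  have "f'' x u v \<bullet> b = f'' x v u \<bullet> b" for b
  proof (rule ccontr)
    assume ne: "f'' x u v \<bullet> b ~= f'' x v u \<bullet> b"
    let ?d = "%u v y. \<bar>f'' y u v \<bullet> b - f'' x u v \<bullet> b\<bar>"
    define c where "c = \<bar>f'' x u v \<bullet> b - f'' x v u \<bullet> b\<bar> / 2"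
    have c: "c > 0" using ne by (simp add: c_def)
    \<comment> \<open>Both mixed derivatives stay within half of the supposed gap on
      \<open>T\<close>, so they cannot coincide at any two of its points.\<close>
    define T where "T = S \<inter> (%y. max (?d u v y) (?d v u y)) -` {..<c}"
    have T: "T <= S" "x \<in> T" "!!p. p \<in> T ==> ?d u v p < c" "!!p. p \<in> T ==> ?d v u p < c" using S(2) c by (auto simp: T_def)
    have "open T" unfolding T_def by (rule continuous_open_preimage[OF _ S(1) open_lessThan]) (intro continuous_intros cont)
    then have "open ((%q::real \<times> real. x + fst q *\<^sub>R u + snd q *\<^sub>R v) -` T)" by (rule open_vimage) (intro continuous_intros)
    moreover have "0 \<in> (%q::real \<times> real. x + fst q *\<^sub>R u + snd q *\<^sub>R v) -` T" using T by simp
    ultimately obtain e where e: "e > 0" "ball 0 e <= (%q::real \<times> real. x + fst q *\<^sub>R u + snd q *\<^sub>R v) -` T" by (rule openE)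
    define r where "r = e / 3"
    have r: "r > 0" using e by (simp add: r_def)
    have box: "x + s *\<^sub>R u + t *\<^sub>R v \<in> T" if "0 <= s" "s <= r" "0 <= t" "t <= r" for s t
    proof -
      have "norm (s, t) < e" using norm_Pair_le[of s t] that e(1) by (simp add: r_def)
      then show ?thesis using e(2) by auto
    qed
    obtain p where p: "p \<in> T" "(f (x + r *\<^sub>R u + r *\<^sub>R v) - f (x + r *\<^sub>R u) - f (x + r *\<^sub>R v) + f x) \<bullet> b = r\<^sup>2 * (f'' p u v \<bullet> b)"
      using key[OF r T(1) box, of b] by blast
    have "x + s *\<^sub>R v + t *\<^sub>R u \<in> T" if "0 <= s" "s <= r" "0 <= t" "t <= r" for s t
      using box[OF that(3,4,1,2)] by (simp add: add_ac)
    from key[OF r T(1) this, of b] obtain q where q: "q \<in> T" "(f (x + r *\<^sub>R v + r *\<^sub>R u) - f (x + r *\<^sub>R v) - f (x + r *\<^sub>R u) + f x) \<bullet> b = r\<^sup>2 * (f'' q v u \<bullet> b)"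
      by blast
    have "r\<^sup>2 * (f'' p u v \<bullet> b) = r\<^sup>2 * (f'' q v u \<bullet> b)"
      unfolding p(2)[symmetric] q(2)[symmetric] by (simp add: algebra_simps)
    then have "f'' p u v \<bullet> b = f'' q v u \<bullet> b" using r by simp
    then show False using T(3)[OF p(1)] T(4)[OF q(1)] unfolding c_def by (auto simp: abs_if split: if_splits)
  qed
  then show ?thesis by (metis vector_eq_ldot inner_commute)
qed

section \<open>Total differential equations\<close>

definition total_eq :: "('a::euclidean_space \<times> 'b::euclidean_space) set => ('a \<times> 'b => 'a => 'b) => bool" where
  "total_eq Om w \<longleftrightarrow> open Om & (ALL p:Om. linear (w p)) & (ALL v. smooth_on (%p. w p v) Om)"

abbreviation Dw where "Dw w p v == fd (%p. w p v) p"

text \<open>The Frobenius condition: \<open>Dw w p v (u, w p u)\<close> is the derivative in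
  direction \<open>u\<close> of \<open>w (x, y x) v\<close> along a solution through
  \<open>p\<close>, thus its second derivative, which has to be symmetric.\<close>

definition integrable_eq :: "('a::euclidean_space \<times> 'b::euclidean_space) set => ('a \<times> 'b => 'a => 'b) => bool" where
  "integrable_eq Om w \<longleftrightarrow> (ALL p:Om. ALL u v. Dw w p v (u, w p u) = Dw w p u (v, w p v))"

lemma total_eqD:
  assumes "total_eq Om w"
  shows "open Om" "p \<in> Om ==> linear (w p)" "Ck_on k (%p. w p v) Om"
    "p \<in> Om ==> der (%p. w p v) (Dw w p v) p"
    "Ck_on k (%p. Dw w p v q) Om"
proof -
  show *: "open Om" "p \<in> Om ==> linear (w p)" "Ck_on k (%p. w p v) Om" for k
    using assms by (auto simp: total_eq_def smooth_on_def)
  show "p \<in> Om ==> der (%p. w p v) (Dw w p v) p"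
    using Ck_on_SucD *(3) by blast
  show "Ck_on k (%p. Dw w p v q) Om" using *(3)[of "Suc k"] unfolding Ck_on.simps by blast
qed

lemma total_eq_linear:
  assumes "total_eq Om w" "p \<in> Om"
  shows "linear (%v. Dw w p v q)" "linear (Dw w p v)"
proof -
  show "linear (%v. Dw w p v q)"
    by (rule has_derivative_linear_param[OF total_eqD(1)[OF assms(1)] assms(2) total_eqD(2)[OF assms(1)] total_eqD(4)[OF assms]])
  show "linear (Dw w p v)" using total_eqD(4)[OF assms] has_derivative_linear by blast
qed

lemma linear_norm_Basis_bound:
  fixes L :: "'a::euclidean_space => 'b::real_normed_vector"
  assumes "linear L" "!!b. b \<in> Basis ==> norm (L b) <= C"
  shows "norm (L v) <= C * DIM('a) * norm v"
proof -
  have "norm (L v) <= (\<Sum>b\<in>(Basis::'a set). norm v * C)"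
    unfolding linear_expand[OF assms(1), of v]
    by (intro sum_norm_le) (use assms(2) Basis_le_norm in "auto intro!: mult_mono")
  then show ?thesis by (simp add: mult_ac)
qed

lemma compact_family_bound:
  fixes f :: "'i => 'a::topological_space => 'b::real_normed_vector"
  assumes "finite I" "compact K" "!!i. i \<in> I ==> continuous_on K (f i)"
  obtains C where "C > 0" "!!i x. i \<in> I ==> x \<in> K ==> norm (f i x) <= C"
proof -
  have "EX C>0. ALL i:I. ALL x:K. norm (f i x) <= C" using assms(1,3)
  proof (induction I rule: finite_induct)
    case empty
    show ?case by (intro exI[of _ 1]) simp
  next
    case (insert i I)
    obtain C where C: "C > 0" "ALL i:I. ALL x:K. norm (f i x) <= C" using insert by auto
    have "bounded (f i ` K)" using compact_continuous_image[OF _ assms(2)] insert.prems compact_imp_bounded by blast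
    then obtain C' where "!!x. x \<in> K ==> norm (f i x) <= C'" by (auto simp: bounded_iff)
    with C show ?case by (intro exI[of _ "max C C'"]) fastforce
  qed
  then show ?thesis using that by blast
qed

text \<open>The constants are uniform over the compact set of initial values. The later continuation
  arguments rest on the common radius of existence that results.\<close>

lemma total_eq_bounds:
  assumes w: "total_eq Om (w :: 'a::euclidean_space \<times> 'b::euclidean_space => 'a => 'b)" and K: "compact K" "K <= Om"
  shows "EX \<delta>>0. EX B>0. ALL (a, b):K. ALL x y. norm (x - a) <= \<delta> --> norm (y - b) <= \<delta> -->
     (x, y) \<in> Om & (ALL v. norm (w (x, y) v) <= B * norm v) &
     (ALL v q. norm (Dw w (x, y) v q) <= B * norm q * norm v)"
proof -
  obtain \<epsilon> where \<epsilon>: "\<epsilon> > 0" "(\<Union>k\<in>K. cball k \<epsilon>) <= Om"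
    using compact_subset_open_imp_cball_epsilon_subset[OF K(1) total_eqD(1)[OF w] K(2)] by auto
  define K' where "K' = {x + y | x y. x \<in> K & y \<in> cball (0::'a\<times>'b) \<epsilon>}"
  have K'c: "compact K'" unfolding K'_def by (intro compact_sums K compact_cball)
  have K'Om: "K' <= Om"
    using \<epsilon>(2) unfolding K'_def by (fastforce simp: dist_norm)
  obtain C where C: "C > 0" "!!i x. i \<in> Basis ==> x \<in> K' ==> norm (w x i) <= C"
  proof (rule compact_family_bound[of Basis K' "%i x. w x i"])
    show "continuous_on K' (%x. w x i)" for i
      using total_eqD(3)[OF w, of 0 i] K'Om continuous_on_subset by auto
  qed (use K'c in auto)
  obtain C2 where C2: "C2 > 0" "!!i x. i \<in> Basis \<times> Basis ==> x \<in> K' ==> norm (Dw w x (fst i) (snd i)) <= C2"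
  proof (rule compact_family_bound[of "Basis \<times> Basis" K' "%i x. Dw w x (fst i) (snd i)"])
    show "continuous_on K' (%x. Dw w x (fst i) (snd i))" for i
      using total_eqD(5)[OF w, of 0 "fst i" "snd i"] K'Om continuous_on_subset by auto
  qed (use K'c in auto)
  define B where "B = max (C * DIM('a)) (C2 * DIM('a \<times> 'b) * DIM('a))"
  have "B > 0" using C by (simp add: B_def less_max_iff_disj)
  moreover have "(x, y) \<in> Om & (ALL v. norm (w (x, y) v) <= B * norm v) &
     (ALL v q. norm (Dw w (x, y) v q) <= B * norm q * norm v)"
    if "(a, b) \<in> K" "norm (x - a) <= \<epsilon> / 2" "norm (y - b) <= \<epsilon> / 2" for a b x y
  proof -
    have "norm (x - a, y - b) <= \<epsilon>"
      using norm_Pair_le[of "x - a" "y - b"] that by linarith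
    then have "(x, y) = (a, b) + (x - a, y - b)" "(x - a, y - b) \<in> cball 0 \<epsilon>" by (simp_all)
    then have in': "(x, y) \<in> K'" unfolding K'_def using that(1) by blast
    then have inOm: "(x, y) \<in> Om" using K'Om by auto
    have 1: "norm (w (x, y) v) <= B * norm v" for v
    proof -
      have "norm (w (x, y) v) <= C * DIM('a) * norm v"
        using linear_norm_Basis_bound[OF total_eqD(2)[OF w inOm]] C(2) in' by auto
      also have "... <= B * norm v" by (intro mult_right_mono) (auto simp: B_def)
      finally show ?thesis .
    qed
    have 2: "norm (Dw w (x, y) v q) <= B * norm q * norm v" for v q
    proof -
      have "norm (Dw w (x, y) i q) <= C2 * DIM('a \<times> 'b) * norm q" if "i \<in> Basis" for i
        by (rule linear_norm_Basis_bound[OF total_eq_linear(2)[OF w inOm]]) (use C2(2) in' that in force)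
      then have "norm (Dw w (x, y) v q) <= (C2 * DIM('a \<times> 'b) * norm q) * DIM('a) * norm v"
        by (rule linear_norm_Basis_bound[OF total_eq_linear(1)[OF w inOm]])
      also have "... = (C2 * DIM('a \<times> 'b) * DIM('a)) * (norm q * norm v)" by (simp add: mult_ac)
      also have "... <= B * (norm q * norm v)" by (intro mult_right_mono) (auto simp: B_def)
      finally show ?thesis by (simp add: mult_ac)
    qed
    from 1 2 inOm show ?thesis by blast
  qed
  ultimately show ?thesis using \<epsilon>(1)
    by (intro exI[of _ "\<epsilon>/2"] conjI exI[of _ B]) auto
qed

lemma total_eq_Lipschitz:
  assumes w: "total_eq Om w"
    and b: "!!y. norm (y - b) <= \<delta> ==> (x, y) \<in> Om & (ALL v q. norm (Dw w (x, y) v q) <= B * norm q * norm v)"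
    and "norm (y1 - b) <= \<delta>" "norm (y2 - b) <= \<delta>"
  shows "norm (w (x, y1) v - w (x, y2) v) <= B * norm (y1 - y2) * norm v"
proof -
  have "norm (w (x, y1) v - w (x, y2) v) <= (B * norm v) * norm (y1 - y2)"
  proof (rule differentiable_bound[of "cball b \<delta>" "%y. w (x, y) v" "%y q. Dw w (x, y) v (0, q)"])
    fix y assume "y \<in> cball b \<delta>"
    then have y: "norm (y - b) <= \<delta>" by (simp add: dist_norm norm_minus_commute)
    have "der (%y. w (x, y) v) (%q. Dw w (x, y) v (0, q)) y"
      using has_derivative_compose[OF has_derivative_Pair[OF has_derivative_const has_derivative_ident] total_eqD(4)[OF w]] b[OF y]
      by blast
    then show "((%y. w (x, y) v) has_derivative (%q. Dw w (x, y) v (0, q))) (at y within cball b \<delta>)"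
      by (rule has_derivative_at_withinI)
    have "norm (Dw w (x, y) v (0, q)) <= B * norm v * norm q" for q
    proof -
      have "norm (Dw w (x, y) v (0, q)) <= B * norm (0::'a, q) * norm v" using b[OF y] by blast
      then show ?thesis by (simp add: mult_ac norm_Pair)
    qed
    then show "onorm (%q. Dw w (x, y) v (0, q)) <= B * norm v" by (rule onorm_le)
  qed (use assms in "auto simp: dist_norm norm_minus_commute")
  then show ?thesis by (simp add: mult_ac)
qed

text \<open>The points of disagreement form an open set by continuity. So do the points of
  agreement, because on a ball with \<open>r * B < 1 / 2\<close> the largest difference
  \<open>s\<close> of the two solutions is at most \<open>s / 2\<close>.\<close>

lemma total_eq_unique:
  assumes w: "total_eq Om w" and D: "open D" "connected D" "a \<in> D" "y1 a = y2 a"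
    and y1: "!!x. x \<in> D ==> (x, y1 x) \<in> Om & der y1 (w (x, y1 x)) x"
    and y2: "!!x. x \<in> D ==> (x, y2 x) \<in> Om & der y2 (w (x, y2 x)) x"
    and x: "x \<in> D"
  shows "y1 x = y2 x"
proof -
  have c: "continuous_on D y1" "continuous_on D y2"
    using y1 y2 by (auto intro!: continuous_at_imp_continuous_on has_derivative_continuous)
  define A where "A = {x\<in>D. y1 x = y2 x}"
  have "open A" unfolding open_contains_ball
  proof
    fix b assume "b \<in> A"
    then have bD: "b \<in> D" and eqb: "y1 b = y2 b" by (auto simp: A_def)
    obtain \<delta> B where d: "\<delta> > 0" "B > 0" and bd: "!!x y. norm (x - b) <= \<delta> ==> norm (y - y1 b) <= \<delta> ==>
       (x, y) \<in> Om & (ALL v. norm (w (x, y) v) <= B * norm v) &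
       (ALL v q. norm (Dw w (x, y) v q) <= B * norm q * norm v)"
      using total_eq_bounds[OF w, of "{(b, y1 b)}"] y1[OF bD] by auto
    have "isCont y1 b" "isCont y2 b" using c D(1) bD by (auto simp: continuous_on_eq_continuous_at)
    then obtain d1 d2 where d1: "d1 > 0" "!!x. norm (x - b) < d1 ==> norm (y1 x - y1 b) < \<delta>"
      and d2: "d2 > 0" "!!x. norm (x - b) < d2 ==> norm (y2 x - y2 b) < \<delta>"
      using d(1) unfolding continuous_at_eps_delta dist_norm by metis
    obtain e where e: "e > 0" "ball b e <= D" using D(1) bD openE by blast
    obtain r where "r > 0" "r < min (min d1 d2) (min e (min \<delta> (1 / (2 * B))))"
      using dense[of 0 "min (min d1 d2) (min e (min \<delta> (1 / (2 * B))))"] d1(1) d2(1) e(1) d by auto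
    then have r: "r > 0" "r < d1" "r < d2" "r < e" "r < \<delta>" "r * B < 1 / 2"
      using d(2) by (simp_all add: pos_less_divide_eq mult.left_commute mult.commute)
    have inD: "x \<in> D" if "x \<in> cball b r" for x using that r e by auto
    have nr: "norm (x - b) <= r" if "x \<in> cball b r" for x using that by (simp add: dist_norm norm_minus_commute)
    have "continuous_on (cball b r) (%x. norm (y1 x - y2 x))"
      by (intro continuous_on_norm continuous_on_diff continuous_on_subset[OF c(1)] continuous_on_subset[OF c(2)] subsetI inD)
    then obtain xm where xm: "xm \<in> cball b r" "!!x. x \<in> cball b r ==> norm (y1 x - y2 x) <= norm (y1 xm - y2 xm)"
      using continuous_attains_sup[of "cball b r" "%x. norm (y1 x - y2 x)"] r(1) by force
    define s where "s = norm (y1 xm - y2 xm)"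
    have "norm ((y1 xm - y2 xm) - (y1 b - y2 b)) <= (B * s) * norm (xm - b)"
    proof (rule differentiable_bound[of "cball b r" "%x. y1 x - y2 x" "%x v. w (x, y1 x) v - w (x, y2 x) v"])
      fix x assume x: "x \<in> cball b r"
      show "((%x. y1 x - y2 x) has_derivative (%v. w (x, y1 x) v - w (x, y2 x) v)) (at x within cball b r)"
        by (rule has_derivative_at_withinI[OF has_derivative_diff[OF conjunct2[OF y1[OF inD[OF x]]] conjunct2[OF y2[OF inD[OF x]]]]])
      have "norm (w (x, y1 x) v - w (x, y2 x) v) <= B * s * norm v" for v
      proof -
        have "norm (w (x, y1 x) v - w (x, y2 x) v) <= B * norm (y1 x - y2 x) * norm v"
        proof (rule total_eq_Lipschitz[OF w, of "y1 b" \<delta>])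
          show "(x, y) \<in> Om & (ALL v q. norm (Dw w (x, y) v q) <= B * norm q * norm v)" if "norm (y - y1 b) <= \<delta>" for y
            using bd[of x y] nr[OF x] r(5) that by auto
          show "norm (y1 x - y1 b) <= \<delta>" using d1(2)[of x] nr[OF x] r(2) by simp
          show "norm (y2 x - y1 b) <= \<delta>" using d2(2)[of x] nr[OF x] r(3) eqb by simp
        qed
        also have "... <= B * s * norm v"
          using xm(2)[OF x] d by (intro mult_right_mono mult_left_mono) (auto simp: s_def)
        finally show ?thesis .
      qed
      then show "onorm (%v. w (x, y1 x) v - w (x, y2 x) v) <= B * s" by (rule onorm_le)
    qed (use xm r in auto)
    then have "s <= B * s * norm (xm - b)" using eqb by (simp add: s_def)
    also have "... <= B * s * r" using nr[OF xm(1)] d by (intro mult_left_mono) (auto simp: s_def)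
    also have "... <= s * (1/2)" using r(6) mult_left_mono[of "r * B" "1/2" s] by (simp add: s_def mult_ac)
    finally have "s = 0" by (simp add: s_def)
    then have "cball b r <= A" using xm(2) inD by (auto simp: A_def s_def)
    then show "EX e>0. ball b e <= A" using r(1) by (meson ball_subset_cball subset_trans)
  qed
  moreover have "open {x\<in>D. y1 x ~= y2 x}"
  proof -
    have "{x\<in>D. y1 x ~= y2 x} = D \<inter> (%x. y1 x - y2 x) -` (- {0})" by auto
    then show ?thesis using continuous_open_preimage[OF continuous_on_diff[OF c] D(1), of "- {0}"] by auto
  qed
  ultimately have "A \<inter> D = {} | {x\<in>D. y1 x ~= y2 x} \<inter> D = {}"
    using D(2) by (intro connectedD[OF D(2)]) (auto simp: A_def)
  then show ?thesis using D(3,4) x by (auto simp: A_def)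
qed

text \<open>The integral runs over the segment from \<open>a\<close> to \<open>x\<close>. Radially
  this is the classical iteration; in the other directions the fixed point solves the equation only
  thanks to integrability.\<close>

definition picard_step :: "('a::euclidean_space \<times> 'b::euclidean_space => 'a => 'b) => 'a => 'b => ('a => 'b) => 'a => 'b" where
  "picard_step w a b f x = b + integral (cbox 0 (1::real)) (%t. w (a + t *\<^sub>R (x - a), f (a + t *\<^sub>R (x - a))) (x - a))"

text \<open>Instead of a contraction in a space of \<open>C\<^sup>1\<close> functions, the defect \<open>f' - w (x, f x)\<close> of the
  iterates is estimated: by the integrability condition, it is shrunk by every Picard step.\<close>

locale picard =
  fixes Om and w :: "'a::euclidean_space \<times> 'b::euclidean_space => 'a => 'b" and a b \<delta> B r
  assumes w: "total_eq Om w" and int: "integrable_eq Om w"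
    and pos: "\<delta> > 0" "B > 0" "r > 0" "r <= \<delta>" "r * B <= \<delta> / 2" "r * B <= 1 / 8"
    and bd: "!!x y. norm (x - a) <= \<delta> ==> norm (y - b) <= \<delta> ==>
       (x, y) \<in> Om & (ALL v. norm (w (x, y) v) <= B * norm v) &
       (ALL v q. norm (Dw w (x, y) v q) <= B * norm q * norm v)"
begin

definition adm :: "('a => 'b) => ('a => 'a => 'b) => bool" where
  "adm f f' \<longleftrightarrow> (ALL x:ball a r. der f (f' x) x & norm (f x - b) <= \<delta>) &
     (ALL v. continuous_on (ball a r) (%x. f' x v))"

lemma ray: "x \<in> ball a r ==> t \<in> cbox 0 1 ==> a + t *\<^sub>R (x - a) \<in> ball a r"
  by (auto simp: dist_norm norm_minus_commute intro: le_less_trans[OF mult_left_le_one_le])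

lemma nr: "x \<in> ball a r ==> norm (x - a) <= r" "x \<in> ball a r ==> norm (x - a) <= \<delta>"
  using pos by (auto simp: dist_norm norm_minus_commute)

lemma adm_continuous: "adm f f' ==> continuous_on (ball a r) f"
  by (auto simp: adm_def intro!: continuous_at_imp_continuous_on has_derivative_continuous)

lemma adm_in: "adm f f' ==> x \<in> ball a r ==> (x, f x) \<in> Om"
  using bd nr by (auto simp: adm_def)

lemma adm_bound: "adm f f' ==> x \<in> ball a r ==> norm (f x - b) <= \<delta>"
  by (simp add: adm_def)

lemma Lip:
  assumes "x \<in> ball a r" "norm (y1 - b) <= \<delta>" "norm (y2 - b) <= \<delta>"
  shows "norm (w (x, y1) v - w (x, y2) v) <= B * norm (y1 - y2) * norm v"
proof (rule total_eq_Lipschitz[OF w _ assms(2,3)])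
  show "(x, y) \<in> Om & (ALL v q. norm (Dw w (x, y) v q) <= B * norm q * norm v)" if "norm (y - b) <= \<delta>" for y
    using bd[OF nr(2)[OF assms(1)] that] by blast
qed

lemma continuous_on_w:
  assumes f: "adm f f'" and U: "continuous_on U x" "continuous_on U v" "!!s. s \<in> U ==> x s \<in> ball a r"
  shows "continuous_on U (%s. w (x s, f (x s)) (v s))"
proof -
  have 1: "continuous_on U (%s. w (x s, f (x s)) i)" for i
  proof (rule continuous_on_compose2[of Om "%p. w p i"])
    show "continuous_on Om (%p. w p i)" using total_eqD(3)[OF w, of 0] by simp
    show "continuous_on U (%s. (x s, f (x s)))"
      by (intro continuous_on_Pair U continuous_on_compose2[OF adm_continuous[OF f] U(1)]) (use U in auto)
  qed (use adm_in[OF f] U(3) in auto)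
  have "continuous_on U (%s. \<Sum>i\<in>Basis. (v s \<bullet> i) *\<^sub>R w (x s, f (x s)) i)"
    by (intro continuous_intros 1 U)
  then show ?thesis
    by (subst continuous_on_cong[OF refl linear_expand[OF total_eqD(2)[OF w]]]) (use adm_in[OF f] U(3) in auto)
qed

lemma continuous_on_Dw:
  assumes f: "adm f f'" and U: "continuous_on U x" "continuous_on U v" "continuous_on U q" "!!s. s \<in> U ==> x s \<in> ball a r"
  shows "continuous_on U (%s. Dw w (x s, f (x s)) (v s) (q s))"
proof -
  have inOm: "(x s, f (x s)) \<in> Om" if "s \<in> U" for s using adm_in[OF f] U(4) that by auto
  have 1: "continuous_on U (%s. Dw w (x s, f (x s)) i j)" for i j
  proof (rule continuous_on_compose2[of Om "%p. Dw w p i j"])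
    show "continuous_on Om (%p. Dw w p i j)" using total_eqD(5)[OF w, of 0] by simp
    show "continuous_on U (%s. (x s, f (x s)))"
      by (intro continuous_on_Pair U continuous_on_compose2[OF adm_continuous[OF f] U(1)]) (use U in auto)
  qed (use inOm in auto)
  have 2: "continuous_on U (%s. Dw w (x s, f (x s)) i (q s))" for i
  proof -
    have "continuous_on U (%s. \<Sum>j\<in>Basis. (q s \<bullet> j) *\<^sub>R Dw w (x s, f (x s)) i j)"
      by (intro continuous_intros 1 U)
    then show ?thesis
      by (subst continuous_on_cong[OF refl linear_expand[OF total_eq_linear(2)[OF w inOm]]]) auto
  qed
  have "continuous_on U (%s. \<Sum>i\<in>Basis. (v s \<bullet> i) *\<^sub>R Dw w (x s, f (x s)) i (q s))"
    by (intro continuous_intros 2 U)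
  then show ?thesis
    by (subst continuous_on_cong[OF refl linear_expand[OF total_eq_linear(1)[OF w inOm]]]) auto
qed

lemma continuous_on_derivative:
  assumes f: "adm f f'" and U: "continuous_on U x" "continuous_on U v" "!!s. s \<in> U ==> x s \<in> ball a r"
  shows "continuous_on U (%s. f' (x s) (v s))"
proof -
  have 1: "continuous_on U (%s. f' (x s) i)" for i
    by (rule continuous_on_compose2[of "ball a r" "%x. f' x i"]) (use f U in "auto simp: adm_def")
  have lin: "linear (f' (x s))" if "s \<in> U" for s
    using f U(3)[OF that] unfolding adm_def by (blast intro: has_derivative_linear)
  have "continuous_on U (%s. \<Sum>i\<in>Basis. (v s \<bullet> i) *\<^sub>R f' (x s) i)"
    by (intro continuous_intros 1 U)
  then show ?thesis by (subst continuous_on_cong[OF refl linear_expand[OF lin]]) auto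
qed

text \<open>The derivative \<open>L\<close> of the integrand in direction \<open>u\<close> is
  compared with \<open>Q\<close>, whose integral is the desired value \<open>w (x, f x) u\<close>.
  Integrability makes their difference linear in the defect of \<open>f\<close>, with a factor at
  most \<open>2 * r * B\<close>, hence 1/4.\<close>

lemma picard_step:
  assumes f: "adm f f'" and \<epsilon>: "!!x u. x \<in> ball a r ==> norm (f' x u - w (x, f x) u) <= \<epsilon> * norm u"
  shows "EX g'. adm (picard_step w a b f) g' &
     (ALL x:ball a r. ALL u. norm (g' x u - w (x, f x) u) <= \<epsilon> / 4 * norm u)"
proof -
  let ?\<xi> = "%x t::real. a + t *\<^sub>R (x - a)"
  let ?\<Phi> = "%x. w (x, f x)"
  let ?\<Phi>' = "%x v u. Dw w (x, f x) v (u, f' x u)"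
  have hf: "der f (f' x) x" if "x \<in> ball a r" for x using f that by (simp add: adm_def)
  have \<Phi>': "der (%x. ?\<Phi> x v) (?\<Phi>' x v) x" if "x \<in> ball a r" for x v
    by (rule has_derivative_compose[of "%x. (x, f x)" "%u. (u, f' x u)" x UNIV, OF _ total_eqD(4)[OF w adm_in[OF f that]]])
      (intro has_derivative_Pair has_derivative_ident hf that)
  define L where "L x t u = ?\<Phi>' (?\<xi> x t) (x - a) (t *\<^sub>R u) + ?\<Phi> (?\<xi> x t) u" for x t u
  have hd: "der (%x. ?\<Phi> (?\<xi> x t) (x - a)) (L x t) x" if x: "x \<in> ball a r" and t: "t \<in> cbox 0 1" for x t
    unfolding L_def
  proof (rule der_linear_arg[where S="ball a r" and T="%x. ?\<Phi> (?\<xi> x t)"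
        and T'="%u w'. ?\<Phi>' (?\<xi> x t) u (t *\<^sub>R w')" and u="%x. x - a" and u'="%u. u"])
    show "linear (?\<Phi> (?\<xi> y t))" if "y \<in> ball a r" for y
      by (rule total_eqD(2)[OF w adm_in[OF f ray[OF that t]]])
    show "der (%y. ?\<Phi> (?\<xi> y t) u) (%w'. ?\<Phi>' (?\<xi> x t) u (t *\<^sub>R w')) x" for u
      by (rule has_derivative_compose[of "%y. ?\<xi> y t" "%w'. t *\<^sub>R w'" x UNIV, OF _ \<Phi>'[OF ray[OF x t]]])
        (auto intro!: derivative_eq_intros)
    show "der (%x. x - a) (%u. u) x" by (auto intro!: derivative_eq_intros)
  qed (use x in auto)
  have bl: "bounded_linear (L x t)" if "x \<in> ball a r" "t \<in> cbox 0 1" for x t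
    using hd[OF that] has_derivative_bounded_linear by blast
  define U where "U = ball a r \<times> cbox 0 (1::real)"
  have cr: "continuous_on U (%p. ?\<xi> (fst p) (snd p))" "!!p. p \<in> U ==> ?\<xi> (fst p) (snd p) \<in> ball a r"
    by (intro continuous_intros) (auto simp: U_def simp del: mem_ball intro!: ray)
  have cL: "continuous_on U (%p. L (fst p) (snd p) u)" for u
    unfolding L_def
    by (intro continuous_on_add continuous_on_Dw[OF f] continuous_on_w[OF f] continuous_on_Pair
        continuous_on_derivative[OF f] cr continuous_intros)
  \<comment> \<open>The Leibniz rule expects the derivative of the integrand as a bounded linear
    map, hence \<open>Blinfun\<close>.\<close>
  define G where "G x = integral (cbox 0 1) (%t. Blinfun (L x t))" for x
  have cB: "continuous_on U (%(x, t). Blinfun (L x t))"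
  proof (rule continuous_on_blinfun_componentwise)
    show "continuous_on U (%p. blinfun_apply (case p of (x, t) => Blinfun (L x t)) i)" for i
      by (rule continuous_on_eq[OF cL[of i]]) (auto simp: U_def bounded_linear_Blinfun_apply[OF bl] simp del: cbox_interval mem_ball)
  qed
  have cI: "continuous_on U (%(x, t). ?\<Phi> (?\<xi> x t) (x - a))"
    unfolding split_beta by (intro continuous_on_w[OF f] cr continuous_intros)
  have cont1: "continuous_on (cbox 0 1) (h x)" if "continuous_on U (%(x, t). h x t)" "x \<in> ball a r" for h :: "'a => real => 'c::topological_space" and x
  proof -
    have "continuous_on (cbox 0 1) (%t. case (x, t) of (x, t) => h x t)"
      by (rule continuous_on_compose2[OF that(1)])
        (use that(2) in "auto simp: U_def intro!: continuous_on_Pair continuous_on_const continuous_on_id simp del: cbox_interval")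
    then show ?thesis by simp
  qed
  have int1: "(%t. ?\<Phi> (?\<xi> x t) (x - a)) integrable_on cbox 0 1" if "x \<in> ball a r" for x
    by (rule integrable_continuous) (rule cont1[OF cI that])
  have hdG: "der (%x. integral (cbox 0 1) (%t. ?\<Phi> (?\<xi> x t) (x - a))) (blinfun_apply (G x)) x"
    if x: "x \<in> ball a r" for x
  proof -
    have "((%x. integral (cbox 0 1) (%t. ?\<Phi> (?\<xi> x t) (x - a))) has_derivative blinfun_apply (G x)) (at x within ball a r)"
      unfolding G_def
    proof (rule leibniz_rule)
      fix x t assume xt: "x \<in> ball a r" "t \<in> cbox 0 (1::real)"
      show "((%x. ?\<Phi> (?\<xi> x t) (x - a)) has_derivative blinfun_apply (Blinfun (L x t))) (at x within ball a r)"
        unfolding bounded_linear_Blinfun_apply[OF bl[OF xt]]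
        by (rule has_derivative_at_withinI[OF hd[OF xt]])
    qed (use int1 cB x in "auto simp: U_def")
    then show ?thesis using x by (simp add: at_within_open[OF x open_ball])
  qed
  have Gapp: "blinfun_apply (G x) u = integral (cbox 0 1) (%t. L x t u)" if "x \<in> ball a r" for x u
  proof -
    have "(%t. Blinfun (L x t)) integrable_on cbox 0 1"
      by (rule integrable_continuous) (rule cont1[OF cB that])
    then show ?thesis unfolding G_def
      by (subst blinfun_apply_integral) (auto intro!: integral_cong simp: bounded_linear_Blinfun_apply[OF bl[OF that]] simp del: cbox_interval)
  qed
  define g' where "g' x u = integral (cbox 0 1) (%t. L x t u)" for x u
  have hg: "der (picard_step w a b f) (g' x) x" if "x \<in> ball a r" for x
  proof -
    have "der (%x. b + integral (cbox 0 1) (%t. ?\<Phi> (?\<xi> x t) (x - a))) (%u. 0 + blinfun_apply (G x) u) x"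
      by (intro has_derivative_add has_derivative_const hdG that)
    then show ?thesis by (simp add: picard_step_def[abs_def] g'_def[abs_def] Gapp[OF that])
  qed
  have nb: "norm (picard_step w a b f x - b) <= \<delta>" if x: "x \<in> ball a r" for x
  proof -
    have "norm (integral (cbox 0 1) (%t. ?\<Phi> (?\<xi> x t) (x - a))) <= (B * r) * measure lborel (cbox 0 (1::real))"
    proof (rule integrable_bound[OF _ int1[OF x]])
      fix t :: real assume t: "t \<in> cbox 0 1"
      have "norm (?\<Phi> (?\<xi> x t) (x - a)) <= B * norm (x - a)"
        using bd[OF nr(2)[OF ray[OF x t]] adm_bound[OF f ray[OF x t]]] by blast
      also have "... <= B * r" using nr[OF x] pos by (intro mult_left_mono) auto
      finally show "norm (?\<Phi> (?\<xi> x t) (x - a)) <= B * r" .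
    qed (use pos in auto)
    then show ?thesis using pos by (simp add: picard_step_def mult.commute)
  qed
  have cg: "continuous_on (ball a r) (%x. g' x u)" for u
    unfolding g'_def
    by (rule integral_continuous_on_param) (use cL[of u] in "simp add: U_def split_beta")
  have est: "norm (g' x u - ?\<Phi> x u) <= \<epsilon> / 4 * norm u" if x: "x \<in> ball a r" for x u
  proof -
    \<comment> \<open>This is the derivative in \<open>t\<close> of \<open>t\<close> times the value
      of \<open>w\<close> on \<open>u\<close> at the point of the ray with parameter
      \<open>t\<close>; so its integral is the value at \<open>x\<close>.\<close>
    define Q where "Q t = ?\<Phi> (?\<xi> x t) u + t *\<^sub>R ?\<Phi>' (?\<xi> x t) u (x - a)" for t :: real
    have "((%t. t *\<^sub>R ?\<Phi> (?\<xi> x t) u) has_vector_derivative Q t) (at t within cbox 0 1)" if t: "t \<in> cbox 0 1" for t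
    proof -
      have 1: "der (%t. ?\<Phi> (?\<xi> x t) u) (%s. ?\<Phi>' (?\<xi> x t) u (s *\<^sub>R (x - a))) t"
        by (rule has_derivative_compose[of "%t. ?\<xi> x t" "%s. s *\<^sub>R (x - a)" t UNIV, OF _ \<Phi>'[OF ray[OF x t]]])
          (auto intro!: derivative_eq_intros)
      have lin: "linear (?\<Phi>' (?\<xi> x t) u)" using \<Phi>'[OF ray[OF x t]] has_derivative_linear by blast
      have "der (%t. t *\<^sub>R ?\<Phi> (?\<xi> x t) u) (%s. t *\<^sub>R ?\<Phi>' (?\<xi> x t) u (s *\<^sub>R (x - a)) + s *\<^sub>R ?\<Phi> (?\<xi> x t) u) t"
        by (rule has_derivative_scaleR[OF has_derivative_ident 1])
      then have "der (%t. t *\<^sub>R ?\<Phi> (?\<xi> x t) u) (%s. s *\<^sub>R Q t) t"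
        unfolding linear_scale[OF lin] Q_def by (simp add: algebra_simps)
      then show ?thesis unfolding has_vector_derivative_def by (rule has_derivative_at_withinI)
    qed
    then have "(Q has_integral (1 *\<^sub>R ?\<Phi> (?\<xi> x 1) u - 0 *\<^sub>R ?\<Phi> (?\<xi> x 0) u)) {0..1}"
      by (intro fundamental_theorem_of_calculus) auto
    then have Q: "(Q has_integral ?\<Phi> x u) (cbox 0 1)" by simp
    have cLx: "continuous_on (cbox 0 1) (%t. L x t u)"
      by (rule cont1[OF _ x, of "%x t. L x t u"]) (use cL in "simp add: split_beta")
    have "((%t. L x t u - Q t) has_integral (g' x u - ?\<Phi> x u)) (cbox 0 1)"
      unfolding g'_def by (intro has_integral_diff Q integrable_integral integrable_continuous cLx)
    moreover have "norm (L x t u - Q t) <= 2 * (\<epsilon> * B * norm u * r)" if t: "t \<in> cbox 0 1" for t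
    proof -
      let ?y = "?\<xi> x t" and ?v = "x - a"
      note y = ray[OF x t]
      note o = adm_in[OF f y]
      note lin2 = total_eq_linear(2)[OF w o]
      have E0: "\<epsilon> * norm v >= 0" for v :: 'a using \<epsilon>[OF y, of v] norm_ge_zero order_trans by blast
      have sp: "?\<Phi>' ?y v u' = Dw w (?y, f ?y) v (u', ?\<Phi> ?y u') + Dw w (?y, f ?y) v (0, f' ?y u' - ?\<Phi> ?y u')" for v u'
        by (subst linear_add[OF lin2, symmetric]) simp
      have ii: "Dw w (?y, f ?y) ?v (u, ?\<Phi> ?y u) = Dw w (?y, f ?y) u (?v, ?\<Phi> ?y ?v)"
        using int o unfolding integrable_eq_def by blast
      have bE: "norm (Dw w (?y, f ?y) v (0, f' ?y u' - ?\<Phi> ?y u')) <= \<epsilon> * B * norm u' * norm v" for v u'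
      proof -
        have "norm (Dw w (?y, f ?y) v (0, f' ?y u' - ?\<Phi> ?y u')) <= B * norm (0::'a, f' ?y u' - ?\<Phi> ?y u') * norm v"
          using bd[OF nr(2)[OF y] adm_bound[OF f y]] by blast
        also have "... <= B * (\<epsilon> * norm u') * norm v"
          using \<epsilon>[OF y, of u'] pos by (intro mult_right_mono mult_left_mono) (auto simp: norm_Pair)
        finally show ?thesis by (simp add: mult_ac)
      qed
      \<comment> \<open>The contributions that an exact solution would make cancel by integrability;
        what remains involves only the defect.\<close>
      let ?Y = "Dw w (?y, f ?y) ?v (0, f' ?y u - ?\<Phi> ?y u) - Dw w (?y, f ?y) u (0, f' ?y ?v - ?\<Phi> ?y ?v)"
      have "L x t u - Q t = t *\<^sub>R (?\<Phi>' ?y ?v u - ?\<Phi>' ?y u ?v)"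
      proof -
        have "linear (?\<Phi>' ?y ?v)" using \<Phi>'[OF y] has_derivative_linear by blast
        from linear_scale[OF this, of t u] show ?thesis unfolding L_def Q_def by (simp add: scaleR_diff_right)
      qed
      moreover have "?\<Phi>' ?y ?v u - ?\<Phi>' ?y u ?v = ?Y"
        using ii by (simp only: sp[of ?v u] sp[of u ?v] add_diff_cancel_left)
      ultimately have "norm (L x t u - Q t) = \<bar>t\<bar> * norm ?Y" by simp
      also have "... <= norm ?Y" using t by (intro mult_left_le_one_le) auto
      also have "... <= \<epsilon> * B * norm u * norm ?v + \<epsilon> * B * norm ?v * norm u"
        by (intro norm_triangle_le_diff add_mono bE)
      also have "... = 2 * ((\<epsilon> * norm u) * B * norm ?v)" by (simp add: mult_ac)
      also have "... <= 2 * ((\<epsilon> * norm u) * B * r)"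
        using nr[OF x] pos E0 by (intro mult_left_mono) auto
      finally show ?thesis by (simp add: mult_ac)
    qed
    ultimately have "norm (g' x u - ?\<Phi> x u) <= 2 * (\<epsilon> * B * norm u * r) * measure lborel (cbox 0 (1::real))"
    proof (rule has_integral_bound[rotated])
      have "\<epsilon> * norm u >= 0" using \<epsilon>[OF x, of u] norm_ge_zero order_trans by blast
      then have "(\<epsilon> * norm u) * (B * r) >= 0" using pos by simp
      then show "0 <= 2 * (\<epsilon> * B * norm u * r)" by (simp add: mult_ac)
    qed
    also have "... = 2 * ((\<epsilon> * norm u) * (r * B))" by (simp add: mult_ac)
    also have "... <= 2 * ((\<epsilon> * norm u) * (1 / 8))"
      using \<epsilon>[OF x, of u] norm_ge_zero[of "f' x u - w (x, f x) u"] pos by (intro mult_left_mono) linarith+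
    finally show ?thesis by simp
  qed
  show ?thesis
    by (rule exI[of _ g']) (use hg nb cg est in "auto simp: adm_def")
qed

lemma picard_step_diff:
  assumes f: "adm f f'" and g: "adm g g'" and d: "!!x. x \<in> ball a r ==> norm (f x - g x) <= d" and x: "x \<in> ball a r"
  shows "norm (picard_step w a b f x - picard_step w a b g x) <= d / 4"
proof -
  let ?\<xi> = "%t::real. a + t *\<^sub>R (x - a)"
  have d0: "d >= 0" using d[OF x] norm_ge_zero order_trans by blast
  have c: "continuous_on (cbox 0 1) (%t. w (?\<xi> t, f (?\<xi> t)) (x - a))" if "adm f f'" for f f'
    by (intro continuous_on_w[OF that] continuous_intros ray x)
  have "norm (integral (cbox 0 1) (%t. w (?\<xi> t, f (?\<xi> t)) (x - a) - w (?\<xi> t, g (?\<xi> t)) (x - a))) <= (B * d * r) * measure lborel (cbox 0 (1::real))"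
  proof (rule integrable_bound)
    fix t :: real assume t: "t \<in> cbox 0 1"
    note y = ray[OF x t]
    have "norm (w (?\<xi> t, f (?\<xi> t)) (x - a) - w (?\<xi> t, g (?\<xi> t)) (x - a)) <= B * norm (f (?\<xi> t) - g (?\<xi> t)) * norm (x - a)"
      by (rule Lip[OF y adm_bound[OF f y] adm_bound[OF g y]])
    also have "... <= B * d * r" using d[OF y] nr[OF x] pos d0 by (intro mult_mono) auto
    finally show "norm (w (?\<xi> t, f (?\<xi> t)) (x - a) - w (?\<xi> t, g (?\<xi> t)) (x - a)) <= B * d * r" .
  next
    show "0 <= B * d * r" using pos d0 by simp
    show "(%t. w (?\<xi> t, f (?\<xi> t)) (x - a) - w (?\<xi> t, g (?\<xi> t)) (x - a)) integrable_on cbox 0 1"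
      by (intro integrable_diff integrable_continuous c[OF f] c[OF g])
  qed
  also have "... = d * (r * B)" by (simp add: mult_ac)
  also have "... <= d * (1 / 8)" using d0 pos by (intro mult_left_mono) auto
  also have "... <= d / 4" using d0 by simp
  finally show ?thesis
    unfolding picard_step_def using integral_diff[OF integrable_continuous[OF c[OF f]] integrable_continuous[OF c[OF g]]] by simp
qed

lemma picard_step_center:
  assumes "adm f f'" shows "picard_step w a b f a = b"
proof -
  have "a \<in> ball a r" using pos by simp
  then have "linear (w (a, f a))" using total_eqD(2)[OF w adm_in[OF assms]] by blast
  then show ?thesis by (simp add: picard_step_def linear_0)
qed

text \<open>Chosen so that the bound \<open>A / 2 ^ m\<close> for the defect is inductive:
  \<open>B\<close> bounds the defect of the constant start, and the term
  \<open>4 * B * \<delta>\<close> pays for replacing the old iterate by the new one inside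
  \<open>w\<close>.\<close>

definition A where "A = B + 4 * B * \<delta>"

lemma picard_iterates:
  "EX f f'. (ALL m. adm (f m) (f' m) & f (Suc m) = picard_step w a b (f m) &
     (ALL x:ball a r. ALL u. norm (f' m x u - w (x, f m x) u) <= A / 2 ^ m * norm u) &
     (ALL x:ball a r. norm (f (Suc m) x - f m x) <= \<delta> / 4 ^ m)) & f 0 = (%_. b)"
proof -
  define P where "P m q \<longleftrightarrow> adm (fst q) (snd q) &
     (ALL x:ball a r. ALL u. norm (snd q x u - w (x, fst q x) u) <= A / 2 ^ m * norm u) &
     (ALL x:ball a r. norm (picard_step w a b (fst q) x - fst q x) <= \<delta> / 4 ^ m) & (m = 0 --> fst q = (%_. b))" for m q
  have b0: "(x, b) \<in> Om & (ALL v. norm (w (x, b) v) <= B * norm v)" if "x \<in> ball a r" for x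
    using bd[of x b] nr[OF that] pos by simp
  have "P 0 (%_. b, %_ _. 0)"
  proof -
    have adm0: "adm (%_. b) (%_ _. 0)" using pos by (auto simp: adm_def)
    have "norm (w (x, b) u) <= A * norm u" if "x \<in> ball a r" for x u
    proof -
      have "norm (w (x, b) u) <= B * norm u" using b0[OF that] by blast
      also have "... <= A * norm u" using pos by (intro mult_right_mono) (auto simp: A_def)
      finally show ?thesis .
    qed
    moreover have "norm (picard_step w a b (%_. b) x - b) <= \<delta>" if "x \<in> ball a r" for x
      using picard_step[OF adm0, of A] calculation that by (auto simp: adm_def)
    ultimately show ?thesis using adm0 by (auto simp: P_def)
  qed
  moreover have "EX q'. P (Suc m) q' & fst q' = picard_step w a b (fst q)" if "P m q" for m q
  proof -
    from that have q: "adm (fst q) (snd q)" "!!x u. x \<in> ball a r ==> norm (snd q x u - w (x, fst q x) u) <= A / 2 ^ m * norm u"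
      "!!x. x \<in> ball a r ==> norm (picard_step w a b (fst q) x - fst q x) <= \<delta> / 4 ^ m"
      by (auto simp: P_def)
    obtain g' where g': "adm (picard_step w a b (fst q)) g'"
      "!!x u. x \<in> ball a r ==> norm (g' x u - w (x, fst q x) u) <= A / 2 ^ m / 4 * norm u"
      using picard_step[OF q(1,2)] by blast
    have "norm (g' x u - w (x, picard_step w a b (fst q) x) u) <= A / 2 ^ Suc m * norm u" if x: "x \<in> ball a r" for x u
    proof -
      have "norm (w (x, fst q x) u - w (x, picard_step w a b (fst q) x) u) <= B * norm (fst q x - picard_step w a b (fst q) x) * norm u"
        by (rule Lip[OF x adm_bound[OF q(1) x] adm_bound[OF g'(1) x]])
      also have "... <= B * (\<delta> / 4 ^ m) * norm u"
        using q(3)[OF x] pos by (intro mult_right_mono mult_left_mono) (auto simp: norm_minus_commute)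
      also have "... <= A / 2 ^ m / 4 * norm u"
      proof (intro mult_right_mono)
        have "(2::real) ^ m <= 4 ^ m" by (intro power_mono) auto
        then have "B * \<delta> / 4 ^ m <= B * \<delta> / 2 ^ m" using pos by (intro divide_left_mono) auto
        also have "... <= A / 4 / 2 ^ m" using pos by (intro divide_right_mono) (auto simp: A_def)
        finally show "B * (\<delta> / 4 ^ m) <= A / 2 ^ m / 4" by simp
      qed simp
      finally have "norm (g' x u - w (x, picard_step w a b (fst q) x) u) <= A / 2 ^ m / 4 * norm u + A / 2 ^ m / 4 * norm u"
        using g'(2)[OF x, of u] norm_triangle_ineq[of "g' x u - w (x, fst q x) u" "w (x, fst q x) u - w (x, picard_step w a b (fst q) x) u"]
        by (simp only: diff_add_cancel add_diff_eq)
      also have "... = A / 2 ^ Suc m * norm u" by (simp add: field_simps)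
      finally show ?thesis .
    qed
    moreover have "norm (picard_step w a b (picard_step w a b (fst q)) x - picard_step w a b (fst q) x) <= \<delta> / 4 ^ Suc m" if "x \<in> ball a r" for x
      using picard_step_diff[OF g'(1) q(1) q(3) that] by simp
    ultimately show ?thesis using g' by (intro exI[of _ "(picard_step w a b (fst q), g')"]) (auto simp: P_def)
  qed
  ultimately obtain q where q: "!!m. P m (q m)" "!!m. fst (q (Suc m)) = picard_step w a b (fst (q m))"
    using dependent_nat_choice[of P "%m q q'. fst q' = picard_step w a b (fst q)"] by metis
  show ?thesis
    by (intro exI[of _ "%m. fst (q m)"] exI[of _ "%m. snd (q m)"]) (use q in "auto simp: P_def")
qed

lemma geometric_Cauchy_bound:
  fixes s :: "nat => 'c::banach"
  assumes "!!m. norm (s (Suc m) - s m) <= \<delta> / 4 ^ m"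
  shows "EX l. s \<longlonglongrightarrow> l & (ALL m. norm (s m - l) <= 2 * \<delta> / 4 ^ m)"
proof -
  \<comment> \<open>The factor \<open>1 - 1 / 4 ^ k\<close> strengthens the bound so that the
    geometric sum can be estimated by induction.\<close>
  have d: "norm (s (m + k) - s m) <= 2 * \<delta> / 4 ^ m * (1 - 1 / 4 ^ k)" for m k
  proof (induction k)
    case (Suc k)
    have "norm (s (m + Suc k) - s m) <= norm (s (Suc (m + k)) - s (m + k)) + norm (s (m + k) - s m)"
      using norm_triangle_ineq[of "s (Suc (m + k)) - s (m + k)" "s (m + k) - s m"] by simp
    also have "... <= \<delta> / 4 ^ (m + k) + 2 * \<delta> / 4 ^ m * (1 - 1 / 4 ^ k)" using assms Suc by (intro add_mono)
    also have "... <= 2 * \<delta> / 4 ^ m * (1 - 1 / 4 ^ Suc k)" using pos by (simp add: field_simps power_add)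
    finally show ?case .
  qed simp
  have d2: "norm (s (m + k) - s m) <= 2 * \<delta> / 4 ^ m" for m k
  proof -
    have "2 * \<delta> / 4 ^ m * (1 - 1 / 4 ^ k) <= 2 * \<delta> / 4 ^ m * 1" using pos by (intro mult_left_mono) auto
    then show ?thesis using d[of m k] by simp
  qed
  have "summable (%m. \<delta> * (1 / 4) ^ m)" by (intro summable_mult summable_geometric) simp
  then have "summable (%m. s (Suc m) - s m)"
    by (rule summable_comparison_test'[of _ 0]) (use assms in "simp add: power_one_over")
  from tendsto_add[OF summable_LIMSEQ[OF this, unfolded sum_lessThan_telescope] tendsto_const[of "s 0"]]
  obtain l where l: "s \<longlonglongrightarrow> l" by auto
  moreover have "norm (s m - l) <= 2 * \<delta> / 4 ^ m" for m
  proof (rule LIMSEQ_le_const2)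
    show "(%k. norm (s m - s (k + m))) \<longlonglongrightarrow> norm (s m - l)" by (intro tendsto_intros LIMSEQ_ignore_initial_segment l)
  qed (use d2[of m] in "auto simp: norm_minus_commute add.commute")
  ultimately show ?thesis by blast
qed

text \<open>The defects tend to 0 uniformly, so the derivatives of the iterates converge uniformly
  to \<open>w (x, y x)\<close>, which is then the derivative of the limit.\<close>

lemma solution:
  "EX y. y a = b & (ALL x:ball a r. (x, y x) \<in> Om & der y (w (x, y x)) x)"
proof -
  obtain f f' where f: "!!m. adm (f m) (f' m)" "!!m. f (Suc m) = picard_step w a b (f m)"
     "!!m x u. x\<in>ball a r ==> norm (f' m x u - w (x, f m x) u) <= A / 2 ^ m * norm u"
     "!!m x. x\<in>ball a r ==> norm (f (Suc m) x - f m x) <= \<delta> / 4 ^ m" "f 0 = (%_. b)"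
    using picard_iterates by blast
  have "ALL x:ball a r. EX l. (%m. f m x) \<longlonglongrightarrow> l & (ALL m. norm (f m x - l) <= 2 * \<delta> / 4 ^ m)"
    using f(4) by (auto intro!: geometric_Cauchy_bound simp del: mem_ball)
  then obtain y where y: "!!x. x \<in> ball a r ==> (%m. f m x) \<longlonglongrightarrow> y x"
    "!!x m. x \<in> ball a r ==> norm (f m x - y x) <= 2 * \<delta> / 4 ^ m" by metis
  have yb: "norm (y x - b) <= \<delta>" if "x \<in> ball a r" for x
  proof (rule LIMSEQ_le_const2)
    show "(%m. norm (f m x - b)) \<longlonglongrightarrow> norm (y x - b)" by (intro tendsto_intros y that)
  qed (use f(1) that in "auto simp: adm_def")
  have A0: "A >= 0" using pos by (simp add: A_def)
  have err: "norm (f' m x u - w (x, y x) u) <= (A / 2 ^ m + B * (2 * \<delta>) / 2 ^ m) * norm u" if x: "x \<in> ball a r" for m x u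
  proof -
    have "norm (w (x, f m x) u - w (x, y x) u) <= B * norm (f m x - y x) * norm u"
      by (rule Lip[OF x adm_bound[OF f(1) x] yb[OF x]])
    also have "... <= B * (2 * \<delta> / 4 ^ m) * norm u"
      using y(2)[OF x] pos by (intro mult_right_mono mult_left_mono) auto
    also have "... <= B * (2 * \<delta> / 2 ^ m) * norm u"
      using pos by (intro mult_right_mono mult_left_mono divide_left_mono power_mono) auto
    finally show ?thesis
      using f(3)[OF x, of m u] norm_triangle_ineq[of "f' m x u - w (x, f m x) u" "w (x, f m x) u - w (x, y x) u"]
      by (simp add: distrib_right)
  qed
  have "EX g. ALL x:ball a r. (%m. f m x) \<longlonglongrightarrow> g x & (g has_derivative w (x, y x)) (at x within ball a r)"
  proof (rule has_derivative_sequence[where ?x0.0=a and l="y a"])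
    show "(f m has_derivative f' m x) (at x within ball a r)" if "x \<in> ball a r" for m x
      using f(1)[of m] that unfolding adm_def by (blast intro: has_derivative_at_withinI)
    fix e :: real assume e: "e > 0"
    have "(%m. (A + B * (2 * \<delta>)) * inverse (2 ^ m)) \<longlonglongrightarrow> (A + B * (2 * \<delta>)) * 0"
      by (intro tendsto_intros LIMSEQ_inverse_realpow_zero) auto
    then have "\<forall>\<^sub>F m in sequentially. (A + B * (2 * \<delta>)) * inverse (2 ^ m) < e"
      using e by (intro order_tendstoD) auto
    then show "\<forall>\<^sub>F m in sequentially. ALL x:ball a r. ALL u. norm (f' m x u - w (x, y x) u) <= e * norm u"
    proof eventually_elim
      case (elim m)
      show ?case
      proof (intro ballI allI)
        fix x u assume "x \<in> ball a r"
        from err[OF this, of m u] have "norm (f' m x u - w (x, y x) u) <= ((A + B * (2 * \<delta>)) * inverse (2 ^ m)) * norm u"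
          by (simp add: field_simps)
        also have "... <= e * norm u" using elim by (intro mult_right_mono) auto
        finally show "norm (f' m x u - w (x, y x) u) <= e * norm u" .
      qed
    qed
  next
    show "a \<in> ball a r" using pos by simp
    show "(%m. f m a) \<longlonglongrightarrow> y a" using y pos by simp
    show "convex (ball a r)" by simp
  qed
  then obtain g where g: "!!x. x \<in> ball a r ==> (%m. f m x) \<longlonglongrightarrow> g x"
    "!!x. x \<in> ball a r ==> (g has_derivative w (x, y x)) (at x within ball a r)" by blast
  have gy: "g x = y x" if "x \<in> ball a r" for x using g(1)[OF that] y(1)[OF that] LIMSEQ_unique by blast
  have hy: "der y (w (x, y x)) x" if "x \<in> ball a r" for x
  proof (rule der_cong[OF _ open_ball that gy])
    show "der g (w (x, y x)) x" using g(2)[OF that] unfolding at_within_open[OF that open_ball] .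
  qed
  have "f m a = b" for m using f(2,5) picard_step_center[OF f(1)] by (cases m) auto
  then have "y a = b" using y(1)[of a] pos LIMSEQ_unique[OF tendsto_const[of b], of "y a"] by simp
  moreover have "(x, y x) \<in> Om" if "x \<in> ball a r" for x using bd[OF nr(2)[OF that] yb[OF that]] by blast
  ultimately show ?thesis using hy by blast
qed

end

theorem total_eq_solvable:
  fixes w :: "'a::euclidean_space \<times> 'b::euclidean_space => 'a => 'b"
  assumes w: "total_eq Om w" and int: "integrable_eq Om w" and K: "compact K" "K <= Om"
  shows "EX r>0. ALL (a, b):K. EX y. y a = b & (ALL x:ball a r. (x, y x) \<in> Om & der y (w (x, y x)) x)"
proof -
  obtain \<delta> B where d: "\<delta> > 0" "B > 0" and bd: "ALL (a, b):K. ALL x y. norm (x - a) <= \<delta> --> norm (y - b) <= \<delta> -->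
     (x, y) \<in> Om & (ALL v. norm (w (x, y) v) <= B * norm v) &
     (ALL v q. norm (Dw w (x, y) v q) <= B * norm q * norm v)"
    using total_eq_bounds[OF w K] by blast
  \<comment> \<open>The first two bounds keep the iterates in the region where \<open>B\<close> is
    valid; the third makes a Picard step divide the defect by 4.\<close>
  define r where "r = min \<delta> (min (\<delta> / (2 * B)) (1 / (8 * B)))"
  have "r > 0" using d by (simp add: r_def)
  moreover have "r <= \<delta>" "r <= \<delta> / (2 * B)" "r <= 1 / (8 * B)" by (auto simp: r_def)
  ultimately have r: "r > 0" "r <= \<delta>" "r * B <= \<delta> / 2" "r * B <= 1 / 8"
    using d by (simp_all add: pos_le_divide_eq mult.commute mult.left_commute)
  have "EX y. y a = b & (ALL x:ball a r. (x, y x) \<in> Om & der y (w (x, y x)) x)" if "(a, b) \<in> K" for a b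
  proof -
    interpret picard Om w a b \<delta> B r
      using w int d r by unfold_locales (use bd that in blast)+
    show ?thesis by (rule solution)
  qed
  then show ?thesis using r(1) by blast
qed

section \<open>Closure properties of smooth functions\<close>

lemma smooth_onD: "smooth_on f S ==> Ck_on k f S" by (simp add: smooth_on_def)
lemma smooth_on_cong: "open S ==> (!!x. x \<in> S ==> f x = g x) ==> smooth_on f S ==> smooth_on g S"
  using Ck_on_cong unfolding smooth_on_def by blast
lemma smooth_on_subset: "smooth_on f S ==> T <= S ==> smooth_on f T"
  using Ck_on_subset unfolding smooth_on_def by blast
lemma smooth_on_local: "(!!x. x \<in> S ==> EX T. open T & x \<in> T & smooth_on f T) ==> smooth_on f S"
  unfolding smooth_on_def by (metis Ck_on_local)
lemma smooth_on_const: "smooth_on (%x. c) S"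
  by (simp add: smooth_on_def Ck_on_const)
lemma smooth_on_id: "open S ==> smooth_on (%x. x) S"
  by (simp add: smooth_on_def Ck_on_id)
lemma smooth_on_add: "open S ==> smooth_on f S ==> smooth_on g S ==> smooth_on (%x. f x + g x) S"
  by (simp add: smooth_on_def Ck_on_add)
lemma smooth_on_linear: "bounded_linear L ==> open S ==> smooth_on f S ==> smooth_on (%x. L (f x)) S"
  by (simp add: smooth_on_def Ck_on_linear)
lemma smooth_on_bilinear:
  "bounded_bilinear B ==> open S ==> smooth_on f S ==> smooth_on g S ==> smooth_on (%x. B (f x) (g x)) S"
  by (simp add: smooth_on_def Ck_on_bilinear)
lemma smooth_on_sum: "open S ==> (!!i. i \<in> I ==> smooth_on (f i) S) ==> smooth_on (%x. \<Sum>i\<in>I. f i x) S"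
  by (simp add: smooth_on_def Ck_on_sum)
lemma smooth_on_linear_arg:
  "open S ==> (!!x. x \<in> S ==> linear (T x)) ==> (!!u. smooth_on (%x. T x u) S) ==> smooth_on u S ==>
   smooth_on (%x. T x (u x)) S"
  unfolding smooth_on_def by (blast intro: Ck_on_linear_arg)
lemma smooth_on_compose:
  "open S ==> smooth_on f T ==> smooth_on g S ==> g ` S <= T ==> smooth_on (%x. f (g x)) S"
  unfolding smooth_on_def by (blast intro: Ck_on_compose)
lemma smooth_on_uminus: "open S ==> smooth_on f S ==> smooth_on (%x. - f x) S"
  by (rule smooth_on_linear[OF bounded_linear_minus[OF bounded_linear_ident]])
lemma smooth_on_diff: "open S ==> smooth_on f S ==> smooth_on g S ==> smooth_on (%x. f x - g x) S"
  using smooth_on_add[of S f "%x. - g x"] smooth_on_uminus[of S g] by simp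
lemma smooth_on_mult:
  fixes f g :: "'a::euclidean_space => 'b::{euclidean_space, real_normed_algebra}"
  shows "open S ==> smooth_on f S ==> smooth_on g S ==> smooth_on (%x. f x * g x) S"
  by (rule smooth_on_bilinear[OF bounded_bilinear_mult])
lemma smooth_on_Pair:
  assumes "open S" "smooth_on f S" "smooth_on g S" shows "smooth_on (%x. (f x, g x)) S"
proof -
  have "smooth_on (%x. (f x, 0) + (0, g x)) S"
    by (intro smooth_on_add assms(1) smooth_on_linear[OF _ assms(1,2)] smooth_on_linear[OF _ assms(1,3)])
      (auto intro!: bounded_linear_intros)
  then show ?thesis by simp
qed

lemma smooth_on_deriv: "smooth_on f S ==> x \<in> S ==> der f (fd f x) x"
  using Ck_on_SucD smooth_onD by blast
lemma smooth_on_frechet: "smooth_on f S ==> smooth_on (%x. fd f x v) S"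
  unfolding smooth_on_def by (metis Ck_on.simps(2))
lemma smooth_on_continuous: "smooth_on f S ==> continuous_on S f"
  using smooth_onD[of f S 0] by simp

text \<open>Here \<open>f'\<close> may be any expression for the derivative near \<open>x\<close>,
  so integrability conditions can be read off from a formula for \<open>f'\<close>.\<close>

lemma second_derivative_commute:
  fixes f :: "'a::euclidean_space => 'b::euclidean_space"
  assumes "open S" "x \<in> S" "smooth_on f S" and f': "!!y. y \<in> S ==> der f (f' y) y"
    and "der (%y. f' y u) Fu x" "der (%y. f' y v) Fv x"
  shows "Fu v = Fv u"
proof -
  let ?f' = "%y. fd f y"
  let ?f'' = "%y u. fd (%y. ?f' y u) y"
  have eq: "?f' y = f' y" if "y \<in> S" for y using frechet_derivative_at[OF f'[OF that]] by simp
  have s: "smooth_on (%y. ?f' y w) S" for w by (rule smooth_on_frechet[OF assms(3)])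
  have F: "?f'' x w = Fw" if "der (%y. f' y w) Fw x" for w Fw
  proof -
    have "der (%y. ?f' y w) Fw x"
      by (rule der_cong[OF that assms(1,2)]) (simp add: eq)
    then show ?thesis using frechet_derivative_at by metis
  qed
  have "?f'' x u v = ?f'' x v u"
    by (rule second_derivative_symmetric[where f'="?f'" and f''="?f''", OF assms(1,2)])
      (use assms(3) s in "auto intro!: smooth_on_deriv smooth_on_continuous smooth_on_frechet")
  then show ?thesis using F assms(5,6) by metis
qed

section \<open>Complex types of real multilinear maps\<close>

lemma scaleR_vec_eq: "r *\<^sub>R (v :: 'n::finite V) = complex_of_real r *s v"
  by (simp add: vec_eq_iff scaleR_conv_of_real[where 'a=complex])

lemma norm_smult: "norm ((a::complex) *s (v :: 'n::finite V)) = norm a * norm v"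
  by (simp add: norm_vec_def norm_mult L2_set_right_distrib)

lemma bounded_bilinear_smult: "bounded_bilinear (%(a::complex) (v::'n::finite V). a *s v)"
proof
  show "EX K. ALL (a::complex) (b :: 'n V). norm (a *s b) <= norm a * norm b * K"
    by (intro exI[of _ 1]) (simp add: norm_smult)
qed (auto simp: vec_eq_iff algebra_simps)

lemmas smooth_on_smult = smooth_on_bilinear[OF bounded_bilinear_smult]

definition clinear :: "('n::finite V => complex) => bool" where
  "clinear f \<longleftrightarrow> (ALL u v. f (u + v) = f u + f v) & (ALL a u. f (a *s u) = a * f u)"

definition clinearv :: "('n::finite V => 'm::finite V) => bool" where
  "clinearv f \<longleftrightarrow> (ALL u v. f (u + v) = f u + f v) & (ALL a u. f (a *s u) = a *s f u)"

lemma clinearD: "clinear f ==> f (u + v) = f u + f v" "clinear f ==> f (a *s u) = a * f u"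
  by (auto simp: clinear_def)
lemma clinearvD: "clinearv f ==> f (u + v) = f u + f v" "clinearv f ==> f (a *s u) = a *s f u"
  by (auto simp: clinearv_def)
lemma clinearv_linear: "clinearv f ==> linear f"
  by (rule linearI) (auto simp: clinearv_def scaleR_vec_eq)

lemma type_split1:
  fixes f g :: "'n::finite V => complex"
  assumes "!!w. f w + g w = 0" "f (\<i> *s w) = \<i> * f w" "g (\<i> *s w) = - (\<i> * g w)"
  shows "f w = 0" "g w = 0"
proof -
  have "f w + g w = 0" "\<i> * (f w - g w) = 0" using assms(1)[of w] assms(1)[of "\<i> *s w"] assms(2,3) by (auto simp: algebra_simps)
  then show "f w = 0" "g w = 0" by auto
qed

text \<open>The four parts acquire different pairs of signs when \<open>\<i>\<close> is inserted
  into the first or second argument. The four resulting equations form an invertible system, so each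
  part vanishes separately.\<close>

lemma type_split2:
  fixes P Q R T :: "'n::finite V => 'n V => complex"
  assumes e: "!!a b. P a b + Q a b + R a b + T a b = 0"
    and "!!a b. P (\<i> *s a) b = \<i> * P a b" "!!a b. P a (\<i> *s b) = \<i> * P a b"
    and "!!a b. Q (\<i> *s a) b = - (\<i> * Q a b)" "!!a b. Q a (\<i> *s b) = \<i> * Q a b"
    and "!!a b. R (\<i> *s a) b = \<i> * R a b" "!!a b. R a (\<i> *s b) = - (\<i> * R a b)"
    and "!!a b. T (\<i> *s a) b = - (\<i> * T a b)" "!!a b. T a (\<i> *s b) = - (\<i> * T a b)"
  shows "P a b = 0" "Q a b = 0" "R a b = 0" "T a b = 0"
proof -
  have "P a b + Q a b + R a b + T a b = 0" by (rule e)
  moreover have "\<i> * (P a b - Q a b + R a b - T a b) = 0" using e[of "\<i> *s a" b] by (simp add: assms(2-) algebra_simps)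
  moreover have "\<i> * (P a b + Q a b - R a b - T a b) = 0" using e[of a "\<i> *s b"] by (simp add: assms(2-) algebra_simps)
  moreover have "- P a b + Q a b + R a b - T a b = 0" using e[of "\<i> *s a" "\<i> *s b"] by (simp add: assms(2-) algebra_simps)
  ultimately have s: "P a b + Q a b + R a b + T a b = 0" "P a b - Q a b + R a b - T a b = 0"
     "P a b + Q a b - R a b - T a b = 0" "- P a b + Q a b + R a b - T a b = 0" by simp_all
  have "4 * P a b = (P a b + Q a b + R a b + T a b) + (P a b - Q a b + R a b - T a b)
      + (P a b + Q a b - R a b - T a b) - (- P a b + Q a b + R a b - T a b)" by (simp add: algebra_simps)
  moreover have "4 * Q a b = (P a b + Q a b + R a b + T a b) - (P a b - Q a b + R a b - T a b)
      + (P a b + Q a b - R a b - T a b) + (- P a b + Q a b + R a b - T a b)" by (simp add: algebra_simps)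
  moreover have "4 * R a b = (P a b + Q a b + R a b + T a b) + (P a b - Q a b + R a b - T a b)
      - (P a b + Q a b - R a b - T a b) + (- P a b + Q a b + R a b - T a b)" by (simp add: algebra_simps)
  ultimately show "P a b = 0" "Q a b = 0" "R a b = 0" unfolding s by simp_all
  with s(1) show "T a b = 0" by simp
qed

section \<open>Local Kaehler calculus\<close>

text \<open>The hermitian form \<open>h (u, v) = g (u, v) + \<i> g (u, J v)\<close> of a metric in a holomorphic chart and its
  Christoffel symbols \<open>Gm\<close>, which are complex bilinear.\<close>

locale kaehler_chart =
  fixes X :: "('n::finite V) set"
    and h :: "'n V => 'n V => 'n V => complex"
    and Gm :: "'n V => 'n V => 'n V => 'n V"
  assumes open_X: "open X"
    and h_add: "x \<in> X ==> h x (u + u') v = h x u v + h x u' v"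
    and h_scale: "x \<in> X ==> h x (a *s u) v = a * h x u v"
    and h_herm: "x \<in> X ==> h x v u = cnj (h x u v)"
    and h_nondeg: "x \<in> X ==> (!!v. h x u v = 0) ==> u = 0"
    and h_smooth: "smooth_on (%x. h x u v) X"
    and Gm_sym: "x \<in> X ==> Gm x u v = Gm x v u"
    and Gm_add: "x \<in> X ==> Gm x (u + u') v = Gm x u v + Gm x u' v"
    and Gm_scale: "x \<in> X ==> Gm x (a *s u) v = a *s Gm x u v"
    and Gm_smooth: "smooth_on (%x. Gm x u v) X"
    and h_deriv: "x \<in> X ==> der (%y. h y u v) (%w. h x (Gm x w u) v + h x u (Gm x w v)) x"
begin

lemma h_add2: "x \<in> X ==> h x v (u + u') = h x v u + h x v u'"
  using h_herm h_add by (metis complex_cnj_add)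
lemma h_scale2: "x \<in> X ==> h x v (a *s u) = cnj a * h x v u"
  using h_herm h_scale by (metis complex_cnj_mult)
lemma Gm_add2: "x \<in> X ==> Gm x v (u + u') = Gm x v u + Gm x v u'"
  using Gm_sym Gm_add by metis
lemma Gm_scale2: "x \<in> X ==> Gm x v (a *s u) = a *s Gm x v u"
  using Gm_sym Gm_scale by metis
lemma h_zero: "x \<in> X ==> h x 0 v = 0" "x \<in> X ==> h x v 0 = 0"
  using h_add[of x 0 0 v] h_add2[of x v 0 0] by auto
lemma Gm_zero: "x \<in> X ==> Gm x 0 v = 0" "x \<in> X ==> Gm x v 0 = 0"
  using Gm_add[of x 0 0 v] Gm_add2[of x v 0 0] by auto
lemma h_minus: "x \<in> X ==> h x (- u) v = - h x u v" "x \<in> X ==> h x v (- u) = - h x v u"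
  using h_scale[of x "-1" u v] h_scale2[of x v "-1" u] by (auto simp: vector_sneg_minus1[symmetric])
lemma h_diff: "x \<in> X ==> h x (u - u') v = h x u v - h x u' v" "x \<in> X ==> h x v (u - u') = h x v u - h x v u'"
  using h_add[of x u "-u'" v] h_add2[of x v u "-u'"] h_minus[of x u' v] h_minus(2)[of x v u'] by auto
lemma Gm_minus: "x \<in> X ==> Gm x (- u) v = - Gm x u v" "x \<in> X ==> Gm x v (- u) = - Gm x v u"
  using Gm_scale[of x "-1" u v] Gm_scale2[of x v "-1" u] by (auto simp: vector_sneg_minus1[symmetric])
lemma Gm_diff: "x \<in> X ==> Gm x (u - u') v = Gm x u v - Gm x u' v" "x \<in> X ==> Gm x v (u - u') = Gm x v u - Gm x v u'"
  using Gm_add[of x u "-u'" v] Gm_add2[of x v u "-u'"] Gm_minus[of x u' v] Gm_minus(2)[of x v u'] by auto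

lemmas h_simps = h_add h_add2 h_scale h_scale2 h_zero h_minus h_diff
lemmas Gm_simps = Gm_add Gm_add2 Gm_scale Gm_scale2 Gm_zero Gm_minus Gm_diff

lemma h_linear: "x \<in> X ==> linear (%u. h x u v)" "x \<in> X ==> linear (h x u)"
  by (auto intro!: linearI simp: h_simps scaleR_vec_eq scaleR_conv_of_real)
lemma Gm_linear: "x \<in> X ==> linear (%u. Gm x u v)" "x \<in> X ==> linear (Gm x u)"
  by (auto intro!: linearI simp: Gm_simps scaleR_vec_eq)

lemma h_eqI: "x \<in> X ==> (!!v. h x u v = h x u' v) ==> u = u'"
  using h_nondeg[of x "u - u'"] by (simp add: h_diff)

lemma h_real: "x \<in> X ==> Im (h x u u) = 0"
  using h_herm[of x u u] by (metis Reals_cnj_iff complex_is_Real_iff)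

lemma smooth_on_h:
  assumes "smooth_on u X" "smooth_on v X" shows "smooth_on (%x. h x (u x) (v x)) X"
  by (rule smooth_on_linear_arg[OF open_X _ smooth_on_linear_arg[OF open_X _ h_smooth assms(1)] assms(2)])
    (auto intro: h_linear)

abbreviation DGm where "DGm x u v == fd (%y. Gm y u v) x"

lemma DGm: "x \<in> X ==> der (%y. Gm y u v) (DGm x u v) x"
  by (rule smooth_on_deriv[OF Gm_smooth])

lemma DGm_sym: "x \<in> X ==> DGm x u v = DGm x v u"
  using der_cong[OF DGm open_X _ Gm_sym] frechet_derivative_at by metis

lemma DGm_add: "x \<in> X ==> DGm x (u + u') v w = DGm x u v w + DGm x u' v w"
proof -
  assume x: "x \<in> X"
  have "der (%y. Gm y (u + u') v) (%w. DGm x u v w + DGm x u' v w) x"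
    by (rule der_cong[OF has_derivative_add[OF DGm[OF x] DGm[OF x]] open_X x]) (simp add: Gm_add)
  from fun_cong[OF has_derivative_unique[OF DGm[OF x] this]] show ?thesis by simp
qed

lemma DGm_scale: "x \<in> X ==> DGm x (a *s u) v w = a *s DGm x u v w"
proof -
  assume x: "x \<in> X"
  have "der (%y. Gm y (a *s u) v) (%w. a *s DGm x u v w) x"
    by (rule der_cong[OF bounded_linear.has_derivative[OF
          bounded_bilinear.bounded_linear_right[OF bounded_bilinear_smult] DGm[OF x]] open_X x]) (simp add: Gm_scale)
  from fun_cong[OF has_derivative_unique[OF DGm[OF x] this]] show ?thesis by simp
qed

lemma DGm_linear: "x \<in> X ==> linear (DGm x u v)" "x \<in> X ==> linear (%u. DGm x u v w)" "x \<in> X ==> linear (%v. DGm x u v w)"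
proof -
  assume x: "x \<in> X"
  show "linear (DGm x u v)" using DGm[OF x] has_derivative_linear by blast
  show 1: "linear (%u. DGm x u v w)" for v w
    by (rule linearI) (auto simp: DGm_add[OF x] DGm_scale[OF x] scaleR_vec_eq)
  show "linear (%v. DGm x u v w)" using 1[of u w] by (simp add: DGm_sym[OF x, of u])
qed

text \<open>Parts of the derivative of \<open>Gm\<close> that are complex linear and antilinear in the direction; the
  latter is the curvature.\<close>

definition "Gm1 x w u v = (1/2) *s (DGm x u v w - \<i> *s DGm x u v (\<i> *s w))"
definition "K x w u v = (1/2) *s (DGm x u v w + \<i> *s DGm x u v (\<i> *s w))"

lemma DGm_split: "DGm x u v w = Gm1 x w u v + K x w u v"
  by (simp add: Gm1_def K_def vec_eq_iff algebra_simps)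

lemma smult_i: "\<i> *s (\<i> *s v) = - (v :: 'm::finite V)" by (simp add: vec_eq_iff)

lemma Gm1_i: "x \<in> X ==> Gm1 x (\<i> *s w) u v = \<i> *s Gm1 x w u v"
  using linear_neg[OF DGm_linear(1)] by (simp add: Gm1_def smult_i vec_eq_iff algebra_simps)
lemma K_i: "x \<in> X ==> K x (\<i> *s w) u v = - (\<i> *s K x w u v)"
  using linear_neg[OF DGm_linear(1)] by (simp add: K_def smult_i vec_eq_iff algebra_simps)

lemma complex_smult_split: "a *s (v :: 'm::finite V) = Re a *\<^sub>R v + Im a *\<^sub>R (\<i> *s v)"
  by (simp add: vec_eq_iff complex_eq_iff)

lemma K_linear1: "x \<in> X ==> linear (%w. K x w u v)"
proof (rule linearI)
  assume x: "x \<in> X"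
  note a = linear_add[OF DGm_linear(1)[OF x]] and s = linear_scale[OF DGm_linear(1)[OF x]]
  fix w w' :: "'n V" and r :: real
  have "\<i> *s (r *\<^sub>R w) = r *\<^sub>R (\<i> *s w)" by (simp add: vec_eq_iff)
  then show "K x (r *\<^sub>R w) u v = r *\<^sub>R K x w u v"
    unfolding K_def by (simp only: s) (simp add: vec_eq_iff algebra_simps)
  show "K x (w + w') u v = K x w u v + K x w' u v"
    unfolding K_def vector_add_ldistrib a by (simp add: vec_eq_iff algebra_simps)
qed

lemma K_add: "x \<in> X ==> K x (w + w') u v = K x w u v + K x w' u v" by (rule linear_add[OF K_linear1])
lemma K_scale: "x \<in> X ==> K x (a *s w) u v = cnj a *s K x w u v"
  by (subst complex_smult_split[of a w])
    (simp add: linear_add[OF K_linear1] linear_scale[OF K_linear1] K_i vec_eq_iff complex_eq_iff)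
lemma K_add2: "x \<in> X ==> K x w (u + u') v = K x w u v + K x w u' v"
  by (simp add: K_def DGm_add vec_eq_iff algebra_simps)
lemma K_scale2: "x \<in> X ==> K x w (a *s u) v = a *s K x w u v"
  by (simp add: K_def DGm_scale vec_eq_iff algebra_simps)
lemma K_sym: "x \<in> X ==> K x w u v = K x w v u"
  by (simp add: K_def DGm_sym[of x u v])
lemma K_scale3: "x \<in> X ==> K x w v (a *s u) = a *s K x w v u"
  using K_scale2 K_sym by metis
lemma Gm1_scale2: "x \<in> X ==> Gm1 x w (a *s u) v = a *s Gm1 x w u v"
  by (simp add: Gm1_def DGm_scale vec_eq_iff algebra_simps)
lemma smooth_on_K0: "smooth_on (%x. K x w u v) X"
  unfolding K_def
  by (intro smooth_on_smult open_X smooth_on_const smooth_on_add smooth_on_diff smooth_on_frechet[OF Gm_smooth])+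

lemma hd_h:
  assumes x: "x \<in> X" and u: "der u u' x" and v: "der v v' x"
  shows "der (%y. h y (u y) (v y)) (%w. h x (Gm x w (u x)) (v x) + h x (u x) (Gm x w (v x)) + h x (u' w) (v x) + h x (u x) (v' w)) x"
proof -
  have 1: "der (%y. h y (u y) b) (%w. (h x (Gm x w (u x)) b + h x (u x) (Gm x w b)) + h x (u' w) b) x" for b
    by (rule der_linear_arg[where T="%y u. h y u b", OF open_X x h_linear(1) h_deriv[OF x] u])
  show ?thesis
    using der_linear_arg[where T="%y. h y (u y)", OF open_X x h_linear(2) 1 v] by (simp add: add_ac)
qed

lemma hd_Gm:
  assumes x: "x \<in> X" and u: "der u u' x" and v: "der v v' x"
  shows "der (%y. Gm y (u y) (v y)) (%w. DGm x (u x) (v x) w + Gm x (u' w) (v x) + Gm x (u x) (v' w)) x"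
proof -
  have 1: "der (%y. Gm y (u y) b) (%w. DGm x (u x) b w + Gm x (u' w) b) x" for b
    by (rule der_linear_arg[where T="%y u. Gm y u b", OF open_X x Gm_linear(1) DGm[OF x] u])
  show ?thesis
    by (rule der_linear_arg[where T="%y. Gm y (u y)", OF open_X x Gm_linear(2) 1 v])
qed

lemma hd_h_Gm:
  assumes x: "x \<in> X"
  shows "der (%y. h y (Gm y b u) v + h y u (Gm y b v)) (%a. h x (Gm x a (Gm x b u) + DGm x b u a) v + h x (Gm x b u) (Gm x a v)
       + (h x (Gm x a u) (Gm x b v) + h x u (Gm x a (Gm x b v) + DGm x b v a))) x"
proof -
  note c = has_derivative_const
  have "der (%y. h y (Gm y b u) v) (%a. h x (Gm x a (Gm x b u)) v + h x (Gm x b u) (Gm x a v) + h x (DGm x b u a) v + h x (Gm x b u) 0) x"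
    by (rule hd_h[OF x DGm[OF x] c])
  moreover have "der (%y. h y u (Gm y b v)) (%a. h x (Gm x a u) (Gm x b v) + h x u (Gm x a (Gm x b v)) + h x 0 (Gm x b v) + h x u (DGm x b v a)) x"
    by (rule hd_h[OF x c DGm[OF x]])
  ultimately show ?thesis
    by (rule has_derivative_eq_rhs[OF has_derivative_add]) (simp add: h_simps[OF x] fun_eq_iff)
qed

text \<open>The second derivative of \<open>h\<close> is symmetric. Its part complex linear in both
  directions gives the commutation of holomorphic derivatives, its mixed part the hermitian symmetry
  of the curvature.\<close>

lemma h_second:
  assumes x: "x \<in> X"
  shows "h x (Gm x a (Gm x b u) + Gm1 x a b u) v = h x (Gm x b (Gm x a u) + Gm1 x b a u) v"
    and "h x (K x a b u) v = h x u (K x b a v)"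
proof -
  let ?P = "%a b. h x (Gm x a (Gm x b u) + Gm1 x a b u) v"
  let ?Q = "%a b. h x (Gm x b u) (Gm x a v) + h x (K x a b u) v"
  let ?R = "%a b. h x (Gm x a u) (Gm x b v) + h x u (K x a b v)"
  let ?T = "%a b. h x u (Gm x a (Gm x b v) + Gm1 x a b v)"
  have e: "(?P a b - ?P b a) + (?Q a b - ?R b a) + (?R a b - ?Q b a) + (?T a b - ?T b a) = 0" for a b
    using second_derivative_commute[OF open_X x h_smooth[of u v] h_deriv hd_h_Gm[OF x, of b u v] hd_h_Gm[OF x, of a u v]]
    by (simp add: DGm_split h_simps[OF x] algebra_simps)
  have i: "Gm1 x (\<i> *s a) b u = \<i> *s Gm1 x a b u" "Gm1 x a (\<i> *s b) u = \<i> *s Gm1 x a b u"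
     "K x (\<i> *s a) b u = - (\<i> *s K x a b u)" "K x a (\<i> *s b) u = \<i> *s K x a b u" for a b u
    using Gm1_i[OF x] Gm1_scale2[OF x] K_i[OF x] K_scale2[OF x] by auto
  note r = type_split2[where P="%a b. ?P a b - ?P b a" and Q="%a b. ?Q a b - ?R b a"
      and R="%a b. ?R a b - ?Q b a" and T="%a b. ?T a b - ?T b a", OF e]
  have "?P a b - ?P b a = 0"
    by (rule r(1)) (auto simp: i h_simps[OF x] Gm_simps[OF x] algebra_simps)
  then show "?P a b = ?P b a" by simp
  have "?Q a b - ?R b a = 0"
    by (rule r(2)) (auto simp: i h_simps[OF x] Gm_simps[OF x] algebra_simps)
  then show "h x (K x a b u) v = h x u (K x b a v)" by simp
qed

text \<open>In invariant terms: the part of the curvature that is complex linear in both directions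
  vanishes.\<close>

lemma Gm1_commute:
  assumes x: "x \<in> X"
  shows "Gm x a (Gm x b u) + Gm1 x a b u = Gm x b (Gm x a u) + Gm1 x b a u"
  by (rule h_eqI[OF x h_second(1)[OF x]])

abbreviation DK where "DK x b c v == fd (%y. K y b c v) x"

lemma DK: "x \<in> X ==> der (%y. K y b c v) (DK x b c v) x"
  by (rule smooth_on_deriv[OF smooth_on_K0])

definition "K1 x a b c v = (1/2) *s (DK x b c v a - \<i> *s DK x b c v (\<i> *s a))"

text \<open>The second Bianchi identity.\<close>

lemma K1_commute:
  assumes x: "x \<in> X"
  shows "K1 x a b c v + K x b a (Gm x c v) + Gm x a (K x b c v) = K1 x c b a v + K x b c (Gm x a v) + Gm x c (K x b a v)"
proof -
  let ?B = "%c w a. fd (%y. DGm y c v w) x a"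
  have B: "der (%y. DGm y c v w) (?B c w) x" for c w
    by (rule smooth_on_deriv[OF smooth_on_frechet[OF Gm_smooth] x])
  have Bsym: "?B c w a = ?B c a w" for c w a
    by (rule second_derivative_commute[OF open_X x Gm_smooth DGm B B])
  have Blin: "linear (?B c w)" for c w using B has_derivative_linear by blast
  note sm = bounded_linear.has_derivative[OF bounded_bilinear.bounded_linear_right[OF bounded_bilinear_smult]]
  have hK: "DK x b c v = (%a. (1/2) *s (?B c b a + \<i> *s ?B c (\<i> *s b) a))" for b c
    by (rule frechet_derivative_at[symmetric]) (unfold K_def, intro sm has_derivative_add B)
  have hG: "der (%y. Gm1 y a c v) (%b. (1/2) *s (?B c a b - \<i> *s ?B c (\<i> *s a) b)) x" for a c
    unfolding Gm1_def by (intro sm has_derivative_diff B)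
  \<comment> \<open>The derivative in direction \<open>b\<close> of one side of
    \<open>Gm1_commute\<close>. Its part antilinear in \<open>b\<close> yields the claim, once the
    second derivatives \<open>?B\<close> of the Christoffel symbols are commuted.\<close>
  define E where "E a c b = (1/2) *s (?B c a b - \<i> *s ?B c (\<i> *s a) b) + (DGm x a (Gm x c v) b + Gm x a (DGm x c v b))" for a c b
  have hE: "der (%y. Gm y a (Gm y c v) + Gm1 y a c v) (E a c) x" for a c
    by (rule has_derivative_eq_rhs[OF has_derivative_add[OF hd_Gm[OF x has_derivative_const[of a] DGm[OF x, of c v]] hG[of a c]]])
      (simp add: E_def Gm_zero[OF x] add_ac fun_eq_iff)
  have "E a c = E c a"
    by (rule has_derivative_unique[OF hE der_cong[OF hE open_X x]]) (simp add: Gm1_commute)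
  then have eq: "(1/2) *s (E a c b + \<i> *s E a c (\<i> *s b)) = (1/2) *s (E c a b + \<i> *s E c a (\<i> *s b))" by simp
  have anti: "(1/2) *s (E a c b + \<i> *s E a c (\<i> *s b)) = K1 x a b c v + K x b a (Gm x c v) + Gm x a (K x b c v)" for a c
  proof -
    have *: "Gm x a (K x b c v) = (1/2) *s (Gm x a (DGm x c v b) + \<i> *s Gm x a (DGm x c v (\<i> *s b)))"
      by (simp add: K_def Gm_simps[OF x])
    show ?thesis
      unfolding * unfolding E_def K1_def hK unfolding K_def
      by (simp add: vec_eq_iff algebra_simps Bsym[of c b a] Bsym[of c "\<i> *s b" a] Bsym[of c b "\<i> *s a"] Bsym[of c "\<i> *s b" "\<i> *s a"])
  qed
  show ?thesis using eq unfolding anti .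
qed

end

section \<open>Complex traces and projective changes\<close>

lemma clinearv_expand:
  assumes "clinearv f" shows "f u = (\<Sum>j\<in>UNIV. u $ j *s f (axis j 1))"
proof -
  have z: "f 0 = 0" using clinearvD(1)[OF assms, of 0 0] by simp
  have "f (\<Sum>j\<in>A. u $ j *s axis j 1) = (\<Sum>j\<in>A. u $ j *s f (axis j 1))" for A
    by (induction A rule: infinite_finite_induct) (auto simp: z clinearvD[OF assms])
  from this[of UNIV] show ?thesis by (simp add: basis_expansion)
qed

lemma clinear_expand:
  assumes "clinear f" shows "f u = (\<Sum>j\<in>UNIV. u $ j * f (axis j 1))"
proof -
  have z: "f 0 = 0" using clinearD(1)[OF assms, of 0 0] by simp
  have "f (\<Sum>j\<in>A. u $ j *s axis j 1) = (\<Sum>j\<in>A. u $ j * f (axis j 1))" for A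
    by (induction A rule: infinite_finite_induct) (auto simp: z clinearD[OF assms])
  from this[of UNIV] show ?thesis by (simp add: basis_expansion)
qed

definition ctrace :: "('n::finite V => 'n V) => complex" where
  "ctrace L = (\<Sum>j\<in>UNIV. L (axis j 1) $ j)"

lemma ctrace_add: "ctrace (%u. f u + g u) = ctrace f + ctrace g"
  by (simp add: ctrace_def sum.distrib)

lemma ctrace_rank_one:
  assumes "clinear f" shows "ctrace (%u. f u *s v) = f v"
  by (simp add: ctrace_def clinear_expand[OF assms, of v] mult.commute)

lemma ctrace_scalar: "ctrace (%u :: 'n::finite V. c *s u) = of_nat CARD('n) * c"
  by (simp add: ctrace_def)

text \<open>This is where the dimension enters: components of the identity at basis vectors need an
  index \<open>k\<close> different from \<open>i\<close>. In complex dimension one the identity only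
  says that \<psi> is symmetric, which is automatic.\<close>

lemma projective_symmetry_zero:
  fixes \<psi> :: "'n::finite V => 'n V => complex"
  assumes n: "CARD('n) >= 2" and lin: "!!a. clinear (\<psi> a)" "!!b. clinear (%a. \<psi> a b)"
    and eq: "!!a b v. (\<psi> a b - \<psi> b a) *s v + \<psi> a v *s b - \<psi> b v *s a = 0"
  shows "\<psi> a b = 0"
proof -
  let ?e = "%i. axis i 1 :: 'n V"
  have c: "(\<psi> a (?e k) - \<psi> (?e k) a) * v $ k + \<psi> a v - \<psi> (?e k) v * a $ k = 0" for a v k
    using arg_cong[OF eq[of a "?e k" v], of "%u. u $ k"] by (simp add: algebra_simps)
  have d: "\<psi> (?e i) (?e i) = 0" for i
  proof -
    have "EX k. k ~= i"
    proof (rule ccontr)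
      assume "~ ?thesis"
      then have "UNIV = {i}" by auto
      then have "CARD('n) = card {i}" by simp
      then show False using n by simp
    qed
    then obtain k where "k ~= i" by blast
    then show ?thesis using c[of "?e i" k "?e i"] by (simp add: axis_def)
  qed
  have o: "2 * \<psi> (?e i) (?e j) = \<psi> (?e j) (?e i)" if "i ~= j" for i j
    using c[of "?e i" j "?e j"] d[of j] that by (simp add: axis_def)
  have "\<psi> (?e i) (?e j) = 0" for i j
  proof (cases "i = j")
    case False
    then have "2 * (2 * \<psi> (?e i) (?e j)) = \<psi> (?e i) (?e j)" using o[of i j] o[of j i] by simp
    then show ?thesis by simp
  qed (use d in simp)
  then have "\<psi> (?e i) b = 0" for i b
    by (subst clinear_expand[OF lin(1)]) simp
  then show ?thesis by (subst clinear_expand[OF lin(2)]) simp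
qed

text \<open>Here \<open>th\<close> is the complex linear part of the differential of
  \<open>f\<close>. By \<open>th_deriv\<close> its covariant derivative has only a mixed part, the
  hermitian form \<open>S\<close>; in other words, the gradient of \<open>f\<close> is holomorphic.
  Tanno's equation is \<open>S_deriv\<close>.\<close>

locale tanno_chart = kaehler_chart X h Gm
  for X :: "('n::finite V) set" and h :: "'n V => 'n V => 'n V => complex" and Gm :: "'n V => 'n V => 'n V => 'n V" +
  fixes f :: "'n V => real" and th :: "'n V => 'n V => complex"
    and S :: "'n V => 'n V => 'n V => complex" and \<kappa> :: real
  assumes f_deriv: "x \<in> X ==> der f (%w. 2 * Re (th x w)) x"
    and th_clinear: "x \<in> X ==> clinear (th x)"
    and th_deriv: "x \<in> X ==> der (%y. th y v) (%w. th x (Gm x w v) + S x v w) x"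
    and S_clinear: "x \<in> X ==> clinear (%u. S x u v)"
    and S_herm: "x \<in> X ==> S x v u = cnj (S x u v)"
    and S_deriv: "x \<in> X ==> der (%y. S y v b) (%w. S x (Gm x w v) b + S x v (Gm x w b)
        - of_real \<kappa> * (th x w * h x v b + th x v * h x w b + cnj (th x w) * h x v b + cnj (th x b) * h x v w)) x"
    and th_smooth: "smooth_on (%x. th x v) X" and S_smooth: "smooth_on (%x. S x u v) X"
    and f_smooth: "smooth_on f X"
begin

lemma S_add: "x \<in> X ==> S x (u + u') v = S x u v + S x u' v"
  and S_scale: "x \<in> X ==> S x (a *s u) v = a * S x u v"
  using S_clinear clinearD by blast+
lemma S_add2: "x \<in> X ==> S x v (u + u') = S x v u + S x v u'"
  using S_herm S_add by (metis complex_cnj_add)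
lemma S_scale2: "x \<in> X ==> S x v (a *s u) = cnj a * S x v u"
  using S_herm S_scale by (metis complex_cnj_mult)
lemma S_minus: "x \<in> X ==> S x (- u) v = - S x u v" "x \<in> X ==> S x v (- u) = - S x v u"
  using S_scale[of x "-1" u v] S_scale2[of x v "-1" u] by (auto simp: vector_sneg_minus1[symmetric])
lemma S_zero: "x \<in> X ==> S x 0 v = 0" "x \<in> X ==> S x v 0 = 0"
  using S_add[of x 0 0 v] S_add2[of x v 0 0] by auto
lemma S_diff: "x \<in> X ==> S x (u - u') v = S x u v - S x u' v" "x \<in> X ==> S x v (u - u') = S x v u - S x v u'"
  using S_add[of x u "-u'" v] S_add2[of x v u "-u'"] S_minus[of x u' v] S_minus(2)[of x v u'] by auto
lemma th_add: "x \<in> X ==> th x (u + v) = th x u + th x v"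
  and th_scale: "x \<in> X ==> th x (a *s u) = a * th x u"
  using th_clinear clinearD by blast+
lemma th_minus: "x \<in> X ==> th x (- u) = - th x u"
  using th_scale[of x "-1" u] by (auto simp: vector_sneg_minus1[symmetric])
lemma th_zero: "x \<in> X ==> th x 0 = 0" using th_add[of x 0 0] by auto
lemma th_diff: "x \<in> X ==> th x (u - v) = th x u - th x v"
  using th_add[of x u "-v"] th_minus[of x v] by auto
lemmas S_simps = S_add S_add2 S_scale S_scale2 S_minus S_zero S_diff
lemmas th_simps = th_add th_scale th_minus th_zero th_diff
lemma S_linear: "x \<in> X ==> linear (%u. S x u v)" "x \<in> X ==> linear (S x u)"
  by (auto intro!: linearI simp: S_simps scaleR_vec_eq scaleR_conv_of_real)
lemma th_linear: "x \<in> X ==> linear (th x)"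
  by (auto intro!: linearI simp: th_simps scaleR_vec_eq scaleR_conv_of_real)
lemma cnj_h: "x \<in> X ==> cnj (h x u v) = h x v u" by (metis h_herm)
lemma cnj_S: "x \<in> X ==> cnj (S x u v) = S x v u" by (metis S_herm)

lemma hd_th:
  assumes x: "x \<in> X" and u: "der u u' x"
  shows "der (%y. th y (u y)) (%w. th x (Gm x w (u x)) + S x (u x) w + th x (u' w)) x"
  by (rule der_linear_arg[where T="th", OF open_X x th_linear th_deriv[OF x] u])

abbreviation DS where "DS x v b w == S x (Gm x w v) b + S x v (Gm x w b)
    - of_real \<kappa> * (th x w * h x v b + th x v * h x w b + cnj (th x w) * h x v b + cnj (th x b) * h x v w)"

lemma hd_S:
  assumes x: "x \<in> X" and u: "der u u' x" and v: "der v v' x"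
  shows "der (%y. S y (u y) (v y)) (%w. DS x (u x) (v x) w + S x (u' w) (v x) + S x (u x) (v' w)) x"
proof -
  have 1: "der (%y. S y (u y) b) (%w. DS x (u x) b w + S x (u' w) b) x" for b
    by (rule der_linear_arg[where T="%y u. S y u b", OF open_X x S_linear(1) S_deriv[OF x] u])
  show ?thesis
    by (rule der_linear_arg[where T="%y. S y (u y)", OF open_X x S_linear(2) 1 v])
qed

text \<open>The difference to the curvature of a metric of constant holomorphic sectional curvature.
  For an Einstein metric with constant \<kappa> it is trace-free, the Bochner tensor.\<close>

definition "W x b u v = K x b u v + of_real \<kappa> *s (h x u b *s v + h x v b *s u)"

text \<open>The integrability condition of \<open>th_deriv\<close>: the mixed part of the commuted
  second derivatives of \<open>th\<close>. The \<kappa>-terms in the derivative of \<open>S\<close>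
  complete the curvature \<open>K\<close> to \<open>W\<close>.\<close>

lemma th_W:
  assumes x: "x \<in> X"
  shows "th x (W x a b v) = 0"
proof -
  let ?P = "%a b. th x (Gm x a (Gm x b v) + Gm1 x a b v)"
  let ?Q = "%a b. S x (Gm x b v) a + th x (K x a b v)"
  let ?R = "%a b. S x (Gm x a v) b - of_real \<kappa> * (th x a * h x v b + th x v * h x a b)"
  let ?T = "%a b. S x v (Gm x a b) - of_real \<kappa> * (cnj (th x a) * h x v b + cnj (th x b) * h x v a)"
  have hd: "der (%y. th y (Gm y b v) + S y v b) (%w. (th x (Gm x w (Gm x b v)) + S x (Gm x b v) w + th x (DGm x b v w)) + DS x v b w) x" for b
    by (rule has_derivative_add[OF hd_th[OF x DGm[OF x]] S_deriv[OF x]])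
  have e: "(?P a b - ?P b a) + (?Q a b - ?R b a) + (?R a b - ?Q b a) + (?T a b - ?T b a) = 0" for a b
    using second_derivative_commute[OF open_X x th_smooth[of v] th_deriv hd[of b] hd[of a]]
    by (simp add: DGm_split th_simps[OF x] Gm_sym[OF x, of b a] algebra_simps)
  have i: "Gm1 x (\<i> *s a) b u = \<i> *s Gm1 x a b u" "Gm1 x a (\<i> *s b) u = \<i> *s Gm1 x a b u"
     "K x (\<i> *s a) b u = - (\<i> *s K x a b u)" "K x a (\<i> *s b) u = \<i> *s K x a b u" for a b u
    using Gm1_i[OF x] Gm1_scale2[OF x] K_i[OF x] K_scale2[OF x] by auto
  note r = type_split2[where P="%a b. ?P a b - ?P b a" and Q="%a b. ?Q a b - ?R b a"
      and R="%a b. ?R a b - ?Q b a" and T="%a b. ?T a b - ?T b a", OF e]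
  have "?Q a b - ?R b a = 0"
    by (rule r(2)) (auto simp: i h_simps[OF x] Gm_simps[OF x] S_simps[OF x] th_simps[OF x] algebra_simps)
  then show ?thesis by (simp add: W_def th_simps[OF x] algebra_simps)
qed

text \<open>The same for \<open>S_deriv\<close>, the next equation of the system. It will say that
  \<open>W\<close> is compatible with the endomorphism belonging to \<open>S\<close>.\<close>

lemma S_W:
  assumes x: "x \<in> X"
  shows "S x (W x a b v) d = S x v (W x b a d)"
proof -
  let ?P = "%a b. S x (Gm x a (Gm x b v) + Gm1 x a b v) d - of_real \<kappa> * (th x a * h x (Gm x b v) d + th x (Gm x b v) * h x a d
      + th x (Gm x a b) * h x v d + th x b * h x (Gm x a v) d + th x (Gm x a v) * h x b d + th x v * h x (Gm x a b) d)"
  let ?Q = "%a b. S x (Gm x b v) (Gm x a d) + S x (K x a b v) d - of_real \<kappa> * (cnj (th x a) * h x (Gm x b v) d + cnj (th x d) * h x (Gm x b v) a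
      + S x b a * h x v d + th x b * h x v (Gm x a d) + S x v a * h x b d + th x v * h x b (Gm x a d))"
  let ?R = "%a b. S x (Gm x a v) (Gm x b d) + S x v (K x a b d) - of_real \<kappa> * (th x a * h x v (Gm x b d) + th x v * h x a (Gm x b d)
      + S x a b * h x v d + cnj (th x b) * h x (Gm x a v) d + S x a d * h x v b + cnj (th x d) * h x (Gm x a v) b)"
  let ?T = "%a b. S x v (Gm x a (Gm x b d) + Gm1 x a b d) - of_real \<kappa> * (cnj (th x a) * h x v (Gm x b d) + cnj (th x (Gm x b d)) * h x v a
      + cnj (th x (Gm x a b)) * h x v d + cnj (th x b) * h x v (Gm x a d) + cnj (th x (Gm x a d)) * h x v b + cnj (th x d) * h x v (Gm x a b))"
  define Z where "Z b w = (DS x (Gm x b v) d w + S x (DGm x b v w) d) + (DS x v (Gm x b d) w + S x v (DGm x b d w))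
     - of_real \<kappa> * ((th x b * (h x (Gm x w v) d + h x v (Gm x w d)) + (th x (Gm x w b) + S x b w) * h x v d)
         + (th x v * (h x (Gm x w b) d + h x b (Gm x w d)) + (th x (Gm x w v) + S x v w) * h x b d)
         + (cnj (th x b) * (h x (Gm x w v) d + h x v (Gm x w d)) + cnj (th x (Gm x w b) + S x b w) * h x v d)
         + (cnj (th x d) * (h x (Gm x w v) b + h x v (Gm x w b)) + cnj (th x (Gm x w d) + S x d w) * h x v b))" for b w
  have 1: "der (%y. S y (Gm y b v) d) (%w. DS x (Gm x b v) d w + S x (DGm x b v w) d) x" for b
    using hd_S[OF x DGm[OF x, of b v] has_derivative_const[of d]] by (simp add: S_zero[OF x])
  have 2: "der (%y. S y v (Gm y b d)) (%w. DS x v (Gm x b d) w + S x v (DGm x b d w)) x" for b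
    using hd_S[OF x has_derivative_const[of v] DGm[OF x, of b d]] by (simp add: S_zero[OF x])
  have c: "der (%y. complex_of_real \<kappa> * F y) (%w. of_real \<kappa> * F' w) x" if "der F F' x" for F F'
    by (rule has_derivative_mult_right[OF that])
  have hd: "der (%y. DS y v d b) (Z b) x" for b
    unfolding Z_def
    by (intro has_derivative_add has_derivative_diff 1 2 c has_derivative_mult h_deriv[OF x] th_deriv[OF x] has_derivative_cnj)
  have e: "(?P a b - ?P b a) + (?Q a b - ?R b a) + (?R a b - ?Q b a) + (?T a b - ?T b a) = 0" for a b
    using second_derivative_commute[where f="%y. S y v d" and f'="%y. DS y v d" and u=b and v=a
        and Fu="Z b" and Fv="Z a", OF open_X x S_smooth S_deriv hd hd]
    by (simp add: Z_def DGm_split S_simps[OF x] cnj_S[OF x] th_simps[OF x] Gm_sym[OF x, of b a] algebra_simps)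
  have i: "Gm1 x (\<i> *s a) b u = \<i> *s Gm1 x a b u" "Gm1 x a (\<i> *s b) u = \<i> *s Gm1 x a b u"
     "K x (\<i> *s a) b u = - (\<i> *s K x a b u)" "K x a (\<i> *s b) u = \<i> *s K x a b u" for a b u
    using Gm1_i[OF x] Gm1_scale2[OF x] K_i[OF x] K_scale2[OF x] by auto
  note r = type_split2[where P="%a b. ?P a b - ?P b a" and Q="%a b. ?Q a b - ?R b a"
      and R="%a b. ?R a b - ?Q b a" and T="%a b. ?T a b - ?T b a", OF e]
  have "?Q a b - ?R b a = 0"
    by (rule r(2)) (auto simp: i h_simps[OF x] Gm_simps[OF x] S_simps[OF x] th_simps[OF x] algebra_simps)
  then show ?thesis by (simp add: W_def S_simps[OF x] cnj_h[OF x] algebra_simps)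
qed

end

locale cproj_pair = A: kaehler_chart X h Gm + B: kaehler_chart X h' Gm'
  for X :: "('n::finite V) set" and h :: "'n V => 'n V => 'n V => complex" and Gm :: "'n V => 'n V => 'n V => 'n V"
    and h' :: "'n V => 'n V => 'n V => complex" and Gm' :: "'n V => 'n V => 'n V => 'n V" +
  fixes \<phi> :: "'n V => 'n V => complex" and \<kappa> \<kappa>' :: real
  assumes n2: "CARD('n) >= 2"
    and \<phi>_clinear: "x \<in> X ==> clinear (\<phi> x)" and \<phi>_smooth: "smooth_on (%x. \<phi> x v) X"
    and Gm_diff: "x \<in> X ==> Gm' x u v = Gm x u v + \<phi> x u *s v + \<phi> x v *s u"
    and einstein: "x \<in> X ==> ctrace (%u. A.K x b u v) = - of_real \<kappa> * (of_nat CARD('n) + 1) * h x v b"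
    and einstein': "x \<in> X ==> ctrace (%u. B.K x b u v) = - of_real \<kappa>' * (of_nat CARD('n) + 1) * h' x v b"
begin

lemma \<phi>_add: "x \<in> X ==> \<phi> x (u + v) = \<phi> x u + \<phi> x v"
  and \<phi>_scale: "x \<in> X ==> \<phi> x (a *s u) = a * \<phi> x u"
  using \<phi>_clinear clinearD by blast+

abbreviation D\<phi> where "D\<phi> x v == fd (%y. \<phi> y v) x"
definition "\<phi>1 x w v = (1/2) * (D\<phi> x v w - \<i> * D\<phi> x v (\<i> *s w))"
definition "\<phi>2 x w v = (1/2) * (D\<phi> x v w + \<i> * D\<phi> x v (\<i> *s w))"

lemma D\<phi>: "x \<in> X ==> der (%y. \<phi> y v) (D\<phi> x v) x"
  by (rule smooth_on_deriv[OF \<phi>_smooth])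

lemma D\<phi>_clinear: "x \<in> X ==> clinear (%v. D\<phi> x v w)"
  unfolding clinear_def
proof (intro conjI allI)
  fix u v a
  assume x: "x \<in> X"
  have "der (%y. \<phi> y (u + v)) (%w. D\<phi> x u w + D\<phi> x v w) x"
    by (rule der_cong[OF has_derivative_add[OF D\<phi>[OF x] D\<phi>[OF x]] A.open_X x]) (simp add: \<phi>_add)
  from fun_cong[OF has_derivative_unique[OF D\<phi>[OF x] this]] show "D\<phi> x (u + v) w = D\<phi> x u w + D\<phi> x v w" by simp
  have "der (%y. \<phi> y (a *s v)) (%w. a * D\<phi> x v w) x"
    by (rule der_cong[OF has_derivative_mult_right[OF D\<phi>[OF x]] A.open_X x]) (simp add: \<phi>_scale)
  from fun_cong[OF has_derivative_unique[OF D\<phi>[OF x] this]] show "D\<phi> x (a *s v) w = a * D\<phi> x v w" by simp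
qed

lemma D\<phi>_split: "D\<phi> x v w = \<phi>1 x w v + \<phi>2 x w v"
  by (simp add: \<phi>1_def \<phi>2_def field_simps)

lemma D\<phi>_linear: "x \<in> X ==> linear (D\<phi> x v)" using D\<phi> has_derivative_linear by blast

lemma \<phi>1_clinear: "x \<in> X ==> clinear (\<phi>1 x w)" "x \<in> X ==> clinear (\<phi>2 x w)"
  using D\<phi>_clinear unfolding clinear_def \<phi>1_def \<phi>2_def by (auto simp: algebra_simps)

lemma \<phi>1_clinear1: "x \<in> X ==> clinear (%w. \<phi>1 x w v)"
  unfolding clinear_def
proof (intro conjI allI)
  assume x: "x \<in> X"
  note l = linear_add[OF D\<phi>_linear[OF x]] linear_scale[OF D\<phi>_linear[OF x]] linear_neg[OF D\<phi>_linear[OF x]]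
  show a: "\<phi>1 x (u + w) v = \<phi>1 x u v + \<phi>1 x w v" for u w
    unfolding \<phi>1_def vector_add_ldistrib l by (simp add: algebra_simps)
  have r: "\<phi>1 x (r *\<^sub>R u) v = r * \<phi>1 x u v" for r :: real and u
  proof -
    have "\<i> *s (r *\<^sub>R u) = r *\<^sub>R (\<i> *s u)" by (simp add: vec_eq_iff)
    then show ?thesis unfolding \<phi>1_def by (simp only: l) (simp add: algebra_simps scaleR_conv_of_real)
  qed
  have i: "\<phi>1 x (\<i> *s u) v = \<i> * \<phi>1 x u v" for u
    unfolding \<phi>1_def A.smult_i l by (simp add: algebra_simps)
  show "\<phi>1 x (a *s u) v = a * \<phi>1 x u v" for a u
    by (subst A.complex_smult_split) (simp add: a r i complex_eq_iff)
qed

lemma DGm': "x \<in> X ==> B.DGm x u v w = A.DGm x u v w + D\<phi> x u w *s v + D\<phi> x v w *s u"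
proof -
  assume x: "x \<in> X"
  note sm = bounded_linear.has_derivative[OF bounded_bilinear.bounded_linear_left[OF bounded_bilinear_smult] D\<phi>[OF x]]
  have "der (%y. Gm' y u v) (%w. A.DGm x u v w + D\<phi> x u w *s v + D\<phi> x v w *s u) x"
    by (rule der_cong[OF has_derivative_add[OF has_derivative_add[OF A.DGm[OF x] sm] sm] A.open_X x])
      (simp add: Gm_diff)
  from fun_cong[OF has_derivative_unique[OF B.DGm[OF x] this]] show ?thesis by simp
qed

lemma K': "x \<in> X ==> B.K x b u v = A.K x b u v + \<phi>2 x b u *s v + \<phi>2 x b v *s u"
  by (simp add: B.K_def A.K_def \<phi>2_def DGm' vec_eq_iff algebra_simps)
lemma Gm1': "x \<in> X ==> B.Gm1 x b u v = A.Gm1 x b u v + \<phi>1 x b u *s v + \<phi>1 x b v *s u"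
  by (simp add: B.Gm1_def A.Gm1_def \<phi>1_def DGm' vec_eq_iff algebra_simps)

text \<open>The Einstein conditions enter here: the trace of the difference of the two curvatures is
  n + 1 times \<open>\<phi>2\<close>, and both traces are prescribed.\<close>

lemma \<phi>2_eq: "x \<in> X ==> \<phi>2 x b v = of_real \<kappa> * h x v b - of_real \<kappa>' * h' x v b"
proof -
  assume x: "x \<in> X"
  have "ctrace (%u. B.K x b u v) = ctrace (%u. A.K x b u v) + \<phi>2 x b v + of_nat CARD('n) * \<phi>2 x b v"
    by (simp add: K'[OF x] ctrace_add ctrace_rank_one[OF \<phi>1_clinear(2)[OF x]] ctrace_scalar)
  then have "(of_nat CARD('n) + 1) * (\<phi>2 x b v - (of_real \<kappa> * h x v b - of_real \<kappa>' * h' x v b)) = 0"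
    unfolding einstein[OF x] einstein'[OF x] by (simp add: algebra_simps)
  moreover have "(of_nat CARD('n) + 1 :: complex) ~= 0" by (metis of_nat_Suc of_nat_neq_0 add.commute)
  ultimately show ?thesis by simp
qed

text \<open>Subtracting \<open>Gm1_commute\<close> for the two connections leaves the identity of
  \<open>projective_symmetry_zero\<close> for the difference of the two sides.\<close>

lemma \<phi>1_eq: "x \<in> X ==> \<phi>1 x a b = \<phi> x (Gm x a b) + \<phi> x a * \<phi> x b"
proof -
  assume x: "x \<in> X"
  define \<psi> where "\<psi> a b = \<phi>1 x a b - (\<phi> x (Gm x a b) + \<phi> x a * \<phi> x b)" for a b
  have "\<psi> a b = 0"
  proof (rule projective_symmetry_zero[OF n2])
    show "clinear (\<psi> a)" "clinear (%a. \<psi> a b)" for a b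
      using \<phi>1_clinear(1)[OF x, of a] \<phi>1_clinear1[OF x, of b] \<phi>_clinear[OF x]
      unfolding clinear_def \<psi>_def by (auto simp: A.Gm_simps[OF x] algebra_simps)
    fix a b v
    have "Gm' x a (Gm' x b v) + B.Gm1 x a b v - (Gm' x b (Gm' x a v) + B.Gm1 x b a v) = 0"
      using B.Gm1_commute[OF x, of a b v] by simp
    moreover have "Gm x a (Gm x b v) + A.Gm1 x a b v - (Gm x b (Gm x a v) + A.Gm1 x b a v) = 0"
      using A.Gm1_commute[OF x, of a b v] by simp
    ultimately have "(Gm' x a (Gm' x b v) + B.Gm1 x a b v - (Gm' x b (Gm' x a v) + B.Gm1 x b a v))
      - (Gm x a (Gm x b v) + A.Gm1 x a b v - (Gm x b (Gm x a v) + A.Gm1 x b a v)) = 0" by simp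
    moreover have "(Gm' x a (Gm' x b v) + B.Gm1 x a b v - (Gm' x b (Gm' x a v) + B.Gm1 x b a v))
      - (Gm x a (Gm x b v) + A.Gm1 x a b v - (Gm x b (Gm x a v) + A.Gm1 x b a v))
      = (\<psi> a b - \<psi> b a) *s v + \<psi> a v *s b - \<psi> b v *s a"
      unfolding \<psi>_def Gm_diff[OF x] Gm1'[OF x]
      by (simp add: A.Gm_simps[OF x] \<phi>_add[OF x] \<phi>_scale[OF x] A.Gm_sym[OF x, of b a] vec_eq_iff algebra_simps)
    ultimately show "(\<psi> a b - \<psi> b a) *s v + \<psi> a v *s b - \<psi> b v *s a = 0" by simp
  qed
  then show ?thesis by (simp add: \<psi>_def)
qed

lemma \<phi>_deriv: "x \<in> X ==> der (%y. \<phi> y v) (%w. \<phi> x (Gm x w v) + \<phi> x w * \<phi> x v + of_real \<kappa> * h x v w - of_real \<kappa>' * h' x v w) x"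
  by (rule has_derivative_eq_rhs[OF D\<phi>]) (auto simp: D\<phi>_split \<phi>1_eq \<phi>2_eq fun_eq_iff)

text \<open>The form \<open>S\<close> is read off from the derivative of \<open>- f \<phi>\<close>
  by means of \<open>\<phi>_deriv\<close>. In its own derivative, the terms with \<open>h'\<close>
  that come from \<open>\<phi>_deriv\<close> cancel those created by writing the connection of
  \<open>h'\<close> through that of \<open>h\<close>, so that only \<kappa> and \<open>h\<close>
  remain.\<close>

lemma tanno:
  assumes f: "!!x. x \<in> X ==> der f (%w. - 2 * f x * Re (\<phi> x w)) x" and sf: "smooth_on f X"
  shows "tanno_chart X h Gm f (%x v. - of_real (f x) * \<phi> x v)
    (%x v w. of_real (f x) * (cnj (\<phi> x w) * \<phi> x v - of_real \<kappa> * h x v w + of_real \<kappa>' * h' x v w)) \<kappa>"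
proof
  fix x v w u b a
  have sF: "smooth_on (%x. complex_of_real (f x)) X"
    by (rule smooth_on_linear[OF bounded_linear_of_real A.open_X sf])
  note sm = A.open_X sF smooth_on_mult smooth_on_uminus smooth_on_add smooth_on_diff smooth_on_const \<phi>_smooth A.h_smooth B.h_smooth
    smooth_on_linear[OF bounded_linear_cnj]
  show "smooth_on (%x. - complex_of_real (f x) * \<phi> x v) X"
    "smooth_on (%x. of_real (f x) * (cnj (\<phi> x v) * \<phi> x u - of_real \<kappa> * h x u v + of_real \<kappa>' * h' x u v)) X"
    by (intro sm)+
  show "smooth_on f X" by (rule sf)
  assume x: "x \<in> X"
  note s = \<phi>_add[OF x] \<phi>_scale[OF x] A.h_simps[OF x] B.h_simps[OF x]
  show "der f (%w. 2 * Re (- complex_of_real (f x) * \<phi> x w)) x"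
    using f[OF x] by (simp add: mult.assoc)
  show "clinear (%v. - complex_of_real (f x) * \<phi> x v)"
    "clinear (%u. of_real (f x) * (cnj (\<phi> x v) * \<phi> x u - of_real \<kappa> * h x u v + of_real \<kappa>' * h' x u v))"
    by (auto simp: clinear_def s algebra_simps)
  show "of_real (f x) * (cnj (\<phi> x u) * \<phi> x v - of_real \<kappa> * h x v u + of_real \<kappa>' * h' x v u) =
     cnj (of_real (f x) * (cnj (\<phi> x v) * \<phi> x u - of_real \<kappa> * h x u v + of_real \<kappa>' * h' x u v))"
    by (simp add: A.h_herm[OF x, of u v] B.h_herm[OF x, of u v] mult_ac)
  have cF: "der (%y. complex_of_real (f y)) (%w. - of_real (f x) * (\<phi> x w + cnj (\<phi> x w))) x"
    by (rule has_derivative_eq_rhs[OF has_derivative_of_real[OF f[OF x]]]) (auto simp: fun_eq_iff complex_eq_iff)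
  show "der (%y. - complex_of_real (f y) * \<phi> y v) (%w. - complex_of_real (f x) * \<phi> x (Gm x w v) + of_real (f x) * (cnj (\<phi> x w) * \<phi> x v - of_real \<kappa> * h x v w + of_real \<kappa>' * h' x v w)) x"
    by (rule has_derivative_eq_rhs[OF has_derivative_mult[OF has_derivative_minus[OF cF] \<phi>_deriv[OF x]]])
      (auto simp: fun_eq_iff algebra_simps)
  have c: "der (%y. complex_of_real k * F y) (%w. of_real k * F' w) x" if "der F F' x" for F F' k
    by (rule has_derivative_mult_right[OF that])
  show "der (%y. of_real (f y) * (cnj (\<phi> y b) * \<phi> y v - of_real \<kappa> * h y v b + of_real \<kappa>' * h' y v b)) (%w. of_real (f x) * (cnj (\<phi> x b) * \<phi> x (Gm x w v) - of_real \<kappa> * h x (Gm x w v) b + of_real \<kappa>' * h' x (Gm x w v) b)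
       + of_real (f x) * (cnj (\<phi> x (Gm x w b)) * \<phi> x v - of_real \<kappa> * h x v (Gm x w b) + of_real \<kappa>' * h' x v (Gm x w b))
       - of_real \<kappa> * (- complex_of_real (f x) * \<phi> x w * h x v b + - complex_of_real (f x) * \<phi> x v * h x w b
          + cnj (- complex_of_real (f x) * \<phi> x w) * h x v b + cnj (- complex_of_real (f x) * \<phi> x b) * h x v w)) x"
    by (rule has_derivative_eq_rhs[OF has_derivative_mult[OF cF has_derivative_add[OF has_derivative_diff[OF
          has_derivative_mult[OF has_derivative_cnj[OF \<phi>_deriv[OF x]] \<phi>_deriv[OF x]] c[OF A.h_deriv[OF x]]] c[OF B.h_deriv[OF x]]]]])
      (simp add: fun_eq_iff Gm_diff[OF x] s A.h_herm[OF x, of _ b, symmetric] B.h_herm[OF x, of _ b, symmetric] algebra_simps)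
qed

end

section \<open>Ordinary differential equations and parallel transport\<close>

lemma integrable_eq_real:
  assumes w: "total_eq Om (w :: real \<times> 'b::euclidean_space => real => 'b)"
  shows "integrable_eq Om w"
  unfolding integrable_eq_def
proof (intro ballI allI)
  fix p u v assume p: "p \<in> Om"
  have 1: "Dw w p v q = v *\<^sub>R Dw w p 1 q" for v q
    using linear_scale[OF total_eq_linear(1)[OF w p], of v 1] by simp
  \<comment> \<open>On the real line all directions are multiples of 1, so both sides are
    \<open>u * v\<close> times one vector.\<close>
  have 2: "(u, w p u) = u *\<^sub>R (1, w p 1)" for u
    using linear_scale[OF total_eqD(2)[OF w p], of u 1] by simp
  show "Dw w p v (u, w p u) = Dw w p u (v, w p v)"
    unfolding 2[of u] 2[of v] 1[of v] 1[of u] linear_scale[OF total_eq_linear(2)[OF w p]] by simp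
qed

lemma smooth_on_linear_arg2:
  assumes "open U" "open V" "!!x. x \<in> V ==> linear (T x)" "!!u. smooth_on (%x. T x u) V"
    and "smooth_on p U" "p ` U <= V" "smooth_on u U"
  shows "smooth_on (%z. T (p z) (u z)) U"
proof (rule smooth_on_linear_arg[where T="%z. T (p z)", OF assms(1) _ _ assms(7)])
  show "linear (T (p x))" if "x \<in> U" for x using that assms(3,6) by auto
  show "smooth_on (%x. T (p x) w) U" for w by (rule smooth_on_compose[OF assms(1,4,5,6)])
qed

context kaehler_chart
begin

lemma smooth_on_Gm2:
  assumes "open U" "smooth_on p U" "p ` U <= X" "smooth_on u U" "smooth_on v U"
  shows "smooth_on (%z. Gm (p z) (u z) (v z)) U"
proof (rule smooth_on_linear_arg[where T="%z. Gm (p z) (u z)", OF assms(1) _ _ assms(5)])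
  show "linear (Gm (p z) (u z))" if "z \<in> U" for z using Gm_linear(2) that assms(3) by auto
  show "smooth_on (%z. Gm (p z) (u z) w) U" for w
    by (rule smooth_on_linear_arg2[where T="%x u. Gm x u w", OF assms(1) open_X Gm_linear(1) Gm_smooth assms(2,3,4)])
qed

lemma smooth_on_h2:
  assumes "open U" "smooth_on p U" "p ` U <= X" "smooth_on u U" "smooth_on v U"
  shows "smooth_on (%z. h (p z) (u z) (v z)) U"
proof (rule smooth_on_linear_arg[where T="%z. h (p z) (u z)", OF assms(1) _ _ assms(5)])
  show "linear (h (p z) (u z))" if "z \<in> U" for z using h_linear(2) that assms(3) by auto
  show "smooth_on (%z. h (p z) (u z) w) U" for w
    by (rule smooth_on_linear_arg2[where T="%x u. h x u w", OF assms(1) open_X h_linear(1) h_smooth assms(2,3,4)])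
qed

text \<open>Parallel transport along the lines of the chart for the connection
  \<open>\<nabla> (v, r) + (r w, - \<kappa> h (v, w))\<close> on the sum of the tangent bundle and \<open>\<complex>\<close>.\<close>

lemma tractor_transport:
  assumes x0: "x0 \<in> X"
  shows "EX \<rho>>0. ball x0 \<rho> <= X & (ALL x:ball x0 \<rho>. ALL y:ball x0 \<rho>. ALL v0 r0. norm v0 <= 1 --> norm (r0::complex) <= 1 -->
    (EX T>=0. EX w v r. x + T *\<^sub>R w = y & v 0 = v0 & r 0 = r0 & (ALL t:{0..T}. x + t *\<^sub>R w \<in> X &
       der v (%s. s *\<^sub>R (- Gm (x + t *\<^sub>R w) w (v t) - r t *s w)) t &
       der r (%s. s *\<^sub>R (of_real \<kappa> * h (x + t *\<^sub>R w) (v t) w)) t)))"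
proof -
  define Om where "Om = (UNIV :: real set) \<times> X \<times> (UNIV :: ('n V) set) \<times> (UNIV :: ('n V) set) \<times> (UNIV :: complex set)"
  \<comment> \<open>The base point and the direction \<open>w\<close> are unknowns as well, with
    \<open>w\<close> constant. The initial data for all segments then form the compact set
    \<open>Kc\<close>, and one radius serves them all.\<close>
  define F where "F z = (case z of (t::real, p, w, v, r::complex) =>
     (w, 0 :: 'n V, - Gm p w v - r *s w, of_real \<kappa> * h p v w))" for z
  define om where "om z s = s *\<^sub>R F z" for z and s :: real
  have oOm: "open Om" unfolding Om_def by (intro open_Times open_X open_UNIV)
  have sF: "smooth_on F Om"
  proof -
    have bl: "bounded_linear (%z::real \<times> ('n V) \<times> ('n V) \<times> ('n V) \<times> complex. fst (snd z))"
      "bounded_linear (%z::real \<times> ('n V) \<times> ('n V) \<times> ('n V) \<times> complex. fst (snd (snd z)))"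
      "bounded_linear (%z::real \<times> ('n V) \<times> ('n V) \<times> ('n V) \<times> complex. fst (snd (snd (snd z))))"
      "bounded_linear (%z::real \<times> ('n V) \<times> ('n V) \<times> ('n V) \<times> complex. snd (snd (snd (snd z))))"
      by (auto intro!: bounded_linear_intros)
    note s = smooth_on_linear[OF _ oOm smooth_on_id[OF oOm]]
    note s1 = s[OF bl(1)] and s2 = s[OF bl(2)] and s3 = s[OF bl(3)] and s4 = s[OF bl(4)]
    have im: "(%z. fst (snd z)) ` Om <= X" by (auto simp: Om_def)
    have "smooth_on (%z. (fst (snd (snd z)), 0 :: 'n V,
       - Gm (fst (snd z)) (fst (snd (snd z))) (fst (snd (snd (snd z)))) - snd (snd (snd (snd z))) *s fst (snd (snd z)),
       of_real \<kappa> * h (fst (snd z)) (fst (snd (snd (snd z)))) (fst (snd (snd z))))) Om"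
      by (intro smooth_on_Pair oOm smooth_on_const smooth_on_diff smooth_on_uminus smooth_on_smult smooth_on_mult
          smooth_on_Gm2 smooth_on_h2 s1 s2 s3 s4 im)
    then show ?thesis by (simp add: F_def[abs_def] split_beta)
  qed
  have te: "total_eq Om om"
    unfolding total_eq_def
  proof (intro conjI ballI allI)
    show "linear (om p)" for p unfolding om_def by (auto intro!: linearI simp: scaleR_add_left)
    show "smooth_on (%p. om p v) Om" for v
      unfolding om_def by (rule smooth_on_linear[OF bounded_linear_scaleR_right oOm sF])
  qed (rule oOm)
  obtain \<rho>0 where \<rho>0: "\<rho>0 > 0" "cball x0 \<rho>0 <= X" using open_X x0 open_contains_cball by blast
  define Kc where "Kc = {0::real} \<times> cball x0 \<rho>0 \<times> cball (0::'n V) 1 \<times> cball (0::'n V) 1 \<times> cball (0::complex) 1"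
  have "compact Kc" "Kc <= Om" unfolding Kc_def using \<rho>0(2) by (auto intro!: compact_Times simp: Om_def)
  from total_eq_solvable[OF te integrable_eq_real[OF te] this]
  obtain R where R: "R > 0" and sol: "!!b. (0, b) \<in> Kc ==> EX y. y 0 = b & (ALL t:ball 0 R. (t, y t) \<in> Om & der y (om (t, y t)) t)"
    unfolding Kc_def by fastforce
  \<comment> \<open>Two points of the ball are less than \<open>R\<close> apart, and the segment
    between them is run through with unit speed.\<close>
  define \<rho> where "\<rho> = min \<rho>0 (R / 2)"
  have \<rho>: "\<rho> > 0" "\<rho> <= \<rho>0" "2 * \<rho> <= R" using \<rho>0 R by (auto simp: \<rho>_def)
  show ?thesis
  proof (rule exI[of _ \<rho>], intro conjI ballI allI impI \<rho>(1))
    show "ball x0 \<rho> <= X" using \<rho> \<rho>0(2) by (meson ball_subset_cball order_trans subset_cball)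
    fix x y v0 :: "'n V" and r0 :: complex
    assume xy: "x \<in> ball x0 \<rho>" "y \<in> ball x0 \<rho>" and vr: "norm v0 <= 1" "norm r0 <= 1"
    define T where "T = norm (y - x)"
    define w where "w = (if y = x then 0 else (1 / T) *\<^sub>R (y - x))"
    have T: "T >= 0" "T < R"
    proof -
      have "dist x y < \<rho> + \<rho>" by (rule dist_triangle_less_add[where y=x0]) (use xy in "auto simp: dist_commute")
      then show "T < R" using \<rho> by (simp add: T_def dist_norm norm_minus_commute)
    qed (simp add: T_def)
    have w: "norm w <= 1" "x + T *\<^sub>R w = y" by (auto simp: w_def T_def)
    have "(0, (x, w, v0, r0)) \<in> Kc" using xy vr w \<rho> by (auto simp: Kc_def)
    from sol[OF this] obtain z where z: "z 0 = (x, w, v0, r0)"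
      "!!t. t \<in> ball 0 R ==> (t, z t) \<in> Om & der z (om (t, z t)) t" by blast
    define p where "p t = fst (z t)" for t
    define w' where "w' t = fst (snd (z t))" for t
    define v where "v t = fst (snd (snd (z t)))" for t
    define r where "r t = snd (snd (snd (z t)))" for t
    have zt: "z t = (p t, w' t, v t, r t)" for t by (simp add: p_def w'_def v_def r_def)
    have D: "p t \<in> X" "der p (%s. s *\<^sub>R w' t) t" "der w' (%s. 0) t"
      "der v (%s. s *\<^sub>R (- Gm (p t) (w' t) (v t) - r t *s w' t)) t"
      "der r (%s. s *\<^sub>R (of_real \<kappa> * h (p t) (v t) (w' t))) t" if "t \<in> ball 0 R" for t
    proof -
      have zt': "der z (%s. s *\<^sub>R (w' t, 0, - Gm (p t) (w' t) (v t) - r t *s w' t, of_real \<kappa> * h (p t) (v t) (w' t))) t"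
        using z(2)[OF that] by (simp add: om_def[abs_def] F_def zt)
      note f = has_derivative_fst[OF zt'] and s = has_derivative_snd[OF zt']
      note fs = has_derivative_fst[OF s] and ss = has_derivative_snd[OF s]
      show "p t \<in> X" using z(2)[OF that] by (simp add: Om_def p_def mem_Times_iff)
      show "der p (%s. s *\<^sub>R w' t) t" using f by (simp add: p_def[abs_def])
      show "der w' (%s. 0) t" using fs by (simp add: w'_def[abs_def])
      show "der v (%s. s *\<^sub>R (- Gm (p t) (w' t) (v t) - r t *s w' t)) t"
        using has_derivative_fst[OF ss] by (simp add: v_def[abs_def])
      show "der r (%s. s *\<^sub>R (of_real \<kappa> * h (p t) (v t) (w' t))) t"
        using has_derivative_snd[OF ss] by (simp add: r_def[abs_def])
    qed
    have w'w: "w' t = w" if "t \<in> ball 0 R" for t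
    proof -
      have "w' t = w' 0"
        by (rule has_derivative_zero_unique[of "ball 0 R"])
          (use D(3) that R in "auto intro: has_derivative_at_withinI simp del: mem_ball")
      then show ?thesis by (simp add: w'_def z(1))
    qed
    have pt: "p t = x + t *\<^sub>R w" if t: "t \<in> ball 0 R" for t
    proof -
      have "p t - t *\<^sub>R w = p 0 - 0 *\<^sub>R w"
      proof (rule has_derivative_zero_unique[of "ball 0 R" "%t. p t - t *\<^sub>R w"])
        show "((%t. p t - t *\<^sub>R w) has_derivative (%h. 0)) (at t within ball 0 R)" if "t \<in> ball 0 R" for t
          by (rule has_derivative_at_withinI, rule has_derivative_eq_rhs[OF has_derivative_diff[OF D(2)[OF that] has_derivative_scaleR_left[OF has_derivative_ident]]])
            (simp add: w'w[OF that])
      qed (use t R in auto)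
      then show ?thesis by (simp add: p_def z(1) algebra_simps)
    qed
    show "EX T>=0. EX w v r. x + T *\<^sub>R w = y & v 0 = v0 & r 0 = r0 & (ALL t:{0..T}. x + t *\<^sub>R w \<in> X &
       der v (%s. s *\<^sub>R (- Gm (x + t *\<^sub>R w) w (v t) - r t *s w)) t &
       der r (%s. s *\<^sub>R (of_real \<kappa> * h (x + t *\<^sub>R w) (v t) w)) t)"
    proof (intro exI[of _ T] exI[of _ w] exI[of _ v] exI[of _ r] conjI ballI)
      show "v 0 = v0" "r 0 = r0" by (auto simp: v_def r_def z(1))
      fix t assume "t \<in> {0..T}"
      then have t: "t \<in> ball 0 R" using T by auto
      show "x + t *\<^sub>R w \<in> X" "der v (%s. s *\<^sub>R (- Gm (x + t *\<^sub>R w) w (v t) - r t *s w)) t"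
       "der r (%s. s *\<^sub>R (of_real \<kappa> * h (x + t *\<^sub>R w) (v t) w)) t"
        using D(1,4,5)[OF t] by (simp_all add: pt[OF t] w'w[OF t])
    qed (use T w in auto)
  qed
qed

end

context tanno_chart
begin

text \<open>For projective space the sum of the tangent bundle and \<complex> is the trivial bundle
  of rank n + 1 up to a twist by a line bundle, and \<open>Hq\<close> is its standard form.
  \<open>Bq\<close> is a second form with blocks \<open>S + \<kappa> f h\<close>, \<open>th\<close>
  and \<open>f\<close>.\<close>

definition "Hq x v r = \<kappa> * Re (h x v v) + (norm (r::complex))\<^sup>2"
definition "Bq x v r = Re (S x v v) + \<kappa> * f x * Re (h x v v) + 2 * Re (cnj r * th x v) + f x * (norm r)\<^sup>2"

text \<open>\<open>Hq\<close> and \<open>Bq\<close> are parallel for the connection of \<open>tractor_transport\<close>.\<close>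

lemma parallel_forms:
  assumes x0: "x0 \<in> X"
  shows "EX \<rho>>0. ball x0 \<rho> <= X & (ALL x:ball x0 \<rho>. ALL y:ball x0 \<rho>. ALL v r. EX v' r'. Hq x v r = Hq y v' r' & Bq x v r = Bq y v' r')"
proof -
  obtain \<rho> where \<rho>: "\<rho> > 0" "ball x0 \<rho> <= X" and tr: "!!x y v0 r0. x \<in> ball x0 \<rho> ==> y \<in> ball x0 \<rho> ==> norm v0 <= 1 ==> norm r0 <= 1 ==>
    (EX T>=0. EX w v r. x + T *\<^sub>R w = y & v 0 = v0 & r 0 = r0 & (ALL t:{0..T}. x + t *\<^sub>R w \<in> X &
       der v (%s. s *\<^sub>R (- Gm (x + t *\<^sub>R w) w (v t) - r t *s w)) t &
       der r (%s. s *\<^sub>R (of_real \<kappa> * h (x + t *\<^sub>R w) (v t) w)) t))"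
    using tractor_transport[OF x0, of \<kappa>] by blast
  have small: "EX v' r'. Hq x v r = Hq y v' r' & Bq x v r = Bq y v' r'"
    if xy: "x \<in> ball x0 \<rho>" "y \<in> ball x0 \<rho>" and vr: "norm v <= 1" "norm r <= 1" for x y v r
  proof -
    obtain T w V R where T: "T >= 0" "x + T *\<^sub>R w = y" "V 0 = v" "R 0 = r" and D: "!!t. t \<in> {0..T} ==> x + t *\<^sub>R w \<in> X"
       "!!t. t \<in> {0..T} ==> der V (%s. s *\<^sub>R (- Gm (x + t *\<^sub>R w) w (V t) - R t *s w)) t"
       "!!t. t \<in> {0..T} ==> der R (%s. s *\<^sub>R (of_real \<kappa> * h (x + t *\<^sub>R w) (V t) w)) t"
      using tr[OF xy vr] by blast
    define p where "p t = x + t *\<^sub>R w" for t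
    \<comment> \<open>\<open>HH\<close> and \<open>BB\<close> are complex versions with real parts
      \<open>Hq\<close> and \<open>Bq\<close>; as complex expressions they can be differentiated
      factor by factor.\<close>
    define HH where "HH t = of_real \<kappa> * h (p t) (V t) (V t) + R t * cnj (R t)" for t
    define BB where "BB t = S (p t) (V t) (V t) + of_real \<kappa> * of_real (f (p t)) * h (p t) (V t) (V t)
      + (cnj (R t) * th (p t) (V t) + R t * cnj (th (p t) (V t))) + of_real (f (p t)) * (R t * cnj (R t))" for t
    have d0: "der HH (%s. 0) t & der BB (%s. 0) t" if t: "t \<in> {0..T}" for t
    proof -
      have px: "p t \<in> X" using D(1)[OF t] by (simp add: p_def)
      let ?v' = "%s. s *\<^sub>R (- Gm (p t) w (V t) - R t *s w)" and ?r' = "%s. s *\<^sub>R (of_real \<kappa> * h (p t) (V t) w)"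
      have V': "der V ?v' t" and R': "der R ?r' t" using D(2,3)[OF t] by (auto simp: p_def)
      have p': "der p (%s. s *\<^sub>R w) t" unfolding p_def by (auto intro!: derivative_eq_intros)
      define O' where "O' = p -` X"
      have "continuous_on UNIV p" unfolding p_def by (intro continuous_intros)
      then have oo: "open O'" "t \<in> O'" using open_X px unfolding O'_def by (auto intro: open_vimage)
      have iO: "p s \<in> X" if "s \<in> O'" for s using that by (simp add: O'_def)
      have comp: "der (%s. F (p s)) (%s. F' (s *\<^sub>R w)) t" if "der F F' (p t)" for F F'
        by (rule has_derivative_compose[OF p' that])
      have h1: "der (%s. h (p s) (V s) b) (%s. (h (p t) (Gm (p t) (s *\<^sub>R w) (V t)) b + h (p t) (V t) (Gm (p t) (s *\<^sub>R w) b)) + h (p t) (?v' s) b) t" for b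
        by (rule der_linear_arg[where T="%s u. h (p s) u b", OF oo h_linear(1)[OF iO] comp[OF h_deriv[OF px]] V'])
      have h2: "der (%s. h (p s) (V s) (V s)) (%s. ((h (p t) (Gm (p t) (s *\<^sub>R w) (V t)) (V t) + h (p t) (V t) (Gm (p t) (s *\<^sub>R w) (V t))) + h (p t) (?v' s) (V t)) + h (p t) (V t) (?v' s)) t"
        by (rule der_linear_arg[where T="%s. h (p s) (V s)", OF oo h_linear(2)[OF iO] h1 V'])
      have s1: "der (%s. S (p s) (V s) b) (%s. DS (p t) (V t) b (s *\<^sub>R w) + S (p t) (?v' s) b) t" for b
        by (rule der_linear_arg[where T="%s u. S (p s) u b", OF oo S_linear(1)[OF iO] comp[OF S_deriv[OF px]] V'])
      have s2: "der (%s. S (p s) (V s) (V s)) (%s. (DS (p t) (V t) (V t) (s *\<^sub>R w) + S (p t) (?v' s) (V t)) + S (p t) (V t) (?v' s)) t"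
        by (rule der_linear_arg[where T="%s. S (p s) (V s)", OF oo S_linear(2)[OF iO] s1 V'])
      have th: "der (%s. th (p s) (V s)) (%s. (th (p t) (Gm (p t) (s *\<^sub>R w) (V t)) + S (p t) (V t) (s *\<^sub>R w)) + th (p t) (?v' s)) t"
        by (rule der_linear_arg[where T="%s. th (p s)", OF oo th_linear[OF iO] comp[OF th_deriv[OF px]] V'])
      have cf: "der (%s. complex_of_real (f (p s))) (%s. th (p t) (s *\<^sub>R w) + cnj (th (p t) (s *\<^sub>R w))) t"
        by (rule has_derivative_eq_rhs[OF has_derivative_of_real[OF comp[OF f_deriv[OF px]]]]) (auto simp: fun_eq_iff complex_eq_iff)
      note ms = has_derivative_mult_right has_derivative_add has_derivative_mult has_derivative_cnj
      note simps = h_simps[OF px] Gm_simps[OF px] S_simps[OF px] th_simps[OF px] cnj_h[OF px] cnj_S[OF px] scaleR_vec_eq scaleR_conv_of_real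
      have "der HH (%s. 0) t"
        unfolding HH_def
        by (rule has_derivative_eq_rhs[OF has_derivative_add[OF has_derivative_mult_right[OF h2] has_derivative_mult[OF R' has_derivative_cnj[OF R']]]])
          (simp add: fun_eq_iff simps algebra_simps)
      moreover have "der BB (%s. 0) t"
        unfolding BB_def
        by (rule has_derivative_eq_rhs[OF has_derivative_add[OF has_derivative_add[OF has_derivative_add[OF s2
             has_derivative_mult[OF has_derivative_mult_right[OF cf] h2]]
             has_derivative_add[OF has_derivative_mult[OF has_derivative_cnj[OF R'] th] has_derivative_mult[OF R' has_derivative_cnj[OF th]]]]
             has_derivative_mult[OF cf has_derivative_mult[OF R' has_derivative_cnj[OF R']]]]])
          (simp add: fun_eq_iff simps algebra_simps)
      ultimately show ?thesis by simp
    qed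
    have "HH T = HH 0" "BB T = BB 0"
      by (rule has_derivative_zero_unique[of "{0..T}"];
          use d0 T in \<open>auto intro: has_derivative_at_withinI\<close>)+
    moreover have "Re (HH t) = Hq (p t) (V t) (R t)" "Re (BB t) = Bq (p t) (V t) (R t)" for t
      by (simp_all add: HH_def BB_def Hq_def Bq_def complex_norm_square[symmetric] cmod_power2 algebra_simps power2_eq_square)
    ultimately have "Hq (p T) (V T) (R T) = Hq (p 0) (V 0) (R 0)" "Bq (p T) (V T) (R T) = Bq (p 0) (V 0) (R 0)"
      by metis+
    then show ?thesis using T by (auto simp: p_def intro!: exI[of _ "V T"] exI[of _ "R T"])
  qed
  have "EX v' r'. Hq x v r = Hq y v' r' & Bq x v r = Bq y v' r'"
    if xy: "x \<in> ball x0 \<rho>" "y \<in> ball x0 \<rho>" for x y v r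
  proof -
    \<comment> \<open>Transport is available for vectors of norm at most 1; both forms are
      quadratic, so scaling by \<open>k\<close> covers the others.\<close>
    define k where "k = 1 / (1 + norm v + norm r)"
    have k: "k > 0" "norm (k *\<^sub>R v) <= 1" "norm (k *\<^sub>R r) <= 1" by (auto simp: k_def field_simps add_pos_nonneg)
    have X: "x \<in> X" "y \<in> X" using xy \<rho> by auto
    have sc: "Hq x (k *\<^sub>R v) (k *\<^sub>R r) = k\<^sup>2 * Hq x v r" "Bq x (k *\<^sub>R v) (k *\<^sub>R r) = k\<^sup>2 * Bq x v r" if "x \<in> X" for x v r k
      by (simp_all add: Hq_def Bq_def scaleR_vec_eq h_simps[OF that] S_simps[OF that] th_simps[OF that]
          norm_mult power2_eq_square scaleR_conv_of_real algebra_simps)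
    obtain v' r' where "Hq x (k *\<^sub>R v) (k *\<^sub>R r) = Hq y v' r'" "Bq x (k *\<^sub>R v) (k *\<^sub>R r) = Bq y v' r'"
      using small[OF xy k(2,3)] by blast
    then have "k\<^sup>2 * Hq x v r = k\<^sup>2 * Hq y ((1/k) *\<^sub>R v') ((1/k) *\<^sub>R r')" "k\<^sup>2 * Bq x v r = k\<^sup>2 * Bq y ((1/k) *\<^sub>R v') ((1/k) *\<^sub>R r')"
      using k sc[OF X(1)] sc[OF X(2)] by (simp_all add: power_divide)
    then show ?thesis using k by (intro exI[of _ "(1/k) *\<^sub>R v'"] exI[of _ "(1/k) *\<^sub>R r'"]) simp
  qed
  with \<rho> show ?thesis by blast
qed

end

section \<open>Second order tests\<close>

definition dd :: "('a::euclidean_space => 'b::euclidean_space) => 'a => 'a => 'b" where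
  "dd F z \<zeta> = fd (%y. fd F y \<zeta>) z \<zeta>"

lemma dd_eq:
  assumes "open U" "z \<in> U" "!!y. y \<in> U ==> der F (F' y) y" "der (%y. F' y \<zeta>) E z"
  shows "dd F z \<zeta> = E \<zeta>"
proof -
  have "der (%y. fd F y \<zeta>) E z"
    by (rule der_cong[OF assms(4,1,2)]) (simp add: frechet_derivative_at[OF assms(3), symmetric])
  from frechet_derivative_at[OF this] show ?thesis by (simp add: dd_def)
qed

lemma dd_cong:
  assumes "open U" "z \<in> U" "!!y. y \<in> U ==> F y = G y" "smooth_on F U"
  shows "dd F z \<zeta> = dd G z \<zeta>"
proof -
  have sG: "smooth_on G U" by (rule smooth_on_cong[OF assms(1,3,4)])
  have "fd F y = fd G y" if "y \<in> U" for y
    using der_cong[OF smooth_on_deriv[OF assms(4) that] assms(1) that assms(3)]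
      frechet_derivative_at by blast
  then have "der (%y. fd F y \<zeta>) (fd (%y. fd G y \<zeta>) z) z"
    by (intro der_cong[OF smooth_on_deriv[OF smooth_on_frechet[OF sG] assms(2)] assms(1,2)]) simp
  from frechet_derivative_at[OF this] show ?thesis by (simp add: dd_def)
qed

text \<open>Since \<open>a\<close> vanishes to first order along \<open>\<zeta>\<close>, all terms
  in which \<open>T\<close> is differentiated contain a vanishing factor.\<close>

lemma dd_linear_arg:
  fixes T :: "'a::euclidean_space => 'b::euclidean_space => 'c::euclidean_space"
  assumes U: "open U" "z \<in> U" and lin: "!!y. y \<in> U ==> linear (T y)" and T: "!!u. smooth_on (%y. T y u) U"
    and a: "smooth_on a U" "a z = 0" "fd a z \<zeta> = 0"
  shows "dd (%y. T y (a y)) z \<zeta> = T z (dd a z \<zeta>)"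
proof -
  let ?T' = "%y u. fd (%y. T y u) y"
  have T': "der (%y. T y u) (?T' y u) y" if "y \<in> U" for y u by (rule smooth_on_deriv[OF T that])
  have a': "der a (fd a y) y" if "y \<in> U" for y by (rule smooth_on_deriv[OF a(1) that])
  have a'': "der (%y. fd a y \<zeta>) (fd (%y. fd a y \<zeta>) z) z"
    by (rule smooth_on_deriv[OF smooth_on_frechet[OF a(1)] U(2)])
  have T'': "der (%y. ?T' y u \<zeta>) (fd (%y. ?T' y u \<zeta>) z) z" for u
    by (rule smooth_on_deriv[OF smooth_on_frechet[OF T] U(2)])
  have lin': "linear (%u. ?T' y u w)" if "y \<in> U" for y w
    by (rule has_derivative_linear_param[OF U(1) that lin T'[OF that]])
  have 1: "der (%y. T y (a y)) (%w. ?T' y (a y) w + T y (fd a y w)) y" if "y \<in> U" for y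
    by (rule der_linear_arg[OF U(1) that lin T'[OF that] a'[OF that]])
  have 2: "der (%y. ?T' y (a y) \<zeta> + T y (fd a y \<zeta>)) (%w. (fd (%y. ?T' y (a z) \<zeta>) z w + ?T' z (fd a z w) \<zeta>) + (?T' z (fd a z \<zeta>) w + T z (fd (%y. fd a y \<zeta>) z w))) z"
    by (rule has_derivative_add[OF der_linear_arg[where T="%y u. ?T' y u \<zeta>", OF U lin' T'' a'[OF U(2)]]
        der_linear_arg[OF U lin T'[OF U(2)] a'']])
  have "fd (%y. ?T' y 0 \<zeta>) z \<zeta> = 0"
    by (rule linear_0[OF has_derivative_linear_param[OF U lin' T'']])
  moreover have "?T' z 0 \<zeta> = 0" by (rule linear_0[OF lin'[OF U(2)]])
  ultimately show ?thesis
    using dd_eq[where F="%y. T y (a y)" and F'="%y w. ?T' y (a y) w + T y (fd a y w)", OF U 1 2] a(2,3)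
    by (simp add: dd_def)
qed

lemma second_order_maximum:
  fixes P :: "'a::euclidean_space => real"
  assumes U: "open U" "z \<in> U" and P: "smooth_on P U" and max: "!!y. y \<in> U ==> P y <= P z"
  shows "fd P z v = 0" "dd P z v <= 0"
proof -
  have P': "der P (fd P y) y" if "y \<in> U" for y by (rule smooth_on_deriv[OF P that])
  have "fd P z = (%v. 0)"
    by (rule differential_zero_maxmin[OF U(2,1) P'[OF U(2)]]) (use max in auto)
  then show z: "fd P z v = 0" for v by simp
  have P'': "der (%y. fd P y v) (fd (%y. fd P y v) z) z"
    by (rule smooth_on_deriv[OF smooth_on_frechet[OF P] U(2)])
  show "dd P z v <= 0"
  proof (rule ccontr)
    assume "~ ?thesis"
    then have pos: "dd P z v > 0" by simp
    have path: "der (%t. z + t *\<^sub>R v) (%h. h *\<^sub>R v) t" for t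
      by (auto intro!: derivative_eq_intros)
    have "isCont (%t. z + t *\<^sub>R v) 0" by (intro continuous_intros)
    then have "\<forall>\<^sub>F t in at 0. z + t *\<^sub>R v \<in> U"
      using topological_tendstoD[of "%t. z + t *\<^sub>R v" z "at 0" U] U by (simp add: isCont_def)
    then obtain d where d: "d > 0" "!!t. t ~= 0 ==> \<bar>t\<bar> < d ==> z + t *\<^sub>R v \<in> U"
      unfolding eventually_at dist_real_def by auto
    then have inU: "z + t *\<^sub>R v \<in> U" if "\<bar>t\<bar> < d" for t using that U(2) by (cases "t = 0") simp_all
    have "der (%t. fd P (z + t *\<^sub>R v) v) (%h. fd (%y. fd P y v) z (h *\<^sub>R v)) 0"
      by (rule has_derivative_compose[OF path]) (simp add: P'')
    then have "DERIV (%t. fd P (z + t *\<^sub>R v) v) 0 :> dd P z v"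
      unfolding has_field_derivative_def dd_def
      by (rule has_derivative_eq_rhs) (simp add: fun_eq_iff linear_scale[OF has_derivative_linear[OF P'']] mult.commute)
    from DERIV_pos_inc_right[OF this pos] obtain e where e: "e > 0" "!!t. 0 < t ==> t < e ==> fd P (z + t *\<^sub>R v) v > 0"
      using z by auto
    define t where "t = min d e / 2"
    have t: "0 < t" "t < d" "t < e" using d(1) e(1) by (auto simp: t_def min_def)
    have der: "der (%t. P (z + t *\<^sub>R v)) (%h. fd P (z + s *\<^sub>R v) (h *\<^sub>R v)) s" if "\<bar>s\<bar> < d" for s
      by (rule has_derivative_compose[OF path P'[OF inU[OF that]]])
    obtain s where s: "0 < s" "s < t" "P (z + t *\<^sub>R v) - P (z + 0 *\<^sub>R v) = fd P (z + s *\<^sub>R v) ((t - 0) *\<^sub>R v)"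
    proof (rule mvt[of 0 t "%t. P (z + t *\<^sub>R v)" "%s h. fd P (z + s *\<^sub>R v) (h *\<^sub>R v)", OF t(1)])
      show "continuous_on {0..t} (%t. P (z + t *\<^sub>R v))"
        by (intro continuous_at_imp_continuous_on ballI has_derivative_continuous[OF der]) (use t in auto)
    qed (use der t in auto)
    have "\<bar>s\<bar> < d" using s t by simp
    then have "fd P (z + s *\<^sub>R v) (t *\<^sub>R v) = t * fd P (z + s *\<^sub>R v) v"
      using linear_scale[OF has_derivative_linear[OF P'[OF inU]]] by simp
    also have "... > 0" using e(2)[of s] s t by simp
    finally have "P (z + t *\<^sub>R v) > P z" using s by simp
    then show False using max[OF inU[of t]] t by simp
  qed
qed

text \<open>Differentiating \<open>dP (\<xi>)\<close> along the vector field \<open>\<xi>\<close> at a maximum of \<open>P\<close> gives the Hessian of \<open>P\<close>;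
  at a zero of \<open>\<xi>\<close> two derivatives are needed.\<close>

lemma maximum_vector_field:
  fixes P :: "'a::euclidean_space => real"
  assumes U: "open U" "z \<in> U" and P: "smooth_on P U" and max: "!!y. y \<in> U ==> P y <= P z"
    and \<xi>: "smooth_on \<xi> U" and \<Psi>: "!!y. y \<in> U ==> \<Psi> y = fd P y (\<xi> y)"
  shows "der \<Psi> D z ==> D (\<xi> z) <= 0"
    and "\<xi> z = 0 ==> fd \<xi> z \<zeta> = \<mu> *\<^sub>R \<zeta> ==> dd \<Psi> z \<zeta> = 2 * \<mu> * dd P z \<zeta>"
proof -
  have P': "der P (fd P y) y" if "y \<in> U" for y by (rule smooth_on_deriv[OF P that])
  have lin: "linear (fd P y)" if "y \<in> U" for y using P'[OF that] has_derivative_linear by blast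
  have sP': "smooth_on (%y. fd P y u) U" for u by (rule smooth_on_frechet[OF P])
  let ?P'' = "%y u. fd (%y. fd P y u) y"
  have P'': "der (%y. fd P y u) (?P'' y u) y" if "y \<in> U" for y u by (rule smooth_on_deriv[OF sP' that])
  have \<xi>': "der \<xi> (fd \<xi> y) y" if "y \<in> U" for y by (rule smooth_on_deriv[OF \<xi> that])
  have d1: "der (%y. fd P y (\<xi> y)) (%w. ?P'' y (\<xi> y) w + fd P y (fd \<xi> y w)) y" if "y \<in> U" for y
    by (rule der_linear_arg[OF U(1) that lin P''[OF that] \<xi>'[OF that]])
  have d1\<Psi>: "der \<Psi> (%w. ?P'' y (\<xi> y) w + fd P y (fd \<xi> y w)) y" if "y \<in> U" for y
    by (rule der_cong[OF d1[OF that] U(1) that]) (simp add: \<Psi>)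
  note so = second_order_maximum[OF U P max]
  show "D (\<xi> z) <= 0" if "der \<Psi> D z"
    using fun_cong[OF has_derivative_unique[OF that d1\<Psi>[OF U(2)]], of "\<xi> z"] so(1) so(2)[of "\<xi> z"]
    by (simp add: dd_def)
  have lin'': "linear (%u. ?P'' y u w)" if "y \<in> U" for y w
    by (rule has_derivative_linear_param[OF U(1) that lin P''[OF that]])
  assume z: "\<xi> z = 0" and e: "fd \<xi> z \<zeta> = \<mu> *\<^sub>R \<zeta>"
  have 3: "der (%y. ?P'' y u \<zeta>) (fd (%y. ?P'' y u \<zeta>) z) z" for u
    by (rule smooth_on_deriv[OF smooth_on_frechet[OF sP'] U(2)])
  have 4: "der (%y. fd \<xi> y \<zeta>) (fd (%y. fd \<xi> y \<zeta>) z) z"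
    by (rule smooth_on_deriv[OF smooth_on_frechet[OF \<xi>] U(2)])
  \<comment> \<open>At \<open>z\<close> the terms containing \<open>\<xi> z\<close> or the
    differential of \<open>P\<close> drop out; each of the other two is
    \<open>\<mu> * dd P z \<zeta>\<close>.\<close>
  have "der (%y. ?P'' y (\<xi> y) \<zeta> + fd P y (fd \<xi> y \<zeta>)) (%w. (fd (%y. ?P'' y (\<xi> z) \<zeta>) z w + ?P'' z (fd \<xi> z w) \<zeta>) + (?P'' z (fd \<xi> z \<zeta>) w + fd P z (fd (%y. fd \<xi> y \<zeta>) z w))) z"
    by (rule has_derivative_add[OF der_linear_arg[where T="%y u. ?P'' y u \<zeta>", OF U lin'' 3 \<xi>'[OF U(2)]]
        der_linear_arg[OF U lin P''[OF U(2)] 4]])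
  note dd_eq[where F=\<Psi> and F'="%y w. ?P'' y (\<xi> y) w + fd P y (fd \<xi> y w)", OF U d1\<Psi> this]
  moreover have "fd (%y. ?P'' y 0 \<zeta>) z \<zeta> = 0"
    by (rule linear_0[OF has_derivative_linear_param[OF U lin'' 3]])
  ultimately show "dd \<Psi> z \<zeta> = 2 * \<mu> * dd P z \<zeta>"
    using z e linear_scale[OF lin''[OF U(2)], of \<mu> \<zeta> \<zeta>] so(1) by (simp add: dd_def)
qed

section \<open>Raising indices\<close>

lemma smooth_riesz:
  fixes B :: "'b::euclidean_space => 'a::euclidean_space => 'a => real"
  assumes X: "open X" and bil: "!!x. x \<in> X ==> bilinear (B x)"
    and nd: "!!x u. x \<in> X ==> (!!v. B x u v = 0) ==> u = 0" and sB: "!!u v. smooth_on (%x. B x u v) X"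
    and l: "!!x. x \<in> X ==> linear (l x)" and sl: "!!w. smooth_on (%x. l x w) X"
  shows "EX z. smooth_on z X & (ALL x:X. ALL w. B x (z x) w = l x w)"
proof -
  have "ALL x:X. EX z. ALL w. B x z w = l x w"
    using nondegenerate_riesz[of "B x" "l x" for x] bil nd l by blast
  then obtain z where z: "!!x w. x \<in> X ==> B x (z x) w = l x w" by metis
  let ?F = "%x u. \<Sum>b\<in>Basis. B x u b *\<^sub>R b"
  have "Ck_on k z X" for k
  proof (rule Ck_on_linear_solve[where F="?F" and l="%x. \<Sum>b\<in>Basis. l x b *\<^sub>R b", OF X])
    fix x assume x: "x \<in> X"
    have lin: "linear (%u. B x u v)" "linear (B x u)" for u v using bil[OF x] by (auto simp: bilinear_def)
    show lF: "linear (?F x)"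
      by (rule linearI) (auto simp: linear_add[OF lin(1)] linear_scale[OF lin(1)] scaleR_add_left sum.distrib scaleR_sum_right)
    show "inj (?F x)" unfolding linear_injective_0[OF lF]
    proof (intro allI impI)
      fix u assume "?F x u = 0"
      then have "B x u b = 0" if "b \<in> Basis" for b
        using that inner_sum_left_Basis[of b "%b. B x u b"] by simp
      then have "B x u v = 0" for v by (subst linear_expand[OF lin(2)]) simp
      then show "u = 0" using nd[OF x] by blast
    qed
    show "?F x (z x) = (\<Sum>b\<in>Basis. l x b *\<^sub>R b)" by (simp add: z[OF x])
  next
    show "Ck_on k (%y. ?F y u) X" for u
      by (intro smooth_onD smooth_on_sum X smooth_on_linear[OF bounded_linear_scaleR_left] sB)
    show "Ck_on k (%x. \<Sum>b\<in>Basis. l x b *\<^sub>R b) X"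
      by (intro smooth_onD smooth_on_sum X smooth_on_linear[OF bounded_linear_scaleR_left] sl)
  qed
  then show ?thesis using z by (auto simp: smooth_on_def)
qed

context kaehler_chart
begin

text \<open>Matching real parts suffices: replacing \<open>w\<close> by \<open>\<i> *s w\<close>
  recovers the imaginary parts, since both sides are antilinear in \<open>w\<close>.\<close>

lemma raise:
  assumes m: "!!x. x \<in> X ==> linear (m x)" "!!x w. x \<in> X ==> m x (\<i> *s w) = - \<i> * m x w" "!!w. smooth_on (%x. m x w) X"
  shows "EX z. smooth_on z X & (ALL x:X. ALL w. h x (z x) w = m x w)"
proof -
  have cx: "a = b" if "Re a = Re b" "Re (- \<i> * a) = Re (- \<i> * b)" for a b :: complex
    using that by (simp add: complex_eq_iff)
  have "EX z. smooth_on z X & (ALL x:X. ALL w. Re (h x (z x) w) = Re (m x w))"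
  proof (rule smooth_riesz[OF open_X])
    fix x assume x: "x \<in> X"
    show "bilinear (%u v. Re (h x u v))" unfolding bilinear_def
      using linear_compose[OF h_linear(1)[OF x] bounded_linear.linear[OF bounded_linear_Re]]
        linear_compose[OF h_linear(2)[OF x] bounded_linear.linear[OF bounded_linear_Re]] by (simp add: o_def)
    show "linear (%w. Re (m x w))"
      using linear_compose[OF m(1)[OF x] bounded_linear.linear[OF bounded_linear_Re]] by (simp add: o_def)
    show "u = 0" if "!!v. Re (h x u v) = 0" for u
    proof (rule h_nondeg[OF x])
      show "h x u v = 0" for v
        using that[of v] that[of "\<i> *s v"] by (simp add: h_simps[OF x] complex_eq_iff)
    qed
  qed (intro smooth_on_linear[OF bounded_linear_Re open_X] h_smooth m)+
  then obtain z where z: "smooth_on z X" "!!x w. x \<in> X ==> Re (h x (z x) w) = Re (m x w)" by blast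
  have "h x (z x) w = m x w" if x: "x \<in> X" for x w
    using z(2)[OF x, of w] z(2)[OF x, of "\<i> *s w"] by (simp add: h_simps[OF x] m(2)[OF x] complex_eq_iff)
  with z(1) show ?thesis by blast
qed

end

section \<open>Vanishing of the Bochner tensor\<close>

context tanno_chart
begin

section \<open>Derivatives of the tensors along a map into the chart\<close>

context
  fixes U :: "'z::euclidean_space set" and z :: 'z and p :: "'z => 'n V" and p'
  assumes U: "open U" "z \<in> U" and pU: "!!y. y \<in> U ==> p y \<in> X" and p': "der p p' z"
begin

lemma px: "p z \<in> X" using pU U(2) by blast

lemma hd_h_comp:
  assumes u: "der u u' z" and v: "der v v' z"
  shows "der (%y. h (p y) (u y) (v y)) (%w. h (p z) (Gm (p z) (p' w) (u z)) (v z)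
    + h (p z) (u z) (Gm (p z) (p' w) (v z)) + h (p z) (u' w) (v z) + h (p z) (u z) (v' w)) z"
proof -
  have 1: "der (%y. h (p y) (u y) b) (%w. (h (p z) (Gm (p z) (p' w) (u z)) b + h (p z) (u z) (Gm (p z) (p' w) b)) + h (p z) (u' w) b) z" for b
    by (rule der_linear_arg[where T="%y u. h (p y) u b", OF U h_linear(1)[OF pU] has_derivative_compose[OF p' h_deriv[OF px]] u])
  show ?thesis
    using der_linear_arg[where T="%y. h (p y) (u y)", OF U h_linear(2)[OF pU] 1 v] by (simp add: add_ac)
qed

lemma hd_Gm_comp:
  assumes u: "der u u' z" and v: "der v v' z"
  shows "der (%y. Gm (p y) (u y) (v y)) (%w. DGm (p z) (u z) (v z) (p' w)
    + Gm (p z) (u' w) (v z) + Gm (p z) (u z) (v' w)) z"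
proof -
  have 1: "der (%y. Gm (p y) (u y) b) (%w. DGm (p z) (u z) b (p' w) + Gm (p z) (u' w) b) z" for b
    by (rule der_linear_arg[where T="%y u. Gm (p y) u b", OF U Gm_linear(1)[OF pU] has_derivative_compose[OF p' DGm[OF px]] u])
  show ?thesis
    by (rule der_linear_arg[where T="%y. Gm (p y) (u y)", OF U Gm_linear(2)[OF pU] 1 v])
qed

lemma hd_th_comp:
  assumes u: "der u u' z"
  shows "der (%y. th (p y) (u y)) (%w. th (p z) (Gm (p z) (p' w) (u z)) + S (p z) (u z) (p' w) + th (p z) (u' w)) z"
  by (rule der_linear_arg[where T="%y. th (p y)", OF U th_linear[OF pU] has_derivative_compose[OF p' th_deriv[OF px]] u])

lemma hd_S_comp:
  assumes u: "der u u' z" and v: "der v v' z"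
  shows "der (%y. S (p y) (u y) (v y)) (%w. DS (p z) (u z) (v z) (p' w)
    + S (p z) (u' w) (v z) + S (p z) (u z) (v' w)) z"
proof -
  have 1: "der (%y. S (p y) (u y) b) (%w. DS (p z) (u z) b (p' w) + S (p z) (u' w) b) z" for b
    by (rule der_linear_arg[where T="%y u. S (p y) u b", OF U S_linear(1)[OF pU] has_derivative_compose[OF p' S_deriv[OF px]] u])
  show ?thesis
    by (rule der_linear_arg[where T="%y. S (p y) (u y)", OF U S_linear(2)[OF pU] 1 v])
qed

end

section \<open>Symmetries of the tensor W\<close>

lemma h_K: "x \<in> X ==> h x (K x a b u) v = h x u (K x b a v)" by (rule h_second(2))

lemma W_sym: "x \<in> X ==> W x b u v = W x b v u" by (simp add: W_def K_sym[of x b u v] add_ac)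
lemma W_add1: "x \<in> X ==> W x (b + b') u v = W x b u v + W x b' u v"
  and W_scale1: "x \<in> X ==> W x (a *s b) u v = cnj a *s W x b u v"
  and W_add2: "x \<in> X ==> W x b (u + u') v = W x b u v + W x b u' v"
  and W_scale2: "x \<in> X ==> W x b (a *s u) v = a *s W x b u v"
  by (simp_all add: W_def K_add K_scale K_add2 K_scale2 h_simps vec_eq_iff algebra_simps)
lemma W_add3: "x \<in> X ==> W x b v (u + u') = W x b v u + W x b v u'"
  and W_scale3: "x \<in> X ==> W x b v (a *s u) = a *s W x b v u"
  using W_sym[of x b v] W_add2 W_scale2 by auto
lemmas W_simps0 = W_add1 W_scale1 W_add2 W_scale2 W_add3 W_scale3

definition "WW x c v b d = h x (W x b c v) d"

lemma WW_add: "x \<in> X ==> WW x (c + c') v b d = WW x c v b d + WW x c' v b d"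
    "x \<in> X ==> WW x c (v + v') b d = WW x c v b d + WW x c v' b d"
    "x \<in> X ==> WW x c v (b + b') d = WW x c v b d + WW x c v b' d"
    "x \<in> X ==> WW x c v b (d + d') = WW x c v b d + WW x c v b d'"
  by (simp_all add: WW_def W_simps0 h_simps)
lemma WW_scale: "x \<in> X ==> WW x (a *s c) v b d = a * WW x c v b d" "x \<in> X ==> WW x c (a *s v) b d = a * WW x c v b d"
   "x \<in> X ==> WW x c v (a *s b) d = cnj a * WW x c v b d" "x \<in> X ==> WW x c v b (a *s d) = cnj a * WW x c v b d"
  by (simp_all add: WW_def W_simps0 h_simps)
lemma WW_linear: "x \<in> X ==> linear (%c. WW x c v b d)" "x \<in> X ==> linear (%v. WW x c v b d)"
   "x \<in> X ==> linear (%b. WW x c v b d)" "x \<in> X ==> linear (%d. WW x c v b d)"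
  by (auto intro!: linearI simp: WW_add WW_scale scaleR_vec_eq scaleR_conv_of_real)
lemma WW_zero: "x \<in> X ==> WW x 0 v b d = 0" "x \<in> X ==> WW x c 0 b d = 0" "x \<in> X ==> WW x c v 0 d = 0" "x \<in> X ==> WW x c v b 0 = 0"
  using linear_0[OF WW_linear(1)] linear_0[OF WW_linear(2)] linear_0[OF WW_linear(3)] linear_0[OF WW_linear(4)] by blast+
lemma WW_minus: "x \<in> X ==> WW x (- c) v b d = - WW x c v b d" "x \<in> X ==> WW x c (- v) b d = - WW x c v b d"
  "x \<in> X ==> WW x c v (- b) d = - WW x c v b d" "x \<in> X ==> WW x c v b (- d) = - WW x c v b d"
  using linear_neg[OF WW_linear(1)] linear_neg[OF WW_linear(2)] linear_neg[OF WW_linear(3)] linear_neg[OF WW_linear(4)] by blast+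
lemma WW_diff: "x \<in> X ==> WW x (c - c') v b d = WW x c v b d - WW x c' v b d"
  using linear_diff[OF WW_linear(1)] by blast
lemma WW_sym: "x \<in> X ==> WW x c v b d = WW x v c b d" by (simp add: WW_def W_sym[of x b c v])
lemma WW_herm: "x \<in> X ==> WW x c v b d = cnj (WW x b d c v)"
  by (simp add: WW_def W_def h_simps cnj_h h_K[of x b c v d] algebra_simps flip: h_herm[of x v])
lemma WW_sym2: "x \<in> X ==> WW x c v b d = WW x c v d b"
  using WW_herm[of x c v b d] WW_herm[of x c v d b] WW_sym[of x b d c v] by simp

lemma smooth_on_WW0: "smooth_on (%x. WW x c v b d) X"
  unfolding WW_def W_def
  by (intro smooth_on_h smooth_on_add smooth_on_smult open_X smooth_on_const smooth_on_K0 h_smooth)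

lemma smooth_on_WW:
  assumes U: "open U" "smooth_on p U" "p ` U <= X" and "smooth_on c U" "smooth_on v U" "smooth_on b U" "smooth_on d U"
  shows "smooth_on (%z. WW (p z) (c z) (v z) (b z) (d z)) U"
proof -
  have pX: "p z \<in> X" if "z \<in> U" for z using that U(3) by auto
  have 0: "smooth_on (%z. WW (p z) c v b d) U" for c v b d
    by (rule smooth_on_compose[OF U(1) smooth_on_WW0 U(2,3)])
  note 1 = smooth_on_linear_arg[where T="%z c. WW (p z) c v b d" for v b d, OF U(1) WW_linear(1)[OF pX] 0 assms(4)]
  note 2 = smooth_on_linear_arg[where T="%z v. WW (p z) (c z) v b d" for b d, OF U(1) WW_linear(2)[OF pX] 1 assms(5)]
  note 3 = smooth_on_linear_arg[where T="%z b. WW (p z) (c z) (v z) b d" for d, OF U(1) WW_linear(3)[OF pX] 2 assms(6)]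
  show ?thesis
    by (rule smooth_on_linear_arg[where T="%z d. WW (p z) (c z) (v z) (b z) d", OF U(1) WW_linear(4)[OF pX] 3 assms(7)])
qed

lemma hd_WW:
  assumes U: "open U" "z \<in> U" "!!y. y \<in> U ==> p y \<in> X" and p: "der p p' z"
    and c: "der c c' z" and v: "der v v' z" and b: "der b b' z" and d: "der d d' z"
  shows "der (%y. WW (p y) (c y) (v y) (b y) (d y)) (%w. fd (%x. WW x (c z) (v z) (b z) (d z)) (p z) (p' w)
     + WW (p z) (c' w) (v z) (b z) (d z) + WW (p z) (c z) (v' w) (b z) (d z) + WW (p z) (c z) (v z) (b' w) (d z)
     + WW (p z) (c z) (v z) (b z) (d' w)) z"
proof -
  have 0: "der (%y. WW (p y) c v b d) (%w. fd (%x. WW x c v b d) (p z) (p' w)) z" for c v b d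
    by (rule has_derivative_compose[OF p smooth_on_deriv[OF smooth_on_WW0 U(3)[OF U(2)]]])
  note 1 = der_linear_arg[where T="%y c. WW (p y) c v b d" for v b d, OF U(1,2) WW_linear(1)[OF U(3)] 0 c]
  note 2 = der_linear_arg[where T="%y v. WW (p y) (c y) v b d" for b d, OF U(1,2) WW_linear(2)[OF U(3)] 1 v]
  note 3 = der_linear_arg[where T="%y b. WW (p y) (c y) (v y) b d" for d, OF U(1,2) WW_linear(3)[OF U(3)] 2 b]
  show ?thesis
    by (rule der_linear_arg[where T="%y d. WW (p y) (c y) (v y) (b y) d", OF U(1,2) WW_linear(4)[OF U(3)] 3 d])
qed

lemma WW_diagonal_zero:
  assumes x: "x \<in> X" and 0: "!!u. Re (WW x u u u u) = 0"
  shows "WW x c v b d = 0"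
proof -
  have r: "WW x u u u u = 0" for u
    using 0[of u] arg_cong[OF WW_herm[OF x, of u u u u], of Im] by (simp add: complex_eq_iff)
  have re: "Re (WW x v v u u) = 0" for u v
  proof -
    note s = WW_add[OF x] WW_scale[OF x] WW_minus[OF x]
    \<comment> \<open>With \<open>v\<close> multiplied by the fourth roots of unity and these
      weights, only the terms survive that contain \<open>v\<close> twice in the linear slots or
      twice in the antilinear slots.\<close>
    have "WW x (u + v) (u + v) (u + v) (u + v) + WW x (u + - v) (u + - v) (u + - v) (u + - v)
       - WW x (u + \<i> *s v) (u + \<i> *s v) (u + \<i> *s v) (u + \<i> *s v) - WW x (u + - (\<i> *s v)) (u + - (\<i> *s v)) (u + - (\<i> *s v)) (u + - (\<i> *s v))
       = 4 * (WW x v v u u + WW x u u v v)"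
      unfolding s by (simp add: algebra_simps)
    then have "WW x v v u u + WW x u u v v = 0" unfolding r by (simp del: distrib_left_numeral)
    then show ?thesis using WW_herm[OF x, of u u v v] by (simp add: complex_eq_iff)
  qed
  have d: "WW x v v u u = 0" for u v
  proof -
    \<comment> \<open>The square of \<open>1 + \<i>\<close> is \<open>2 * \<i>\<close>, which
      exchanges real and imaginary parts.\<close>
    have "WW x ((1 + \<i>) *s v) ((1 + \<i>) *s v) u u = (1 + \<i>) * ((1 + \<i>) * WW x v v u u)"
      by (simp only: WW_scale[OF x])
    then have "Re ((1 + \<i>) * ((1 + \<i>) * WW x v v u u)) = 0" using re by metis
    then show ?thesis using re[of v u] by (simp add: complex_eq_iff)
  qed
  have d2: "WW x c v u u = 0" for c v u
  proof -
    have "WW x (c + v) (c + v) u u = WW x c c u u + WW x c v u u + (WW x v c u u + WW x v v u u)"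
      by (simp only: WW_add[OF x] add_ac)
    then show ?thesis using WW_sym[OF x, of v c u u] by (simp add: d)
  qed
  have "WW x c v (b + d) (b + d) = WW x c v b b + WW x c v b d + (WW x c v d b + WW x c v d d)"
    by (simp only: WW_add[OF x] add_ac)
  then show ?thesis using WW_sym2[OF x, of c v d b] by (simp add: d2)
qed

end

lemma linear_coefficient_zero:
  assumes "!!t::real. 2 * t * a + t\<^sup>2 * b <= 0" shows "a = 0"
proof (rule ccontr)
  assume "a ~= 0"
  define t where "t = a / (\<bar>b\<bar> + 1)"
  have "2 * t * a + t\<^sup>2 * b >= 2 * (a\<^sup>2 / (\<bar>b\<bar> + 1)) - t\<^sup>2 * (\<bar>b\<bar> + 1)"
  proof -
    have "- (\<bar>b\<bar> + 1) <= b" by linarith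
    then have "t\<^sup>2 * - (\<bar>b\<bar> + 1) <= t\<^sup>2 * b" by (intro mult_left_mono) auto
    then have "t\<^sup>2 * b >= - (t\<^sup>2 * (\<bar>b\<bar> + 1))" by (simp only: mult_minus_right)
    then show ?thesis by (simp add: t_def power2_eq_square)
  qed
  moreover have "t\<^sup>2 * (\<bar>b\<bar> + 1) = a\<^sup>2 / (\<bar>b\<bar> + 1)"
    by (simp add: t_def power_divide power2_eq_square)
  moreover have "a\<^sup>2 / (\<bar>b\<bar> + 1) > 0" using \<open>a ~= 0\<close> by (simp add: add_nonneg_pos)
  ultimately show False using assms[of t] by linarith
qed

section \<open>The definite case: the gradient of f and the derivative of W along it\<close>

locale tanno_pos = tanno_chart X h Gm f th S 1
  for X :: "('n::finite V) set" and h :: "'n V => 'n V => 'n V => complex"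
    and Gm :: "'n V => 'n V => 'n V => 'n V" and f th S +
  assumes h_pos: "x \<in> X ==> u ~= 0 ==> 0 < Re (h x u u)"
begin

text \<open>\<open>Lam\<close> is the gradient of \<open>f\<close> up to a constant factor, and
  \<open>A\<close> is \<open>S\<close> as an endomorphism. The choice is made among smooth fields,
  so that smoothness comes with the defining equation.\<close>

definition "Lam = (SOME z. smooth_on z X & (ALL x:X. ALL w. h x (z x) w = cnj (th x w)))"
definition "A x u = (SOME z. smooth_on z X & (ALL x:X. ALL w. h x (z x) w = S x u w)) x"

lemma smooth_on_Lam: "smooth_on Lam X" and h_Lam: "x \<in> X ==> h x (Lam x) w = cnj (th x w)"
proof -
  have "EX z. smooth_on z X & (ALL x:X. ALL w. h x (z x) w = cnj (th x w))"
  proof (rule raise)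
    show "linear (%w. cnj (th x w))" if "x \<in> X" for x
      using linear_compose[OF th_linear[OF that] bounded_linear.linear[OF bounded_linear_cnj]] by (simp add: o_def)
    show "cnj (th x (\<i> *s w)) = - \<i> * cnj (th x w)" if "x \<in> X" for x w by (simp add: th_scale[OF that])
    show "smooth_on (%x. cnj (th x w)) X" for w by (rule smooth_on_linear[OF bounded_linear_cnj open_X th_smooth])
  qed
  from someI_ex[OF this] show "smooth_on Lam X" "x \<in> X ==> h x (Lam x) w = cnj (th x w)" by (auto simp: Lam_def)
qed

lemma smooth_on_A0: "smooth_on (%x. A x u) X" and h_A: "x \<in> X ==> h x (A x u) w = S x u w"
proof -
  have "EX z. smooth_on z X & (ALL x:X. ALL w. h x (z x) w = S x u w)"
  proof (rule raise)
    show "S x u (\<i> *s w) = - \<i> * S x u w" if "x \<in> X" for x w by (simp add: S_scale2[OF that])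
  qed (auto intro: S_linear S_smooth)
  from someI_ex[OF this] show "smooth_on (%x. A x u) X" "x \<in> X ==> h x (A x u) w = S x u w" by (auto simp: A_def)
qed

lemma h_Lam2: "x \<in> X ==> h x w (Lam x) = th x w" using h_Lam[of x w] cnj_h[of x "Lam x" w] by simp
lemma h_A2: "x \<in> X ==> h x w (A x u) = S x w u" using h_A[of x u w] cnj_h[of x "A x u" w] cnj_S[of x u w] by simp

lemma A_add: "x \<in> X ==> A x (u + v) = A x u + A x v"
  by (rule h_eqI[of x]; simp add: h_simps h_A S_simps)
lemma A_scale: "x \<in> X ==> A x (a *s u) = a *s A x u"
  by (rule h_eqI[of x]; simp add: h_simps h_A S_simps)
lemma A_linear: "x \<in> X ==> linear (A x)" by (rule linearI) (auto simp: A_add A_scale scaleR_vec_eq)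
lemma A_simps: "x \<in> X ==> A x 0 = 0" "x \<in> X ==> A x (- u) = - A x u" "x \<in> X ==> A x (u - v) = A x u - A x v"
  using linear_0[OF A_linear] linear_neg[OF A_linear] linear_diff[OF A_linear] by blast+

lemma Lam_deriv:
  assumes x: "x \<in> X" shows "der Lam (%w. A x w - Gm x w (Lam x)) x"
proof -
  have L: "der Lam (fd Lam x) x" by (rule smooth_on_deriv[OF smooth_on_Lam x])
  have "fd Lam x = (%w. A x w - Gm x w (Lam x))"
  proof (rule ext, rule h_eqI[OF x])
    fix w b
    have "der (%y. h y (Lam y) b) (%w. cnj (th x (Gm x w b) + S x b w)) x"
      by (rule der_cong[OF has_derivative_cnj[OF th_deriv[OF x]] open_X x]) (simp add: h_Lam)
    from fun_cong[OF has_derivative_unique[OF hd_h[OF x L has_derivative_const[of b]] this], of w]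
    show "h x (fd Lam x w) b = h x (A x w - Gm x w (Lam x)) b"
      by (simp add: h_simps[OF x] h_Lam[OF x] h_A[OF x] cnj_S[OF x] algebra_simps)
  qed
  with L show ?thesis by simp
qed

lemma A_deriv:
  assumes x: "x \<in> X"
  shows "der (%y. A y u) (%w. A x (Gm x w u) - Gm x w (A x u)
     - (th x w *s u + th x u *s w + cnj (th x w) *s u + h x u w *s Lam x)) x" (is "(_ has_derivative ?D) _")
proof -
  have L: "der (%y. A y u) (fd (%y. A y u) x) x" by (rule smooth_on_deriv[OF smooth_on_A0 x])
  have "fd (%y. A y u) x = ?D"
  proof (rule ext, rule h_eqI[OF x])
    fix w b
    have "der (%y. h y (A y u) b) (%w. DS x u b w) x"
      by (rule der_cong[OF S_deriv[OF x] open_X x]) (simp add: h_A)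
    from fun_cong[OF has_derivative_unique[OF hd_h[OF x L has_derivative_const[of b]] this], of w]
    show "h x (fd (%y. A y u) x w) b = h x (?D w) b"
      by (simp add: h_simps[OF x] h_Lam[OF x] h_A[OF x] algebra_simps)
  qed
  with L show ?thesis by simp
qed

lemma WW_Lam: "x \<in> X ==> WW x c v b (Lam x) = 0" "x \<in> X ==> WW x (Lam x) v b d = 0"
proof -
  show 1: "WW x c v b (Lam x) = 0" if "x \<in> X" for c v b using h_Lam2[OF that] th_W[OF that] by (simp add: WW_def)
  assume x: "x \<in> X"
  show "WW x (Lam x) v b d = 0"
    using 1[OF x, of b d v] WW_herm[OF x, of "Lam x" v b d] WW_sym2[OF x, of b d v "Lam x"] by simp
qed

lemma W_Lam: "x \<in> X ==> W x b (Lam x) v = 0"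
  using WW_Lam(2) by (intro h_nondeg) (auto simp: WW_def)

text \<open>This is \<open>S_W\<close> with the index raised: \<open>A\<close> may be moved from one
  slot of \<open>WW\<close> to another.\<close>

lemma WW_A: "x \<in> X ==> WW x b (A x v) a d = WW x b v a (A x d)"
proof -
  assume x: "x \<in> X"
  have "WW x b v a (A x d) = S x (W x a b v) d" by (simp add: WW_def h_A2[OF x])
  also have "... = h x (A x v) (W x b a d)" by (simp add: S_W[OF x] h_A[OF x])
  also have "... = cnj (WW x a d b (A x v))" by (simp add: WW_def cnj_h[OF x])
  finally show ?thesis using WW_herm[OF x, of b "A x v" a d] by simp
qed

lemma WW_A1: "x \<in> X ==> WW x (A x c) v b d = WW x c v b (A x d)"
  using WW_A[of x v c b d] WW_sym[of x "A x c" v b d] WW_sym[of x v c b "A x d"] by simp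
lemma WW_A2: "x \<in> X ==> WW x c v (A x b) d = WW x (A x c) v b d"
  using WW_A1[of x c v d b] WW_sym2[of x c v "A x b" d] WW_sym2[of x "A x c" v b d] by simp

definition "W1 x a b c v = (1/2) *s (fd (%y. W y b c v) x a - \<i> *s fd (%y. W y b c v) x (\<i> *s a))"

lemma smooth_on_W0: "smooth_on (%y. W y b c v) X"
  unfolding W_def by (intro smooth_on_add smooth_on_smult open_X smooth_on_const smooth_on_K0 h_smooth)

lemma DW: "x \<in> X ==> der (%y. W y b c v) (fd (%y. W y b c v) x) x"
  by (rule smooth_on_deriv[OF smooth_on_W0])

lemma W1_eq:
  assumes x: "x \<in> X"
  shows "W1 x a b c v = K1 x a b c v + h x (Gm x a c) b *s v + h x (Gm x a v) b *s c"
proof -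
  note sm = bounded_linear.has_derivative[OF bounded_bilinear.bounded_linear_left[OF bounded_bilinear_smult] h_deriv[OF x]]
  have "der (%y. W y b c v) (%w. DK x b c v w + ((h x (Gm x w c) b + h x c (Gm x w b)) *s v + (h x (Gm x w v) b + h x v (Gm x w b)) *s c)) x"
    unfolding W_def using has_derivative_add[OF DK[OF x, of b c v] has_derivative_add[OF sm[of c b v] sm[of v b c]]] by simp
  from fun_cong[OF frechet_derivative_at[OF this, symmetric]] have e: "fd (%y. W y b c v) x w = DK x b c v w + ((h x (Gm x w c) b + h x c (Gm x w b)) *s v + (h x (Gm x w v) b + h x v (Gm x w b)) *s c)" for w
    by metis
  show ?thesis unfolding W1_def K1_def e
    by (simp add: Gm_simps[OF x] h_simps[OF x] vec_eq_iff algebra_simps)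
qed

text \<open>\<open>W\<close> differs from \<open>K\<close> by a tensor built from the parallel form
  \<open>h\<close>, and inherits the second Bianchi identity. The additional terms \<open>E\<close>
  are symmetric in \<open>a\<close> and \<open>c\<close>.\<close>

lemma W1_commute:
  assumes x: "x \<in> X"
  shows "W1 x a b c v + W x b a (Gm x c v) + Gm x a (W x b c v) = W1 x c b a v + W x b c (Gm x a v) + Gm x c (W x b a v)"
proof -
  define E where "E a c = h x (Gm x a c) b *s v + h x (Gm x a v) b *s c + h x a b *s Gm x c v + h x (Gm x c v) b *s a
    + h x c b *s Gm x a v + h x v b *s Gm x a c" for a c
  have "W1 x a b c v + W x b a (Gm x c v) + Gm x a (W x b c v) = (K1 x a b c v + K x b a (Gm x c v) + Gm x a (K x b c v)) + E a c" for a c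
    unfolding W1_eq[OF x] W_def E_def by (simp add: Gm_simps[OF x])
  moreover have "E a c = E c a" unfolding E_def Gm_sym[OF x, of c a] by simp
  ultimately show ?thesis using K1_commute[OF x, of a b c v] by simp
qed

text \<open>Since \<open>W\<close> annihilates \<open>\<Lambda>\<close>, the Bianchi identity determines \<open>\<nabla>\<^sub>\<Lambda> W\<close>.\<close>

lemma W1_Lam:
  assumes x: "x \<in> X"
  shows "W1 x (Lam x) b c v + Gm x (Lam x) (W x b c v)
    = W x b c (Gm x (Lam x) v) + W x b (Gm x (Lam x) c) v - W x b (A x c) v"
proof -
  have lin: "linear (%c. W y b c v)" if "y \<in> X" for y
    by (rule linearI) (auto simp: W_simps0[OF that] scaleR_vec_eq)
  have h1: "der (%y. W y b (Lam y) v) (%w. fd (%y. W y b (Lam x) v) x w + W x b (A x w - Gm x w (Lam x)) v) x"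
    by (rule der_linear_arg[where T="%y c. W y b c v", OF open_X x lin DW[OF x] Lam_deriv[OF x]])
  have "der (%y. W y b (Lam y) v) (%w. 0) x"
    by (rule der_cong[OF has_derivative_const open_X x]) (simp add: W_Lam)
  from fun_cong[OF has_derivative_unique[OF h1 this]]
  have e: "fd (%y. W y b (Lam x) v) x w = - W x b (A x w - Gm x w (Lam x)) v" for w
    by (simp add: eq_neg_iff_add_eq_0)
  have "W1 x c b (Lam x) v = - W x b (A x c - Gm x c (Lam x)) v"
    unfolding W1_def e by (simp add: A_scale[OF x] Gm_scale[OF x] W_scale2[OF x] linear_diff[OF lin[OF x]] vec_eq_iff algebra_simps)
  then show ?thesis
    using W1_commute[OF x, of "Lam x" b c v]
    by (simp add: W_Lam[OF x] Gm_zero[OF x] linear_diff[OF lin[OF x]] Gm_sym[OF x, of c "Lam x"] algebra_simps)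
qed

text \<open>Covariantly, the derivative of \<open>WW\<close> along the gradient is
  \<open>- 2 * WW x (A x c) v b d\<close>. The complex linear part is given by
  \<open>W1_Lam\<close>; the antilinear part is its conjugate by hermitian symmetry, and
  \<open>WW_A2\<close> moves the endomorphism to the same slot.\<close>

lemma DWW_Lam:
  assumes x: "x \<in> X"
  shows "fd (%y. WW y c v b d) x (Lam x) = - 2 * WW x (A x c) v b d + WW x (Gm x (Lam x) c) v b d + WW x c (Gm x (Lam x) v) b d
     + WW x c v (Gm x (Lam x) b) d + WW x c v b (Gm x (Lam x) d)"
proof -
  define L where "L w c v b d = h x (Gm x w (W x b c v) + W1 x w b c v) d" for w c v b d
  define W2 where "W2 w b c v = (1/2) *s (fd (%y. W y b c v) x w + \<i> *s fd (%y. W y b c v) x (\<i> *s w))" for w b c v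
  define R where "R w c v b d = h x (W x b c v) (Gm x w d) + h x (W2 w b c v) d" for w c v b d
  have Dneg: "fd (%y. W y b c v) x (- w) = - fd (%y. W y b c v) x w" for w b c v
    using linear_neg[OF has_derivative_linear[OF DW[OF x]]] by blast
  have D: "der (%y. WW y c v b d) (%w. L w c v b d + R w c v b d) x" for c v b d
    unfolding WW_def
    by (rule has_derivative_eq_rhs[OF hd_h[OF x DW[OF x] has_derivative_const]])
      (simp add: fun_eq_iff L_def R_def W1_def W2_def h_simps[OF x] algebra_simps)
  have "der (%y. WW y c v b d) (%w. cnj (L w b d c v + R w b d c v)) x"
    by (rule der_cong[OF has_derivative_cnj[OF D] open_X x]) (simp add: WW_herm[of _ c v b d])
  from fun_cong[OF has_derivative_unique[OF D this]]
  have e: "(L w c v b d - cnj (R w b d c v)) + (R w c v b d - cnj (L w b d c v)) = 0" for w by (simp add: algebra_simps)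
  have i: "W1 x (\<i> *s w) b c v = \<i> *s W1 x w b c v" "W2 (\<i> *s w) b c v = - (\<i> *s W2 w b c v)" for w b c v
    by (simp_all add: W1_def W2_def smult_i Dneg vec_eq_iff algebra_simps)
  have LR: "L (\<i> *s w) c v b d = \<i> * L w c v b d" "R (\<i> *s w) c v b d = - (\<i> * R w c v b d)" for w c v b d
    unfolding L_def R_def i by (simp_all add: h_simps[OF x] Gm_scale[OF x] algebra_simps)
  have "R w c v b d - cnj (L w b d c v) = 0" for w
    by (rule type_split1(2)[where f="%w. L w c v b d - cnj (R w b d c v)", OF e])
      (simp_all add: LR algebra_simps)
  then have "fd (%y. WW y c v b d) x (Lam x) = L (Lam x) c v b d + cnj (L (Lam x) b d c v)"
    using fun_cong[OF frechet_derivative_at[OF D[of c v b d]], of "Lam x"] by simp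
  moreover have "L (Lam x) c v b d = WW x c (Gm x (Lam x) v) b d + WW x (Gm x (Lam x) c) v b d - WW x (A x c) v b d" for c v b d
    using W1_Lam[OF x, of b c v] by (simp add: L_def WW_def h_simps[OF x] add.commute)
  moreover have "cnj (WW x b (Gm x (Lam x) d) c v) = WW x c v b (Gm x (Lam x) d)" "cnj (WW x (Gm x (Lam x) b) d c v) = WW x c v (Gm x (Lam x) b) d"
    "cnj (WW x (A x b) d c v) = WW x (A x c) v b d"
    using WW_herm[OF x, of c v b "Gm x (Lam x) d"] WW_herm[OF x, of c v "Gm x (Lam x) b" d] WW_herm[OF x, of c v "A x b" d] WW_A2[OF x, of c v b d]
    by simp_all
  ultimately show ?thesis by simp
qed

text \<open>A maximum of the Rayleigh quotient of \<open>S\<close> by \<open>h\<close> on the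
  sphere. The sign \<open>s\<close> is chosen so that the maximum is positive, which makes the
  eigenvalue nonzero.\<close>

lemma eigenvector:
  assumes m: "m \<in> X" and "S m u0 v0 ~= 0"
  shows "EX Y \<mu>. Y ~= 0 & (\<mu>::real) ~= 0 & A m Y = of_real \<mu> *s Y"
proof -
  have "EX u. Re (S m u u) ~= 0"
  proof (rule ccontr)
    assume "~ ?thesis"
    then have 0: "Re (S m u u) = 0" for u by blast
    have re: "Re (S m u v) = 0" for u v
      using 0[of "u + v"] 0[of u] 0[of v] arg_cong[OF cnj_S[OF m, of u v], of Re] by (simp add: S_simps[OF m])
    have "S m u v = 0" for u v using re[of u v] re[of "\<i> *s u" v] by (simp add: S_simps[OF m] complex_eq_iff)
    then show False using assms by blast
  qed
  then obtain u1 where u1: "Re (S m u1 u1) ~= 0" by blast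
  define s where "s = sgn (Re (S m u1 u1))"
  have s: "s * Re (S m u1 u1) > 0" "s ~= 0" using u1 by (auto simp: s_def sgn_if)
  define F where "F Y = s * Re (S m Y Y) / Re (h m Y Y)" for Y
  have c: "continuous_on UNIV (%Y. S m Y Y)" "continuous_on UNIV (%Y. h m Y Y)"
  proof -
    have "smooth_on (%Y. S m Y Y) UNIV" "smooth_on (%Y. h m Y Y) UNIV"
      using m by (auto intro!: smooth_on_linear_arg[where T="%Y. S m Y"] smooth_on_linear_arg[where T="%Y. h m Y"]
          smooth_on_linear_arg[where T="%Y v. S m v w" for w] smooth_on_linear_arg[where T="%Y v. h m v w" for w]
          S_linear h_linear smooth_on_const smooth_on_id)
    then show "continuous_on UNIV (%Y. S m Y Y)" "continuous_on UNIV (%Y. h m Y Y)" using smooth_on_continuous by auto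
  qed
  have nz: "Re (h m Y Y) ~= 0" if "Y \<in> sphere 0 1" for Y
  proof -
    have "Y ~= 0" using that by auto
    then show ?thesis using h_pos[OF m] by force
  qed
  have "continuous_on (sphere 0 1) F" unfolding F_def
    by (intro continuous_intros continuous_on_subset[OF c(1)] continuous_on_subset[OF c(2)]) (use nz in auto)
  moreover have "u1 ~= 0" using u1 by (auto simp: S_zero[OF m])
  then have "(1 / norm u1) *\<^sub>R u1 \<in> sphere 0 1" by simp
  then have "sphere 0 1 ~= ({} :: ('n V) set)" by blast
  ultimately obtain Y where Y: "Y \<in> sphere 0 1" "!!V. V \<in> sphere 0 1 ==> F V <= F Y"
    using continuous_attains_sup[of "sphere 0 1" F] compact_sphere by blast
  have sc: "F (r *\<^sub>R V) = F V" if "r ~= 0" for r V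
    using that by (simp add: F_def scaleR_vec_eq S_simps[OF m] h_simps[OF m])
  have max: "s * Re (S m V V) <= F Y * Re (h m V V)" for V
  proof (cases "V = 0")
    case False
    have "F V = F ((1 / norm V) *\<^sub>R V)" using False by (simp add: sc)
    also have "... <= F Y" using False by (intro Y) simp
    finally show ?thesis using h_pos[OF m False] by (simp add: F_def pos_divide_le_eq)
  qed (simp add: S_zero[OF m] h_zero[OF m])
  have Y0: "Y ~= 0" using Y by auto
  have eqY: "s * Re (S m Y Y) = F Y * Re (h m Y Y)" using h_pos[OF m Y0] by (simp add: F_def)
  have FY: "F Y > 0" using max[of u1] s(1) h_pos[OF m \<open>u1 ~= 0\<close>] by (metis less_le_trans zero_less_mult_pos2)
  have lin: "Re (s * S m Y Z - F Y * h m Y Z) = 0" for Z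
  proof (rule linear_coefficient_zero)
    fix t :: real
    have "s * Re (S m (Y + of_real t *s Z) (Y + of_real t *s Z)) - F Y * Re (h m (Y + of_real t *s Z) (Y + of_real t *s Z)) <= 0"
      using max[of "Y + of_real t *s Z"] by simp
    moreover have "Re (S m Z Y) = Re (S m Y Z)" "Re (h m Z Y) = Re (h m Y Z)"
      using arg_cong[OF cnj_S[OF m, of Y Z], of Re] arg_cong[OF cnj_h[OF m, of Y Z], of Re] by auto
    ultimately show "2 * t * Re (s * S m Y Z - F Y * h m Y Z) + t\<^sup>2 * (s * Re (S m Z Z) - F Y * Re (h m Z Z)) <= 0"
      using eqY by (simp add: S_simps[OF m] h_simps[OF m] algebra_simps power2_eq_square)
  qed
  have "s * S m Y Z - F Y * h m Y Z = 0" for Z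
    using lin[of Z] lin[of "\<i> *s Z"] by (simp add: S_simps[OF m] h_simps[OF m] complex_eq_iff)
  then have "A m Y = of_real (F Y / s) *s Y"
    using s(2) by (intro h_eqI[OF m]) (simp add: h_A[OF m] h_simps[OF m] field_simps)
  then show ?thesis using Y0 FY s(2) by (intro exI[of _ Y] exI[of _ "F Y / s"]) simp
qed


section \<open>The maximum principle on the tangent bundle\<close>

abbreviation "U0 == X \<times> (UNIV :: ('n V) set)"
text \<open>The horizontal lift of the gradient to the tangent bundle.\<close>

definition "vf z = (Lam (fst z), - Gm (fst z) (Lam (fst z)) (snd z))"

lemma open_U0: "open U0" by (intro open_Times open_X open_UNIV)
lemma fst_U0: "z \<in> U0 ==> fst z \<in> X" by auto
lemma smooth_fst: "smooth_on fst U0" and smooth_snd: "smooth_on snd U0"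
  using smooth_on_linear[OF bounded_linear_fst open_U0 smooth_on_id[OF open_U0]]
    smooth_on_linear[OF bounded_linear_snd open_U0 smooth_on_id[OF open_U0]] by auto
lemma hd_fst: "der fst fst z" and hd_snd: "der snd snd z"
  by (auto intro: bounded_linear_imp_has_derivative bounded_linear_fst bounded_linear_snd)

lemma smooth_vf: "smooth_on vf U0"
  unfolding vf_def
  by (intro smooth_on_Pair open_U0 smooth_on_uminus smooth_on_Gm2 smooth_fst smooth_snd
      smooth_on_compose[OF open_U0 smooth_on_Lam smooth_fst]) auto

lemma A_comp_deriv:
  assumes z: "z \<in> U0"
  shows "der (%z. A (fst z) (snd z)) (%w. (A (fst z) (Gm (fst z) (fst w) (snd z)) - Gm (fst z) (fst w) (A (fst z) (snd z))
     - (th (fst z) (fst w) *s snd z + th (fst z) (snd z) *s fst w + cnj (th (fst z) (fst w)) *s snd z + h (fst z) (snd z) (fst w) *s Lam (fst z)))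
     + A (fst z) (snd w)) z"
  by (rule der_linear_arg[where T="%z. A (fst z)", OF open_U0 z A_linear[OF fst_U0]
        has_derivative_compose[OF hd_fst A_deriv[OF fst_U0[OF z]]] hd_snd])

lemma smooth_A: "smooth_on (%z. A (fst z) (snd z)) U0"
  by (rule smooth_on_linear_arg2[where T=A, OF open_U0 open_X A_linear smooth_on_A0 smooth_fst _ smooth_snd]) auto

text \<open>The function \<open>P\<close> on the tangent bundle is at most 0 and vanishes at
  \<open>(m, X0)\<close>. By \<open>DWW_Lam\<close> its derivative along \<open>vf\<close> is the
  algebraic expression \<open>\<Psi>\<close>, so both parts of \<open>maximum_vector_field\<close>
  apply: the first gives \<open>A m X0 = 0\<close> and \<open>Lam m = 0\<close>, the second excludes
  eigenvectors of \<open>A m\<close> with nonzero eigenvalue.\<close>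

lemma sectional_maximum:
  assumes m: "m \<in> X" and X0: "X0 ~= 0" and \<sigma>: "\<sigma> > 0" and eq: "s * Re (WW m X0 X0 X0 X0) = \<sigma> * (Re (h m X0 X0))\<^sup>2"
    and le: "!!x u. x \<in> X ==> s * Re (WW x u u u u) <= \<sigma> * (Re (h x u u))\<^sup>2"
  shows "th m v = 0 & S m u v = 0"
proof -
  let ?z = "(m, X0)"
  define P where "P z = s * Re (WW (fst z) (snd z) (snd z) (snd z) (snd z)) - \<sigma> * (Re (h (fst z) (snd z) (snd z)))\<^sup>2" for z
  define \<Psi> where "\<Psi> z = - 2 * s * Re (WW (fst z) (A (fst z) (snd z)) (snd z) (snd z) (snd z))" for z
  define q where "q u = Re (h m u u)" for u
  have zU: "?z \<in> U0" using m by simp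
  have qX: "q X0 > 0" using h_pos[OF m X0] by (simp add: q_def)
  have im: "fst ` U0 <= X" by auto
  have sP: "smooth_on P U0" unfolding P_def power2_eq_square
    by (intro smooth_on_diff smooth_on_mult smooth_on_const open_U0 smooth_on_linear[OF bounded_linear_Re] smooth_on_WW smooth_on_h2
        smooth_fst smooth_snd im)
  have hdP: "der P (%w. s * Re (fd (%x. WW x (snd z) (snd z) (snd z) (snd z)) (fst z) (fst w)
     + WW (fst z) (snd w) (snd z) (snd z) (snd z) + WW (fst z) (snd z) (snd w) (snd z) (snd z) + WW (fst z) (snd z) (snd z) (snd w) (snd z)
     + WW (fst z) (snd z) (snd z) (snd z) (snd w)) - \<sigma> * (2 * Re (h (fst z) (snd z) (snd z)) *
      Re (h (fst z) (Gm (fst z) (fst w) (snd z)) (snd z) + h (fst z) (snd z) (Gm (fst z) (fst w) (snd z)) + h (fst z) (snd w) (snd z) + h (fst z) (snd z) (snd w)))) z"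
    if z: "z \<in> U0" for z
    unfolding P_def
    by (rule has_derivative_eq_rhs[OF has_derivative_diff[OF
        has_derivative_mult_right[OF has_derivative_Re[OF hd_WW[OF open_U0 z fst_U0 hd_fst hd_snd hd_snd hd_snd hd_snd]]]
        has_derivative_mult_right[OF has_derivative_power[OF has_derivative_Re[OF hd_h_comp[OF open_U0 z fst_U0 hd_fst hd_snd hd_snd]]]]]])
      (simp_all add: fun_eq_iff mult_ac)
  have fdP: "fd P z w = s * Re (fd (%x. WW x (snd z) (snd z) (snd z) (snd z)) (fst z) (fst w)
     + WW (fst z) (snd w) (snd z) (snd z) (snd z) + WW (fst z) (snd z) (snd w) (snd z) (snd z) + WW (fst z) (snd z) (snd z) (snd w) (snd z)
     + WW (fst z) (snd z) (snd z) (snd z) (snd w)) - \<sigma> * (2 * Re (h (fst z) (snd z) (snd z)) *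
      Re (h (fst z) (Gm (fst z) (fst w) (snd z)) (snd z) + h (fst z) (snd z) (Gm (fst z) (fst w) (snd z)) + h (fst z) (snd w) (snd z) + h (fst z) (snd z) (snd w)))"
    if "z \<in> U0" for z w
    using fun_cong[OF frechet_derivative_at[OF hdP[OF that], symmetric]] .
  have Pmax: "P y <= P ?z" if "y \<in> U0" for y
    using le[of "fst y" "snd y"] that eq by (auto simp: P_def)
  have \<Psi>: "\<Psi> z = fd P z (vf z)" if z: "z \<in> U0" for z
    unfolding fdP[OF z] using fst_U0[OF z]
    by (simp add: \<Psi>_def vf_def DWW_Lam WW_minus h_simps algebra_simps)
  have mv1: "D (vf ?z) <= 0" if "der \<Psi> D ?z" for D
    by (rule maximum_vector_field(1)[OF open_U0 zU sP _ smooth_vf _ that]) (erule Pmax, erule \<Psi>)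
  have mv2: "dd \<Psi> ?z \<zeta> = 2 * \<mu> * dd P ?z \<zeta>" if "vf ?z = 0" "fd vf ?z \<zeta> = \<mu> *\<^sub>R \<zeta>" for \<zeta> \<mu>
    by (rule maximum_vector_field(2)[OF open_U0 zU sP _ smooth_vf _ that]) (erule Pmax, erule \<Psi>)
  have so: "fd P ?z v = 0" "dd P ?z v <= 0" for v
    by (rule second_order_maximum[OF open_U0 zU sP]; erule Pmax)+
  note s4 = h_simps[OF m] S_simps[OF m] th_simps[OF m]
  \<comment> \<open>The derivative of \<open>P\<close> along the fibre vanishes: \<open>X0\<close>
    is a critical point of the quartic form relative to the squared metric.\<close>
  have eig: "s * WW m X0 X0 X0 Y = \<sigma> * q X0 * h m X0 Y" for Y
  proof -
    have re: "Re (s * WW m X0 X0 X0 Y - \<sigma> * q X0 * h m X0 Y) = 0" for Y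
    proof -
      have "Re (WW m X0 X0 Y X0) = Re (WW m X0 X0 X0 Y)" "Re (WW m Y X0 X0 X0) = Re (WW m X0 X0 X0 Y)" "Re (WW m X0 Y X0 X0) = Re (WW m X0 X0 X0 Y)"
        using WW_sym2[OF m, of X0 X0 Y X0] WW_herm[OF m, of Y X0 X0 X0] WW_sym[OF m, of X0 Y X0 X0] by auto
      moreover have "Re (h m Y X0) = Re (h m X0 Y)" using arg_cong[OF cnj_h[OF m, of X0 Y], of Re] by simp
      moreover have "fd (%x. WW x X0 X0 X0 X0) m 0 = 0"
        by (rule linear_0[OF has_derivative_linear[OF smooth_on_deriv[OF smooth_on_WW0 m]]])
      ultimately show ?thesis
        using so(1)[of "(0, Y)"] unfolding fdP[OF zU] by (simp add: q_def Gm_zero[OF m] h_zero[OF m] algebra_simps)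
    qed
    show ?thesis using re[of Y] re[of "\<i> *s Y"] by (simp add: WW_scale[OF m] h_simps[OF m] complex_eq_iff)
  qed
  have q_ge: "q u >= 0" for u using h_pos[OF m, of u] by (cases "u = 0") (auto simp: q_def h_zero[OF m])
  have q0: "u = 0" if "q u = 0" for u using h_pos[OF m, of u] that by (auto simp: q_def)
  have qh: "h m u u = of_real (q u)" for u using h_real[OF m, of u] by (simp add: q_def complex_eq_iff)
  \<comment> \<open>In the derivative of \<open>\<Psi>\<close> along \<open>vf\<close>, the tensor
    contributes a second \<open>A\<close> and the derivative of \<open>A\<close> contributes
    \<open>th m (Lam m)\<close>; terms with \<open>Lam\<close> in a slot of \<open>WW\<close>
    vanish. Two nonnegative squares remain, against the sign required at a maximum.\<close>
  obtain D where D: "der \<Psi> D ?z" "D (vf ?z) = 4 * \<sigma> * q X0 * q (A m X0) + 4 * \<sigma> * (q X0)\<^sup>2 * q (Lam m)"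
  proof -
    note a' = A_comp_deriv[OF zU]
    note d = has_derivative_mult_right[OF has_derivative_Re[OF hd_WW[OF open_U0 zU fst_U0 hd_fst a' hd_snd hd_snd hd_snd]], of "- 2 * s"]
    have thL: "th m (Lam m) = of_real (q (Lam m))" using h_Lam2[OF m, of "Lam m"] by (simp add: qh)
    have e1: "s * Re (WW m X0 X0 X0 X0) = \<sigma> * (q X0)\<^sup>2" using eq by (simp add: q_def)
    have e2: "s * Re (WW m (A m (A m X0)) X0 X0 X0) = \<sigma> * q X0 * q (A m X0)"
    proof -
      have "WW m (A m (A m X0)) X0 X0 X0 = cnj (WW m X0 X0 X0 (A m (A m X0)))"
        using WW_herm[OF m, of "A m (A m X0)" X0 X0 X0] WW_sym2[OF m, of X0 X0 "A m (A m X0)" X0] by simp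
      then have "s * Re (WW m (A m (A m X0)) X0 X0 X0) = Re (s * WW m X0 X0 X0 (A m (A m X0)))" by simp
      also have "... = \<sigma> * q X0 * Re (h m X0 (A m (A m X0)))" by (simp add: eig)
      also have "h m X0 (A m (A m X0)) = of_real (q (A m X0))" by (simp add: h_A2[OF m] h_A[OF m, symmetric] qh)
      finally show ?thesis by simp
    qed
    have s0: "s ~= 0" using e1 \<sigma> qX by auto
    have e1': "Re (WW m X0 X0 X0 X0) = \<sigma> * (q X0)\<^sup>2 / s" and e2': "Re (WW m (A m (A m X0)) X0 X0 X0) = \<sigma> * q X0 * q (A m X0) / s"
      using e1 e2 s0 by (simp_all add: field_simps)
    show ?thesis
    proof (rule that[OF d[folded \<Psi>_def]])
      show "(- 2 * s) * Re (fd (%x. WW x (A (fst ?z) (snd ?z)) (snd ?z) (snd ?z) (snd ?z)) (fst ?z) (fst (vf ?z)) +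
         WW (fst ?z) (A (fst ?z) (Gm (fst ?z) (fst (vf ?z)) (snd ?z)) - Gm (fst ?z) (fst (vf ?z)) (A (fst ?z) (snd ?z))
     - (th (fst ?z) (fst (vf ?z)) *s snd ?z + th (fst ?z) (snd ?z) *s fst (vf ?z) + cnj (th (fst ?z) (fst (vf ?z))) *s snd ?z + h (fst ?z) (snd ?z) (fst (vf ?z)) *s Lam (fst ?z))
     + A (fst ?z) (snd (vf ?z))) (snd ?z) (snd ?z) (snd ?z) + WW (fst ?z) (A (fst ?z) (snd ?z)) (snd (vf ?z)) (snd ?z) (snd ?z) +
         WW (fst ?z) (A (fst ?z) (snd ?z)) (snd ?z) (snd (vf ?z)) (snd ?z) + WW (fst ?z) (A (fst ?z) (snd ?z)) (snd ?z) (snd ?z) (snd (vf ?z))) =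
         4 * \<sigma> * q X0 * q (A m X0) + 4 * \<sigma> * (q X0)\<^sup>2 * q (Lam m)"
        by (simp only: vf_def fst_conv snd_conv DWW_Lam[OF m] WW_minus[OF m] WW_add[OF m] WW_diff[OF m] WW_scale[OF m] WW_Lam[OF m] A_simps[OF m] thL)
          (simp add: e1' e2' s0 field_simps power2_eq_square)
    qed
  qed
  have "D (vf ?z) <= 0" by (rule mv1[OF D(1)])
  then have "4 * \<sigma> * q X0 * q (A m X0) + 4 * \<sigma> * (q X0)\<^sup>2 * q (Lam m) <= 0" using D(2) by simp
  moreover have "4 * \<sigma> * q X0 * q (A m X0) >= 0" "4 * \<sigma> * (q X0)\<^sup>2 * q (Lam m) >= 0"
    using \<sigma> qX q_ge by simp_all
  ultimately have "4 * \<sigma> * q X0 * q (A m X0) = 0" "4 * \<sigma> * (q X0)\<^sup>2 * q (Lam m) = 0" by linarith+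
  then have AX: "A m X0 = 0" and L0: "Lam m = 0" using \<sigma> qX q0 by auto
  have th0: "th m v = 0" for v using h_Lam2[OF m, of v] L0 by (simp add: h_zero[OF m])
  have SX: "S m X0 b = 0" for b using h_A[OF m, of X0 b] AX by (simp add: h_zero[OF m])
  have "S m u v = 0"
  proof (rule ccontr)
    assume "S m u v ~= 0"
    from eigenvector[OF m this] obtain Y \<mu> where Y: "Y ~= 0" "(\<mu>::real) ~= 0" "A m Y = of_real \<mu> *s Y" by blast
    have qY: "q Y > 0" using h_pos[OF m Y(1)] by (simp add: q_def)
    \<comment> \<open>The pair \<open>(Y, g)\<close> is the horizontal lift of \<open>Y\<close>. It
      is an eigenvector, for the eigenvalue \<mu>, of the linearisation of \<open>vf\<close> at its
      zero.\<close>
    define g where "g = - Gm m Y X0"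
    let ?\<zeta> = "(Y, g)"
    have vf0: "vf ?z = 0" by (simp add: vf_def L0 Gm_zero[OF m] zero_prod_def)
    have Lc: "der (%z. Lam (fst z)) (%w. A m (fst w) - Gm m (fst w) (Lam m)) ?z"
      using has_derivative_compose[OF hd_fst Lam_deriv[OF fst_U0[OF zU]]] by simp
    have "fd vf ?z ?\<zeta> = \<mu> *\<^sub>R ?\<zeta>"
    proof -
      have "der vf (%w. (A m (fst w) - Gm m (fst w) (Lam m),
         - (DGm m (Lam m) X0 (fst w) + Gm m (A m (fst w) - Gm m (fst w) (Lam m)) X0 + Gm m (Lam m) (snd w)))) ?z"
        unfolding vf_def using has_derivative_Pair[OF Lc has_derivative_minus[OF hd_Gm_comp[OF open_U0 zU fst_U0 hd_fst Lc hd_snd]]] by simp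
      from fun_cong[OF frechet_derivative_at[OF this, symmetric], of ?\<zeta>]
      show ?thesis using linear_0[OF DGm_linear(2)[OF m]]
        by (simp add: L0 Y(3) Gm_simps[OF m] g_def scaleR_vec_eq vec_eq_iff)
    qed
    from mv2[OF vf0 this] have dd\<Psi>: "dd \<Psi> ?z ?\<zeta> = 2 * \<mu> * dd P ?z ?\<zeta>" .
    \<comment> \<open>The vector \<open>A X\<close> vanishes at this point together with its
      derivative along \<open>?\<zeta>\<close>, so \<open>dd \<Psi>\<close> involves only its second
      derivative.\<close>
    let ?a = "%z. A (fst z) (snd z)"
    have a0: "?a ?z = 0" using AX by simp
    have a1: "fd ?a ?z ?\<zeta> = 0"
      using fun_cong[OF frechet_derivative_at[OF A_comp_deriv[OF zU], symmetric], of ?\<zeta>]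
      by (simp add: AX L0 th0 Gm_zero[OF m] g_def A_simps[OF m])
    have l\<Psi>: "linear (%c. - 2 * s * Re (WW (fst y) c (snd y) (snd y) (snd y)))" if "y \<in> U0" for y
      by (rule linearI) (simp_all add: WW_add[OF fst_U0[OF that]] WW_scale[OF fst_U0[OF that]] scaleR_vec_eq algebra_simps)
    have s\<Psi>: "smooth_on (%y. - 2 * s * Re (WW (fst y) c (snd y) (snd y) (snd y))) U0" for c
      by (intro smooth_on_mult smooth_on_const open_U0 smooth_on_linear[OF bounded_linear_Re] smooth_on_WW smooth_fst smooth_snd im)
    have 1: "dd \<Psi> ?z ?\<zeta> = - 2 * s * Re (WW m (dd ?a ?z ?\<zeta>) X0 X0 X0)"
      using dd_linear_arg[where T="%z c. - 2 * s * Re (WW (fst z) c (snd z) (snd z) (snd z))" and a="?a", OF open_U0 zU l\<Psi> s\<Psi> smooth_A a0 a1]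
      by (simp add: \<Psi>_def[abs_def])
    \<comment> \<open>The terms with Christoffel symbols. They enter through \<open>A m Z\<close>,
      and moving \<open>A\<close> over to \<open>X0\<close> removes them.\<close>
    define Z where "Z = DGm m Y X0 Y + Gm m Y g"
    have SY: "S m Y Y = of_real (\<mu> * q Y)" using h_A[OF m, of Y Y] Y(3) by (simp add: h_scale[OF m] qh)
    have hXY: "h m X0 Y = 0" using SX[of Y] h_A2[OF m, of X0 Y] Y(2,3) by (simp add: h_scale2[OF m])
    have ddS: "dd (%z. S (fst z) (snd z) b) ?z ?\<zeta> = S m Z b - 2 * \<mu> * q Y * h m X0 b" for b
    proof -
      define F' where "F' y w = DS (fst y) (snd y) b (fst w) + S (fst y) (snd w) b" for y w
      have c: "der (%y. v) (%w. 0) ?z" for v :: "'n V" by (rule has_derivative_const)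
      have 1: "der (%z. S (fst z) (snd z) b) (F' y) y" if "y \<in> U0" for y
        using hd_S_comp[OF open_U0 that fst_U0 hd_fst hd_snd has_derivative_const[of b]] fst_U0[OF that]
        by (simp add: F'_def[abs_def] S_zero)
      have Gmu: "der (%y. Gm (fst y) Y (snd y)) (%w. DGm m Y X0 (fst w) + Gm m Y (snd w)) ?z"
        using hd_Gm_comp[OF open_U0 zU fst_U0 hd_fst c[of Y] hd_snd] by (simp add: Gm_zero[OF m])
      have Gmb: "der (%y. Gm (fst y) Y b) (%w. DGm m Y b (fst w)) ?z"
        using hd_Gm_comp[OF open_U0 zU fst_U0 hd_fst c[of Y] c[of b]] by (simp add: Gm_zero[OF m])
      have hh: "der (%y. h (fst y) (u y) (v y)) (%w. h m (Gm m (fst w) (u ?z)) (v ?z) + h m (u ?z) (Gm m (fst w) (v ?z)) + h m (u' w) (v ?z) + h m (u ?z) (v' w)) ?z"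
        if "der u u' ?z" "der v v' ?z" for u v u' v'
        using hd_h_comp[OF open_U0 zU fst_U0 hd_fst that] by simp
      have SS: "der (%y. S (fst y) (u y) (v y)) (%w. DS m (u ?z) (v ?z) (fst w) + S m (u' w) (v ?z) + S m (u ?z) (v' w)) ?z"
        if "der u u' ?z" "der v v' ?z" for u v u' v'
        using hd_S_comp[OF open_U0 zU fst_U0 hd_fst that] by simp
      have tt: "der (%y. th (fst y) (u y)) (%w. th m (Gm m (fst w) (u ?z)) + S m (u ?z) (fst w) + th m (u' w)) ?z"
        if "der u u' ?z" for u u'
        using hd_th_comp[OF open_U0 zU fst_U0 hd_fst that] by simp
      note E = has_derivative_add[OF has_derivative_diff[OF has_derivative_add[OF SS[OF Gmu c[of b]] SS[OF hd_snd Gmb]]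
          has_derivative_mult_right[OF has_derivative_add[OF has_derivative_add[OF has_derivative_add[OF
             has_derivative_mult[OF tt[OF c[of Y]] hh[OF hd_snd c[of b]]] has_derivative_mult[OF tt[OF hd_snd] hh[OF c[of Y] c[of b]]]]
             has_derivative_mult[OF has_derivative_cnj[OF tt[OF c[of Y]]] hh[OF hd_snd c[of b]]]]
             has_derivative_mult[OF has_derivative_cnj[OF tt[OF c[of b]]] hh[OF hd_snd c[of Y]]]], of "complex_of_real 1"]]
          SS[OF c[of g] c[of b]]]
      have 2: "(%y. F' y ?\<zeta>) = (%y. S (fst y) (Gm (fst y) Y (snd y)) b + S (fst y) (snd y) (Gm (fst y) Y b)
        - complex_of_real 1 * (th (fst y) Y * h (fst y) (snd y) b + th (fst y) (snd y) * h (fst y) Y b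
          + cnj (th (fst y) Y) * h (fst y) (snd y) b + cnj (th (fst y) b) * h (fst y) (snd y) Y) + S (fst y) g b)"
        by (simp add: F'_def)
      have zz: "fst ?z = m" "snd ?z = X0" "fst ?\<zeta> = Y" "snd ?\<zeta> = g" by simp_all
      have "S m g b = - S m (Gm m Y X0) b" "S m g d = - S m (Gm m Y X0) d" for d by (simp_all add: g_def S_simps[OF m])
      moreover have "S m (Gm m Y g) b = - S m (Gm m Y (Gm m Y X0)) b" by (simp add: g_def S_simps[OF m] Gm_simps[OF m])
      ultimately show ?thesis
        using dd_eq[where \<zeta>="?\<zeta>", OF open_U0 zU 1 E[folded 2]]
        by (simp only: zz) (simp add: th0 SX s4 Gm_simps[OF m] hXY SY cnj_S[OF m] Z_def algebra_simps)
    qed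
    have "dd ?a ?z ?\<zeta> = A m Z - of_real (2 * \<mu> * q Y) *s X0"
    proof (rule h_eqI[OF m])
      fix b
      have "h m (dd ?a ?z ?\<zeta>) b = dd (%z. h (fst z) (?a z) b) ?z ?\<zeta>"
        using dd_linear_arg[where T="%z c. h (fst z) c b" and a="?a", OF open_U0 zU h_linear(1)[OF fst_U0] _ smooth_A a0 a1]
          smooth_on_h2[OF open_U0 smooth_fst im smooth_on_const smooth_on_const] by simp
      also have "... = dd (%z. S (fst z) (snd z) b) ?z ?\<zeta>"
        by (rule dd_cong[OF open_U0 zU h_A[OF fst_U0] smooth_on_h2[OF open_U0 smooth_fst im smooth_A smooth_on_const]])
      finally show "h m (dd ?a ?z ?\<zeta>) b = h m (A m Z - of_real (2 * \<mu> * q Y) *s X0) b"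
        by (simp add: ddS h_simps[OF m] h_A[OF m])
    qed
    moreover have "WW m (A m Z) X0 X0 X0 = 0"
      using WW_A1[OF m, of Z X0 X0 X0] AX by (simp add: WW_zero[OF m])
    ultimately have "dd \<Psi> ?z ?\<zeta> = 4 * \<mu> * q Y * (s * Re (WW m X0 X0 X0 X0))"
      by (simp add: 1 WW_diff[OF m] WW_scale[OF m])
    then have "2 * \<mu> * dd P ?z ?\<zeta> = 2 * \<mu> * (2 * q Y * (\<sigma> * (q X0)\<^sup>2))" using dd\<Psi> eq by (simp add: q_def)
    then have "dd P ?z ?\<zeta> = 2 * q Y * (\<sigma> * (q X0)\<^sup>2)" using Y(2) by simp
    also have "... > 0" using qY \<sigma> qX by simp
    finally show False using so(2)[of ?\<zeta>] by simp
  qed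
  with th0 show ?thesis by blast
qed

end

section \<open>Charts of a complex manifold\<close>

locale cmanifold =
  fixes M :: "('m, 'n::finite) charted"
  assumes M: "complex_manifold M"
begin

abbreviation "TM == topspace (mtop M)"
abbreviation pt :: "('m, 'n) chart => 'n V => 'm" where "pt c == inv_into (fst c) (snd c)"
abbreviation Xc :: "('m, 'n) chart => ('n V) set" where "Xc == chart_image"
abbreviation \<psi> :: "('m, 'n) chart => ('m, 'n) chart => 'n V => 'n V" where "\<psi> c d == chart_rep id c d"
abbreviation Ov :: "('m, 'n) chart => ('m, 'n) chart => ('n V) set" where "Ov c d == chart_rep_dom id c d"

lemma topspace_M: "TM = (\<Union>c\<in>atlas M. fst c)" and Hausdorff_M: "Hausdorff_space (mtop M)"
  using M by (auto simp: complex_manifold_def)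

lemma chart_ex: "p \<in> TM ==> EX c:atlas M. p \<in> fst c" by (auto simp: topspace_M)

context fixes c assumes c: "c \<in> atlas M" begin

lemma openin_chart: "openin (mtop M) (fst c)" and open_Xc: "open (Xc c)"
  and homeo_c: "homeomorphic_map (subtopology (mtop M) (fst c)) (top_of_set (Xc c)) (snd c)"
  using M c unfolding complex_manifold_def by blast+

lemma fst_subset: "fst c <= TM" using c topspace_M by auto

lemma inj_c: "inj_on (snd c) (fst c)"
  using homeo_c fst_subset unfolding homeomorphic_eq_everything_map by (simp add: Int_absorb1)

lemma pt_in: "x \<in> Xc c ==> pt c x \<in> fst c" and snd_pt: "x \<in> Xc c ==> snd c (pt c x) = x"
  unfolding chart_image_def by (auto intro: inv_into_into f_inv_into_f)
lemma pt_snd: "p \<in> fst c ==> pt c (snd c p) = p" using inj_c by simp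
lemma snd_in: "p \<in> fst c ==> snd c p \<in> Xc c" by (simp add: chart_image_def)
lemma pt_top: "x \<in> Xc c ==> pt c x \<in> TM" using pt_in fst_subset by blast

lemma Ov_iff: "x \<in> Ov c d \<longleftrightarrow> x \<in> Xc c & pt c x \<in> fst d"
  unfolding chart_rep_dom_def using pt_snd by (auto simp: snd_in pt_in snd_pt intro!: rev_image_eqI[of "pt c x"])
lemma snd_Ov: "p \<in> fst c ==> p \<in> fst d ==> snd c p \<in> Ov c d"
  by (auto simp: chart_rep_dom_def)

lemma Ov_sub: "Ov c d <= Xc c" by (auto simp: Ov_iff)
lemma \<psi>_eq: "\<psi> c d x = snd d (pt c x)" by (simp add: chart_rep_def)

lemma openin_iff: "U <= fst c ==> openin (mtop M) U \<longleftrightarrow> open (snd c ` U)"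
proof -
  assume U: "U <= fst c"
  have "openin (mtop M) U \<longleftrightarrow> openin (subtopology (mtop M) (fst c)) U"
    using openin_open_subtopology[OF openin_chart] U by simp
  also have "... \<longleftrightarrow> openin (top_of_set (Xc c)) (snd c ` U)"
    using homeomorphic_map_openness[OF homeo_c] U fst_subset by simp
  also have "... \<longleftrightarrow> open (snd c ` U)"
    using U openin_open_eq[OF open_Xc] by (auto simp: chart_image_def)
  finally show ?thesis .
qed

lemma snd_image_pt: "V <= Xc c ==> snd c ` pt c ` V = V"
  using snd_pt by (force simp: image_iff)
lemma openin_pt: "open V ==> V <= Xc c ==> openin (mtop M) (pt c ` V)"
  using openin_iff[of "pt c ` V"] snd_image_pt pt_in by auto

lemma open_coords: "openin (mtop M) U ==> open {x \<in> Xc c. pt c x \<in> U}"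
proof -
  assume U: "openin (mtop M) U"
  have "snd c ` (U \<inter> fst c) = {x \<in> Xc c. pt c x \<in> U}"
    using pt_snd snd_pt pt_in snd_in by (force simp: image_iff)
  then show ?thesis using openin_iff[of "U \<inter> fst c"] openin_Int[OF U openin_chart] by simp
qed

end

context fixes c d assumes c: "c \<in> atlas M" and d: "d \<in> atlas M" begin

lemma smooth_\<psi>: "smooth_on (\<psi> c d) (Ov c d)" and J_linear_\<psi>: "J_linear_on (\<psi> c d) (Ov c d)"
  using M c d unfolding complex_manifold_def by blast+

lemma open_Ov: "open (Ov c d)"
proof -
  have "Ov c d = {x \<in> Xc c. pt c x \<in> fst d}" using Ov_iff[OF c] by blast
  then show ?thesis using open_coords[OF c openin_chart[OF d]] by simp
qed

lemma pt_\<psi>: "x \<in> Ov c d ==> pt d (\<psi> c d x) = pt c x"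
  using pt_snd[OF d] by (simp add: \<psi>_eq[OF c] Ov_iff[OF c])
lemma \<psi>_Ov: "x \<in> Ov c d ==> \<psi> c d x \<in> Ov d c"
  by (simp add: \<psi>_eq[OF c] Ov_iff[OF c] snd_Ov[OF d] pt_in[OF c])
lemma \<psi>_Xc: "x \<in> Ov c d ==> \<psi> c d x \<in> Xc d" using \<psi>_Ov Ov_sub[OF d] by blast
lemma \<psi>_inv: "x \<in> Ov c d ==> \<psi> d c (\<psi> c d x) = x"
  by (simp add: \<psi>_eq[OF d] pt_\<psi> Ov_iff[OF c] snd_pt[OF c])
lemma hd_\<psi>: "x \<in> Ov c d ==> der (\<psi> c d) (fd (\<psi> c d) x) x"
  by (rule smooth_on_deriv[OF smooth_\<psi>])

lemma d\<psi>_clinearv: "x \<in> Ov c d ==> clinearv (fd (\<psi> c d) x)"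
proof -
  assume x: "x \<in> Ov c d"
  have l: "linear (fd (\<psi> c d) x)" using hd_\<psi>[OF x] has_derivative_linear by blast
  have j: "fd (\<psi> c d) x (\<i> *s u) = \<i> *s fd (\<psi> c d) x u" for u
    using J_linear_\<psi> x by (simp add: J_linear_on_def J_def)
  have "a *s (v :: 'n V) = Re a *\<^sub>R v + Im a *\<^sub>R (\<i> *s v)" for a v
    by (simp add: vec_eq_iff complex_eq_iff)
  then show ?thesis unfolding clinearv_def by (metis j linear_add[OF l] linear_scale[OF l])
qed

end

lemma d\<psi>_inv:
  assumes c: "c \<in> atlas M" and d: "d \<in> atlas M" and x: "x \<in> Ov c d"
  shows "fd (\<psi> d c) (\<psi> c d x) (fd (\<psi> c d) x u) = u"
proof -
  have "der (%y. \<psi> d c (\<psi> c d y)) (%u. fd (\<psi> d c) (\<psi> c d x) (fd (\<psi> c d) x u)) x"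
    by (rule has_derivative_compose[OF hd_\<psi>[OF c d x] hd_\<psi>[OF d c \<psi>_Ov[OF c d x]]])
  then have "der (%y. y) (%u. fd (\<psi> d c) (\<psi> c d x) (fd (\<psi> c d) x u)) x"
    by (rule der_cong[OF _ open_Ov[OF c d] x]) (rule \<psi>_inv[OF c d])
  from fun_cong[OF has_derivative_unique[OF this has_derivative_ident]] show ?thesis by simp
qed

lemma d\<psi>_inv':
  assumes c: "c \<in> atlas M" and d: "d \<in> atlas M" and x: "x \<in> Ov c d"
  shows "fd (\<psi> c d) x (fd (\<psi> d c) (\<psi> c d x) u) = u"
  using d\<psi>_inv[OF d c \<psi>_Ov[OF c d x], of u] by (simp add: \<psi>_inv[OF c d x])

lemma connected_constant:
  assumes conn: "connected_space (mtop M)" and p: "p \<in> TM" "q \<in> TM" "Q p"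
    and loc: "!!c x0. c \<in> atlas M ==> x0 \<in> Xc c ==> EX \<rho>>0. ball x0 \<rho> <= Xc c & (ALL x:ball x0 \<rho>. Q (pt c x) \<longleftrightarrow> Q (pt c x0))"
  shows "Q q"
proof -
  have op: "openin (mtop M) {p \<in> TM. P p}"
    if P: "!!c x0. c \<in> atlas M ==> x0 \<in> Xc c ==> P (pt c x0) ==> EX \<rho>>0. ball x0 \<rho> <= Xc c & (ALL x:ball x0 \<rho>. P (pt c x))" for P
  proof (subst openin_subopen, intro ballI)
    fix p assume "p \<in> {p \<in> TM. P p}"
    then obtain c where c: "c \<in> atlas M" "p \<in> fst c" and Pp: "P p" using chart_ex by blast
    obtain \<rho> where \<rho>: "\<rho> > 0" "ball (snd c p) \<rho> <= Xc c" "ALL x:ball (snd c p) \<rho>. P (pt c x)"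
      using P[OF c(1) snd_in[OF c]] Pp pt_snd[OF c] by auto
    have "p \<in> pt c ` ball (snd c p) \<rho>" using pt_snd[OF c] \<rho>(1) by (intro image_eqI[of _ _ "snd c p"]) auto
    then show "EX T. openin (mtop M) T & p \<in> T & T <= {p \<in> TM. P p}"
      using openin_pt[OF c(1) open_ball \<rho>(2)] \<rho>(2,3) pt_top[OF c(1)] by blast
  qed
  have "openin (mtop M) {p \<in> TM. Q p}" "openin (mtop M) {p \<in> TM. ~ Q p}"
    by (rule op; use loc in blast)+
  then show ?thesis using conn p unfolding connected_space_def by blast
qed

text \<open>\<open>F\<close> is given chart by chart without invariance, so the bound at a point is
  asserted in some chart around it; invariance transfers it later. The set \<open>K\<close> is a
  point for functions and the coordinate unit sphere for curvatures.\<close>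

lemma compact_max:
  fixes F :: "('m, 'n) chart => 'n V => 'b::topological_space => real"
  assumes "compact_space (mtop M)" "TM ~= {}" and K: "compact K" "K ~= {}"
    and F: "!!c. c \<in> atlas M ==> continuous_on (Xc c \<times> K) (%(x, k). F c x k)"
  shows "EX c:atlas M. EX x:Xc c. EX k:K. ALL p:TM. EX d:atlas M. p \<in> fst d & (ALL k':K. F d (snd d p) k' <= F c x k)"
proof -
  have "EX U c B. openin (mtop M) U & p \<in> U & c \<in> atlas M & U <= fst c & compact B & B <= Xc c & snd c ` U <= B" if p: "p \<in> TM" for p
  proof -
    obtain c where c: "c \<in> atlas M" "p \<in> fst c" using chart_ex[OF p] by blast
    obtain r where r: "r > 0" "cball (snd c p) r <= Xc c" using open_Xc[OF c(1)] snd_in[OF c] open_contains_cball by blast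
    have b: "ball (snd c p) r <= Xc c" using r(2) ball_subset_cball by blast
    show ?thesis
    proof (intro exI conjI)
      show "openin (mtop M) (pt c ` ball (snd c p) r)" by (rule openin_pt[OF c(1) open_ball b])
      show "p \<in> pt c ` ball (snd c p) r" using pt_snd[OF c] r(1) by (intro image_eqI[of _ _ "snd c p"]) auto
      show "pt c ` ball (snd c p) r <= fst c" using pt_in[OF c(1)] b by auto
      show "snd c ` pt c ` ball (snd c p) r <= cball (snd c p) r" unfolding snd_image_pt[OF c(1) b] by (rule ball_subset_cball)
    qed (use c r in auto)
  qed
  then obtain U c B where U: "!!p. p \<in> TM ==> openin (mtop M) (U p) & p \<in> U p & c p \<in> atlas M & U p <= fst (c p) &
      compact (B p) & B p <= Xc (c p) & snd (c p) ` U p <= B p" by metis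
  obtain \<F> where "finite \<F>" "\<F> <= U ` TM" "TM <= \<Union>\<F>"
  proof -
    have "TM <= \<Union>(U ` TM)" "ALL W:U ` TM. openin (mtop M) W" using U by auto
    then show ?thesis using assms(1)[unfolded compact_space_alt, rule_format, of "U ` TM"] that by auto
  qed
  then obtain T where T: "finite T" "T <= TM" "TM <= (\<Union>p\<in>T. U p)"
    by (metis finite_subset_image)
  have "T ~= {}" using T(3) assms(2) by auto
  have "EX x:B p. EX k:K. ALL y:B p. ALL k':K. F (c p) y k' <= F (c p) x k" if "p \<in> T" for p
  proof -
    note Up = U[of p] and pT = subsetD[OF T(2) that]
    have "compact (B p \<times> K)" "B p \<times> K ~= {}" using Up[OF pT] K compact_Times by auto
    moreover have "continuous_on (B p \<times> K) (%(x, k). F (c p) x k)"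
      by (rule continuous_on_subset[OF F]) (use Up[OF pT] in auto)
    ultimately obtain z where "z \<in> B p \<times> K" "ALL y:B p \<times> K. (%(x, k). F (c p) x k) y <= (%(x, k). F (c p) x k) z"
      using continuous_attains_sup by metis
    then show ?thesis by (cases z) auto
  qed
  then obtain x k where xk: "!!p. p \<in> T ==> x p \<in> B p & k p \<in> K & (ALL y:B p. ALL k':K. F (c p) y k' <= F (c p) (x p) (k p))" by metis
  define m where "m = Max ((%p. F (c p) (x p) (k p)) ` T)"
  obtain p0 where p0: "p0 \<in> T" "F (c p0) (x p0) (k p0) = m"
    using Max_in[of "(%p. F (c p) (x p) (k p)) ` T"] T(1) \<open>T ~= {}\<close> unfolding m_def[symmetric] by fastforce
  show ?thesis
  proof (rule bexI[of _ "c p0"], rule bexI[of _ "x p0"], rule bexI[of _ "k p0"], rule ballI)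
    fix q assume "q \<in> TM"
    then obtain p where p: "p \<in> T" "q \<in> U p" using T(3) by blast
    have "F (c p) (x p) (k p) <= m" unfolding m_def using T(1) p(1) by simp
    then have "F (c p) (snd (c p) q) k' <= F (c p0) (x p0) (k p0)" if "k' \<in> K" for k'
      using xk[OF p(1)] U[of p] p T(2) that p0(2) by (meson image_subset_iff order_trans subsetD)
    then show "EX d:atlas M. q \<in> fst d & (ALL k':K. F d (snd d q) k' <= F (c p0) (x p0) (k p0))"
      using U[of p] p T(2) by blast
  qed (use p0 xk U T(2) in blast)+
qed

section \<open>Smooth maps from a vector space into the manifold\<close>

definition smooth_into :: "'e::euclidean_space set => ('e => 'm) => bool" where
  "smooth_into U G \<longleftrightarrow> open U & (ALL x:U. EX c:atlas M. EX V. open V & x \<in> V & V <= U & G ` V <= fst c & smooth_on (snd c o G) V)"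

lemma smooth_into_continuous:
  assumes "smooth_into U G" shows "continuous_map (top_of_set U) (mtop M) G"
proof -
  have U: "open U" using assms by (simp add: smooth_into_def)
  have G: "G \<in> U \<rightarrow> TM" using assms fst_subset unfolding smooth_into_def by blast
  have "openin (top_of_set U) {x \<in> U. G x \<in> W}" if W: "openin (mtop M) W" for W
  proof -
    have "EX T. open T & x \<in> T & T <= {x \<in> U. G x \<in> W}" if x: "x \<in> U" "G x \<in> W" for x
    proof -
      obtain c V where c: "c \<in> atlas M" and V: "open V" "x \<in> V" "V <= U" "G ` V <= fst c" "smooth_on (snd c o G) V"
        using assms x(1) unfolding smooth_into_def by blast
      have "open ((snd c o G) -` {y \<in> Xc c. pt c y \<in> W} \<inter> V)"
        by (rule continuous_open_preimage[OF smooth_on_continuous[OF V(5)] V(1) open_coords[OF c W], unfolded Int_commute[of V]])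
      moreover have "(snd c o G) -` {y \<in> Xc c. pt c y \<in> W} \<inter> V <= {x \<in> U. G x \<in> W}"
        using V(3,4) pt_snd[OF c] by auto
      moreover have "x \<in> (snd c o G) -` {y \<in> Xc c. pt c y \<in> W} \<inter> V"
        using V(2,4) x pt_snd[OF c] snd_in[OF c] by auto
      ultimately show ?thesis by blast
    qed
    then have "open {x \<in> U. G x \<in> W}" by (subst open_subopen) blast
    then show ?thesis by (simp add: openin_open_eq[OF U] Collect_conj_eq)
  qed
  then show ?thesis using G by (simp add: continuous_map_def)
qed

lemma smooth_into_open:
  assumes "smooth_into U G" "openin (mtop M) W" shows "open (U \<inter> G -` W)"
proof -
  have "openin (top_of_set U) {x \<in> U. G x \<in> W}" using smooth_into_continuous[OF assms(1)] assms(2) by (auto simp: continuous_map_def)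
  then show ?thesis using assms(1) by (auto simp: openin_open_eq smooth_into_def Collect_conj_eq vimage_def)
qed

lemma smooth_into_chart:
  assumes "smooth_into U G" and c: "c \<in> atlas M"
  shows "smooth_on (snd c o G) (U \<inter> G -` fst c)"
proof (rule smooth_on_local)
  fix x assume x: "x \<in> U \<inter> G -` fst c"
  obtain d V where d: "d \<in> atlas M" and V: "open V" "x \<in> V" "V <= U" "G ` V <= fst d" "smooth_on (snd d o G) V"
    using assms x(1) unfolding smooth_into_def by blast
  define V' where "V' = V \<inter> (U \<inter> G -` fst c)"
  have oV: "open V'" unfolding V'_def using smooth_into_open[OF assms(1) openin_chart[OF c]] V(1) by blast
  have "smooth_on (%y. \<psi> d c ((snd d o G) y)) V'"
    by (rule smooth_on_compose[OF oV smooth_\<psi>[OF d c] smooth_on_subset[OF V(5)]])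
      (use V(4) snd_Ov[OF d, of _ c] in "auto simp: V'_def")
  then have "smooth_on (snd c o G) V'"
    by (rule smooth_on_cong[OF oV, rotated]) (use V(4) pt_snd[OF d] in "auto simp: V'_def \<psi>_eq[OF d]")
  then show "EX T. open T & x \<in> T & smooth_on (snd c o G) T" using oV x V(2) by (auto simp: V'_def)
qed

lemma smooth_into_pt:
  assumes c: "c \<in> atlas M" and U: "open U" "smooth_on F U" "F ` U <= Xc c"
  shows "smooth_into U (%x. pt c (F x))"
  unfolding smooth_into_def
proof (intro conjI ballI bexI[OF _ c] exI[of _ U])
  show "smooth_on (snd c o (%x. pt c (F x))) U"
    by (rule smooth_on_cong[OF U(1) _ U(2)]) (use U(3) snd_pt[OF c] in auto)
qed (use U pt_in[OF c] in auto)

end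

section \<open>Hermitian form, curvature and Christoffel symbols in charts\<close>

definition hform :: "'n::finite local_metric => 'n V => 'n V => 'n V => complex" where
  "hform G x u v = Complex (G x u v) (G x u (J v))"

lemma sum_Basis_complex_vec: "(\<Sum>b\<in>(Basis :: ('n::finite V) set). F b) = (\<Sum>i\<in>UNIV. F (axis i 1) + F (axis i \<i>))"
proof -
  have B: "(Basis :: ('n V) set) = (%(i, z). axis i z) ` (UNIV \<times> {1, \<i>})"
    by (auto simp: Basis_vec_def Basis_complex_def)
  have inj: "inj_on (%(i, z). axis i z :: 'n V) (UNIV \<times> {1, \<i>})"
    by (auto simp: inj_on_def axis_eq_axis)
  have "F o (%(i, z). axis i z) = (%(i, z). F (axis i z))" by auto
  then show ?thesis unfolding B sum.reindex[OF inj] by (simp add: sum.cartesian_product[symmetric])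
qed

lemma real_trace_complex:
  fixes f :: "'n::finite V => 'n V"
  shows "real_trace f = (\<Sum>i\<in>UNIV. Re (f (axis i 1) $ i) + Im (f (\<i> *s axis i 1) $ i))"
proof -
  have "\<i> *s axis i 1 = (axis i \<i> :: 'n V)" for i by (simp add: vec_eq_iff axis_def)
  then show ?thesis unfolding real_trace_def sum_Basis_complex_vec by (simp add: inner_axis inner_complex_def)
qed

locale kaehler_manifold = cmanifold M for M :: "('m, 'n::finite) charted" +
  fixes g :: "('m, 'n) metric"
  assumes kaehler: "kaehler M g"
begin

abbreviation "hc c == hform (g c)"
abbreviation "Gc c == christoffel (g c)"

lemma pseudo_riemannian_g: "pseudo_riemannian M g" using kaehler by (simp add: kaehler_def)

context fixes c assumes c: "c \<in> atlas M" begin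

lemma g_smooth: "smooth_on (%x. g c x u v) (Xc c)"
  and g_bilinear: "x \<in> Xc c ==> bilinear (g c x)" and g_sym: "x \<in> Xc c ==> g c x u v = g c x v u"
  and g_nondeg: "x \<in> Xc c ==> (!!v. g c x u v = 0) ==> u = 0"
  using pseudo_riemannian_g c unfolding pseudo_riemannian_def by blast+

lemma christoffel_g: "x \<in> Xc c ==> is_christoffel (g c) x (Gc c x)"
  unfolding christoffel_def by (rule theI'[OF christoffel_ex1[OF pseudo_riemannian_g c open_Xc[OF c]]])

lemma christoffel_eqI: "x \<in> Xc c ==> is_christoffel (g c) x Gm ==> Gc c x = Gm"
  using christoffel_ex1[OF pseudo_riemannian_g c open_Xc[OF c]] christoffel_g by blast

lemma g_deriv: "x \<in> Xc c ==> der (%y. g c y u v) (%w. g c x (Gc c x w u) v + g c x u (Gc c x w v)) x"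
  by (rule has_derivative_eq_rhs[OF smooth_on_deriv[OF g_smooth]])
    (use christoffel_g in "auto simp: is_christoffel_def")

lemma Gc_sym: "x \<in> Xc c ==> Gc c x u v = Gc c x v u" and Gc_bilinear: "x \<in> Xc c ==> bilinear (Gc c x)"
  using christoffel_g by (auto simp: is_christoffel_def)

lemma g_J: "x \<in> Xc c ==> g c x (\<i> *s u) (\<i> *s v) = g c x u v"
  and Gc_J: "x \<in> Xc c ==> Gc c x u (\<i> *s v) = \<i> *s Gc c x u v"
  using kaehler c unfolding kaehler_def J_def by auto

text \<open>The Koszul formula \<open>K\<close> expresses the lowered symbols by derivatives of the
  metric, and raising an index preserves smoothness.\<close>

lemma Gc_smooth: "smooth_on (%x. Gc c x u v) (Xc c)"
proof -
  let ?D = "%x u v w. fd (%y. g c y u v) x w"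
  have D: "?D x u v w = g c x (Gc c x w u) v + g c x u (Gc c x w v)" if "x \<in> Xc c" for x u v w
    using christoffel_g[OF that] by (simp add: is_christoffel_def)
  have K: "g c x (Gc c x u v) w = (?D x v w u + ?D x u w v - ?D x u v w) / 2" if x: "x \<in> Xc c" for x w
    unfolding D[OF x] by (simp add: Gc_sym[OF x, of u w] Gc_sym[OF x, of v w] Gc_sym[OF x, of v u] g_sym[OF x, of v "Gc c x w u"])
  have "EX z. smooth_on z (Xc c) & (ALL x:Xc c. ALL w. g c x (z x) w = g c x (Gc c x u v) w)"
  proof (rule smooth_riesz[OF open_Xc[OF c] g_bilinear g_nondeg g_smooth])
    show "linear (g c x (Gc c x u v))" if "x \<in> Xc c" for x using g_bilinear[OF that] by (simp add: bilinear_def)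
    have "smooth_on (%x. (1/2) * (?D x v w u + ?D x u w v - ?D x u v w)) (Xc c)" for w
      by (intro smooth_on_mult smooth_on_const smooth_on_diff smooth_on_add smooth_on_frechet g_smooth open_Xc[OF c])
    then show "smooth_on (%x. g c x (Gc c x u v) w) (Xc c)" for w
      by (rule smooth_on_cong[OF open_Xc[OF c], rotated]) (simp add: K)
  qed
  then obtain z where z: "smooth_on z (Xc c)" "!!x w. x \<in> Xc c ==> g c x (z x) w = g c x (Gc c x u v) w" by blast
  have "z x = Gc c x u v" if x: "x \<in> Xc c" for x
    using g_nondeg[OF x, of "z x - Gc c x u v"] z(2)[OF x] bilinear_lsub[OF g_bilinear[OF x]] by simp
  then show ?thesis by (rule smooth_on_cong[OF open_Xc[OF c] _ z(1)])
qed

lemma hc_Re: "Re (hc c x u v) = g c x u v" by (simp add: hform_def)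

lemma kaehler_chart_c: "kaehler_chart (Xc c) (hc c) (Gc c)"
proof
  show "open (Xc c)" by (rule open_Xc[OF c])
  fix x u u' v a
  show "smooth_on (%x. Gc c x u v) (Xc c)" by (rule Gc_smooth)
  have "smooth_on (%x. complex_of_real (g c x u v) + \<i> * complex_of_real (g c x u (J v))) (Xc c)"
    by (intro smooth_on_add smooth_on_mult smooth_on_const open_Xc[OF c] smooth_on_linear[OF bounded_linear_of_real] g_smooth)
  then show "smooth_on (%x. hc c x u v) (Xc c)"
    by (rule smooth_on_cong[OF open_Xc[OF c], rotated]) (simp add: hform_def complex_eq_iff)
  assume x: "x \<in> Xc c"
  note b = bilinear_ladd[OF g_bilinear[OF x]] bilinear_lmul[OF g_bilinear[OF x]] bilinear_radd[OF g_bilinear[OF x]] bilinear_rmul[OF g_bilinear[OF x]]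
    bilinear_lneg[OF g_bilinear[OF x]] bilinear_rneg[OF g_bilinear[OF x]]
  have ii: "\<i> *s (\<i> *s w) = - w" for w :: "'n V" by (simp add: vec_eq_iff)
  have sp: "a *s w = Re a *\<^sub>R w + Im a *\<^sub>R (\<i> *s w)" for w :: "'n V" by (simp add: vec_eq_iff complex_eq_iff)
  have gJ: "g c x (\<i> *s u) v = - g c x u (\<i> *s v)" for u v using g_J[OF x, of u "\<i> *s v"] by (simp add: ii b)
  show "hc c x (u + u') v = hc c x u v + hc c x u' v" by (simp add: hform_def b complex_eq_iff)
  show "hc c x (a *s u) v = a * hc c x u v"
    unfolding sp[of u] by (simp add: hform_def b complex_eq_iff J_def gJ ii algebra_simps)
  show "hc c x v u = cnj (hc c x u v)"
    using gJ[of u v] g_sym[OF x, of u v] g_sym[OF x, of v "\<i> *s u"] by (simp add: hform_def complex_eq_iff J_def)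
  show "u = 0" if "!!v. hc c x u v = 0" using g_nondeg[OF x, of u] hc_Re[of x u] that by simp
  show "Gc c x u v = Gc c x v u" by (rule Gc_sym[OF x])
  note B = bilinear_ladd[OF Gc_bilinear[OF x]] bilinear_lmul[OF Gc_bilinear[OF x]]
  show "Gc c x (u + u') v = Gc c x u v + Gc c x u' v" by (rule B)
  have "Gc c x (\<i> *s u) v = \<i> *s Gc c x u v" using Gc_J[OF x, of v u] Gc_sym[OF x] by simp
  then show "Gc c x (a *s u) v = a *s Gc c x u v" unfolding sp[of u] sp[of "Gc c x u v"] by (simp add: B)
  have "der (%y. complex_of_real (g c y u v) + \<i> * complex_of_real (g c y u (\<i> *s v))) (%w. complex_of_real (g c x (Gc c x w u) v + g c x u (Gc c x w v)) + \<i> * complex_of_real (g c x (Gc c x w u) (\<i> *s v) + g c x u (Gc c x w (\<i> *s v)))) x"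
    by (intro has_derivative_add has_derivative_mult_right has_derivative_of_real g_deriv x)
  then show "der (%y. hc c y u v) (%w. hc c x (Gc c x w u) v + hc c x u (Gc c x w v)) x"
    by (rule has_derivative_eq_rhs[OF der_cong[OF _ open_Xc[OF c] x]])
      (simp_all add: hform_def complex_eq_iff J_def fun_eq_iff Gc_J[OF x])
qed

text \<open>The Riemann tensor is \<open>K u v w - K v u w\<close>. As a map of \<open>u\<close>,
  the first term is antilinear and has real trace 0; the second is complex linear and its real trace
  is twice the real part of the complex one.\<close>

lemma ricci_K: "x \<in> Xc c ==> ricci (g c) x v w = - 2 * Re (ctrace (%u. kaehler_chart.K (Gc c) x v u w))"
proof -
  interpret C: kaehler_chart "Xc c" "hc c" "Gc c" by (rule kaehler_chart_c)
  assume x: "x \<in> Xc c"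
  have "riemann (g c) x u v w = C.K x u v w - C.K x v u w" for u
    using C.Gm1_commute[OF x, of u v w] unfolding riemann_def C.DGm_split by (simp add: algebra_simps)
  then show ?thesis
    by (simp add: ricci_def real_trace_complex C.K_i[OF x] C.K_scale2[OF x] ctrace_def sum_distrib_left sum_negf)
qed

lemma einstein_K:
  assumes ein: "!!u v. ricci (g c) x u v = s / real (2 * CARD('n)) * g c x u v" and x: "x \<in> Xc c"
  shows "ctrace (%u. kaehler_chart.K (Gc c) x b u v) = - of_real (s / (4 * real CARD('n) * (real CARD('n) + 1))) * (of_nat CARD('n) + 1) * hc c x v b"
proof -
  interpret C: kaehler_chart "Xc c" "hc c" "Gc c" by (rule kaehler_chart_c)
  let ?n = "real CARD('n)"
  \<comment> \<open>The factor 2 in \<open>ricci_K\<close> turns the Einstein constant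
    \<open>s / (2 n)\<close> into \<open>s / (4 n)\<close>; splitting off n + 1 gives the \<kappa>
    that occurs in the curvature of projective space.\<close>
  let ?k = "s / (4 * ?n * (?n + 1))"
  have n: "?n > 0" by simp
  have "?n + 1 ~= 0" by linarith
  then have k: "?k * (?n + 1) = s / (4 * ?n)" by simp
  have 1: "Re (ctrace (%u. C.K x b u v)) = Re (- of_real (?k * (?n + 1)) * hc c x v b)" for v
    using ein[of b v] ricci_K[OF x, of b v] g_sym[OF x, of b v] unfolding k by (simp add: hc_Re field_simps)
  have "ctrace (%u. C.K x b u (\<i> *s v)) = \<i> * ctrace (%u. C.K x b u v)"
    by (simp add: ctrace_def C.K_scale3[OF x] sum_distrib_left)
  then have 2: "ctrace (%u. C.K x b u v) = - of_real (?k * (?n + 1)) * hc c x v b"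
    using 1[of v] 1[of "\<i> *s v"] by (simp add: C.h_scale[OF x] complex_eq_iff)
  have "- of_real (?k * (?n + 1)) = - of_real ?k * (of_nat CARD('n) + 1 :: complex)"
    by (simp only: of_real_mult of_real_add of_real_of_nat_eq of_real_1 mult_minus_left)
  then show ?thesis unfolding 2 by (rule arg_cong)
qed

end

lemma g_trans: "c \<in> atlas M ==> d \<in> atlas M ==> x \<in> Ov c d ==> g d (\<psi> c d x) (fd (\<psi> c d) x u) (fd (\<psi> c d) x v) = g c x u v"
  using pseudo_riemannian_g unfolding pseudo_riemannian_def isometric_def by blast

lemma h_trans: "c \<in> atlas M ==> d \<in> atlas M ==> x \<in> Ov c d ==> hc d (\<psi> c d x) (fd (\<psi> c d) x u) (fd (\<psi> c d) x v) = hc c x u v"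
  using g_trans clinearvD(2)[OF d\<psi>_clinearv, symmetric] by (simp add: hform_def J_def)

text \<open>Transported from \<open>d\<close> to \<open>c\<close>, the symbols \<open>Gm\<close> are
  symmetric and compatible with the metric, so they are the Christoffel symbols by
  uniqueness.\<close>

lemma Gc_trans:
  assumes c: "c \<in> atlas M" and d: "d \<in> atlas M" and x: "x \<in> Ov c d"
  shows "Gc d (\<psi> c d x) (fd (\<psi> c d) x u) (fd (\<psi> c d) x v) = fd (\<psi> c d) x (Gc c x u v) - fd (%y. fd (\<psi> c d) y v) x u"
proof -
  let ?F = "\<psi> c d" let ?y = "\<psi> c d x" let ?L = "fd ?F x" let ?L' = "fd (\<psi> d c) ?y"
  let ?H = "%u v. fd (%y. fd ?F y v) x u"
  interpret D: kaehler_chart "Xc d" "hc d" "Gc d" by (rule kaehler_chart_c[OF d])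
  have xX: "x \<in> Xc c" and yX: "?y \<in> Xc d" using x Ov_sub[OF c, of d] \<psi>_Xc[OF c d] by auto
  have oO: "open (Ov c d)" by (rule open_Ov[OF c d])
  note gb = g_bilinear[OF d yX]
  have hF: "der (%y. fd ?F y v) (%w. ?H w v) x" for v
    by (rule smooth_on_deriv[OF smooth_on_frechet[OF smooth_\<psi>[OF c d]] x])
  have Hsym: "?H u v = ?H v u" for u v
    by (rule second_derivative_commute[where f="?F" and f'="fd ?F" and Fu="%w. ?H w v" and u=v and v=u and Fv="%w. ?H w u", OF oO x smooth_\<psi>[OF c d] hd_\<psi>[OF c d] hF hF])
  have lL: "linear ?L" "linear ?L'" using d\<psi>_clinearv[OF c d x] d\<psi>_clinearv[OF d c \<psi>_Ov[OF c d x]] clinearv_linear by auto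
  have lH: "linear (%w. ?H w v)" for v using hF has_derivative_linear by blast
  have lH2: "linear (?H u)" for u using lH[of u] Hsym by (metis (no_types, lifting) ext)
  define Gm where "Gm u v = ?L' (Gc d ?y (?L u) (?L v) + ?H u v)" for u v
  have LGm: "?L (Gm u v) = Gc d ?y (?L u) (?L v) + ?H u v" for u v
    unfolding Gm_def by (rule d\<psi>_inv'[OF c d x])
  have "is_christoffel (g c) x Gm"
    unfolding is_christoffel_def bilinear_def
  proof (intro conjI allI)
    show sym: "Gm u v = Gm v u" for u v unfolding Gm_def Gc_sym[OF d yX, of "?L u"] Hsym[of u] ..
    show l: "linear (Gm u)" for u
      unfolding Gm_def
      by (rule linear_compose[OF linear_compose_add[OF linear_compose[OF lL(1) D.Gm_linear(2)[OF yX]] lH2] lL(2), unfolded comp_def])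
    show "linear (%u. Gm u v)" for v using l[of v] sym by (metis (no_types, lifting) ext)
    fix u v w
    have 1: "der (%y. g d (?F y) u' v') (%w. g d ?y (Gc d ?y (?L w) u') v' + g d ?y u' (Gc d ?y (?L w) v')) x" for u' v'
      by (rule has_derivative_compose[OF hd_\<psi>[OF c d x] g_deriv[OF d yX]])
    have lin: "linear (%u. g d (?F y) u v')" "linear (g d (?F y) v')" if "y \<in> Ov c d" for y v'
      using g_bilinear[OF d \<psi>_Xc[OF c d that]] by (auto simp: bilinear_def)
    have 2: "der (%y. g d (?F y) (fd ?F y u) v') (%w. (g d ?y (Gc d ?y (?L w) (?L u)) v' + g d ?y (?L u) (Gc d ?y (?L w) v')) + g d ?y (?H w u) v') x" for v'
      by (rule der_linear_arg[where T="%y u'. g d (?F y) u' v'", OF oO x lin(1) 1 hF])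
    have "der (%y. g d (?F y) (fd ?F y u) (fd ?F y v)) (%w. ((g d ?y (Gc d ?y (?L w) (?L u)) (?L v) + g d ?y (?L u) (Gc d ?y (?L w) (?L v))) + g d ?y (?H w u) (?L v)) + g d ?y (?L u) (?H w v)) x"
      by (rule der_linear_arg[where T="%y v'. g d (?F y) (fd ?F y u) v'", OF oO x lin(2) 2 hF])
    then have "der (%y. g c y u v) (%w. ((g d ?y (Gc d ?y (?L w) (?L u)) (?L v) + g d ?y (?L u) (Gc d ?y (?L w) (?L v))) + g d ?y (?H w u) (?L v)) + g d ?y (?L u) (?H w v)) x"
      by (rule der_cong[OF _ oO x]) (rule g_trans[OF c d])
    from fun_cong[OF frechet_derivative_at[OF this, symmetric], of w]
    show "fd (%y. g c y u v) x w = g c x (Gm w u) v + g c x u (Gm w v)"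
      unfolding g_trans[OF c d x, symmetric] LGm by (simp add: bilinear_ladd[OF gb] bilinear_radd[OF gb])
  qed
  then have "Gc c x u v = Gm u v" using christoffel_eqI[OF c xX] by simp
  then show ?thesis by (simp add: LGm)
qed

end

section \<open>J-planar curves\<close>

lemma vector_derivative_open:
  assumes "open I" "t \<in> I" "!!s. s \<in> I ==> F s = G s" "der G (%s. s *\<^sub>R v) t"
  shows "vector_derivative F (at t) = v"
proof -
  have "der F (%s. s *\<^sub>R v) t"
    by (rule der_cong[OF assms(4,1,2)]) (simp add: assms(3))
  then show ?thesis by (simp add: vector_derivative_at has_vector_derivative_def)
qed

context kaehler_manifold
begin

lemma geodesic_local:
  assumes c: "c \<in> atlas M" and x0: "x0 \<in> Xc c" and u0: "u0 ~= 0"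
  shows "EX I x v. open I & is_interval I & 0 \<in> I & smooth_on x I & x 0 = x0 & v 0 = u0 &
    (ALL t:I. x t \<in> Xc c & v t ~= 0 & der x (%s. s *\<^sub>R v t) t &
       der v (%s. s *\<^sub>R (- Gc c (x t) (v t) (v t))) t)"
proof -
  interpret C: kaehler_chart "Xc c" "hc c" "Gc c" by (rule kaehler_chart_c[OF c])
  \<comment> \<open>With the zero velocity removed from the domain, solutions are regular
    curves.\<close>
  define Om where "Om = (UNIV :: real set) \<times> Xc c \<times> (- {0 :: 'n V})"
  define w where "w z s = s *\<^sub>R (snd (snd z), - Gc c (fst (snd z)) (snd (snd z)) (snd (snd z)))" for z :: "real \<times> ('n V) \<times> ('n V)" and s :: real
  have O: "open Om" unfolding Om_def by (intro open_Times C.open_X) auto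
  have w: "total_eq Om w" unfolding total_eq_def
  proof (intro conjI O allI ballI)
    show "linear (w p)" for p unfolding w_def by (rule linearI) (simp_all add: algebra_simps)
    have p: "smooth_on (%z. fst (snd z)) Om" "smooth_on (%z. snd (snd z)) Om"
      by (intro smooth_on_linear[OF bounded_linear_fst O] smooth_on_linear[OF bounded_linear_snd O] smooth_on_id[OF O])+
    show "smooth_on (%p. w p v) Om" for v unfolding w_def
      by (intro smooth_on_linear[OF bounded_linear_scaleR_right O] smooth_on_Pair O p smooth_on_uminus C.smooth_on_Gm2) (auto simp: Om_def)
  qed
  have "{(0, x0, u0)} <= Om" using x0 u0 by (simp add: Om_def)
  from total_eq_solvable[OF w integrable_eq_real[OF w] _ this]
  obtain r y where r: "r > 0" and y: "y 0 = (x0, u0)" "!!t. t \<in> ball 0 r ==> (t, y t) \<in> Om & der y (w (t, y t)) t" by auto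
  have "Ck_on k y (ball 0 r)" for k
    by (rule Ck_on_total_differential[where w=w and T=Om, OF open_ball]) (use y(2) w in "auto simp: total_eq_def")
  then have sy: "smooth_on y (ball 0 r)" by (simp add: smooth_on_def)
  show ?thesis
  proof (rule exI[of _ "ball 0 r"], rule exI[of _ "fst o y"], rule exI[of _ "snd o y"], intro conjI ballI)
    show "smooth_on (fst o y) (ball 0 r)" unfolding comp_def by (rule smooth_on_linear[OF bounded_linear_fst open_ball sy])
    fix t assume t: "t \<in> ball (0::real) r"
    show "(fst o y) t \<in> Xc c" "(snd o y) t ~= 0" using y(2)[OF t] by (auto simp: Om_def)
    show "der (fst o y) (%s. s *\<^sub>R (snd o y) t) t"
      "der (snd o y) (%s. s *\<^sub>R (- Gc c ((fst o y) t) ((snd o y) t) ((snd o y) t))) t"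
      using has_derivative_fst[of y "w (t, y t)"] has_derivative_snd[of y "w (t, y t)"] y(2)[OF t] by (auto simp: w_def comp_def)
  qed (use r y(1) in "auto simp: is_interval_ball_real")
qed

text \<open>\<open>J_planar\<close> speaks about every chart, so the vanishing of the acceleration
  is carried over from \<open>c\<close> by \<open>Gc_trans\<close>.\<close>

lemma geodesic_J_planar:
  assumes c: "c \<in> atlas M" and I: "open I" "is_interval I" and x: "smooth_on x I"
    and xv: "!!t. t \<in> I ==> x t \<in> Xc c & v t ~= 0 & der x (%s. s *\<^sub>R v t) t &
       der v (%s. s *\<^sub>R (- Gc c (x t) (v t) (v t))) t"
  shows "J_planar M g I (%t. pt c (x t))"
proof -
  let ?\<gamma> = "%t. pt c (x t)"
  have si: "smooth_into I ?\<gamma>" by (rule smooth_into_pt[OF c I(1) x]) (use xv in auto)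
  have *: "velocity (snd d o ?\<gamma>) t ~= 0 & acceleration (g d) (snd d o ?\<gamma>) t = 0"
    if d: "d \<in> atlas M" and t: "t \<in> I \<inter> ?\<gamma> -` fst d" for d t
  proof -
    interpret D: kaehler_chart "Xc d" "hc d" "Gc d" by (rule kaehler_chart_c[OF d])
    let ?I = "I \<inter> ?\<gamma> -` fst d" let ?F = "\<psi> c d"
    have oI: "open ?I" by (rule smooth_into_open[OF si openin_chart[OF d]])
    have xO: "x s \<in> Ov c d" if "s \<in> ?I" for s using that xv by (auto simp: Ov_iff[OF c])
    have oc: "(%y. snd d (pt c y)) = ?F" by (simp add: fun_eq_iff \<psi>_eq[OF c])
    have vel: "velocity (snd d o ?\<gamma>) s = fd ?F (x s) (v s)" if s: "s \<in> ?I" for s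
    proof -
      have l: "linear (fd ?F (x s))" by (rule clinearv_linear[OF d\<psi>_clinearv[OF c d xO[OF s]]])
      have hx: "der x (%r. r *\<^sub>R v s) s" using xv s by blast
      have "der (%s. ?F (x s)) (%r. fd ?F (x s) (r *\<^sub>R v s)) s"
        by (rule has_derivative_compose[OF hx hd_\<psi>[OF c d xO[OF s]]])
      then have "der (%s. ?F (x s)) (%r. r *\<^sub>R fd ?F (x s) (v s)) s" by (simp add: linear_scale[OF l])
      then show ?thesis unfolding velocity_def by (rule vector_derivative_open[where I="?I", OF oI s, rotated]) (simp add: \<psi>_eq[OF c])
    qed
    let ?x = "x t" let ?v = "v t"
    note xt = xO[OF t]
    have tI: "t \<in> I" using t by simp
    let ?H = "%u v. fd (%y. fd ?F y v) ?x u"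
    have hF: "der (%y. fd ?F y u) (%w. ?H w u) ?x" for u
      by (rule smooth_on_deriv[OF smooth_on_frechet[OF smooth_\<psi>[OF c d]] xt])
    have lH: "linear (%w. ?H w u)" for u using hF has_derivative_linear by blast
    have lin: "linear (fd ?F (x s))" if "s \<in> ?I" for s by (rule clinearv_linear[OF d\<psi>_clinearv[OF c d xO[OF that]]])
    have hx: "der x (%s. s *\<^sub>R ?v) t" and hv: "der v (%s. s *\<^sub>R (- Gc c ?x ?v ?v)) t"
      using xv[OF tI] by auto
    have "der (%s. fd ?F (x s) (v s)) (%s. ?H (s *\<^sub>R ?v) ?v + fd ?F ?x (s *\<^sub>R (- Gc c ?x ?v ?v))) t"
      by (rule der_linear_arg[where T="%s. fd ?F (x s)", OF oI t lin has_derivative_compose[OF hx hF] hv])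
    then have "der (%s. fd ?F (x s) (v s)) (%s. s *\<^sub>R (?H ?v ?v - fd ?F ?x (Gc c ?x ?v ?v))) t"
      by (simp add: linear_scale[OF lH] linear_scale[OF lin[OF t]] linear_neg[OF lin[OF t]] scaleR_diff_right)
    from vector_derivative_open[where F="velocity (snd d o ?\<gamma>)" and G="%s. fd ?F (x s) (v s)", OF oI t vel this]
    have "vector_derivative (velocity (snd d o ?\<gamma>)) (at t) = ?H ?v ?v - fd ?F ?x (Gc c ?x ?v ?v)" .
    then have "acceleration (g d) (snd d o ?\<gamma>) t = 0"
      unfolding acceleration_def vel[OF t] using Gc_trans[OF c d xt, of ?v ?v] by (simp add: \<psi>_eq[OF c])
    moreover have "velocity (snd d o ?\<gamma>) t ~= 0"
      unfolding vel[OF t] using d\<psi>_inv[OF c d xt, of ?v] xv[OF tI]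
        linear_0[OF clinearv_linear[OF d\<psi>_clinearv[OF d c \<psi>_Ov[OF c d xt]]]] by auto
    ultimately show ?thesis by blast
  qed
  have "regular_curve M I ?\<gamma>"
    unfolding regular_curve_def
    using I smooth_into_continuous[OF si] smooth_into_chart[OF si] * by (auto simp: velocity_def)
  then show ?thesis unfolding J_planar_def using *
    by (auto simp: wedge3_def det_3 vector_3)
qed

end

lemma wedge3_span:
  fixes a u :: "'n::finite V"
  assumes u: "u ~= 0" and 0: "!!i j k. i \<in> Basis ==> j \<in> Basis ==> k \<in> Basis ==> wedge3 a u (J u) i j k = 0"
  shows "EX z. a = z *s u"
proof -
  obtain m where m: "u $ m ~= 0" using u by (auto simp: vec_eq_iff)
  \<comment> \<open>The two real directions of a coordinate in which \<open>u\<close> is nonzero: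
    the minor of \<open>u\<close> and \<open>J u\<close> in these directions is
    \<open>p\<^sup>2 + q\<^sup>2\<close>, the squared modulus of that coordinate, so the vanishing
    determinants solve for \<open>a\<close>.\<close>
  let ?i = "axis m 1 :: 'n V" let ?j = "axis m \<i> :: 'n V"
  have B: "?i \<in> Basis" "?j \<in> Basis" by (auto simp: axis_in_Basis_iff Basis_complex_def)
  define p q r s where "p = Re (u $ m)" "q = Im (u $ m)" "r = Re (a $ m)" "s = Im (a $ m)"
  have c: "u \<bullet> ?i = p" "u \<bullet> ?j = q" "J u \<bullet> ?i = - q" "J u \<bullet> ?j = p" "a \<bullet> ?i = r" "a \<bullet> ?j = s"
    by (simp_all add: inner_axis inner_complex_def J_def p_q_r_s_def)
  have N: "p\<^sup>2 + q\<^sup>2 ~= 0" using m by (simp add: p_q_r_s_def complex_eq_iff sum_power2_eq_zero_iff)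
  have k: "(p\<^sup>2 + q\<^sup>2) * (a \<bullet> k) = (r * p + s * q) * (u \<bullet> k) + (s * p - r * q) * (J u \<bullet> k)" if "k \<in> Basis" for k
    using 0[OF B that] by (simp add: wedge3_def det_3 vector_3 c algebra_simps power2_eq_square)
  define \<alpha> \<beta> where "\<alpha> = (r * p + s * q) / (p\<^sup>2 + q\<^sup>2)" "\<beta> = (s * p - r * q) / (p\<^sup>2 + q\<^sup>2)"
  then have \<alpha>\<beta>: "r * p + s * q = (p\<^sup>2 + q\<^sup>2) * \<alpha>" "s * p - r * q = (p\<^sup>2 + q\<^sup>2) * \<beta>" using N by simp_all
  have "a = \<alpha> *\<^sub>R u + \<beta> *\<^sub>R J u"
  proof (rule euclidean_eqI)
    fix k :: "'n V" assume "k \<in> Basis"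
    from k[OF this] have "(p\<^sup>2 + q\<^sup>2) * (a \<bullet> k) = (p\<^sup>2 + q\<^sup>2) * (\<alpha> * (u \<bullet> k) + \<beta> * (J u \<bullet> k))"
      unfolding \<alpha>\<beta> by (simp add: algebra_simps)
    then show "a \<bullet> k = (\<alpha> *\<^sub>R u + \<beta> *\<^sub>R J u) \<bullet> k" using N by (auto simp: inner_left_distrib)
  qed
  then have "a = Complex \<alpha> \<beta> *s u" by (simp add: vec_eq_iff J_def complex_eq_iff algebra_simps)
  then show ?thesis by blast
qed

text \<open>After subtraction of the right-hand side the form \<open>S\<close> still maps each
  \<open>u\<close> to a multiple of \<open>u\<close> and vanishes on the diagonal of the basis.
  Comparing the sum and the difference of two basis vectors kills the other entries.\<close>

lemma eigen_quadratic:
  fixes T :: "'n::finite V => 'n V => 'n V"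
  assumes sym: "!!u v. T u v = T v u" and lin: "!!u. clinearv (T u)" and e: "!!u. EX z. T u u = z *s u"
  defines "\<phi> u == \<Sum>i\<in>UNIV. u $ i * (T (axis i 1) (axis i 1) $ i / 2)"
  shows "T u v = \<phi> u *s v + \<phi> v *s u"
proof -
  let ?e = "%i. axis i 1 :: 'n V"
  have \<phi>: "clinear \<phi>" unfolding clinear_def \<phi>_def by (simp add: sum.distrib[symmetric] sum_distrib_left algebra_simps add_divide_distrib)
  have \<phi>e: "\<phi> (?e i) = T (?e i) (?e i) $ i / 2" for i unfolding \<phi>_def by (simp add: axis_def if_distrib if_distribR cong: if_cong)
  define S where "S u v = T u v - \<phi> u *s v - \<phi> v *s u" for u v
  have Sl: "clinearv (S u)" for u using lin[of u] \<phi>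
    by (auto simp: clinearv_def clinear_def S_def vec_eq_iff algebra_simps)
  have Ss: "S u v = S v u" for u v by (simp add: S_def sym[of u v])
  have Se: "EX z. S u u = z *s u" for u
  proof -
    obtain z where "T u u = z *s u" using e by blast
    then have "S u u = (z - 2 * \<phi> u) *s u" by (simp add: S_def vec_eq_iff algebra_simps)
    then show ?thesis by blast
  qed
  have d: "S (?e i) (?e i) = 0" for i
  proof -
    obtain z where z: "T (?e i) (?e i) = z *s ?e i" using e by blast
    then have "\<phi> (?e i) = z / 2" by (simp add: \<phi>e)
    then show ?thesis by (simp add: S_def z vec_eq_iff algebra_simps)
  qed
  have o: "S (?e i) (?e j) = 0" if "i ~= j" for i j
  proof -
    obtain z where "S (?e i + ?e j) (?e i + ?e j) = z *s (?e i + ?e j)" using Se by blast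
    moreover have "S (?e i + ?e j) w = S (?e i) w + S (?e j) w" for w using Ss clinearvD(1)[OF Sl] by metis
    ultimately have z: "2 *\<^sub>R S (?e i) (?e j) = z *s (?e i + ?e j)"
      using d Ss[of "?e j" "?e i"] by (simp add: clinearvD(1)[OF Sl] scaleR_2)
    obtain z' where "S (?e i + (-1) *s ?e j) (?e i + (-1) *s ?e j) = z' *s (?e i + (-1) *s ?e j)" using Se by blast
    moreover have "S (?e i + (-1) *s ?e j) w = S (?e i) w - S (?e j) w" for w
      using Ss[of _ w] clinearvD(1)[OF Sl, of w "?e i" "(-1) *s ?e j"] clinearvD(2)[OF Sl, of w "-1" "?e j"] by (simp add: vector_sneg_minus1[symmetric])
    ultimately have z': "- (2 *\<^sub>R S (?e i) (?e j)) = z' *s (?e i - ?e j)"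
      using d Ss[of "?e j" "?e i"] clinearvD(1)[OF Sl] clinearvD(2)[OF Sl, of _ "-1"] by (simp add: scaleR_2 vector_sneg_minus1[symmetric] del: add_uminus_conv_diff)
    have "z = - z'" "z = z'"
      using arg_cong[OF z, of "%w. w $ i"] arg_cong[OF z', of "%w. w $ i"] arg_cong[OF z, of "%w. w $ j"] arg_cong[OF z', of "%w. w $ j"] that
      by (auto simp: axis_def)
    then have "z = 0" by simp
    then show ?thesis using z by (simp add: vec_eq_iff)
  qed
  have "S (?e i) v = 0" for i v
    unfolding clinearv_expand[OF Sl, of "?e i" v] by (rule sum.neutral) (use d o in "metis vector_smult_rzero")
  then have "S v (?e i) = 0" for i v using Ss by metis
  then have "S u v = 0" unfolding clinearv_expand[OF Sl, of u v] by simp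
  then show ?thesis by (simp add: S_def algebra_simps)
qed

section \<open>The Gram determinant\<close>

lemma det_row_combination:
  fixes H :: "'n::finite V ^ 'n"
  shows "det (\<chi> k. if k = i then \<Sum>l\<in>UNIV. B l *s H $ l else H $ k) = B i * det H"
proof -
  have "det (\<chi> k. if k = i then \<Sum>l\<in>UNIV. B l *s H $ l else H $ k)
      = (\<Sum>l\<in>UNIV. det (\<chi> k. if k = i then B l *s H $ l else H $ k))"
    by (rule det_linear_row_sum) simp
  also have "... = (\<Sum>l\<in>UNIV. B l * det (\<chi> k. if k = i then H $ l else H $ k))"
    by (simp add: det_row_mul)
  also have "... = (\<Sum>l\<in>UNIV. B l * (if l = i then det H else 0))"
  proof (rule sum.cong[OF refl], rule arg_cong[where f="(*) _"])
    fix l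
    show "det (\<chi> k. if k = i then H $ l else H $ k) = (if l = i then det H else 0)"
  proof (cases "l = i")
    case True
    then have "(\<chi> k. if k = i then H $ l else H $ k) = H" by (simp add: vec_eq_iff)
    then show ?thesis using True by simp
  next
    case False
    then show ?thesis
      by simp (rule det_identical_rows[of i l], auto simp: row_def vec_eq_iff)
  qed
  qed
  finally show ?thesis by (simp add: if_distrib cong: if_cong)
qed

lemma has_derivative_det_rows:
  fixes H :: "'a::real_normed_vector => 'n::finite V ^ 'n"
  assumes H: "!!i j. der (%x. H x $ i $ j) (%w. E w $ i $ j) x"
  shows "der (%x. det (H x)) (%w. \<Sum>i\<in>UNIV. det (\<chi> k. if k = i then E w $ i else H x $ k)) x"
proof -
  let ?P = "{p. p permutes (UNIV :: 'n set)}"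
  have 1: "der (%x. \<Sum>p\<in>?P. of_int (sign p) * (\<Prod>i\<in>UNIV. H x $ i $ p i)) (%w. \<Sum>p\<in>?P. of_int (sign p) * (\<Sum>i\<in>UNIV. E w $ i $ p i * (\<Prod>k\<in>UNIV - {i}. H x $ k $ p k))) x"
    by (intro has_derivative_sum has_derivative_mult_right has_derivative_prod H)
  have 2: "E w $ i $ p i * (\<Prod>k\<in>UNIV - {i}. H x $ k $ p k) = (\<Prod>k\<in>UNIV. (\<chi> k. if k = i then E w $ i else H x $ k) $ k $ p k)" for w p i
    by (subst prod.remove[of UNIV i]) auto
  have "(\<Sum>p\<in>?P. of_int (sign p) * (\<Sum>i\<in>UNIV. E w $ i $ p i * (\<Prod>k\<in>UNIV - {i}. H x $ k $ p k)))
      = (\<Sum>i\<in>UNIV. det (\<chi> k. if k = i then E w $ i else H x $ k))" for w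
    unfolding det_def 2 sum_distrib_left by (rule sum.swap)
  then show ?thesis using 1 unfolding det_def by simp
qed

text \<open>Jacobi's formula for a derivative of the form \<open>B H + H C\<close>, which avoids the
  inverse of \<open>H\<close>. The first term acts on rows; the second is reduced to rows by
  transposition.\<close>

lemma has_derivative_det:
  fixes H :: "'a::real_normed_vector => 'n::finite V ^ 'n"
  assumes H: "!!i j. der (%x. H x $ i $ j) (%w. (B w ** H x) $ i $ j + (H x ** C w) $ i $ j) x"
  shows "der (%x. det (H x)) (%w. ((\<Sum>i\<in>UNIV. B w $ i $ i) + (\<Sum>i\<in>UNIV. C w $ i $ i)) * det (H x)) x"
proof -
  have row: "(B ** K) $ i = (\<Sum>l\<in>UNIV. B $ i $ l *s K $ l)" for B K :: "'n V ^ 'n" and i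
    by (simp add: vec_eq_iff matrix_matrix_mult_def)
  have L: "(\<Sum>i\<in>UNIV. det (\<chi> k. if k = i then (B ** K) $ i else K $ k)) = (\<Sum>i\<in>UNIV. B $ i $ i) * det K" for B K :: "'n V ^ 'n"
    unfolding row det_row_combination by (simp add: sum_distrib_right)
  have D: "der (%x. det (K x)) (%w. (\<Sum>i\<in>UNIV. det (\<chi> k. if k = i then E w $ i else K x $ k))) x"
    if "!!i j. der (%x. K x $ i $ j) (%w. E w $ i $ j) x" for K :: "'a => 'n V ^ 'n" and E
    by (rule has_derivative_det_rows[OF that])
  define d where "d K E = (\<Sum>i\<in>UNIV. det (\<chi> k. if k = i then E $ i else K $ k))" for K E :: "'n V ^ 'n"
  have dadd: "d K (E + F) = d K E + d K F" for K E F
    unfolding d_def sum.distrib[symmetric] by (rule sum.cong) (simp_all only: vector_add_component det_row_add)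
  have dB: "d K (B ** K) = (\<Sum>i\<in>UNIV. B $ i $ i) * det K" for K B unfolding d_def by (rule L)
  have hd: "der (%z. z) (%w. w) K" for K :: "'n V ^ 'n" by (rule has_derivative_ident)
  have comp: "der (%z. z $ i $ j) (%w. w $ i $ j) K" for K :: "'n V ^ 'n" and i j
    by (intro bounded_linear_imp_has_derivative bounded_linear_compose[OF bounded_linear_vec_nth bounded_linear_vec_nth])
  have D1: "der det (d K) K" for K
    using has_derivative_det_rows[where H="%z. z" and E="%w. w", OF comp] unfolding d_def .
  have "der (%z. det (transpose z)) (%w. d (transpose K) (transpose w)) K" for K :: "'n V ^ 'n"
    using has_derivative_det_rows[where H="transpose" and E="transpose" and x=K] comp unfolding d_def by (simp add: transpose_def)
  then have D2: "der det (%w. d (transpose K) (transpose w)) K" for K by (simp add: det_transpose)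
  have dt: "d K E = d (transpose K) (transpose E)" for K E
    using fun_cong[OF has_derivative_unique[OF D1 D2]] .
  have dC: "d K (K ** C) = (\<Sum>i\<in>UNIV. C $ i $ i) * det K" for K C
    unfolding dt[of K] matrix_transpose_mul dB by (simp only: det_transpose) (simp add: transpose_def)
  have "der (%x. det (H x)) (%w. d (H x) (B w ** H x + H x ** C w)) x"
    using has_derivative_det_rows[where H=H and E="%w. B w ** H x + H x ** C w"] H unfolding d_def by simp
  then show ?thesis by (simp add: dadd dB dC distrib_right)
qed

definition gram :: "('n::finite V => 'n V => complex) => 'n V ^ 'n" where
  "gram H = (\<chi> i j. H (axis i 1) (axis j 1))"
text \<open>The squared modulus is positive in every signature and is the absolute value of the
  determinant of the underlying real metric.\<close>

definition gdet :: "('n::finite V => 'n V => complex) => real" where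
  "gdet H = (norm (det (gram H :: 'n V ^ 'n)))\<^sup>2"

context kaehler_chart
begin

lemma gdet_pos: "x \<in> X ==> gdet (h x) > 0"
proof -
  assume x: "x \<in> X"
  have "y = 0" if y: "gram (h x) *v y = 0" for y
  proof -
    \<comment> \<open>The coefficients are conjugated because \<open>h\<close> is antilinear in its
      second argument; a null vector of the Gram matrix becomes a vector orthogonal to
      everything.\<close>
    define z where "z = (\<Sum>j\<in>UNIV. cnj (y $ j) *s axis j 1 :: 'n V)"
    have zj: "z $ j = cnj (y $ j)" for j unfolding z_def by (simp add: axis_def if_distrib if_distribR cong: if_cong)
    have cl: "clinear (%v. h x v b)" for b by (simp add: clinear_def h_simps[OF x])
    have "h x z b = 0" for b
    proof -
      have hz: "cnj (h x b z) = h x z b" for b using h_herm[OF x, of z b] by simp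
      have "h x z (axis i 1) = 0" for i
      proof -
        have "h x z (axis i 1) = (\<Sum>j\<in>UNIV. cnj (y $ j) * h x (axis j 1) (axis i 1))"
          by (subst clinear_expand[OF cl]) (simp add: zj)
        also have "... = cnj (\<Sum>j\<in>UNIV. h x (axis i 1) (axis j 1) * y $ j)"
          using h_herm[OF x, of "axis i 1"] by (simp add: mult.commute cnj_sum)
        also have "... = 0" using y by (simp add: vec_eq_iff matrix_vector_mult_def gram_def)
        finally show ?thesis .
      qed
      then have "h x (axis i 1) z = 0" for i using h_herm[OF x, of "axis i 1" z] by simp
      then have "h x b z = 0" by (subst clinear_expand[OF cl]) simp
      then show ?thesis using hz[of b] by simp
    qed
    then have "z = 0" using h_nondeg[OF x] by blast
    then show "y = 0" using zj by (simp add: vec_eq_iff)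
  qed
  then have "invertible (gram (h x))" using matrix_left_invertible_ker invertible_left_inverse by metis
  then show ?thesis by (simp add: gdet_def invertible_det_nz)
qed

lemma gdet_deriv:
  assumes x: "x \<in> X"
  shows "der (%x. gdet (h x)) (%w. 4 * Re (ctrace (Gm x w)) * gdet (h x)) x"
proof -
  define B where "B w = (\<chi> i k. Gm x w (axis i 1) $ k)" for w
  define C where "C w = (\<chi> k j. cnj (Gm x w (axis j 1) $ k))" for w
  have cl: "clinear (%v. h x v b)" for b by (simp add: clinear_def h_simps[OF x])
  have 1: "h x (Gm x w (axis i 1)) (axis j 1) = (B w ** gram (h x)) $ i $ j" for w i j
    by (subst clinear_expand[OF cl]) (simp add: matrix_matrix_mult_def B_def gram_def)
  have 2: "h x (axis i 1) (Gm x w (axis j 1)) = (gram (h x) ** C w) $ i $ j" for w i j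
  proof -
    have "h x (axis i 1) (Gm x w (axis j 1)) = cnj (h x (Gm x w (axis j 1)) (axis i 1))" by (rule h_herm[OF x])
    also have "... = (\<Sum>k\<in>UNIV. cnj (Gm x w (axis j 1) $ k) * cnj (h x (axis k 1) (axis i 1)))"
      by (subst clinear_expand[OF cl]) (simp add: cnj_sum)
    also have "... = (gram (h x) ** C w) $ i $ j"
      by (simp add: matrix_matrix_mult_def C_def gram_def h_herm[OF x, of "axis i 1"] mult.commute)
    finally show ?thesis .
  qed
  have d: "der (%x. det (gram (h x))) (%w. ((\<Sum>i\<in>UNIV. B w $ i $ i) + (\<Sum>i\<in>UNIV. C w $ i $ i)) * det (gram (h x))) x"
  proof (rule has_derivative_det)
    fix i j show "der (%x. gram (h x) $ i $ j) (%w. (B w ** gram (h x)) $ i $ j + (gram (h x) ** C w) $ i $ j) x"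
      using h_deriv[OF x, of "axis i 1" "axis j 1"] unfolding 1 2 by (simp add: gram_def)
  qed
  have tr: "(\<Sum>i\<in>UNIV. B w $ i $ i) + (\<Sum>i\<in>UNIV. C w $ i $ i) = of_real (2 * Re (ctrace (Gm x w)))" for w
    by (simp add: B_def C_def ctrace_def complex_eq_iff sum_negf)
  have g: "(%x. gdet (h x)) = (%x. Re (det (gram (h x)) * cnj (det (gram (h x)))))"
    by (simp add: fun_eq_iff gdet_def complex_mult_cnj cmod_power2)
  show ?thesis unfolding g
    by (rule has_derivative_eq_rhs[OF has_derivative_Re[OF has_derivative_mult[OF d has_derivative_cnj[OF d]]]])
      (simp add: fun_eq_iff tr gdet_def cmod_power2, simp add: power2_eq_square algebra_simps)
qed

end

lemma gram_transform:
  fixes L :: "'n::finite V => 'n V"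
  assumes h': "kaehler_chart X' h' Gm'" and y: "y \<in> X'" and L: "clinearv L" and h: "!!u v. h' y (L u) (L v) = h u v"
  shows "gram h = (\<chi> i j. L (axis i 1) $ j) ** gram (h' y) ** (\<chi> i j. cnj (L (axis j 1) $ i))"
proof -
  interpret B: kaehler_chart X' h' Gm' by (rule h')
  have cl: "clinear (%v. h' y v b)" for b by (simp add: clinear_def B.h_simps[OF y])
  have hc: "cnj (h' y u v) = h' y v u" for u v by (metis B.h_herm[OF y])
  have e: "h (axis i 1) (axis j 1) = (\<Sum>l\<in>UNIV. (\<Sum>k\<in>UNIV. L (axis i 1) $ k * h' y (axis k 1) (axis l 1)) * cnj (L (axis j 1) $ l))" for i j
  proof -
    have "h (axis i 1) (axis j 1) = cnj (h' y (L (axis j 1)) (L (axis i 1)))" by (simp add: h[symmetric] hc)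
    also have "h' y (L (axis j 1)) (L (axis i 1)) = (\<Sum>l\<in>UNIV. L (axis j 1) $ l * h' y (axis l 1) (L (axis i 1)))"
      by (rule clinear_expand[OF cl])
    also have "cnj ... = (\<Sum>l\<in>UNIV. h' y (L (axis i 1)) (axis l 1) * cnj (L (axis j 1) $ l))"
      by (simp add: cnj_sum hc mult.commute)
    finally show ?thesis unfolding clinear_expand[OF cl, of "L (axis i 1)"] .
  qed
  show ?thesis by (simp add: vec_eq_iff matrix_matrix_mult_def gram_def e)
qed

section \<open>C-projectively equivalent Kaehler-Einstein metrics\<close>

lemma kaehler_einstein_constant:
  assumes M: "complex_manifold M" and ke: "kaehler_einstein M (g :: ('m, 'n::finite) metric)"
  shows "EX \<kappa>. ALL c:atlas M. ALL x:chart_image c. ALL b v.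
    ctrace (%u. kaehler_chart.K (christoffel (g c)) x b u v) = - of_real \<kappa> * (of_nat CARD('n) + 1) * hform (g c) x v b"
proof -
  interpret kaehler_manifold M g by standard (use M ke in "auto simp: kaehler_einstein_def")
  obtain s where s: "!!c x u v. c \<in> atlas M ==> x \<in> chart_image c ==> ricci (g c) x u v = s / real (2 * CARD('n)) * g c x u v"
    using ke unfolding kaehler_einstein_def by metis
  show ?thesis
    by (intro exI[of _ "s / (4 * real CARD('n) * (real CARD('n) + 1))"] ballI allI einstein_K s)
qed

locale tanno_manifold = kaehler_manifold M g for M :: "('m, 'n::finite) charted" and g :: "('m, 'n) metric" +
  fixes f :: "('m, 'n) chart => 'n V => real" and th :: "('m, 'n) chart => 'n V => 'n V => complex"
    and S :: "('m, 'n) chart => 'n V => 'n V => 'n V => complex" and \<kappa> :: real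
  assumes tanno: "c \<in> atlas M ==> tanno_chart (Xc c) (hc c) (Gc c) (f c) (th c) (S c) \<kappa>"
    and f_trans: "c \<in> atlas M ==> d \<in> atlas M ==> x \<in> Ov c d ==> f d (\<psi> c d x) = f c x"
    and th_trans: "c \<in> atlas M ==> d \<in> atlas M ==> x \<in> Ov c d ==> th d (\<psi> c d x) (fd (\<psi> c d) x u) = th c x u"
    and S_trans: "c \<in> atlas M ==> d \<in> atlas M ==> x \<in> Ov c d ==> S d (\<psi> c d x) (fd (\<psi> c d) x u) (fd (\<psi> c d) x v) = S c x u v"

section \<open>The linear form of a c-projective change of metric\<close>

locale kaehler_pair = A: kaehler_manifold M g + B: kaehler_manifold M h
  for M :: "('m, 'n::finite) charted" and g h :: "('m, 'n) metric" +
  assumes n2: "CARD('n) >= 2" and cp: "c_projectively_equivalent M g h"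
begin

definition "T c x u v = B.Gc c x u v - A.Gc c x u v"
definition "\<phi> c x u = (\<Sum>i\<in>UNIV. u $ i * (T c x (axis i 1) (axis i 1) $ i / 2))"

text \<open>The geodesic of \<open>g\<close> with initial velocity \<open>u\<close> is J-planar for
  \<open>h\<close>, and its acceleration for \<open>h\<close> at time 0 is
  \<open>T c x0 u u\<close>.\<close>

lemma T_span:
  assumes c: "c \<in> atlas M" and x0: "x0 \<in> A.Xc c"
  shows "EX z. T c x0 u u = z *s u"
proof (cases "u = 0")
  case True
  then show ?thesis
    using bilinear_lzero[OF A.Gc_bilinear[OF c x0]] bilinear_lzero[OF B.Gc_bilinear[OF c x0]] by (simp add: T_def)
next
  case False
  obtain I x v where I: "open I" "is_interval I" "0 \<in> I" "smooth_on x I" "x 0 = x0" "v 0 = u"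
    and xv: "ALL t:I. x t \<in> A.Xc c & v t ~= 0 & der x (%s. s *\<^sub>R v t) t &
       der v (%s. s *\<^sub>R (- A.Gc c (x t) (v t) (v t))) t"
    using A.geodesic_local[OF c x0 False] by blast
  let ?\<gamma> = "%t. A.pt c (x t)"
  have "J_planar M g I ?\<gamma>" by (rule A.geodesic_J_planar[where v=v, OF c I(1,2,4)]) (use xv in blast)
  then have J: "J_planar M h I ?\<gamma>" using cp by (simp add: c_projectively_equivalent_def)
  have 0: "0 \<in> I \<inter> ?\<gamma> -` fst c" using I(3) xv A.pt_in[OF c] by auto
  have e: "(snd c o ?\<gamma>) t = x t" if "t \<in> I" for t using xv that A.snd_pt[OF c] by simp
  have vel: "velocity (snd c o ?\<gamma>) t = v t" if t: "t \<in> I" for t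
    unfolding velocity_def by (rule vector_derivative_open[OF I(1) t e]) (use xv t in auto)
  have "vector_derivative (velocity (snd c o ?\<gamma>)) (at 0) = - A.Gc c (x 0) (v 0) (v 0)"
    by (rule vector_derivative_open[OF I(1,3) vel]) (use xv I(3) in auto)
  then have "acceleration (h c) (snd c o ?\<gamma>) 0 = T c x0 u u"
    using e[OF I(3)] by (simp add: acceleration_def vel[OF I(3)] I(5,6) T_def)
  moreover have "wedge3 (acceleration (h c) (snd c o ?\<gamma>) 0) (velocity (snd c o ?\<gamma>) 0) (J (velocity (snd c o ?\<gamma>) 0)) i j k = 0"
    if "i \<in> Basis" "j \<in> Basis" "k \<in> Basis" for i j k
    using J c 0 that unfolding J_planar_def by blast
  ultimately show ?thesis
    by (intro wedge3_span[OF False]) (simp add: vel[OF I(3)] I(6))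
qed

lemma T_eq: "c \<in> atlas M ==> x \<in> A.Xc c ==> T c x u v = \<phi> c x u *s v + \<phi> c x v *s u"
proof -
  assume c: "c \<in> atlas M" and x: "x \<in> A.Xc c"
  interpret P: kaehler_chart "A.Xc c" "A.hc c" "A.Gc c" by (rule A.kaehler_chart_c[OF c])
  interpret Q: kaehler_chart "A.Xc c" "B.hc c" "B.Gc c" by (rule B.kaehler_chart_c[OF c])
  show ?thesis
    unfolding \<phi>_def
  proof (rule eigen_quadratic)
    show "T c x u v = T c x v u" for u v by (simp add: T_def P.Gm_sym[OF x, of u v] Q.Gm_sym[OF x, of u v])
    show "clinearv (T c x u)" for u
      by (simp add: clinearv_def T_def P.Gm_simps[OF x] Q.Gm_simps[OF x] vec_eq_iff algebra_simps)
  qed (rule T_span[OF c x])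
qed

lemma \<phi>_clinear: "clinear (\<phi> c x)"
  unfolding clinear_def \<phi>_def by (simp add: sum.distrib[symmetric] sum_distrib_left algebra_simps add_divide_distrib)

lemma \<phi>_smooth: "c \<in> atlas M ==> smooth_on (%x. \<phi> c x v) (A.Xc c)"
  unfolding \<phi>_def T_def divide_inverse
  by (intro smooth_on_sum smooth_on_mult smooth_on_const A.open_Xc smooth_on_linear[OF bounded_linear_vec_nth] smooth_on_diff A.Gc_smooth B.Gc_smooth)

lemma \<phi>_trans:
  assumes c: "c \<in> atlas M" and d: "d \<in> atlas M" and x: "x \<in> A.Ov c d"
  shows "\<phi> d (A.\<psi> c d x) (fd (A.\<psi> c d) x u) = \<phi> c x u"
proof (cases "u = 0")
  let ?L = "fd (A.\<psi> c d) x"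
  note L = A.d\<psi>_clinearv[OF c d x]
  case True
  then show ?thesis using clinearvD(2)[OF L, of 0] clinearD(2)[OF \<phi>_clinear, of _ _ 0] by simp
next
  let ?L = "fd (A.\<psi> c d) x"
  note L = A.d\<psi>_clinearv[OF c d x]
  case False
  have xX: "x \<in> A.Xc c" and yX: "A.\<psi> c d x \<in> A.Xc d" using x A.Ov_sub[OF c, of d] A.\<psi>_Xc[OF c d] by auto
  have "T d (A.\<psi> c d x) (?L u) (?L u) = ?L (T c x u u)"
    unfolding T_def A.Gc_trans[OF c d x] B.Gc_trans[OF c d x] linear_diff[OF clinearv_linear[OF L]] by simp
  then have "2 * \<phi> d (A.\<psi> c d x) (?L u) *s ?L u = 2 * \<phi> c x u *s ?L u"
    unfolding T_eq[OF c xX] T_eq[OF d yX] clinearvD[OF L] by (simp add: vec_eq_iff algebra_simps)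
  then have "2 * (\<phi> d (A.\<psi> c d x) (?L u) - \<phi> c x u) *s ?L u = 0" by (simp add: vec_eq_iff algebra_simps)
  moreover have "?L u ~= 0"
    using A.d\<psi>_inv[OF c d x, of u] False linear_0[OF clinearv_linear[OF A.d\<psi>_clinearv[OF d c A.\<psi>_Ov[OF c d x]]]] by metis
  ultimately show ?thesis by simp
qed

definition "q c x = gdet (B.hc c x) / gdet (A.hc c x)"
text \<open>The trace of \<open>T\<close> is n + 1 times \<open>\<phi>\<close>, so the logarithm of
  \<open>q\<close> has derivative \<open>4 (n + 1) Re \<phi>\<close>; this exponent makes the
  logarithmic derivative of \<open>f\<close> equal to \<open>- 2 Re \<phi>\<close>.\<close>

definition "f c x = q c x powr (- 1 / (2 * (real CARD('n) + 1)))"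

lemma q_pos: "c \<in> atlas M ==> x \<in> A.Xc c ==> q c x > 0"
  using kaehler_chart.gdet_pos[OF A.kaehler_chart_c] kaehler_chart.gdet_pos[OF B.kaehler_chart_c] by (simp add: q_def)

lemma f_pos: "c \<in> atlas M ==> x \<in> A.Xc c ==> f c x > 0"
  using q_pos[of c x] by (simp add: f_def)

lemma f_trans:
  assumes c: "c \<in> atlas M" and d: "d \<in> atlas M" and x: "x \<in> A.Ov c d"
  shows "f d (A.\<psi> c d x) = f c x"
proof -
  have xX: "x \<in> A.Xc c" and yX: "A.\<psi> c d x \<in> A.Xc d" using x A.Ov_sub[OF c, of d] A.\<psi>_Xc[OF c d] by auto
  note t = gram_transform[OF _ yX A.d\<psi>_clinearv[OF c d x]]
  define D where "D = (norm (det (\<chi> i j. fd (A.\<psi> c d) x (axis i 1) $ j)))\<^sup>2 * (norm (det (\<chi> i j. cnj (fd (A.\<psi> c d) x (axis j 1) $ i))))\<^sup>2"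
  have D: "gdet (A.hc c x) = D * gdet (A.hc d (A.\<psi> c d x))" "gdet (B.hc c x) = D * gdet (B.hc d (A.\<psi> c d x))"
    unfolding gdet_def t[OF A.kaehler_chart_c[OF d] A.h_trans[OF c d x]] t[OF B.kaehler_chart_c[OF d] B.h_trans[OF c d x]] D_def
    by (simp_all add: det_mul norm_mult power_mult_distrib mult_ac)
  have "D ~= 0" using D(1) kaehler_chart.gdet_pos[OF A.kaehler_chart_c[OF c] xX] by auto
  then show ?thesis by (simp add: f_def q_def D)
qed

lemma f_deriv:
  assumes c: "c \<in> atlas M" and x: "x \<in> A.Xc c"
  shows "der (f c) (%w. - 2 * f c x * Re (\<phi> c x w)) x"
proof -
  interpret P: kaehler_chart "A.Xc c" "A.hc c" "A.Gc c" by (rule A.kaehler_chart_c[OF c])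
  interpret Q: kaehler_chart "A.Xc c" "B.hc c" "B.Gc c" by (rule B.kaehler_chart_c[OF c])
  let ?n = "real CARD('n)"
  have pos: "gdet (A.hc c x) > 0" "gdet (B.hc c x) > 0" by (rule P.gdet_pos[OF x], rule Q.gdet_pos[OF x])
  have tr: "ctrace (B.Gc c x w) = ctrace (A.Gc c x w) + of_real (?n + 1) * \<phi> c x w" for w
  proof -
    have "B.Gc c x w = (%u. A.Gc c x w u + (\<phi> c x w *s u + \<phi> c x u *s w))"
      using T_eq[OF c x, of w] by (simp add: T_def fun_eq_iff algebra_simps)
    then show ?thesis
      by (simp add: ctrace_add ctrace_scalar ctrace_rank_one[OF \<phi>_clinear] algebra_simps)
  qed
  have q': "der (q c) (%w. 4 * (?n + 1) * Re (\<phi> c x w) * q c x) x"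
    unfolding q_def
    by (rule has_derivative_eq_rhs[OF has_derivative_divide'[OF Q.gdet_deriv[OF x] P.gdet_deriv[OF x]]])
      (use pos in "auto simp: fun_eq_iff tr field_simps")
  let ?a = "- 1 / (2 * (?n + 1))"
  have "?n + 1 ~= 0" by linarith
  then have n: "4 * (?n + 1) * ?a = - 2" by (simp add: divide_simps)
  have e: "0 * l + 4 * (?n + 1) * R * Q * ?a / Q = - 2 * R" if "Q ~= 0" for l R Q
  proof -
    have "0 * l + 4 * (?n + 1) * R * Q * ?a / Q = (4 * (?n + 1) * ?a) * R" using that by simp
    then show ?thesis unfolding n .
  qed
  have "der (%y. q c y powr ?a) (%w. q c x powr ?a * (0 * ln (q c x) + 4 * (?n + 1) * Re (\<phi> c x w) * q c x * ?a / q c x)) x"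
    by (rule has_derivative_powr[OF q' has_derivative_const q_pos[OF c x]]) simp
  moreover have "q c x ~= 0" using q_pos[OF c x] by linarith
  ultimately show ?thesis unfolding f_def[abs_def] e[OF \<open>q c x ~= 0\<close>]
    by (elim has_derivative_eq_rhs) (simp add: fun_eq_iff)
qed

text \<open>\<open>f\<close> solves the total equation of \<open>f_deriv\<close> with smooth
  coefficients, so smoothness follows without differentiating determinants and powers again.\<close>

lemma f_smooth: "c \<in> atlas M ==> smooth_on (f c) (A.Xc c)"
proof -
  assume c: "c \<in> atlas M"
  let ?T = "A.Xc c \<times> (UNIV :: real set)"
  have oT: "open ?T" by (intro open_Times A.open_Xc c open_UNIV)
  have s: "smooth_on (%p. \<phi> c (fst p) v) ?T" for v
    by (rule smooth_on_compose[OF oT \<phi>_smooth[OF c] smooth_on_linear[OF bounded_linear_fst oT smooth_on_id[OF oT]]]) auto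
  have "smooth_on (%p. - 2 * snd p * Re (\<phi> c (fst p) v)) ?T" for v
    by (intro smooth_on_mult smooth_on_const smooth_on_linear[OF bounded_linear_Re] smooth_on_linear[OF bounded_linear_snd] smooth_on_id oT s)
  then have "Ck_on k (f c) (A.Xc c)" for k
    by (rule Ck_on_total_differential[where w="%p v. - 2 * snd p * Re (\<phi> c (fst p) v)" and T="?T", OF A.open_Xc[OF c]])
      (use f_deriv[OF c] in auto)
  then show ?thesis by (simp add: smooth_on_def)
qed

lemma tanno_manifold_ex:
  assumes ke: "kaehler_einstein M g" "kaehler_einstein M h"
  shows "EX f th S \<kappa>. tanno_manifold M g f th S \<kappa> &
    ((ALL c:atlas M. ALL x:chart_image c. ALL v. th c x v = 0) --> affinely_equivalent M g h)"
proof -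
  obtain \<kappa> where \<kappa>: "!!c x b v. c \<in> atlas M ==> x \<in> A.Xc c ==>
    ctrace (%u. kaehler_chart.K (A.Gc c) x b u v) = - of_real \<kappa> * (of_nat CARD('n) + 1) * A.hc c x v b"
    using kaehler_einstein_constant[OF A.M ke(1)] by blast
  obtain \<kappa>' where \<kappa>': "!!c x b v. c \<in> atlas M ==> x \<in> A.Xc c ==>
    ctrace (%u. kaehler_chart.K (B.Gc c) x b u v) = - of_real \<kappa>' * (of_nat CARD('n) + 1) * B.hc c x v b"
    using kaehler_einstein_constant[OF A.M ke(2)] by blast
  have pair: "cproj_pair (A.Xc c) (A.hc c) (A.Gc c) (B.hc c) (B.Gc c) (\<phi> c) \<kappa> \<kappa>'" if c: "c \<in> atlas M" for c
    by (intro cproj_pair.intro A.kaehler_chart_c[OF c] B.kaehler_chart_c[OF c] cproj_pair_axioms.intro n2 \<phi>_clinear \<phi>_smooth[OF c] \<kappa>[OF c] \<kappa>'[OF c])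
      (use T_eq[OF c] in "auto simp: T_def algebra_simps")
  let ?th = "%c x v. - of_real (f c x) * \<phi> c x v"
  let ?S = "%c x v w. of_real (f c x) * (cnj (\<phi> c x w) * \<phi> c x v - of_real \<kappa> * A.hc c x v w + of_real \<kappa>' * B.hc c x v w)"
  have "tanno_manifold M g f ?th ?S \<kappa>"
  proof (intro tanno_manifold.intro A.kaehler_manifold_axioms tanno_manifold_axioms.intro)
    show "tanno_chart (A.Xc c) (A.hc c) (A.Gc c) (f c) (?th c) (?S c) \<kappa>" if c: "c \<in> atlas M" for c
      by (rule cproj_pair.tanno[OF pair[OF c] f_deriv[OF c] f_smooth[OF c]])
  qed (simp_all add: f_trans \<phi>_trans A.h_trans B.h_trans)
  moreover have "affinely_equivalent M g h" if 0: "ALL c:atlas M. ALL x:chart_image c. ALL v. ?th c x v = 0"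
    unfolding affinely_equivalent_def
  proof (intro ballI ext)
    fix c x u v assume c: "c \<in> atlas M" and x: "x \<in> chart_image c"
    have "- of_real (f c x) * \<phi> c x v = 0" for v using 0 c x by blast
    then have "\<phi> c x v = 0" for v using f_pos[OF c x] by simp
    then show "A.Gc c x u v = B.Gc c x u v" using T_eq[OF c x, of u v] by (simp add: T_def)
  qed
  ultimately show ?thesis by blast
qed

end

context kaehler_manifold
begin

abbreviation "Kc c == kaehler_chart.K (Gc c)"

text \<open>In the derivative of \<open>Gc_trans\<close>, the terms with second and third
  derivatives of the holomorphic transition map are complex linear in the direction
  \<open>w\<close>. They disappear in \<open>K\<close>, the antilinear part.\<close>

lemma K_trans:
  assumes c: "c \<in> atlas M" and d: "d \<in> atlas M" and x: "x \<in> Ov c d"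
  shows "Kc d (\<psi> c d x) (fd (\<psi> c d) x w) (fd (\<psi> c d) x u) (fd (\<psi> c d) x v) = fd (\<psi> c d) x (Kc c x w u v)"
proof -
  interpret C: kaehler_chart "Xc c" "hc c" "Gc c" by (rule kaehler_chart_c[OF c])
  interpret D: kaehler_chart "Xc d" "hc d" "Gc d" by (rule kaehler_chart_c[OF d])
  let ?F = "\<psi> c d" let ?L = "%y. fd ?F y" let ?H = "%y w v. fd (%y. ?L y v) y w" let ?E = "%u v w. fd (%y. ?H y u v) x w"
  have oO: "open (Ov c d)" by (rule open_Ov[OF c d])
  have xX: "x \<in> Xc c" and yX: "?F x \<in> Xc d" using x Ov_sub[OF c, of d] \<psi>_Xc[OF c d] by auto
  have Lcl: "clinearv (?L y)" if "y \<in> Ov c d" for y by (rule d\<psi>_clinearv[OF c d that])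
  have sL: "smooth_on (%y. ?L y v) (Ov c d)" for v by (rule smooth_on_frechet[OF smooth_\<psi>[OF c d]])
  have hL: "der (%y. ?L y v) (%w. ?H y w v) y" if "y \<in> Ov c d" for y v by (rule smooth_on_deriv[OF sL that])
  have hH: "der (%y. ?H y u v) (?E u v) x" for u v by (rule smooth_on_deriv[OF smooth_on_frechet[OF sL] x])
  have Hsym: "?H y u v = ?H y v u" if "y \<in> Ov c d" for y u v
    by (rule second_derivative_commute[where f="?F" and f'="fd ?F" and Fu="%w. ?H y w v" and u=v and v=u and Fv="%w. ?H y w u", OF oO that smooth_\<psi>[OF c d] hd_\<psi>[OF c d] hL[OF that] hL[OF that]])
  have Hi2: "?H y w (\<i> *s v) = \<i> *s ?H y w v" if y: "y \<in> Ov c d" for y w v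
  proof -
    have "der (%y. ?L y (\<i> *s v)) (%w. \<i> *s ?H y w v) y"
      by (rule der_cong[OF bounded_linear.has_derivative[OF bounded_bilinear.bounded_linear_right[OF bounded_bilinear_smult] hL[OF y]] oO y])
        (simp add: clinearvD[OF Lcl])
    from fun_cong[OF has_derivative_unique[OF hL[OF y] this]] show ?thesis .
  qed
  have Hi: "?H y (\<i> *s w) v = \<i> *s ?H y w v" if "y \<in> Ov c d" for y w v
  proof -
    have a: "?H y (\<i> *s w) v = ?H y v (\<i> *s w)" by (rule Hsym[OF that])
    have b: "\<i> *s ?H y v w = \<i> *s ?H y w v" by (rule arg_cong[where f="(*s) \<i>", OF Hsym[OF that]])
    show ?thesis by (rule trans[OF trans[OF a Hi2[OF that]] b])
  qed
  have Esym: "?E u v w = ?E w v u" for u v w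
    by (rule second_derivative_commute[where f="%y. ?L y v" and f'="%y w. ?H y w v" and u=u and v=w and Fu="?E u v" and Fv="?E w v", OF oO x sL hL hH hH])
  have Ei: "?E u v (\<i> *s w) = \<i> *s ?E u v w" for u v w
  proof -
    have "der (%y. ?H y (\<i> *s w) v) (%u. \<i> *s ?E w v u) x"
      by (rule der_cong[OF bounded_linear.has_derivative[OF bounded_bilinear.bounded_linear_right[OF bounded_bilinear_smult] hH] oO x])
        (simp add: Hi)
    note e = fun_cong[OF has_derivative_unique[OF hH this], of u]
    have a: "?E u v (\<i> *s w) = ?E (\<i> *s w) v u" by (rule Esym)
    have b: "\<i> *s ?E w v u = \<i> *s ?E u v w" by (rule arg_cong[where f="(*s) \<i>", OF Esym])
    show ?thesis by (rule trans[OF trans[OF a e] b])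
  qed
  have comp: "der (%y. Gc d (?F y) a b) (%w. D.DGm (?F x) a b (?L x w)) x" for a b
    by (rule has_derivative_compose[OF hd_\<psi>[OF c d x] D.DGm[OF yX]])
  have 1: "der (%y. Gc d (?F y) (?L y u) b) (%w. D.DGm (?F x) (?L x u) b (?L x w) + Gc d (?F x) (?H x w u) b) x" for b
    by (rule der_linear_arg[where T="%y a. Gc d (?F y) a b", OF oO x D.Gm_linear(1)[OF \<psi>_Xc[OF c d]] comp hL[OF x]])
  have 2: "der (%y. Gc d (?F y) (?L y u) (?L y v)) (%w. D.DGm (?F x) (?L x u) (?L x v) (?L x w) + Gc d (?F x) (?H x w u) (?L x v) + Gc d (?F x) (?L x u) (?H x w v)) x"
    by (rule der_linear_arg[where T="%y. Gc d (?F y) (?L y u)", OF oO x D.Gm_linear(2)[OF \<psi>_Xc[OF c d]] 1 hL[OF x]])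
  have 3: "der (%y. ?L y (Gc c y u v) - ?H y u v) (%w. (?H x w (Gc c x u v) + ?L x (C.DGm x u v w)) - ?E u v w) x"
    by (rule has_derivative_diff[OF der_linear_arg[where T="?L", OF oO x clinearv_linear[OF Lcl] hL[OF x] C.DGm[OF xX]] hH])
  have "der (%y. Gc d (?F y) (?L y u) (?L y v)) (%w. (?H x w (Gc c x u v) + ?L x (C.DGm x u v w)) - ?E u v w) x"
    by (rule der_cong[OF 3 oO x]) (simp add: Gc_trans[OF c d])
  note e = fun_cong[OF has_derivative_unique[OF 2 this]]
  have r: "D.DGm (?F x) (?L x u) (?L x v) (?L x w) = ?H x w (Gc c x u v) + ?L x (C.DGm x u v w) - ?E u v w
      - Gc d (?F x) (?H x w u) (?L x v) - Gc d (?F x) (?L x u) (?H x w v)" for w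
    using e[of w] by (simp add: algebra_simps)
  note L = Lcl[OF x]
  have "D.K (?F x) (?L x w) (?L x u) (?L x v) = (1/2) *s (D.DGm (?F x) (?L x u) (?L x v) (?L x w) + \<i> *s D.DGm (?F x) (?L x u) (?L x v) (?L x (\<i> *s w)))"
    by (simp add: D.K_def clinearvD(2)[OF L])
  also have "... = (1/2) *s (?L x (C.DGm x u v w) + \<i> *s ?L x (C.DGm x u v (\<i> *s w)))"
    unfolding r by (simp add: Hi[OF x] Ei D.Gm_scale[OF yX] D.Gm_scale2[OF yX] vec_eq_iff algebra_simps)
  also have "... = ?L x (C.K x w u v)"
    by (simp add: C.K_def clinearvD(2)[OF L, symmetric] clinearvD(1)[OF L, symmetric])
  finally show ?thesis .
qed

end

text \<open>Replacing \<open>h\<close> by \<open>\<kappa> h\<close> keeps the connection and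
  normalises the constant to 1. The definite case is applied to this form, whatever the sign of
  \<kappa>.\<close>

lemma (in tanno_chart) rescale:
  assumes k: "\<kappa> ~= 0"
  shows "tanno_chart X (%x u v. of_real \<kappa> * h x u v) Gm f th S 1"
proof
  fix x u u' v w b :: "'n V" and a
  show "open X" by (rule open_X)
  show "smooth_on (%x. of_real \<kappa> * h x u v) X" by (intro smooth_on_mult smooth_on_const open_X h_smooth)
  show "smooth_on (%x. Gm x u v) X" "smooth_on (%x. th x v) X" "smooth_on (%x. S x u v) X" "smooth_on f X"
    by (rule Gm_smooth th_smooth S_smooth f_smooth)+
  assume x: "x \<in> X"
  show "u = 0" if "!!v. of_real \<kappa> * h x u v = 0" using that k h_nondeg[OF x] by simp
  show "der (%y. of_real \<kappa> * h y u v) (%w. of_real \<kappa> * h x (Gm x w u) v + of_real \<kappa> * h x u (Gm x w v)) x"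
    by (rule has_derivative_eq_rhs[OF has_derivative_mult_right[OF h_deriv[OF x]]]) (simp add: fun_eq_iff algebra_simps)
  show "der (%y. S y v b) (%w. S x (Gm x w v) b + S x v (Gm x w b)
        - of_real 1 * (th x w * (of_real \<kappa> * h x v b) + th x v * (of_real \<kappa> * h x w b) + cnj (th x w) * (of_real \<kappa> * h x v b) + cnj (th x b) * (of_real \<kappa> * h x v w))) x"
    by (rule has_derivative_eq_rhs[OF S_deriv[OF x]]) (simp add: fun_eq_iff algebra_simps)
  show "der (%y. th y v) (%w. th x (Gm x w v) + S x v w) x" by (rule th_deriv[OF x])
  show "Gm x u v = Gm x v u" by (rule Gm_sym[OF x])
qed (simp_all add: h_simps Gm_simps f_deriv th_clinear S_clinear cnj_h cnj_S algebra_simps)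

section \<open>Consequences of compactness\<close>

context tanno_manifold
begin

definition "Hc c x v r = \<kappa> * g c x v v + (norm (r::complex))\<^sup>2"
definition "Bc c x v r = Re (S c x v v) + \<kappa> * f c x * g c x v v + 2 * Re (cnj r * th c x v) + f c x * (norm r)\<^sup>2"

text \<open>Transport matches the values of both forms at nearby points, so a relation between them
  that holds for all vectors at one point holds for all vectors everywhere.\<close>

lemma forms_propagate:
  assumes conn: "connected_space (mtop M)" and c: "c \<in> atlas M" "x \<in> Xc c" and P: "!!v r. P (Hc c x v r) (Bc c x v r)"
    and d: "d \<in> atlas M" "y \<in> Xc d"
  shows "P (Hc d y v r) (Bc d y v r)"
proof -
  define Q where "Q p \<longleftrightarrow> (ALL e:atlas M. p \<in> fst e --> (ALL v r. P (Hc e (snd e p) v r) (Bc e (snd e p) v r)))" for p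
  have Q: "Q (pt c x) \<longleftrightarrow> (ALL v r. P (Hc c x v r) (Bc c x v r))" if c: "c \<in> atlas M" and x: "x \<in> Xc c" for c x
  proof
    show "ALL v r. P (Hc c x v r) (Bc c x v r)" if "Q (pt c x)"
      using that c x pt_in[OF c] snd_pt[OF c] unfolding Q_def by auto
    assume 0: "ALL v r. P (Hc c x v r) (Bc c x v r)"
    show "Q (pt c x)" unfolding Q_def
    proof (intro ballI impI allI)
      fix e v r assume e: "e \<in> atlas M" "pt c x \<in> fst e"
      then have O: "x \<in> Ov c e" using x by (simp add: Ov_iff[OF c])
      define v' where "v' = fd (\<psi> e c) (\<psi> c e x) v"
      have v: "v = fd (\<psi> c e) x v'" unfolding v'_def by (rule d\<psi>_inv'[OF c e(1) O, symmetric])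
      have "Hc e (\<psi> c e x) v r = Hc c x v' r" "Bc e (\<psi> c e x) v r = Bc c x v' r"
        unfolding Hc_def Bc_def v g_trans[OF c e(1) O] S_trans[OF c e(1) O] th_trans[OF c e(1) O] f_trans[OF c e(1) O] by simp_all
      then show "P (Hc e (snd e (pt c x)) v r) (Bc e (snd e (pt c x)) v r)" using 0 by (simp add: \<psi>_eq[OF c])
    qed
  qed
  have "Q (pt d y)"
  proof (rule connected_constant[where p="pt c x", OF conn pt_top[OF c] pt_top[OF d]])
    show "Q (pt c x)" using Q[OF c] P by simp
    fix e x0 assume e: "e \<in> atlas M" and x0: "x0 \<in> Xc e"
    interpret E: tanno_chart "Xc e" "hc e" "Gc e" "f e" "th e" "S e" \<kappa> by (rule tanno[OF e])
    have HB: "E.Hq = Hc e" "E.Bq = Bc e" by (simp_all add: fun_eq_iff E.Hq_def E.Bq_def Hc_def Bc_def hc_Re[OF e])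
    obtain \<rho> where \<rho>: "\<rho> > 0" "ball x0 \<rho> <= Xc e" "!!x y v r. x \<in> ball x0 \<rho> ==> y \<in> ball x0 \<rho> ==> EX v' r'. Hc e x v r = Hc e y v' r' & Bc e x v r = Bc e y v' r'"
      using E.parallel_forms[OF x0] unfolding HB by blast
    have "Q (pt e x) = Q (pt e x0)" if x: "x \<in> ball x0 \<rho>" for x
    proof -
      have x0': "x0 \<in> ball x0 \<rho>" using \<rho>(1) by simp
      show ?thesis unfolding Q[OF e subsetD[OF \<rho>(2) x]] Q[OF e x0] using \<rho>(3)[OF x x0'] \<rho>(3)[OF x0' x] by metis
    qed
    then show "EX \<rho>>0. ball x0 \<rho> <= Xc e & (ALL x:ball x0 \<rho>. Q (pt e x) = Q (pt e x0))" using \<rho>(1,2) by blast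
  qed
  then show ?thesis using Q[OF d] by blast
qed

lemma constant_th:
  assumes c: "c \<in> atlas M" and f: "!!x. x \<in> Xc c ==> f c x = a" and x: "x \<in> Xc c"
  shows "th c x v = 0"
proof -
  interpret C: tanno_chart "Xc c" "hc c" "Gc c" "f c" "th c" "S c" \<kappa> by (rule tanno[OF c])
  have "der (f c) (%w. 0) x"
    by (rule der_cong[OF has_derivative_const C.open_X x]) (simp add: f)
  from fun_cong[OF has_derivative_unique[OF C.f_deriv[OF x] this]] have "Re (th c x w) = 0" for w by simp
  from this[of v] this[of "\<i> *s v"] show ?thesis by (simp add: C.th_scale[OF x] complex_eq_iff)
qed

lemma f_extremum:
  assumes c: "c \<in> atlas M" and m: "m \<in> Xc c" and s: "s = 1 | s = - 1" and le: "!!x. x \<in> Xc c ==> s * f c x <= s * f c m"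
  shows "th c m v = 0" "s * Re (S c m v v) <= 0"
proof -
  interpret C: tanno_chart "Xc c" "hc c" "Gc c" "f c" "th c" "S c" \<kappa> by (rule tanno[OF c])
  have sf: "smooth_on (%x. s * f c x) (Xc c)" by (intro smooth_on_mult smooth_on_const C.open_X C.f_smooth)
  have hf: "der (%x. s * f c x) (%w. s * (2 * Re (th c y w))) y" if "y \<in> Xc c" for y
    by (rule has_derivative_mult_right[OF C.f_deriv[OF that]])
  have so: "fd (%x. s * f c x) m v = 0" "dd (%x. s * f c x) m v <= 0" for v
    by (rule second_order_maximum[OF C.open_X m sf]; erule le)+
  have "Re (th c m w) = 0" for w
    using so(1)[of w] frechet_derivative_at[OF hf[OF m], symmetric] s by auto
  from this[of w for w] this[of "\<i> *s w" for w] have th: "th c m w = 0" for w by (simp add: C.th_scale[OF m] complex_eq_iff)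
  then show "th c m v = 0" .
  have "der (%y. s * (2 * Re (th c y v))) (%w. s * (2 * Re (th c m (Gc c m w v) + S c m v w))) m"
    by (intro has_derivative_mult_right has_derivative_Re C.th_deriv m)
  from dd_eq[OF C.open_X m hf this] so(2)[of v] show "s * Re (S c m v v) <= 0" by (simp add: th)
qed

definition "hh c x u v = of_real \<kappa> * hc c x u v"

lemma f_max_ex:
  assumes comp: "compact_space (mtop M)" and ne: "TM ~= {}" and s: "s = 1 | s = - 1"
  shows "EX c:atlas M. EX m:Xc c. ALL d:atlas M. ALL x:Xc d. s * f d x <= s * f c m"
proof -
  have cont: "continuous_on (Xc c \<times> {0::real}) (%(x, k). s * f c x)" if c: "c \<in> atlas M" for c
  proof -
    have "continuous_on (Xc c) (f c)" by (rule smooth_on_continuous[OF tanno_chart.f_smooth[OF tanno[OF c]]])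
    then have "continuous_on (Xc c \<times> {0::real}) (%z. f c (fst z))"
      by (rule continuous_on_compose2[OF _ continuous_on_fst[OF continuous_on_id]]) auto
    then have "continuous_on (Xc c \<times> {0::real}) (%z. s * f c (fst z))"
      by (rule continuous_on_mult[OF continuous_on_const])
    then show ?thesis by (simp add: case_prod_beta)
  qed
  have "EX c:atlas M. EX x:Xc c. EX k:{0::real}. ALL p:TM. EX d:atlas M. p \<in> fst d & (ALL k':{0::real}. s * f d (snd d p) <= s * f c x)"
    by (rule compact_max[OF comp ne _ _ cont]) auto
  then obtain c m where c: "c \<in> atlas M" "m \<in> Xc c" and le: "ALL p:TM. EX d:atlas M. p \<in> fst d & s * f d (snd d p) <= s * f c m"
    by blast
  have "s * f d x <= s * f c m" if d: "d \<in> atlas M" and x: "x \<in> Xc d" for d x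
  proof -
    obtain e where e: "e \<in> atlas M" "pt d x \<in> fst e" "s * f e (snd e (pt d x)) <= s * f c m" using le pt_top[OF d x] by blast
    have O: "x \<in> Ov d e" using x e(2) by (simp add: Ov_iff[OF d])
    show ?thesis using e(3) f_trans[OF d e(1) O] by (simp add: \<psi>_eq[OF d])
  qed
  then show ?thesis using c by blast
qed

lemma positive_or_trivial:
  assumes comp: "compact_space (mtop M)" and conn: "connected_space (mtop M)"
  shows "(ALL c:atlas M. ALL x:Xc c. ALL v. th c x v = 0) | (\<kappa> ~= 0 & (ALL c:atlas M. ALL x:Xc c. ALL u. u ~= 0 --> \<kappa> * g c x u u > 0))"
proof (cases "TM = {}")
  case True
  then have "Xc c = {}" if "c \<in> atlas M" for c using pt_top[OF that] by blast
  then show ?thesis by auto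
next
  case False
  obtain c1 m1 where c1: "c1 \<in> atlas M" "m1 \<in> Xc c1" and max: "!!d x. d \<in> atlas M ==> x \<in> Xc d ==> 1 * f d x <= 1 * f c1 m1"
    using f_max_ex[OF comp False, of 1] by blast
  obtain c2 m2 where c2: "c2 \<in> atlas M" "m2 \<in> Xc c2" and min: "!!d x. d \<in> atlas M ==> x \<in> Xc d ==> -1 * f d x <= -1 * f c2 m2"
    using f_max_ex[OF comp False, of "-1"] by blast
  define a b where "a = f c1 m1" "b = f c2 m2"
  have ub: "Bc c x v r <= a * Hc c x v r" if "c \<in> atlas M" "x \<in> Xc c" for c x v r
  proof (rule forms_propagate[where P="%H B. B <= a * H", OF conn c1 _ that])
    show "Bc c1 m1 v r <= a * Hc c1 m1 v r" for v r
      using f_extremum(1)[OF c1 _ max[OF c1(1)], of v] f_extremum(2)[OF c1 _ max[OF c1(1)], of v] by (simp add: Bc_def Hc_def a_b_def algebra_simps)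
  qed
  have lb: "Bc c x v r >= b * Hc c x v r" if "c \<in> atlas M" "x \<in> Xc c" for c x v r
  proof (rule forms_propagate[where P="%H B. B >= b * H", OF conn c2 _ that])
    show "Bc c2 m2 v r >= b * Hc c2 m2 v r" for v r
      using f_extremum(1)[OF c2 _ min[OF c2(1)], of v] f_extremum(2)[OF c2 _ min[OF c2(1)], of v] by (simp add: Bc_def Hc_def a_b_def algebra_simps)
  qed
  show ?thesis
  proof (cases "a = b")
    case True
    have "th c x v = 0" if c: "c \<in> atlas M" "x \<in> Xc c" for c x v
    proof (rule constant_th[OF c(1) _ c(2)])
      show "f c x = a" if "x \<in> Xc c" for x using max[OF c(1) that] min[OF c(1) that] True by (simp add: a_b_def)
    qed
    then show ?thesis by blast
  next
    case False
    then have ab: "a - b > 0" using max[OF c2] by (simp add: a_b_def)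
    have H0: "\<kappa> * g c x v v >= 0" if c: "c \<in> atlas M" "x \<in> Xc c" for c x v
    proof -
      have "(a - b) * Hc c x v 0 >= 0" using ub[OF c, of v 0] lb[OF c, of v 0] by (simp add: algebra_simps)
      then have "Hc c x v 0 >= 0" using ab by (simp add: zero_le_mult_iff)
      then show ?thesis by (simp add: Hc_def)
    qed
    show ?thesis
    proof (cases "\<kappa> = 0")
      case True
      have "th c x v = 0" if c: "c \<in> atlas M" and x: "x \<in> Xc c" for c x v
      proof -
        interpret C: tanno_chart "Xc c" "hc c" "Gc c" "f c" "th c" "S c" \<kappa> by (rule tanno[OF c])
        let ?r = "th c x v"
        \<comment> \<open>For \<kappa> = 0 the form \<open>Hc\<close> does not depend on
          \<open>v\<close>, whereas \<open>Bc\<close> is linear in \<open>t\<close> once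
          \<open>S\<close> is known to vanish on \<open>v\<close>. An upper bound for all
          \<open>t\<close> forces the slope, a multiple of the squared modulus of \<open>th\<close>,
          to be 0.\<close>
        have B: "Bc c x (of_real t *s v) ?r = t\<^sup>2 * Re (S c x v v) + 2 * t * (norm ?r)\<^sup>2 + f c x * (norm ?r)\<^sup>2" for t
        proof -
          have "Re (cnj ?r * (of_real t * ?r)) = t * (norm ?r)\<^sup>2" by (simp add: cmod_power2) (simp add: power2_eq_square algebra_simps)
          then show ?thesis unfolding Bc_def C.th_scale[OF x] by (simp add: True C.S_scale[OF x] C.S_scale2[OF x] power2_eq_square mult.assoc)
        qed
        define q where "q = (norm ?r)\<^sup>2"
        have S0: "Re (S c x v v) = 0" using ub[OF c x, of v 0] lb[OF c x, of v 0] unfolding Bc_def Hc_def by (simp add: True)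
        have u: "2 * t * q <= (a - f c x) * q" for t
          using ub[OF c x, of "of_real t *s v" ?r] unfolding B S0 Hc_def q_def by (simp add: True algebra_simps)
        have "q = 0"
        proof (rule ccontr)
          assume "q ~= 0"
          then have "q > 0" by (simp add: q_def)
          then have "2 * ((a - f c x) / 2 + 1) <= a - f c x" using u[of "(a - f c x) / 2 + 1"] by (metis mult_le_cancel_right_pos)
          moreover have "2 * ((a - f c x) / 2 + 1) = a - f c x + 2" by simp
          ultimately show False by linarith
        qed
        then show ?thesis by (simp add: q_def)
      qed
      then show ?thesis by blast
    next
      case k: False
      have "\<kappa> * g c x u u > 0" if c: "c \<in> atlas M" and x: "x \<in> Xc c" and u: "u ~= 0" for c x u
      proof (rule ccontr)
        assume "~ ?thesis"
        then have 0: "\<kappa> * g c x u u = 0" using H0[OF c x, of u] by simp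
        note gb = bilinear_ladd[OF g_bilinear[OF c x]] bilinear_radd[OF g_bilinear[OF c x]] bilinear_lmul[OF g_bilinear[OF c x]] bilinear_rmul[OF g_bilinear[OF c x]]
        \<comment> \<open>A null vector of a semidefinite form is orthogonal to everything, which
          contradicts nondegeneracy.\<close>
        have "- (\<kappa> * g c x u v) = 0" for v
        proof (rule linear_coefficient_zero)
          fix t :: real
          have "g c x (u + t *\<^sub>R v) (u + t *\<^sub>R v) = g c x u u + 2 * t * g c x u v + t\<^sup>2 * g c x v v"
            by (simp add: gb g_sym[OF c x, of v u] power2_eq_square algebra_simps)
          then have "\<kappa> * g c x (u + t *\<^sub>R v) (u + t *\<^sub>R v) = 2 * t * (\<kappa> * g c x u v) + t\<^sup>2 * (\<kappa> * g c x v v)"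
            using 0 by (simp add: algebra_simps)
          then show "2 * t * - (\<kappa> * g c x u v) + t\<^sup>2 * - (\<kappa> * g c x v v) <= 0" using H0[OF c x, of "u + t *\<^sub>R v"] by simp
        qed
        then show False using g_nondeg[OF c x, of u] k u by simp
      qed
      then show ?thesis using k by blast
    qed
  qed
qed

text \<open>If \<open>W\<close> had a nonzero diagonal value, \<open>sectional_maximum\<close> would
  give a point where \<open>th\<close> and \<open>S\<close> vanish. There \<open>Bc\<close> is a
  multiple of \<open>Hc\<close>; this propagates and makes \<open>f\<close> constant, against
  \<open>nt\<close>.\<close>

lemma constant_curvature:
  assumes comp: "compact_space (mtop M)" and conn: "connected_space (mtop M)"
    and k: "\<kappa> ~= 0" and pos: "!!c x u. c \<in> atlas M ==> x \<in> Xc c ==> u ~= 0 ==> \<kappa> * g c x u u > 0"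
    and nt: "~ (ALL c:atlas M. ALL x:Xc c. ALL v. th c x v = 0)" and c: "c \<in> atlas M" and x: "x \<in> Xc c"
  shows "Kc c x b u v = - (hh c x u b *s v + hh c x v b *s u)"
proof -
  have tp: "tanno_pos (Xc c) (hh c) (Gc c) (f c) (th c) (S c)" if c: "c \<in> atlas M" for c
    using tanno_chart.rescale[OF tanno[OF c] k] pos[OF c]
    by (simp add: tanno_pos_def tanno_pos_axioms_def hh_def[abs_def] hc_Re[OF c])
  define w where "w c x u = Re (hh c x (Kc c x u u u + 2 *s (hh c x u u *s u)) u)" for c x u
  define qq where "qq c x u = Re (hh c x u u)" for c x u
  have hh_trans: "hh d (\<psi> c d x) (fd (\<psi> c d) x u) (fd (\<psi> c d) x v) = hh c x u v"
    if "c \<in> atlas M" "d \<in> atlas M" "x \<in> Ov c d" for c d x u v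
    unfolding hh_def h_trans[OF that] ..
  have w_trans: "w d (\<psi> c d x) (fd (\<psi> c d) x u) = w c x u"
    if t: "c \<in> atlas M" "d \<in> atlas M" "x \<in> Ov c d" for c d x u
    unfolding w_def K_trans[OF t] hh_trans[OF t] clinearvD(2)[OF d\<psi>_clinearv[OF t], symmetric] clinearvD(1)[OF d\<psi>_clinearv[OF t], symmetric] hh_trans[OF t] ..
  have qq_pos: "qq c x u > 0" if "c \<in> atlas M" "x \<in> Xc c" "u ~= 0" for c x u
    using pos[OF that] by (simp add: qq_def hh_def hc_Re[OF that(1)])
  have ww: "w c x u = Re (tanno_chart.WW (hh c) (Gc c) 1 x u u u u)" if c: "c \<in> atlas M" for c x u
  proof -
    interpret P: tanno_pos "Xc c" "hh c" "Gc c" "f c" "th c" "S c" by (rule tp[OF c])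
    have "P.W x u u u = Kc c x u u u + 2 *s (hh c x u u *s u)" by (simp add: P.W_def vec_eq_iff)
    then show ?thesis by (simp add: P.WW_def w_def)
  qed
  have zero: "w c x u <= 0 & 0 <= w c x u" if c: "c \<in> atlas M" and x: "x \<in> Xc c" for c x u
  proof -
    have "s * w c x u <= 0" if s: "s = 1 | s = -1" for s
    proof (rule ccontr)
      assume n: "~ ?thesis"
      have ne: "TM ~= {}" using pt_top[OF c x] by auto
      \<comment> \<open>The sign \<open>s\<close> treats maximum and minimum together. Dividing by
        the squared metric makes \<open>F\<close> invariant under scaling of \<open>u\<close>, so
        the unit sphere may be that of the coordinates.\<close>
      define F where "F c x u = s * w c x u / (qq c x u)\<^sup>2" for c x u
      let ?K = "sphere (0 :: 'n V) 1"
      have cont: "continuous_on (Xc d \<times> ?K) (%(x, u). F d x u)" if d: "d \<in> atlas M" for d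
      proof -
        interpret P: tanno_pos "Xc d" "hh d" "Gc d" "f d" "th d" "S d" by (rule tp[OF d])
        have sub: "Xc d \<times> ?K <= P.U0" by auto
        have "smooth_on (%z. P.WW (fst z) (snd z) (snd z) (snd z) (snd z)) P.U0" "smooth_on (%z. hh d (fst z) (snd z) (snd z)) P.U0"
          by (rule P.smooth_on_WW P.smooth_on_h2; (intro P.open_U0 P.smooth_fst P.smooth_snd)?; auto)+
        note c = this[THEN smooth_on_continuous, THEN continuous_on_subset, OF sub]
        have "continuous_on (Xc d \<times> ?K) (%z. s * Re (P.WW (fst z) (snd z) (snd z) (snd z) (snd z)) / (Re (hh d (fst z) (snd z) (snd z)))\<^sup>2)"
        proof (intro continuous_intros c)
          show "ALL z:Xc d \<times> ?K. (Re (hh d (fst z) (snd z) (snd z)))\<^sup>2 ~= 0"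
          proof
            fix z assume "z \<in> Xc d \<times> ?K"
            then have "fst z \<in> Xc d" "snd z ~= 0" by auto
            from qq_pos[OF d this] show "(Re (hh d (fst z) (snd z) (snd z)))\<^sup>2 ~= 0" by (simp add: qq_def)
          qed
        qed
        then show ?thesis by (simp add: F_def ww[OF d] qq_def case_prod_beta)
      qed
      obtain e m X0 where e: "e \<in> atlas M" "m \<in> Xc e" "X0 \<in> ?K"
        and le0: "ALL p:TM. EX d:atlas M. p \<in> fst d & (ALL u:?K. F d (snd d p) u <= F e m X0)"
      proof -
        have "EX c:atlas M. EX x:Xc c. EX k:?K. ALL p:TM. EX d:atlas M. p \<in> fst d & (ALL u:?K. F d (snd d p) u <= F c x k)"
          by (rule compact_max[OF comp ne compact_sphere _ cont]) simp
        then show ?thesis using that by blast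
      qed
      define \<sigma> where "\<sigma> = F e m X0"
      \<comment> \<open>\<open>compact_max\<close> bounds \<open>F\<close> on unit vectors in some
        chart \<open>d'\<close>. Homogeneity of degree four on both sides extends this to all
        vectors, and the transformation laws bring it back to \<open>d\<close>.\<close>
      have le: "s * w d y u <= \<sigma> * (qq d y u)\<^sup>2" if d: "d \<in> atlas M" and y: "y \<in> Xc d" for d y u
      proof (cases "u = 0")
        case True
        interpret P: tanno_pos "Xc d" "hh d" "Gc d" "f d" "th d" "S d" by (rule tp[OF d])
        show ?thesis using True by (simp add: ww[OF d] qq_def P.WW_zero[OF y] P.h_zero[OF y])
      next
        case False
        obtain d' where d': "d' \<in> atlas M" "pt d y \<in> fst d'" "!!u. u \<in> ?K ==> F d' (snd d' (pt d y)) u <= \<sigma>"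
          using le0 pt_top[OF d y] unfolding \<sigma>_def by blast
        interpret P: tanno_pos "Xc d'" "hh d'" "Gc d'" "f d'" "th d'" "S d'" by (rule tp[OF d'(1)])
        have O: "y \<in> Ov d d'" using y d'(2) by (simp add: Ov_iff[OF d])
        let ?y = "\<psi> d d' y" define u' where "u' = fd (\<psi> d d') y u"
        have yX: "?y \<in> Xc d'" by (rule \<psi>_Xc[OF d d'(1) O])
        have u0: "u' ~= 0" using d\<psi>_inv[OF d d'(1) O, of u] False
            linear_0[OF clinearv_linear[OF d\<psi>_clinearv[OF d'(1) d \<psi>_Ov[OF d d'(1) O]]]] unfolding u'_def by metis
        define N where "N = norm u'" define e where "e = of_real (inverse N) *s u'"
        have N: "N > 0" using u0 by (simp add: N_def)
        have eK: "e \<in> ?K" using N by (simp add: e_def norm_smult norm_inverse flip: N_def)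
        then have "e ~= 0" by auto
        then have "s * w d' ?y e <= \<sigma> * (qq d' ?y e)\<^sup>2"
          using d'(3)[OF eK] qq_pos[OF d'(1) yX, of e] by (auto simp: F_def \<psi>_eq[OF d] divide_le_eq)
        moreover have ue: "u' = of_real N *s e" using N by (simp add: e_def)
        then have "w d' ?y u' = N ^ 4 * w d' ?y e" "qq d' ?y u' = N\<^sup>2 * qq d' ?y e"
          by (simp_all only: ww[OF d'(1)] qq_def P.WW_scale[OF yX] P.h_scale[OF yX] P.h_scale2[OF yX])
            (simp_all add: power4_eq_xxxx power2_eq_square)
        ultimately have "s * w d' ?y u' <= \<sigma> * (qq d' ?y u')\<^sup>2"
          using mult_left_mono[of "s * w d' ?y e" "\<sigma> * (qq d' ?y e)\<^sup>2" "N ^ 4"] by (simp add: power_mult_distrib mult_ac flip: power_mult)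
        then show ?thesis
          unfolding u'_def w_trans[OF d d'(1) O] qq_def hh_trans[OF d d'(1) O] .
      qed
      have "0 < \<sigma> * (qq c x u)\<^sup>2" using le[OF c x, of u] n by simp
      then have \<sigma>: "\<sigma> > 0" by (simp add: zero_less_mult_iff)
      have X0: "X0 ~= 0" using e(3) by auto
      interpret P: tanno_pos "Xc e" "hh e" "Gc e" "f e" "th e" "S e" by (rule tp[OF e(1)])
      have "s * w e m X0 = \<sigma> * (qq e m X0)\<^sup>2" using qq_pos[OF e(1,2) X0] by (simp add: \<sigma>_def F_def)
      then have 0: "th e m v = 0" "S e m u v = 0" for u v
        using P.sectional_maximum[OF e(2) X0 \<sigma>, of s] le[OF e(1)] by (auto simp: ww[OF e(1)] qq_def)
      have B: "Bc d y v r = f e m * Hc d y v r" if "d \<in> atlas M" "y \<in> Xc d" for d y v r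
        by (rule forms_propagate[where P="%H B. B = f e m * H", OF conn e(1,2) _ that])
          (simp add: Bc_def Hc_def 0 algebra_simps)
      have "f d y = f e m" if d: "d \<in> atlas M" and y: "y \<in> Xc d" for d y
      proof -
        interpret Q: tanno_pos "Xc d" "hh d" "Gc d" "f d" "th d" "S d" by (rule tp[OF d])
        have "g d y 0 0 = 0" using bilinear_lzero[OF g_bilinear[OF d y]] by simp
        then show ?thesis using B[OF d y, of 0 1] by (simp add: Bc_def Hc_def Q.S_zero[OF y] Q.th_zero[OF y])
      qed
      then have "th d y v = 0" if "d \<in> atlas M" "y \<in> Xc d" for d y v by (rule constant_th[OF that(1) _ that(2)]) (use that in auto)
      then show False using nt by blast
    qed
    from this[of 1] this[of "-1"] show ?thesis by simp
  qed
  interpret P: tanno_pos "Xc c" "hh c" "Gc c" "f c" "th c" "S c" by (rule tp[OF c])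
  have "P.WW x u v b d = 0" for u v b d
    by (rule P.WW_diagonal_zero[OF x]) (use zero[OF c x] ww[OF c, of x] in "simp add: antisym")
  then have "P.W x b u v = 0" using P.h_nondeg[OF x] by (simp add: P.WW_def)
  then have "Kc c x b u v + (hh c x u b *s v + hh c x v b *s u) = 0" by (simp add: P.W_def)
  then show ?thesis by (rule eq_neg_iff_add_eq_0[THEN iffD2])
qed

end

section \<open>The Fubini-Study form in homogeneous coordinates\<close>

lemma herm_add: "herm (u + u') v = herm u v + herm u' v" "herm v (u + u') = herm v u + herm v u'"
  and herm_scale: "herm (a *s u) v = a * herm u v" "herm v (a *s u) = cnj a * herm v u"
  and herm_minus: "herm (- u) v = - herm u v" "herm v (- u) = - herm v u"
  and herm_diff: "herm (u - u') v = herm u v - herm u' v" "herm v (u - u') = herm v u - herm v u'"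
  and herm_zero: "herm 0 v = 0" "herm v 0 = 0"
  by (simp_all add: herm_def sum.distrib sum_distrib_left sum_negf sum_subtractf algebra_simps)
lemmas herm_simps = herm_add herm_scale herm_minus herm_diff herm_zero

lemma cnj_herm: "cnj (herm u v) = herm v u"
  by (simp add: herm_def cnj_sum mult.commute)
lemma herm_self: "herm z z = of_real ((norm z)\<^sup>2)"
  by (simp add: herm_def norm_vec_def L2_set_def sum_nonneg complex_norm_square[symmetric] of_real_sum)
lemma herm_self_0 [simp]: "herm z z = 0 \<longleftrightarrow> z = 0" by (simp add: herm_self)
lemma Re_herm: "Re (herm u v) = u \<bullet> v"
  by (simp add: herm_def inner_vec_def inner_complex_def)
lemma bounded_bilinear_herm: "bounded_bilinear (herm :: 'k::finite V => _)"
proof -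
  have "bilinear (herm :: 'k V => _)"
    unfolding bilinear_def by (auto intro!: linearI simp: herm_simps scaleR_vec_eq scaleR_conv_of_real)
  then show ?thesis by (simp add: bilinear_conv_bounded_bilinear)
qed
lemma herm_axis: "herm (axis i 1) u = cnj (u $ i)" "herm u (axis i 1) = u $ i"
  by (simp_all add: herm_def axis_def if_distrib if_distribR cong: if_cong)
text \<open>The pull-back of the Fubini-Study form to homogeneous coordinates: the mixed Hessian of
  the logarithm of the squared norm.\<close>

definition hF :: "'k::finite V => 'k V => 'k V => complex" where
  "hF z u v = herm u v / herm z z - herm u z * herm z v / (herm z z)\<^sup>2"
text \<open>Minus the complex linear part of the differential of that logarithm. It takes the part
  of Christoffel symbols for the degenerate form \<open>hF\<close>.\<close>

definition aF :: "'k::finite V => 'k V => complex" where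
  "aF z u = - herm u z / herm z z"

lemma hF_simps: "hF z (u + u') v = hF z u v + hF z u' v" "hF z v (u + u') = hF z v u + hF z v u'"
  "hF z (a *s u) v = a * hF z u v" "hF z v (a *s u) = cnj a * hF z v u"
  by (simp_all add: hF_def herm_simps add_divide_distrib algebra_simps)
lemma aF_simps: "aF z (u + u') = aF z u + aF z u'" "aF z (a *s u) = a * aF z u"
  by (simp_all add: aF_def herm_simps diff_divide_distrib)
lemma hF_z: "hF z z v = 0" "hF z v z = 0"
  by (cases "z = 0"; simp add: hF_def herm_simps power2_eq_square)+
lemma hF_homogeneous: "c ~= 0 ==> hF (c *s z) (c *s u) (c *s v) = hF z u v"
  by (cases "z = 0") (simp_all add: hF_def herm_simps power2_eq_square field_simps)
lemma hF_herm: "cnj (hF z u v) = hF z v u"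
  by (simp add: hF_def cnj_herm mult.commute)

text \<open>Subtracting the orthogonal projection of \<open>u\<close> to the line of
  \<open>z\<close> does not change \<open>hF\<close>, and on the orthogonal complement
  \<open>hF\<close> is the standard form divided by the squared norm of \<open>z\<close>.\<close>

lemma hF_degenerate:
  assumes z: "z ~= 0" and u: "Re (hF z u u) <= 0" shows "u = (herm u z / herm z z) *s z"
proof -
  let ?a = "herm u z / herm z z" let ?x = "u - ?a *s z"
  have N: "herm z z ~= 0" using z by simp
  have x: "herm ?x z = 0" "herm z ?x = 0"
    using N cnj_herm[of u z] cnj_herm[of z z] by (simp_all add: herm_simps)
  have "hF z u u = hF z (?x + ?a *s z) (?x + ?a *s z)" by simp
  also have "... = hF z ?x ?x" unfolding hF_simps hF_z by simp
  also have "... = herm ?x ?x / herm z z" unfolding hF_def x by simp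
  also have "... = of_real ((norm ?x)\<^sup>2 / (norm z)\<^sup>2)" by (simp add: herm_self)
  finally have "(norm ?x)\<^sup>2 / (norm z)\<^sup>2 <= 0" using u by simp
  then have "(norm ?x)\<^sup>2 <= 0" using z by (simp add: divide_le_0_iff)
  then show ?thesis by simp
qed

lemma hd_herm:
  "der u u' x ==> der v v' x ==> der (%y. herm (u y) (v y)) (%w. herm (u x) (v' w) + herm (u' w) (v x)) x"
  by (rule bounded_bilinear.FDERIV[OF bounded_bilinear_herm])

lemma aF_deriv:
  assumes z: "z ~= 0"
  shows "der (%z. aF z u) (%w. aF z w * aF z u - hF z u w) z"
proof -
  have N: "herm z z ~= 0" using z by simp
  note i = has_derivative_ident and c = has_derivative_const
  show ?thesis unfolding aF_def
    by (rule has_derivative_eq_rhs[OF has_derivative_divide'[OF has_derivative_minus[OF hd_herm[OF c i]] hd_herm[OF i i] N]])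
      (use N in "simp add: fun_eq_iff hF_def herm_simps field_simps power2_eq_square")
qed

lemma hF_deriv:
  fixes z :: "'k::finite V"
  assumes z: "z ~= 0"
  shows "der (%z. hF z u v) (%w. aF z w * hF z u v + aF z u * hF z w v + cnj (aF z w) * hF z u v + cnj (aF z v) * hF z u w) z"
proof -
  have N: "herm z z ~= 0" using z by simp
  note i = has_derivative_ident and c = has_derivative_const
  define I where "I z = inverse (herm z z)" for z :: "'k V"
  have e: "hF z u v = herm u v * I z - herm u z * herm z v * (I z * I z)" "aF z u = - herm u z * I z" for z u v
    by (simp_all add: hF_def aF_def I_def power2_eq_square divide_inverse)
  have I: "der I (%w. - (I z * (herm z w + herm w z) * I z)) z"
  proof -
    have "der (%z. herm z z) (%w. herm z w + herm w z) z" by (rule hd_herm[OF i i])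
    from Deriv.has_derivative_inverse[OF _ this] show ?thesis unfolding I_def using N by simp
  qed
  show ?thesis unfolding e
    by (rule has_derivative_eq_rhs[OF has_derivative_diff[OF has_derivative_mult_right[OF I]
        has_derivative_mult[OF has_derivative_mult[OF hd_herm[OF c i] hd_herm[OF i c]] has_derivative_mult[OF I I]]]])
      (simp add: fun_eq_iff cnj_herm herm_simps I_def algebra_simps)
qed

lemma smooth_on_vec:
  fixes f :: "'k::finite => 'a::euclidean_space => 'b::euclidean_space"
  assumes S: "open S" and f: "!!j. smooth_on (f j) S" shows "smooth_on (%x. \<chi> j. f j x) S"
proof -
  have "bounded_linear (axis j :: 'b => 'b ^ 'k)" for j
    by (simp add: linear_conv_bounded_linear[symmetric]) (rule linearI; simp add: vec_eq_iff axis_def)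
  then have "smooth_on (%x. \<Sum>j\<in>UNIV. axis j (f j x)) S" by (intro smooth_on_sum S smooth_on_linear[OF _ S f])
  moreover have "(\<Sum>j\<in>UNIV. axis j (f j x)) = (\<chi> j. f j x)" for x
    by (simp add: vec_eq_iff axis_def if_distrib if_distribR cong: if_cong)
  ultimately show ?thesis by simp
qed

lemma hd_vec:
  fixes f :: "'k::finite => 'a::euclidean_space => 'b::euclidean_space"
  assumes f: "!!j. der (f j) (f' j) x" shows "der (%x. \<chi> j. f j x) (%w. \<chi> j. f' j w) x"
proof -
  have b: "bounded_linear (axis j :: 'b => 'b ^ 'k)" for j
    by (simp add: linear_conv_bounded_linear[symmetric]) (rule linearI; simp add: vec_eq_iff axis_def)
  have "der (%x. \<Sum>j\<in>UNIV. axis j (f j x)) (%w. \<Sum>j\<in>UNIV. axis j (f' j w)) x"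
    by (intro has_derivative_sum bounded_linear.has_derivative[OF b] f)
  moreover have "(\<Sum>j\<in>UNIV. axis j (a j)) = (\<chi> j. a j)" for a :: "'k => 'b"
    by (simp add: vec_eq_iff axis_def if_distrib if_distribR cong: if_cong)
  ultimately show ?thesis by simp
qed

text \<open>Linear maps are stored by their values on the standard basis, so that they are points of
  a Euclidean space and can be unknowns of a total equation.\<close>

definition lin :: "'n V ^ 'k::finite => 'k V => 'n::finite V" where "lin P u = (\<Sum>j\<in>UNIV. u $ j *s P $ j)"
definition lin1 :: "'k::finite V => 'k V => complex" where "lin1 a u = (\<Sum>j\<in>UNIV. u $ j * a $ j)"

lemma lin_simps: "lin P (u + v) = lin P u + lin P v" "lin P (a *s u) = a *s lin P u" "lin (P + Q) u = lin P u + lin Q u"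
  "lin1 b (u + v) = lin1 b u + lin1 b v" "lin1 b (a *s u) = a * lin1 b u"
  by (simp_all add: lin_def lin1_def vec_eq_iff sum.distrib sum_distrib_left algebra_simps)
lemma lin_axis: "lin P (axis j 1) = P $ j" "lin1 a (axis j 1) = a $ j"
  by (simp_all add: lin_def lin1_def vec_eq_iff axis_def if_distrib if_distribR cong: if_cong)
lemma linear_lin1: "linear (%a. lin1 a u)"
  by (rule linearI; unfold lin1_def; simp add: scaleR_sum_right sum.distrib distrib_left)
lemma linear_lin: "linear (%P. lin P u)"
proof (rule linearI)
  show "lin (r *\<^sub>R P) u = r *\<^sub>R lin P u" for r P by (simp add: lin_def vec_eq_iff scaleR_sum_right)
qed (rule lin_simps)

lemma lin_eq: "clinearv L ==> lin (\<chi> j. L (axis j 1)) = L"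
  by (rule ext) (simp add: lin_def clinearv_expand[symmetric])
lemma lin1_eq: "clinear L ==> lin1 (\<chi> j. L (axis j 1)) = L"
  by (rule ext) (simp add: lin1_def clinear_expand[symmetric])

section \<open>Developing maps\<close>

locale cp_manifold = tanno_manifold M g f th S \<kappa>
  for M :: "('m, 'n::finite) charted" and g f th S \<kappa> +
  assumes comp: "compact_space (mtop M)" and conn: "connected_space (mtop M)"
    and k: "\<kappa> ~= 0" and pos: "!!c x u. c \<in> atlas M ==> x \<in> Xc c ==> u ~= 0 ==> \<kappa> * g c x u u > 0"
    and curv: "!!c x b u v. c \<in> atlas M ==> x \<in> Xc c ==> Kc c x b u v = - (hh c x u b *s v + hh c x v b *s u)"
begin

lemma tp: "c \<in> atlas M ==> tanno_pos (Xc c) (hh c) (Gc c) (f c) (th c) (S c)"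
  using tanno_chart.rescale[OF tanno k] pos by (simp add: tanno_pos_def tanno_pos_axioms_def hh_def[abs_def] hc_Re)

lemma hh_trans: "c \<in> atlas M ==> d \<in> atlas M ==> x \<in> Ov c d ==> hh d (\<psi> c d x) (fd (\<psi> c d) x u) (fd (\<psi> c d) x v) = hh c x u v"
  unfolding hh_def by (simp add: h_trans)

text \<open>The unknowns are the map \<open>F\<close>, its differential \<open>P\<close> (by columns) and a linear form \<open>a\<close>, which is \<open>aF\<close>
  for developing maps. With \<open>a\<close> as an unknown the system is integrable without side conditions.\<close>

definition devsys :: "('m, 'n) chart => ('n option V) \<times> ('n V) \<times> ('n V ^ ('n option)) \<times> ('n option V) =>
    'n option V => ('n V) \<times> ('n V ^ ('n option)) \<times> ('n option V)" where
  "devsys c p u = (let F = fst (snd p); P = fst (snd (snd p)); a = snd (snd (snd p)) in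
     (lin P u, \<chi> j. - Gc c F (lin P u) (P $ j) + lin1 a u *s P $ j + a $ j *s lin P u,
      \<chi> j. lin1 a u * a $ j - hh c F (P $ j) (lin P u)))"

abbreviation "Omd c == (UNIV :: ('n option V) set) \<times> Xc c \<times> (UNIV :: ('n V ^ ('n option)) set) \<times> (UNIV :: ('n option V) set)"

text \<open>Commuting the derivatives of the differential \<open>P\<close> produces the curvature.
  If it has the form \<open>curv\<close>, it is compensated by the \<open>hh\<close>-term in the
  equation for \<open>a\<close>.\<close>

lemma devsys_total:
  assumes c: "c \<in> atlas M" shows "total_eq (Omd c) (devsys c)" and "integrable_eq (Omd c) (devsys c)"
proof -
  interpret P: tanno_pos "Xc c" "hh c" "Gc c" "f c" "th c" "S c" by (rule tp[OF c])
  let ?F = "%p::('n option V) \<times> ('n V) \<times> ('n V ^ ('n option)) \<times> ('n option V). fst (snd p)"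
  let ?P = "%p::('n option V) \<times> ('n V) \<times> ('n V ^ ('n option)) \<times> ('n option V). fst (snd (snd p))"
  let ?a = "%p::('n option V) \<times> ('n V) \<times> ('n V ^ ('n option)) \<times> ('n option V). snd (snd (snd p))"
  have O: "open (Omd c)" by (intro open_Times P.open_X open_UNIV)
  have bl: "bounded_linear ?F" "bounded_linear (%p. lin (?P p) u)" "bounded_linear (%p. lin1 (?a p) u)"
     "bounded_linear (%p. ?P p $ j)" "bounded_linear (%p. ?a p $ j)" for u j
    by (intro bounded_linear_compose[OF _ bounded_linear_compose[OF _ bounded_linear_snd]] bounded_linear_compose[OF _ bounded_linear_snd]
        bounded_linear_fst bounded_linear_snd bounded_linear_compose[OF _ bounded_linear_compose[OF bounded_linear_fst bounded_linear_compose[OF bounded_linear_snd bounded_linear_snd]]]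
        bounded_linear_compose[OF _ bounded_linear_compose[OF bounded_linear_snd bounded_linear_compose[OF bounded_linear_snd bounded_linear_snd]]]
        bounded_linear_vec_nth linear_lin linear_lin1 | simp add: linear_conv_bounded_linear[symmetric])+
  note sb = smooth_on_linear[OF bl(1) O smooth_on_id[OF O]] smooth_on_linear[OF bl(2) O smooth_on_id[OF O]] smooth_on_linear[OF bl(3) O smooth_on_id[OF O]]
     smooth_on_linear[OF bl(4) O smooth_on_id[OF O]] smooth_on_linear[OF bl(5) O smooth_on_id[OF O]]
  show T: "total_eq (Omd c) (devsys c)" unfolding total_eq_def
  proof (intro conjI O ballI allI)
    fix p assume "p \<in> Omd c"
    then have x: "?F p \<in> Xc c" by auto
    note s = lin_simps P.Gm_simps[OF x] P.h_simps[OF x] vec_eq_iff algebra_simps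
    show "linear (devsys c p)" unfolding devsys_def Let_def
    proof (rule linearI, goal_cases)
      case (2 r b)
      show ?case unfolding scaleR_vec_eq[of r b] by (simp add: s scaleR_conv_of_real[where 'a=complex])
    qed (simp add: s)
  next
    fix v show "smooth_on (%p. devsys c p v) (Omd c)" unfolding devsys_def Let_def
      by (intro smooth_on_Pair O smooth_on_vec smooth_on_add smooth_on_uminus smooth_on_diff smooth_on_smult smooth_on_mult
          P.smooth_on_Gm2 P.smooth_on_h2 sb) auto
  qed
  show "integrable_eq (Omd c) (devsys c)" unfolding integrable_eq_def
  proof (intro ballI allI)
    fix p u v assume p: "p \<in> Omd c"
    have FX: "?F y \<in> Xc c" if "y \<in> Omd c" for y using that by auto
    have x: "?F p \<in> Xc c" by (rule FX[OF p])
    note hb = bounded_linear_imp_has_derivative[OF bl(1)] bounded_linear_imp_has_derivative[OF bl(2)] bounded_linear_imp_has_derivative[OF bl(3)]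
      bounded_linear_imp_has_derivative[OF bl(4)] bounded_linear_imp_has_derivative[OF bl(5)]
    note sm = bounded_bilinear.FDERIV[OF bounded_bilinear_smult]
    define D where "D v q = (lin (?P q) v,
      \<chi> j. - (P.DGm (?F p) (lin (?P p) v) (?P p $ j) (?F q) + Gc c (?F p) (lin (?P q) v) (?P p $ j) + Gc c (?F p) (lin (?P p) v) (?P q $ j))
        + (lin1 (?a p) v *s ?P q $ j + lin1 (?a q) v *s ?P p $ j) + (?a p $ j *s lin (?P q) v + ?a q $ j *s lin (?P p) v),
      \<chi> j. (lin1 (?a p) v * ?a q $ j + lin1 (?a q) v * ?a p $ j) - (hh c (?F p) (Gc c (?F p) (?F q) (?P p $ j)) (lin (?P p) v)
        + hh c (?F p) (?P p $ j) (Gc c (?F p) (?F q) (lin (?P p) v)) + hh c (?F p) (?P q $ j) (lin (?P p) v) + hh c (?F p) (?P p $ j) (lin (?P q) v)))" for v q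
    have "der (%p. devsys c p v) (D v) p" for v
      unfolding devsys_def Let_def D_def
      by (intro has_derivative_Pair hd_vec has_derivative_add has_derivative_diff has_derivative_minus has_derivative_mult sm hb
          P.hd_Gm_comp[OF O p FX hb(1)] P.hd_h_comp[OF O p FX hb(1)])
    then have Dw: "Dw (devsys c) p v = D v" for v using frechet_derivative_at by metis
    define F P a where "F = ?F p" "P = ?P p" "a = ?a p"
    have q: "?F (u, devsys c p u) = lin P u" "?P (u, devsys c p u) = (\<chi> j. - Gc c F (lin P u) (P $ j) + lin1 a u *s P $ j + a $ j *s lin P u)"
      "?a (u, devsys c p u) = (\<chi> j. lin1 a u * a $ j - hh c F (P $ j) (lin P u))" for u
      by (simp_all add: devsys_def Let_def F_P_a_def)
    have xF: "F \<in> Xc c" using x by (simp add: F_P_a_def)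
    note G = P.Gm_simps[OF xF] and H = P.h_simps[OF xF]
    have linQ: "lin (\<chi> j. - Gc c F (lin P u) (P $ j) + lin1 a u *s P $ j + a $ j *s lin P u) v = - Gc c F (lin P u) (lin P v) + lin1 a u *s lin P v + lin1 a v *s lin P u" for u v
    proof -
      have "clinearv (%v. - Gc c F (lin P u) (lin P v) + lin1 a u *s lin P v + lin1 a v *s lin P u)"
        by (simp add: clinearv_def lin_simps G vec_eq_iff algebra_simps)
      from fun_cong[OF lin_eq[OF this], of v] show ?thesis by (simp add: lin_axis)
    qed
    have linb: "lin1 (\<chi> j. lin1 a u * a $ j - hh c F (P $ j) (lin P u)) v = lin1 a u * lin1 a v - hh c F (lin P v) (lin P u)" for u v
    proof -
      have "clinear (%v. lin1 a u * lin1 a v - hh c F (lin P v) (lin P u))"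
        by (simp add: clinear_def lin_simps H algebra_simps)
      from fun_cong[OF lin1_eq[OF this], of v] show ?thesis by (simp add: lin_axis)
    qed
    \<comment> \<open>The assumption \<open>curv\<close> as a commutator of derivatives of
      Christoffel symbols; \<open>Gm1_commute\<close> removes their complex linear parts.\<close>
    have cv: "P.DGm F r x p - P.DGm F p x r = Gc c F r (Gc c F p x) - Gc c F p (Gc c F r x)
       - (hh c F r p *s x + hh c F x p *s r) + (hh c F p r *s x + hh c F x r *s p)" for p r x
    proof -
      have K: "P.K F b u v = - (hh c F u b *s v + hh c F v b *s u)" for b u v using curv[OF c xF] .
      show ?thesis using P.Gm1_commute[OF xF, of p r x] unfolding P.DGm_split K by (simp add: algebra_simps)
    qed
    show "Dw (devsys c) p v (u, devsys c p u) = Dw (devsys c) p u (v, devsys c p v)"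
      unfolding Dw D_def prod.inject q linQ linb F_P_a_def[symmetric]
    proof (intro conjI)
      show "- Gc c F (lin P u) (lin P v) + lin1 a u *s lin P v + lin1 a v *s lin P u = - Gc c F (lin P v) (lin P u) + lin1 a v *s lin P u + lin1 a u *s lin P v"
        by (simp add: P.Gm_sym[OF xF, of "lin P u"])
      let ?r = "lin P v" and ?p = "lin P u"
      show "(\<chi> j. - (P.DGm F ?r (P $ j) ?p + Gc c F (- Gc c F ?p ?r + lin1 a u *s ?r + lin1 a v *s ?p) (P $ j) + Gc c F ?r ((\<chi> j. - Gc c F ?p (P $ j) + lin1 a u *s P $ j + a $ j *s ?p) $ j))
        + (lin1 a v *s (\<chi> j. - Gc c F ?p (P $ j) + lin1 a u *s P $ j + a $ j *s ?p) $ j + (lin1 a u * lin1 a v - hh c F ?r ?p) *s P $ j)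
        + (a $ j *s (- Gc c F ?p ?r + lin1 a u *s ?r + lin1 a v *s ?p) + (\<chi> j. lin1 a u * a $ j - hh c F (P $ j) ?p) $ j *s ?r)) =
        (\<chi> j. - (P.DGm F ?p (P $ j) ?r + Gc c F (- Gc c F ?r ?p + lin1 a v *s ?p + lin1 a u *s ?r) (P $ j) + Gc c F ?p ((\<chi> j. - Gc c F ?r (P $ j) + lin1 a v *s P $ j + a $ j *s ?r) $ j))
        + (lin1 a u *s (\<chi> j. - Gc c F ?r (P $ j) + lin1 a v *s P $ j + a $ j *s ?r) $ j + (lin1 a v * lin1 a u - hh c F ?p ?r) *s P $ j)
        + (a $ j *s (- Gc c F ?r ?p + lin1 a v *s ?p + lin1 a u *s ?r) + (\<chi> j. lin1 a v * a $ j - hh c F (P $ j) ?r) $ j *s ?p))"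
      proof (subst vec_eq_iff, rule allI, simp only: vec_lambda_beta, goal_cases)
        case (1 j)
        have "P.DGm F ?r (P $ j) ?p = P.DGm F ?p (P $ j) ?r + Gc c F ?r (Gc c F ?p (P $ j)) - Gc c F ?p (Gc c F ?r (P $ j))
       - (hh c F ?r ?p *s P $ j + hh c F (P $ j) ?p *s ?r) + (hh c F ?p ?r *s P $ j + hh c F (P $ j) ?r *s ?p)"
          using cv[of ?r "P $ j" ?p] by (simp add: algebra_simps)
        then show ?case
          by (simp only: G P.Gm_sym[OF xF, of ?r ?p]) (simp add: vec_eq_iff algebra_simps)
      qed
      show "(\<chi> j. (lin1 a v * (\<chi> j. lin1 a u * a $ j - hh c F (P $ j) ?p) $ j + (lin1 a u * lin1 a v - hh c F ?r ?p) * a $ j)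
        - (hh c F (Gc c F ?p (P $ j)) ?r + hh c F (P $ j) (Gc c F ?p ?r) + hh c F ((\<chi> j. - Gc c F ?p (P $ j) + lin1 a u *s P $ j + a $ j *s ?p) $ j) ?r
           + hh c F (P $ j) (- Gc c F ?p ?r + lin1 a u *s ?r + lin1 a v *s ?p))) =
        (\<chi> j. (lin1 a u * (\<chi> j. lin1 a v * a $ j - hh c F (P $ j) ?r) $ j + (lin1 a v * lin1 a u - hh c F ?p ?r) * a $ j)
        - (hh c F (Gc c F ?r (P $ j)) ?p + hh c F (P $ j) (Gc c F ?r ?p) + hh c F ((\<chi> j. - Gc c F ?r (P $ j) + lin1 a v *s P $ j + a $ j *s ?r) $ j) ?p
           + hh c F (P $ j) (- Gc c F ?r ?p + lin1 a v *s ?p + lin1 a u *s ?r)))"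
        by (simp add: vec_eq_iff H algebra_simps)
    qed
  qed
qed

end

lemma clinear_eqI: "clinear p ==> clinear q ==> (!!i. p (axis i 1) = q (axis i 1)) ==> p u = q u"
  using clinear_expand[of p u] clinear_expand[of q u] by simp

lemma sesquilinear_eqI:
  assumes "!!v. clinear (%u. B u v)" "!!v. clinear (%u. B' u v)" "!!u. clinear (%v. cnj (B u v))" "!!u. clinear (%v. cnj (B' u v))"
    and "!!i j. B (axis i 1) (axis j 1) = B' (axis i 1) (axis j 1)"
  shows "B u v = B' u v"
proof -
  have "B u (axis j 1) = B' u (axis j 1)" for u j
    by (rule clinear_eqI[where p="%u. B u (axis j 1)" and q="%u. B' u (axis j 1)", OF assms(1,2,5)])
  then have c: "cnj (B u (axis j 1)) = cnj (B' u (axis j 1))" for u j by (rule arg_cong)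
  have "cnj (B u v) = cnj (B' u v)"
    by (rule clinear_eqI[where p="%v. cnj (B u v)" and q="%v. cnj (B' u v)", OF assms(3,4) c])
  then show ?thesis by simp
qed

lemma hF_clinear: "clinear (%u. hF z u v)" "clinear (%v. cnj (hF z u v))" "clinear (aF z)"
  by (simp_all add: clinear_def hF_simps aF_simps)

text \<open>The system satisfied by the pull-back \<open>hh (P u, P v)\<close> and \<open>a\<close> along solutions of \<open>devsys\<close>; \<open>hF\<close> and \<open>aF\<close>
  solve it as well.\<close>

definition gramsys :: "('k V) \<times> ('k V ^ 'k) \<times> ('k V) => 'k::finite V => ('k V ^ 'k) \<times> ('k V)" where
  "gramsys p w = (let B = fst (snd p); b = snd (snd p) in
     (\<chi> i j. lin1 b w * B $ i $ j + b $ i * (\<Sum>k\<in>UNIV. w $ k * B $ k $ j) + cnj (lin1 b w) * B $ i $ j + cnj (b $ j) * (\<Sum>k\<in>UNIV. cnj (w $ k) * B $ i $ k),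
      \<chi> j. lin1 b w * b $ j - (\<Sum>k\<in>UNIV. cnj (w $ k) * B $ j $ k)))"

lemma gramsys_total: "total_eq UNIV (gramsys :: ('k::finite V) \<times> ('k V ^ 'k) \<times> ('k V) => _)"
proof -
  let ?B = "%p::('k V) \<times> ('k V ^ 'k) \<times> ('k V). fst (snd p)"
  let ?b = "%p::('k V) \<times> ('k V ^ 'k) \<times> ('k V). snd (snd p)"
  have bl: "bounded_linear (%p. ?B p $ i $ j)" "bounded_linear (%p. ?b p $ j)" "bounded_linear (%p. lin1 (?b p) w)" for i j w
    using bounded_linear_compose[OF bounded_linear_compose[OF bounded_linear_vec_nth bounded_linear_vec_nth] bounded_linear_compose[OF bounded_linear_fst bounded_linear_snd]]
      bounded_linear_compose[OF bounded_linear_vec_nth bounded_linear_compose[OF bounded_linear_snd bounded_linear_snd]]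
      bounded_linear_compose[OF _ bounded_linear_compose[OF bounded_linear_snd bounded_linear_snd]] linear_lin1[unfolded linear_conv_bounded_linear] by blast+
  note sb = smooth_on_linear[OF bl(1) open_UNIV smooth_on_id[OF open_UNIV]] smooth_on_linear[OF bl(2) open_UNIV smooth_on_id[OF open_UNIV]] smooth_on_linear[OF bl(3) open_UNIV smooth_on_id[OF open_UNIV]]
  show ?thesis unfolding total_eq_def
  proof (intro conjI open_UNIV ballI allI)
    fix p :: "('k V) \<times> ('k V ^ 'k) \<times> ('k V)"
    note s = lin_simps vec_eq_iff sum.distrib sum_distrib_left distrib_left
    show "linear (gramsys p)" unfolding gramsys_def Let_def
    proof (rule linearI, goal_cases)
      case (2 r b)
      show ?case unfolding scaleR_vec_eq[of r b] by (simp add: s scaleR_conv_of_real[where 'a=complex] algebra_simps)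
    qed (simp add: s algebra_simps)
    show "smooth_on (%p. gramsys p v) UNIV" for v :: "'k V" unfolding gramsys_def Let_def
      by (intro smooth_on_Pair open_UNIV smooth_on_vec smooth_on_add smooth_on_diff smooth_on_mult smooth_on_sum smooth_on_const
          smooth_on_linear[OF bounded_linear_cnj] sb)
  qed
qed

section \<open>Developing maps and their differential system\<close>

context cp_manifold
begin

text \<open>Holomorphic maps from homogeneous coordinates that pull \<open>hh\<close> back to
  \<open>hF\<close>. The conditions are stated for all charts; by \<open>devI\<close> one chart
  around each image point suffices.\<close>

definition dev :: "('n option V) set => ('n option V => 'm) => bool" where
  "dev D G \<longleftrightarrow> smooth_into D G & 0 \<notin> D & (ALL c:atlas M. ALL z:D. G z \<in> fst c --> clinearv (fd (snd c o G) z) &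
     (ALL u v. hh c (snd c (G z)) (fd (snd c o G) z u) (fd (snd c o G) z v) = hF z u v))"

lemma chart_change:
  fixes G :: "'n option V => 'm"
  assumes G: "smooth_into D G" and c: "c \<in> atlas M" and d: "d \<in> atlas M" and z: "z \<in> D" "G z \<in> fst c" "G z \<in> fst d"
  shows "fd (snd d o G) z = (%u. fd (\<psi> c d) (snd c (G z)) (fd (snd c o G) z u))"
proof -
  let ?D = "D \<inter> G -` fst c \<inter> (D \<inter> G -` fst d)"
  have O: "snd c (G z) \<in> Ov c d" by (rule snd_Ov[OF c z(2,3)])
  have D: "open ?D" "z \<in> ?D"
    using smooth_into_open[OF G openin_chart[OF c]] smooth_into_open[OF G openin_chart[OF d]] z by auto
  have "der (%z. \<psi> c d ((snd c o G) z)) (%u. fd (\<psi> c d) (snd c (G z)) (fd (snd c o G) z u)) z"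
    using has_derivative_compose[OF smooth_on_deriv[OF smooth_into_chart[OF G c]] hd_\<psi>[OF c d]] z O by simp
  then have "der (snd d o G) (%u. fd (\<psi> c d) (snd c (G z)) (fd (snd c o G) z u)) z"
    by (rule der_cong[OF _ D]) (use pt_snd[OF c] in "auto simp: \<psi>_eq[OF c]")
  from frechet_derivative_at[OF this] show ?thesis by simp
qed

lemma devI:
  assumes G: "smooth_into D G" and 0: "0 \<notin> D"
    and D: "!!z. z \<in> D ==> EX c:atlas M. G z \<in> fst c & clinearv (fd (snd c o G) z) &
     (ALL u v. hh c (snd c (G z)) (fd (snd c o G) z u) (fd (snd c o G) z v) = hF z u v)"
  shows "dev D G"
  unfolding dev_def
proof (intro conjI G 0 ballI impI)
  fix d z assume d: "d \<in> atlas M" "G z \<in> fst d" and z: "z \<in> D"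
  obtain c where c: "c \<in> atlas M" "G z \<in> fst c" "clinearv (fd (snd c o G) z)"
     "!!u v. hh c (snd c (G z)) (fd (snd c o G) z u) (fd (snd c o G) z v) = hF z u v" using D[OF z] by blast
  have O: "snd c (G z) \<in> Ov c d" by (rule snd_Ov[OF c(1,2) d(2)])
  note e = chart_change[OF G c(1) d(1) z c(2) d(2)]
  have sd: "snd d (G z) = \<psi> c d (snd c (G z))" by (simp add: \<psi>_eq[OF c(1)] pt_snd[OF c(1,2)])
  show "clinearv (fd (snd d o G) z)" unfolding e using d\<psi>_clinearv[OF c(1) d(1) O] c(3) by (simp add: clinearv_def)
  show "ALL u v. hh d (snd d (G z)) (fd (snd d o G) z u) (fd (snd d o G) z v) = hF z u v"
    unfolding e sd hh_trans[OF c(1) d(1) O] using c(4) by blast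
qed

lemma dev_subset: "dev D G ==> open D' ==> D' <= D ==> dev D' G"
proof -
  assume G: "dev D G" and D: "open D'" "D' <= D"
  have "EX c:atlas M. EX V. open V & x \<in> V & V <= D' & G ` V <= fst c & smooth_on (snd c o G) V" if x: "x \<in> D'" for x
  proof -
    obtain c V where "c \<in> atlas M" "open V" "x \<in> V" "V <= D" "G ` V <= fst c" "smooth_on (snd c o G) V"
      using G D x unfolding dev_def smooth_into_def by (meson subsetD)
    then show ?thesis using D x smooth_on_subset[of "snd c o G" V "V \<inter> D'"] by (intro bexI[of _ c] exI[of _ "V \<inter> D'"]) auto
  qed
  then have "smooth_into D' G" using D(1) by (simp add: smooth_into_def)
  then show ?thesis using G D(2) unfolding dev_def by blast
qed

text \<open>The pull-back of \<open>hh\<close> along the solution, paired with \<open>a\<close>, and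
  the pair of \<open>hF\<close> and \<open>aF\<close> both solve \<open>gramsys\<close> with the
  same initial value. Hence a solution that is isometric at one point is isometric
  throughout.\<close>

lemma devsys_gram:
  assumes c: "c \<in> atlas M" and D: "open D" "connected D" "z0 \<in> D" "0 \<notin> D"
    and y: "!!z. z \<in> D ==> (z, y z) \<in> Omd c & der y (devsys c (z, y z)) z"
    and y0: "!!u v. hh c (fst (y z0)) (lin (fst (snd (y z0))) u) (lin (fst (snd (y z0))) v) = hF z0 u v" "lin1 (snd (snd (y z0))) = aF z0"
    and z: "z \<in> D"
  shows "hh c (fst (y z)) (lin (fst (snd (y z))) u) (lin (fst (snd (y z))) v) = hF z u v"
proof -
  interpret P: tanno_pos "Xc c" "hh c" "Gc c" "f c" "th c" "S c" by (rule tp[OF c])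
  let ?F = "%z. fst (y z)" and ?P = "%z. fst (snd (y z))" and ?a = "%z. snd (snd (y z))"
  have FX: "?F z \<in> Xc c" if "z \<in> D" for z using y[OF that] by auto
  define y1 where "y1 z = (\<chi> i j. hh c (?F z) (?P z $ i) (?P z $ j), ?a z)" for z
  define y2 :: "'n option V => _" where "y2 z = (\<chi> i j. hF z (axis i 1) (axis j 1), \<chi> j. aF z (axis j 1))" for z
  have s1: "der y1 (gramsys (z, y1 z)) z" if z: "z \<in> D" for z
  proof -
    note x = FX[OF z]
    note y' = conjunct2[OF y[OF z]]
    have F': "der ?F (%w. lin (?P z) w) z"
      using has_derivative_fst[OF y'] by (simp add: devsys_def Let_def)
    have P': "der (%z. ?P z $ i) (%w. - Gc c (?F z) (lin (?P z) w) (?P z $ i) + lin1 (?a z) w *s ?P z $ i + ?a z $ i *s lin (?P z) w) z" for i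
      using bounded_linear.has_derivative[OF bounded_linear_vec_nth has_derivative_fst[OF has_derivative_snd[OF y']], of i] by (simp add: devsys_def Let_def)
    have a': "der ?a (%w. \<chi> j. lin1 (?a z) w * ?a z $ j - hh c (?F z) (?P z $ j) (lin (?P z) w)) z"
      using has_derivative_snd[OF has_derivative_snd[OF y']] by (simp add: devsys_def Let_def)
    have e1: "hh c (?F z) (lin (?P z) w) b = (\<Sum>k\<in>UNIV. w $ k * hh c (?F z) (?P z $ k) b)" for w b
    proof -
      have "clinear (%w. hh c (?F z) (lin (?P z) w) b)" by (simp add: clinear_def lin_simps P.h_simps[OF x])
      from clinear_expand[OF this, of w] show ?thesis by (simp add: lin_axis)
    qed
    have e2: "hh c (?F z) b (lin (?P z) w) = (\<Sum>k\<in>UNIV. cnj (w $ k) * hh c (?F z) b (?P z $ k))" for w b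
      using arg_cong[OF e1[of w b], of cnj] by (simp add: cnj_sum P.cnj_h[OF x])
    show ?thesis unfolding y1_def
      by (rule has_derivative_eq_rhs[OF has_derivative_Pair[OF hd_vec[OF hd_vec[OF P.hd_h_comp[OF D(1) z FX F' P' P']]] a']])
        (assumption, rule ext, simp only: gramsys_def Let_def fst_conv snd_conv prod.inject vec_lambda_beta e1[symmetric] e2[symmetric]
          P.h_add[OF x] P.h_add2[OF x] P.h_minus[OF x] P.h_scale[OF x] P.h_scale2[OF x], simp add: vec_eq_iff)
  qed
  have s2: "der y2 (gramsys (z, y2 z)) z" if z: "z \<in> D" for z
  proof -
    have z0: "z ~= 0" using z D(4) by auto
    have e1: "hF z w b = (\<Sum>k\<in>UNIV. w $ k * hF z (axis k 1) b)" for w b by (rule clinear_expand[OF hF_clinear(1)])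
    have e2: "hF z b w = (\<Sum>k\<in>UNIV. cnj (w $ k) * hF z b (axis k 1))" for w b
      using arg_cong[OF e1[of w b], of cnj] by (simp add: cnj_sum hF_herm)
    have e3: "lin1 (\<chi> j. aF z (axis j 1)) = aF z" by (rule lin1_eq[OF hF_clinear(3)])
    show ?thesis unfolding y2_def
      by (rule has_derivative_eq_rhs[OF has_derivative_Pair[OF hd_vec[OF hd_vec[OF hF_deriv[OF z0]]] hd_vec[OF aF_deriv[OF z0]]]])
        (simp add: fun_eq_iff gramsys_def e3 e1[symmetric] e2[symmetric] vec_eq_iff)
  qed
  have y12: "y1 z0 = y2 z0"
    using y0(1)[of "axis _ 1" "axis _ 1"] fun_cong[OF y0(2), of "axis _ 1"] by (simp add: y1_def y2_def lin_axis vec_eq_iff)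
  have "y1 z = y2 z"
    by (rule total_eq_unique[where ?y1.0=y1 and ?y2.0=y2, OF gramsys_total D(1-3) y12 _ _ z]) (use s1 s2 in auto)
  then have "hh c (?F z) (lin (?P z) (axis i 1)) (lin (?P z) (axis j 1)) = hF z (axis i 1) (axis j 1)" for i j
    by (simp add: y1_def y2_def lin_axis vec_eq_iff)
  then show ?thesis
    by (rule sesquilinear_eqI[where B="%u v. hh c (?F z) (lin (?P z) u) (lin (?P z) v)" and B'="hF z", OF _ hF_clinear(1) _ hF_clinear(2), rotated 2])
      (simp_all only: clinear_def lin_simps P.h_simps[OF FX[OF z]] complex_cnj_add complex_cnj_mult complex_cnj_cnj simp_thms)
qed

lemma dev_devsys:
  assumes c: "c \<in> atlas M" and D: "open D" "connected D" "z0 \<in> D" "0 \<notin> D"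
    and y: "!!z. z \<in> D ==> (z, y z) \<in> Omd c & der y (devsys c (z, y z)) z"
    and y0: "!!u v. hh c (fst (y z0)) (lin (fst (snd (y z0))) u) (lin (fst (snd (y z0))) v) = hF z0 u v" "lin1 (snd (snd (y z0))) = aF z0"
  shows "dev D (%z. pt c (fst (y z)))" "fd (snd c o (%z. pt c (fst (y z)))) z0 = lin (fst (snd (y z0)))"
proof -
  let ?F = "%z. fst (y z)" let ?G = "%z. pt c (?F z)"
  have FX: "?F z \<in> Xc c" if "z \<in> D" for z using y[OF that] by auto
  have "Ck_on k y D" for k
    by (rule Ck_on_total_differential[where w="devsys c" and T="Omd c", OF D(1)]) (use y devsys_total(1)[OF c] in "auto simp: total_eq_def")
  then have sF: "smooth_on ?F D" by (intro smooth_on_linear[OF bounded_linear_fst D(1)]) (simp add: smooth_on_def)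
  have G: "smooth_into D ?G" by (rule smooth_into_pt[OF c D(1) sF]) (use FX in auto)
  have fdG: "fd (snd c o ?G) z = lin (fst (snd (y z)))" if z: "z \<in> D" for z
  proof -
    have "der ?F (%w. lin (fst (snd (y z))) w) z"
      using has_derivative_fst[OF conjunct2[OF y[OF z]]] by (simp add: devsys_def Let_def)
    then have "der (snd c o ?G) (lin (fst (snd (y z)))) z"
      by (rule der_cong[OF _ D(1) z]) (simp add: snd_pt[OF c FX])
    from frechet_derivative_at[OF this] show ?thesis by simp
  qed
  show "fd (snd c o ?G) z0 = lin (fst (snd (y z0)))" by (rule fdG[OF D(3)])
  show "dev D ?G"
  proof (rule devI[OF G D(4)], rule bexI[OF _ c], intro conjI allI)
    fix z u v assume z: "z \<in> D"
    show "?G z \<in> fst c" by (rule pt_in[OF c FX[OF z]])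
    show "clinearv (fd (snd c o ?G) z)" unfolding fdG[OF z] by (simp add: clinearv_def lin_simps)
    show "hh c (snd c (?G z)) (fd (snd c o ?G) z u) (fd (snd c o ?G) z v) = hF z u v"
      unfolding fdG[OF z] snd_pt[OF c FX[OF z]] by (rule devsys_gram[OF c D y y0 z])
  qed
qed

section \<open>Uniform existence, rigidity and uniqueness of developing maps\<close>

lemma compact_uniform:
  fixes Q :: "real => 'm => bool"
  assumes loc: "!!m. m \<in> TM ==> EX U \<rho>. openin (mtop M) U & m \<in> U & \<rho> > 0 & (ALL q:U. Q \<rho> q)"
    and mono: "!!\<rho> \<rho>' q. 0 < \<rho> ==> \<rho> <= \<rho>' ==> Q \<rho>' q ==> Q \<rho> q"
  shows "EX \<rho>>0. ALL q:TM. Q \<rho> q"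
proof -
  obtain U \<rho> where U: "!!m. m \<in> TM ==> openin (mtop M) (U m) & m \<in> U m & \<rho> m > (0::real) & (ALL q:U m. Q (\<rho> m) q)"
    using loc by metis
  have "ALL W:U ` TM. openin (mtop M) W" "TM <= \<Union>(U ` TM)" using U by auto
  then obtain \<F> where "finite \<F>" "\<F> <= U ` TM" "TM <= \<Union>\<F>"
    using comp[unfolded compact_space_alt, rule_format, of "U ` TM"] by auto
  then obtain T where T: "finite T" "T <= TM" "TM <= (\<Union>p\<in>T. U p)"
    by (metis finite_subset_image)
  define r where "r = Min (insert 1 (\<rho> ` T))"
  have "r > 0" unfolding r_def using T(1,2) U by (subst Min_gr_iff) auto
  moreover have "Q r q" if q: "q \<in> TM" for q
  proof -
    obtain p where p: "p \<in> T" "q \<in> U p" using T(3) q by blast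
    have "r <= \<rho> p" unfolding r_def using T(1) p(1) by simp
    then show ?thesis using mono[OF \<open>r > 0\<close>] U[of p] p T(2) by blast
  qed
  ultimately show ?thesis by blast
qed

text \<open>Every isometric initial differential is realised, on a ball whose radius depends on the
  bounds for the norm of \<open>z\<close> but not on the point of the compact manifold.\<close>

lemma dev_uniform:
  assumes r: "0 < r1"
  shows "EX \<rho>>0. ALL m:TM. EX c:atlas M. m \<in> fst c & (ALL z L. r1 <= norm z & norm z <= r2 & clinearv L &
     (ALL u v. hh c (snd c m) (L u) (L v) = hF z u v) --> (EX G. dev (ball z \<rho>) G & G z = m & fd (snd c o G) z = L))" (is "EX \<rho>>0. ALL m:_. ?Q \<rho> m")
proof (rule compact_uniform)
  fix \<rho> \<rho>' :: real and q assume \<rho>: "0 < \<rho>" "\<rho> <= \<rho>'"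
  then have "ball z \<rho> <= ball z \<rho>'" for z :: "'n option V" by auto
  moreover assume "?Q \<rho>' q"
  ultimately show "?Q \<rho> q"
    using dev_subset[OF _ open_ball] by meson
next
  fix m assume "m \<in> TM"
  then obtain c where c: "c \<in> atlas M" "m \<in> fst c" using chart_ex by blast
  interpret P: tanno_pos "Xc c" "hh c" "Gc c" "f c" "th c" "S c" by (rule tp[OF c(1)])
  obtain s where s: "s > 0" "cball (snd c m) s <= Xc c" using P.open_X snd_in[OF c] open_contains_cball by blast
  let ?B = "cball (snd c m) s" let ?E = "sphere (0 :: 'n V) 1"
  have "smooth_on (%z. hh c (fst z) (snd z) (snd z)) P.U0"
    by (rule P.smooth_on_h2; (intro P.open_U0 P.smooth_fst P.smooth_snd)?; auto)
  then have "continuous_on (?B \<times> ?E) (%z. Re (hh c (fst z) (snd z) (snd z)))"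
    by (intro continuous_intros continuous_on_subset[OF smooth_on_continuous]) (use s in auto)
  note cont = this
  have cmp: "compact (?B \<times> ?E)" by (intro compact_Times) simp_all
  have "?E ~= {}" "?B ~= {}" using s by auto
  then have ne: "?B \<times> ?E ~= {}" by blast
  obtain p where p: "p \<in> ?B \<times> ?E" "ALL q:?B \<times> ?E. Re (hh c (fst p) (snd p) (snd p)) <= Re (hh c (fst q) (snd q) (snd q))"
    using continuous_attains_inf[OF cmp ne cont] by blast
  \<comment> \<open>The minimum of \<open>hh\<close> on coordinate unit vectors near
    \<open>m\<close>, positive because \<open>hh\<close> is definite.\<close>
  define \<mu> where "\<mu> = Re (hh c (fst p) (snd p) (snd p))"
  have "fst p \<in> Xc c" "snd p ~= 0" using p(1) s(2) by auto
  then have \<mu>: "\<mu> > 0" unfolding \<mu>_def by (rule P.h_pos)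
  have low: "\<mu> * (norm u)\<^sup>2 <= Re (hh c x u u)" if x: "x \<in> ?B" for x u
  proof (cases "u = 0")
    case True
    then show ?thesis using x s(2) by (auto simp: P.h_zero subsetD)
  next
    case False
    have xX: "x \<in> Xc c" using x s(2) by blast
    define e where "e = of_real (inverse (norm u)) *s u"
    have "e \<in> ?E" using False by (simp add: e_def norm_smult norm_inverse)
    then have "\<mu> <= Re (hh c x e e)" using p(2)[rule_format, of "(x, e)"] x by (simp add: \<mu>_def)
    moreover have ue: "of_real (norm u) *s e = u" using False by (simp add: e_def)
    have "Re (hh c x (of_real t *s e) (of_real t *s e)) = t\<^sup>2 * Re (hh c x e e)" for t
      by (simp add: P.h_scale[OF xX] P.h_scale2[OF xX] power2_eq_square)
    from this[of "norm u"] have "Re (hh c x u u) = (norm u)\<^sup>2 * Re (hh c x e e)" unfolding ue .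
    ultimately show ?thesis using mult_left_mono[of \<mu> "Re (hh c x e e)" "(norm u)\<^sup>2"] by (simp add: mult.commute)
  qed
  let ?Z = "{z :: 'n option V. r1 <= norm z & norm z <= r2}"
  have "closed ?Z" by (intro closed_Collect_conj closed_Collect_le continuous_intros)
  moreover have "bounded ?Z" by (rule boundedI[of _ r2]) auto
  ultimately have Z: "compact ?Z" by (simp add: compact_eq_bounded_closed)
  \<comment> \<open>The columns of an isometric differential have norm at most
    \<open>1 / (r1 * sqrt \<mu>)\<close> and the entries of \<open>aF z\<close> modulus at most
    \<open>1 / r1\<close>. So all initial data lie in the compact set \<open>?K\<close>.\<close>
  define R where "R = real CARD('n option) * (1 / (r1 * sqrt \<mu>) + 1 / r1)"
  let ?K = "?Z \<times> ?B \<times> cball (0 :: 'n V ^ ('n option)) R \<times> cball (0 :: 'n option V) R"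
  have K: "compact ?K" "?K <= Omd c" using s(2) by (auto intro!: compact_Times Z)
  from total_eq_solvable[OF devsys_total[OF c(1)] K]
  obtain \<rho> where \<rho>: "\<rho> > 0" "ALL (a, b):?K. EX y. y a = b & (ALL x:ball a \<rho>. (x, y x) \<in> Omd c & der y (devsys c (x, y x)) x)"
    by (elim exE conjE) (rule that)
  \<comment> \<open>The bound \<open>r1\<close> keeps 0, where \<open>hF\<close> is singular, out of
    the ball.\<close>
  define \<rho>' where "\<rho>' = min \<rho> r1"
  show "EX U \<rho>. openin (mtop M) U & m \<in> U & \<rho> > 0 & (ALL q:U. ?Q \<rho> q)"
  proof (rule exI[of _ "pt c ` ball (snd c m) s"], rule exI[of _ \<rho>'], intro conjI ballI)
    have b: "ball (snd c m) s <= Xc c" using s(2) ball_subset_cball by blast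
    show "openin (mtop M) (pt c ` ball (snd c m) s)" by (rule openin_pt[OF c(1) open_ball b])
    show "m \<in> pt c ` ball (snd c m) s" using pt_snd[OF c] s(1) by (intro image_eqI[of _ _ "snd c m"]) auto
    show "\<rho>' > 0" using \<rho> r by (simp add: \<rho>'_def)
    fix q assume "q \<in> pt c ` ball (snd c m) s"
    then obtain x where x: "q = pt c x" "x \<in> ball (snd c m) s" by blast
    then have xX: "x \<in> Xc c" and xB: "x \<in> ?B" using b by auto
    have sq: "snd c q = x" "q \<in> fst c" using x(1) snd_pt[OF c(1) xX] pt_in[OF c(1) xX] by auto
    show "?Q \<rho>' q"
    proof (rule bexI[OF _ c(1)], intro conjI sq(2) allI impI, elim conjE)
      fix z :: "'n option V" and L assume z: "r1 <= norm z" "norm z <= r2" and L: "clinearv L" and iso: "ALL u v. hh c (snd c q) (L u) (L v) = hF z u v"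
      define P0 :: "'n V ^ ('n option)" where "P0 = (\<chi> j. L (axis j 1))"
      define a0 where "a0 = (\<chi> j. aF z (axis j 1))"
      have lP: "lin P0 = L" and la: "lin1 a0 = aF z" unfolding P0_def a0_def by (rule lin_eq[OF L], rule lin1_eq[OF hF_clinear(3)])
      have nz: "norm z > 0" using z r by linarith
      have bP: "norm (P0 $ j) <= 1 / (r1 * sqrt \<mu>)" for j
      proof -
        have "Re (hF z (axis j 1) (axis j 1)) <= 1 / (norm z)\<^sup>2"
        proof -
          have m: "cnj (z $ j) * z $ j = of_real ((norm (z $ j))\<^sup>2)" by (metis complex_norm_square mult.commute)
          have "hF z (axis j 1) (axis j 1) = 1 / of_real ((norm z)\<^sup>2) - of_real ((norm (z $ j))\<^sup>2) / (of_real ((norm z)\<^sup>2))\<^sup>2"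
          proof -
            have "herm (axis j 1) (axis j (1::complex)) = 1" by (simp only: herm_axis axis_nth complex_cnj_one)
            then show ?thesis by (simp only: hF_def herm_axis herm_self[of z] m)
          qed
          also have "... = of_real (1 / (norm z)\<^sup>2 - (norm (z $ j))\<^sup>2 / ((norm z)\<^sup>2)\<^sup>2)" by simp
          finally show ?thesis by simp
        qed
        also have "... <= 1 / r1\<^sup>2" using z r nz by (intro divide_left_mono power_mono mult_pos_pos) auto
        finally have "\<mu> * (norm (P0 $ j))\<^sup>2 <= 1 / r1\<^sup>2" using low[OF xB, of "P0 $ j"] iso sq(1) by (simp add: P0_def)
        then have "(norm (P0 $ j) * (r1 * sqrt \<mu>))\<^sup>2 <= 1\<^sup>2" using r \<mu> by (simp add: power_mult_distrib field_simps)
        then have "norm (P0 $ j) * (r1 * sqrt \<mu>) <= 1" by (rule power2_le_imp_le) simp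
        then show ?thesis using r \<mu> by (simp add: pos_le_divide_eq)
      qed
      have ba: "norm (a0 $ j) <= 1 / r1" for j
      proof -
        have "norm (a0 $ j) = norm (z $ j) / (norm z)\<^sup>2" by (simp add: a0_def aF_def herm_axis herm_self norm_divide norm_power)
        also have "... <= norm z / (norm z)\<^sup>2" by (intro divide_right_mono Finite_Cartesian_Product.norm_nth_le) simp
        also have "... = 1 / norm z" using nz by (simp add: power2_eq_square)
        also have "... <= 1 / r1" using z r nz by (intro divide_left_mono) auto
        finally show ?thesis .
      qed
      have l2: "norm v <= real CARD('n option) * b" if "!!j. norm (v $ j) <= b" for v :: "'x::real_normed_vector ^ 'n option" and b
      proof -
        have "norm v <= (\<Sum>j\<in>UNIV. norm (v $ j))" unfolding norm_vec_def by (rule L2_set_le_sum) simp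
        also have "... <= (\<Sum>j\<in>(UNIV :: 'n option set). b)" by (rule sum_mono) (rule that)
        finally show ?thesis by simp
      qed
      have "1 / (r1 * sqrt \<mu>) > 0" "1 / r1 > 0" using r \<mu> by simp_all
      then have PR: "norm P0 <= R" "norm a0 <= R" unfolding R_def
        by (intro order_trans[OF l2[OF bP]] order_trans[OF l2[OF ba]] mult_left_mono; simp)+
      then have "(z, x, P0, a0) \<in> ?K" using z xB by simp
      from bspec[OF \<rho>(2) this, unfolded case_prod_conv]
      obtain y where y: "y z = (x, P0, a0)" "!!w. w \<in> ball z \<rho> ==> (w, y w) \<in> Omd c & der y (devsys c (w, y w)) w"
        by (elim exE conjE) (erule that, erule (1) bspec)
      have D: "open (ball z \<rho>')" "connected (ball z \<rho>')" "z \<in> ball z \<rho>'" "0 \<notin> ball z \<rho>'" "ball z \<rho>' <= ball z \<rho>"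
        using \<rho> r z by (auto simp: \<rho>'_def)
      note dv = dev_devsys[where y=y, OF c(1) D(1-4)]
      have "dev (ball z \<rho>') (%z. pt c (fst (y z)))" "fd (snd c o (%z. pt c (fst (y z)))) z = L"
        using dv(1) dv(2) y D(5) iso sq(1) by (auto simp: lP la subset_iff)
      then show "EX G. dev (ball z \<rho>') G & G z = q & fd (snd c o G) z = L" using y(1) x(1) by (intro exI[of _ "%z. pt c (fst (y z))"]) simp
    qed
  qed
qed

text \<open>As for the Levi-Civita connection, differentiating the isometry condition determines the
  second derivative. The kernel of the differential is the line of \<open>z\<close>, on which
  \<open>herm u z\<close> is injective; a count of dimensions then gives surjectivity.\<close>

lemma dev_rigid:
  assumes G: "dev D G" and c: "c \<in> atlas M" and z: "z \<in> D" "G z \<in> fst c"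
  shows "fd (%y. fd (snd c o G) y v) z u = - Gc c (snd c (G z)) (fd (snd c o G) z u) (fd (snd c o G) z v)
      + aF z u *s fd (snd c o G) z v + aF z v *s fd (snd c o G) z u"
    and "surj (fd (snd c o G) z)" "linear (%u. (fd (snd c o G) z u, herm u z))" "inj (%u. (fd (snd c o G) z u, herm u z))"
proof -
  interpret P: tanno_pos "Xc c" "hh c" "Gc c" "f c" "th c" "S c" by (rule tp[OF c])
  let ?F = "snd c o G" let ?P = "%y. fd ?F y" let ?D = "D \<inter> G -` fst c" let ?Q = "%w v. fd (%y. ?P y v) z w"
  have si: "smooth_into D G" and D0: "0 \<notin> D" using G by (auto simp: dev_def)
  have oD: "open ?D" by (rule smooth_into_open[OF si openin_chart[OF c]])
  have zD: "z \<in> ?D" using z by simp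
  have z0: "z ~= 0" using z(1) D0 by auto
  have sF: "smooth_on ?F ?D" by (rule smooth_into_chart[OF si c])
  have FX: "?F y \<in> Xc c" if "y \<in> ?D" for y using that snd_in[OF c] by simp
  have x: "snd c (G z) \<in> Xc c" using FX[OF zD] by simp
  have cl: "clinearv (?P y)" and iso: "hh c (?F y) (?P y u) (?P y v) = hF y u v" if "y \<in> ?D" for y u v
    using G c that by (auto simp: dev_def)
  have hF: "der ?F (?P y) y" if "y \<in> ?D" for y by (rule smooth_on_deriv[OF sF that])
  have hP: "der (%y. ?P y v) (%w. ?Q w v) z" for v by (rule smooth_on_deriv[OF smooth_on_frechet[OF sF] zD])
  have Qsym: "?Q w v = ?Q v w" for w v
    by (rule second_derivative_commute[where f="?F" and f'="?P" and Fu="%w. ?Q w v" and Fv="%v. ?Q v w" and u=v and v=w, OF oD zD sF hF hP hP])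
  have Qi: "?Q (\<i> *s w) v = \<i> *s ?Q w v" for w v
  proof -
    have "der (%y. ?P y (\<i> *s w)) (%v. \<i> *s ?Q v w) z"
      by (rule der_cong[OF bounded_linear.has_derivative[OF bounded_bilinear.bounded_linear_right[OF bounded_bilinear_smult] hP] oD zD])
        (simp add: clinearvD[OF cl])
    from fun_cong[OF has_derivative_unique[OF hP this], of v] have e: "?Q v (\<i> *s w) = \<i> *s ?Q v w" .
    have a: "?Q (\<i> *s w) v = ?Q v (\<i> *s w)" by (rule Qsym)
    have b: "\<i> *s ?Q v w = \<i> *s ?Q w v" by (rule arg_cong[where f="(*s) \<i>", OF Qsym])
    show ?thesis by (rule trans[OF trans[OF a e] b])
  qed
  note L = clinearvD[OF cl[OF zD]]
  have lin2: "linear (%u. (?P z u, herm u z))"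
    by (rule linearI) (simp_all add: L herm_simps scaleR_vec_eq scaleR_conv_of_real)
  then show "linear (%u. (?P z u, herm u z))" .
  have inj: "inj (%u. (?P z u, herm u z))" unfolding linear_injective_0[OF lin2]
  proof (intro allI impI)
    fix u assume u: "(?P z u, herm u z) = 0"
    then have "hF z u u = 0" using iso[OF zD, of u u] by (simp add: zero_prod_def P.h_zero[OF x])
    then have "u = (herm u z / herm z z) *s z" by (intro hF_degenerate[OF z0]) simp
    then show "u = 0" using u by (simp add: zero_prod_def)
  qed
  then show "inj (%u. (?P z u, herm u z))" .
  have "surj (%u. (?P z u, herm u z))"
    by (rule linear_injective_imp_surjective[OF lin2 inj]) (simp add: dim_UNIV)
  then show su: "surj (?P z)" by (metis (no_types, lifting) fst_conv surj_def)
  let ?x = "snd c (G z)"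
  \<comment> \<open>The claim is that \<open>?e u\<close> vanishes; it is tested against the values
    of the differential, which exhaust the tangent space.\<close>
  let ?e = "%w. Gc c ?x (?P z w) (?P z v) + ?Q w v - aF z w *s ?P z v - aF z v *s ?P z w"
  have h0: "hh c ?x (?e w) (?P z b) = 0" for w b
  proof -
    have d: "der (%y. hh c (?F y) (?P y v) (?P y b)) (%w. hh c (?F z) (Gc c (?F z) (?P z w) (?P z v)) (?P z b)
       + hh c (?F z) (?P z v) (Gc c (?F z) (?P z w) (?P z b)) + hh c (?F z) (?Q w v) (?P z b) + hh c (?F z) (?P z v) (?Q w b)) z"
      by (rule P.hd_h_comp[OF oD zD FX hF[OF zD] hP hP])
    have "der (%y. hF y v b) (%w. hh c (?F z) (Gc c (?F z) (?P z w) (?P z v)) (?P z b)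
       + hh c (?F z) (?P z v) (Gc c (?F z) (?P z w) (?P z b)) + hh c (?F z) (?Q w v) (?P z b) + hh c (?F z) (?P z v) (?Q w b)) z"
      by (rule der_cong[OF d oD zD]) (rule iso)
    then have "der (%y. hF y v b) (%w. hh c ?x (Gc c ?x (?P z w) (?P z v)) (?P z b)
       + hh c ?x (?P z v) (Gc c ?x (?P z w) (?P z b)) + hh c ?x (?Q w v) (?P z b) + hh c ?x (?P z v) (?Q w b)) z" by simp
    note e = fun_cong[OF has_derivative_unique[OF this hF_deriv[OF z0]], unfolded iso[OF zD, symmetric]]
    \<comment> \<open>The differentiated isometry condition says that \<open>p + q\<close> vanishes.
      Here \<open>p\<close> is complex linear and \<open>q\<close> antilinear in the direction, so
      \<open>p\<close> vanishes alone.\<close>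
    define p where "p w = hh c ?x (?e w) (?P z b)" for w
    define q where "q w = hh c ?x (?P z v) (Gc c ?x (?P z w) (?P z b)) + hh c ?x (?P z v) (?Q w b)
      - cnj (aF z w) * hh c ?x (?P z v) (?P z b) - cnj (aF z b) * hh c ?x (?P z v) (?P z w)" for w
    have "p w + q w = 0" for w using e[of w] by (simp add: p_def q_def P.h_simps[OF x] algebra_simps)
    moreover have "p (\<i> *s w) = \<i> * p w" "q (\<i> *s w) = - (\<i> * q w)" for w
      by (simp_all add: p_def q_def L Qi aF_simps P.Gm_simps[OF x] P.h_simps[OF x] algebra_simps)
    ultimately have "p w = 0" by (rule type_split1(1))
    then show ?thesis by (simp add: p_def)
  qed
  have "?e u = 0"
  proof (rule P.h_nondeg[OF x])
    fix b' obtain b where "b' = ?P z b" using su by (rule surjE)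
    then show "hh c ?x (?e u) b' = 0" using h0 by simp
  qed
  then show "?Q u v = - Gc c (snd c (G z)) (?P z u) (?P z v) + aF z u *s ?P z v + aF z v *s ?P z u"
    by (simp add: algebra_simps)
qed

lemma devD: "dev D G ==> c \<in> atlas M ==> z \<in> D ==> G z \<in> fst c ==> clinearv (fd (snd c o G) z)"
  "dev D G ==> c \<in> atlas M ==> z \<in> D ==> G z \<in> fst c ==> hh c (snd c (G z)) (fd (snd c o G) z u) (fd (snd c o G) z v) = hF z u v"
  "dev D G ==> smooth_into D G" "dev D G ==> open D"
  unfolding dev_def smooth_into_def by blast+

lemma dev_chart: "dev D G ==> z \<in> D ==> EX c:atlas M. G z \<in> fst c & der (snd c o G) (fd (snd c o G) z) z"
proof -
  assume G: "dev D G" and z: "z \<in> D"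
  then obtain c where c: "c \<in> atlas M" "G z \<in> fst c" unfolding dev_def smooth_into_def by blast
  have "der (snd c o G) (fd (snd c o G) z) z"
    by (rule smooth_on_deriv[OF smooth_into_chart[OF devD(3)[OF G] c(1)]]) (use z c in simp)
  then show ?thesis using c by blast
qed

text \<open>The converse of \<open>dev_devsys\<close>, which makes uniqueness for total equations
  available for developing maps.\<close>

lemma dev_solves:
  assumes G: "dev D G" and c: "c \<in> atlas M" and z: "z \<in> D" "G z \<in> fst c"
  defines "y == %z. (snd c (G z), (\<chi> j. fd (snd c o G) z (axis j 1), \<chi> j. aF z (axis j 1)))"
  shows "(z, y z) \<in> Omd c & der y (devsys c (z, y z)) z"
proof
  let ?F = "snd c o G"
  have si: "smooth_into D G" and z0: "z ~= 0" using G z(1) by (auto simp: dev_def)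
  have zD: "z \<in> D \<inter> G -` fst c" using z by simp
  have sF: "smooth_on ?F (D \<inter> G -` fst c)" by (rule smooth_into_chart[OF si c])
  have cl: "clinearv (fd ?F z)" and iso: "!!u v. hh c (snd c (G z)) (fd ?F z u) (fd ?F z v) = hF z u v" using G c z by (auto simp: dev_def)
  show "(z, y z) \<in> Omd c" using snd_in[OF c z(2)] by (simp add: y_def)
  have h1: "der (%z. snd c (G z)) (fd ?F z) z" using smooth_on_deriv[OF sF zD] by (simp add: comp_def)
  have h2: "der (%y. fd ?F y v) (%u. - Gc c (snd c (G z)) (fd ?F z u) (fd ?F z v) + aF z u *s fd ?F z v + aF z v *s fd ?F z u) z" for v
    by (rule has_derivative_eq_rhs[OF smooth_on_deriv[OF smooth_on_frechet[OF sF] zD]]) (simp add: fun_eq_iff dev_rigid(1)[OF G c z])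
  show "der y (devsys c (z, y z)) z" unfolding y_def
    by (rule has_derivative_eq_rhs[OF has_derivative_Pair[OF h1 has_derivative_Pair[OF hd_vec[OF h2] hd_vec[OF aF_deriv[OF z0]]]]])
      (simp add: fun_eq_iff devsys_def lin_eq[OF cl] lin1_eq[OF hF_clinear(3)] iso)
qed

lemma dev_unique_chart:
  assumes G: "dev B G1" "dev B G2" and c: "c \<in> atlas M" and B: "open B" "connected B" "a \<in> B" "G1 ` B <= fst c" "G2 ` B <= fst c"
    and a: "G1 a = G2 a" "fd (snd c o G1) a = fd (snd c o G2) a" and z: "z \<in> B"
  shows "G1 z = G2 z"
proof -
  let ?y = "%G z. (snd c (G z), (\<chi> j. fd (snd c o G) z (axis j 1), \<chi> j. aF z (axis j 1)))"
  have e: "?y G1 a = ?y G2 a" by (simp add: a)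
  have s: "(x, ?y G1 x) \<in> Omd c & der (?y G1) (devsys c (x, ?y G1 x)) x"
    "(x, ?y G2 x) \<in> Omd c & der (?y G2) (devsys c (x, ?y G2 x)) x" if "x \<in> B" for x
    using dev_solves[OF G(1) c that] dev_solves[OF G(2) c that] B(4,5) that by blast+
  have "?y G1 z = ?y G2 z"
    by (rule total_eq_unique[where ?y1.0="?y G1" and ?y2.0="?y G2", OF devsys_total(1)[OF c] B(1-3) e s(1) s(2) z])
  then have "snd c (G1 z) = snd c (G2 z)" by simp
  then show ?thesis by (rule inj_onD[OF inj_c[OF c]]) (use B(4,5) z in auto)
qed

text \<open>\<open>A\<close> consists of the points near which the maps coincide. At a point outside
  \<open>A\<close> where the values agree, a small ball inside a chart cannot meet \<open>A\<close>,
  by uniqueness in the chart; where the values differ, the Hausdorff property separates them. So the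
  complement is open too.\<close>

lemma dev_unique:
  assumes G: "dev D G1" "dev D G2" and D: "open D" "connected D" "z0 \<in> D"
    and c: "c \<in> atlas M" "G1 z0 \<in> fst c" "G1 z0 = G2 z0" "fd (snd c o G1) z0 = fd (snd c o G2) z0" and z: "z \<in> D"
  shows "G1 z = G2 z"
proof -
  have si: "smooth_into D G1" "smooth_into D G2" using G by (auto simp: dev_def)
  define A where "A = {z. EX e>0. ball z e <= D & (ALL w:ball z e. G1 w = G2 w)}"
  have AD: "G1 w = G2 w" if "w \<in> A" for w using that by (auto simp: A_def)
  have loc: "EX e>0. ball z e <= D & G1 ` ball z e <= fst c & G2 ` ball z e <= fst c"
    if "z \<in> D" "c \<in> atlas M" "G1 z \<in> fst c" "G1 z = G2 z" for z c
  proof -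
    have o: "open (D \<inter> G1 -` fst c \<inter> (D \<inter> G2 -` fst c))" by (intro open_Int smooth_into_open si openin_chart that)
    have "z \<in> D \<inter> G1 -` fst c \<inter> (D \<inter> G2 -` fst c)" using that by auto
    from openE[OF o this] obtain e where "e > 0" "ball z e <= D \<inter> G1 -` fst c \<inter> (D \<inter> G2 -` fst c)" by blast
    then show ?thesis by (intro exI[of _ e]) auto
  qed
  have openA: "open A" unfolding open_contains_ball
  proof
    fix w assume "w \<in> A"
    then obtain e where e: "e > 0" "ball w e <= D" "ALL x:ball w e. G1 x = G2 x" by (auto simp: A_def)
    have "x \<in> A" if x: "x \<in> ball w e" for x
    proof -
      obtain d where "d > 0" "ball x d <= ball w e" using x open_contains_ball open_ball by blast
      then show ?thesis using e by (auto simp: A_def)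
    qed
    then show "EX e>0. ball w e <= A" using e(1) by blast
  qed
  have openC: "open (D - A)" unfolding open_contains_ball
  proof
    fix w assume w: "w \<in> D - A"
    show "EX e>0. ball w e <= D - A"
    proof (cases "G1 w = G2 w")
      case True
      obtain c where c: "c \<in> atlas M" "G1 w \<in> fst c" using dev_chart[OF G(1), of w] w by blast
      obtain e where e: "e > 0" "ball w e <= D" "G1 ` ball w e <= fst c" "G2 ` ball w e <= fst c" using loc[OF _ c True] w by blast
      have "ball w e \<inter> A = {}"
      proof (rule ccontr)
        assume "ball w e \<inter> A ~= {}"
        then obtain x where x: "x \<in> ball w e" "x \<in> A" by blast
        then obtain d where d: "d > 0" "ALL v:ball x d. G1 v = G2 v" by (auto simp: A_def)
        have xD: "x \<in> D \<inter> G1 -` fst c" using e x by auto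
        have "der (snd c o G1) (fd (snd c o G1) x) x"
          by (rule smooth_on_deriv[OF smooth_into_chart[OF si(1) c(1)] xD])
        then have "der (snd c o G2) (fd (snd c o G1) x) x"
          by (rule der_cong[OF _ open_ball centre_in_ball[THEN iffD2, OF d(1)]]) (use d in auto)
        then have "fd (snd c o G1) x = fd (snd c o G2) x" by (rule frechet_derivative_at)
        then have "G1 v = G2 v" if "v \<in> ball w e" for v
          using dev_unique_chart[OF dev_subset[OF G(1) _ e(2)] dev_subset[OF G(2) _ e(2)] c(1) open_ball _ x(1) e(3,4) AD[OF x(2)] _ that] by simp
        then have "w \<in> A" using e by (auto simp: A_def)
        then show False using w by simp
      qed
      then show ?thesis using e by blast
    next
      case False
      have "G1 w \<in> TM" "G2 w \<in> TM"
        using smooth_into_continuous[OF si(1)] smooth_into_continuous[OF si(2)] w by (auto simp: continuous_map_def)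
      then obtain W1 W2 where W: "openin (mtop M) W1" "openin (mtop M) W2" "G1 w \<in> W1" "G2 w \<in> W2" "disjnt W1 W2"
        using Hausdorff_M False unfolding Hausdorff_space_def by metis
      have o: "open (D \<inter> G1 -` W1 \<inter> (D \<inter> G2 -` W2))" by (intro open_Int smooth_into_open si W)
      have "w \<in> D \<inter> G1 -` W1 \<inter> (D \<inter> G2 -` W2)" using w W by auto
      from openE[OF o this] obtain e where "e > 0" "ball w e <= D \<inter> G1 -` W1 \<inter> (D \<inter> G2 -` W2)" by blast
      moreover from this have "ball w e \<inter> A = {}" using AD W(5) by (fastforce simp: disjnt_iff)
      ultimately show ?thesis by blast
    qed
  qed
  obtain e where e: "e > 0" "ball z0 e <= D" "G1 ` ball z0 e <= fst c" "G2 ` ball z0 e <= fst c" using loc[OF D(3) c(1-3)] by blast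
  have "G1 v = G2 v" if "v \<in> ball z0 e" for v
    using dev_unique_chart[OF dev_subset[OF G(1) _ e(2)] dev_subset[OF G(2) _ e(2)] c(1) open_ball _ _ e(3,4) c(3,4) that] e(1) by simp
  then have "z0 \<in> A" using e by (auto simp: A_def)
  moreover have "A \<inter> D = {} | (D - A) \<inter> D = {}" by (rule connectedD[OF D(2) openA openC]) auto
  ultimately have "z \<in> A" using D(3) z by blast
  then show ?thesis by (rule AD)
qed

lemma dev_cong:
  assumes D: "open D" and loc: "!!z. z \<in> D ==> EX V G'. open V & z \<in> V & dev V G' & (ALL w:V. G w = G' w)"
  shows "dev D G"
proof (rule devI)
  note smc = smooth_on_cong[where f="snd c o G'" for c G']
  show "0 \<notin> D" using loc by (force simp: dev_def)
  show "smooth_into D G" unfolding smooth_into_def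
  proof (intro conjI D ballI)
    fix z assume z: "z \<in> D"
    obtain V G' where V: "open V" "z \<in> V" "dev V G'" "ALL w:V. G w = G' w" using loc[OF z] by blast
    then obtain c W where W: "c \<in> atlas M" "open W" "z \<in> W" "W <= V" "G' ` W <= fst c" "smooth_on (snd c o G') W"
      unfolding dev_def smooth_into_def by blast
    have o: "open (W \<inter> D)" using W D by blast
    have "smooth_on (snd c o G) (W \<inter> D)"
      by (rule smooth_on_cong[OF o _ smooth_on_subset[OF W(6)]]) (use W V in auto)
    then show "EX c:atlas M. EX V. open V & z \<in> V & V <= D & G ` V <= fst c & smooth_on (snd c o G) V"
      using W V z o by (intro bexI[OF _ W(1)] exI[of _ "W \<inter> D"]) auto
  qed
  fix z assume z: "z \<in> D"
  obtain V G' where V: "open V" "z \<in> V" "dev V G'" "ALL w:V. G w = G' w" using loc[OF z] by blast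
  obtain c where c: "c \<in> atlas M" "G' z \<in> fst c" and h: "der (snd c o G') (fd (snd c o G') z) z"
    using dev_chart[OF V(3,2)] by blast
  have "der (snd c o G) (fd (snd c o G') z) z"
    by (rule der_cong[OF h V(1,2)]) (use V(4) in auto)
  then have e: "fd (snd c o G) z = fd (snd c o G') z" by (rule frechet_derivative_at[symmetric])
  show "EX c:atlas M. G z \<in> fst c & clinearv (fd (snd c o G) z) &
     (ALL u v. hh c (snd c (G z)) (fd (snd c o G) z u) (fd (snd c o G) z v) = hF z u v)"
    using V(2,4) c devD(1,2)[OF V(3) c(1) V(2) c(2)] by (intro bexI[OF _ c(1)]) (simp add: e)
qed

lemma dev_glue:
  assumes G: "!!i. i \<in> I ==> dev (D i) (G i)" and eq: "!!i j z. i \<in> I ==> j \<in> I ==> z \<in> D i ==> z \<in> D j ==> G i z = G j z"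
  shows "EX G'. dev (\<Union>i\<in>I. D i) G' & (ALL i:I. ALL z:D i. G' z = G i z)"
proof -
  define G' where "G' z = G (SOME i. i \<in> I & z \<in> D i) z" for z
  have G': "G' z = G i z" if i: "i \<in> I" "z \<in> D i" for i z
    unfolding G'_def using someI[of "%i. i \<in> I & z \<in> D i" i] i by (intro eq) auto
  have o: "open (D i)" if "i \<in> I" for i using G[OF that] by (simp add: dev_def smooth_into_def)
  have "dev (\<Union>i\<in>I. D i) G'"
  proof (rule dev_cong)
    fix z assume "z \<in> (\<Union>i\<in>I. D i)"
    then obtain i where i: "i \<in> I" "z \<in> D i" by blast
    show "EX V G''. open V & z \<in> V & dev V G'' & (ALL w:V. G' w = G'' w)"
      by (intro exI[of _ "D i"] exI[of _ "G i"] conjI ballI o G G' i)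
  qed (use o in blast)
  then show ?thesis using G' by blast
qed

lemma dev_agree:
  assumes G: "dev D G1" "dev D G2" and D: "connected D" and V: "open V" "V <= D" "V ~= {}" "!!z. z \<in> V ==> G1 z = G2 z" and z: "z \<in> D"
  shows "G1 z = G2 z"
proof -
  obtain z0 where z0: "z0 \<in> V" using V(3) by blast
  obtain c where c: "c \<in> atlas M" "G1 z0 \<in> fst c" and h: "der (snd c o G1) (fd (snd c o G1) z0) z0"
    using dev_chart[OF G(1), of z0] z0 V(2) by blast
  have "der (snd c o G2) (fd (snd c o G1) z0) z0"
    by (rule der_cong[OF h V(1) z0]) (use V(4) in auto)
  then have "fd (snd c o G1) z0 = fd (snd c o G2) z0" by (rule frechet_derivative_at)
  then show ?thesis using dev_unique[OF G devD(4)[OF G(1)] D _ c V(4)[OF z0] _ z] z0 V(2) by blast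
qed

end

section \<open>Complements of complex hyperplanes\<close>

lemma affine_zero_finite:
  fixes a b e :: "'k::finite V"
  assumes "herm a e ~= 0 | herm b e ~= 0"
  shows "finite {t. herm (a + t *s (b - a)) e = 0}"
proof -
  have "{t. herm (a + t *s (b - a)) e = 0} <= {- herm a e / herm (b - a) e}"
  proof
    fix t assume "t \<in> {t. herm (a + t *s (b - a)) e = 0}"
    then have t: "herm a e + t * herm (b - a) e = 0" by (simp only: mem_Collect_eq herm_add herm_scale)
    then have "herm (b - a) e ~= 0" using assms by (auto simp: herm_diff)
    moreover have "t * herm (b - a) e = - herm a e" using t by (simp add: eq_neg_iff_add_eq_0 add.commute)
    ultimately show "t \<in> {- herm a e / herm (b - a) e}" by (metis nonzero_eq_divide_eq singletonI)
  qed
  then show ?thesis by (rule finite_subset) simp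
qed

text \<open>The complex line through two points of the set meets the hyperplanes in finitely many
  points, and the plane without a finite set is connected.\<close>

lemma connected_hyperplane_complement:
  fixes E :: "('k::finite V) set"
  assumes "finite E" shows "connected {z. ALL e:E. herm z e ~= 0}" (is "connected ?S")
proof -
  have "EX T. connected T & T <= ?S & a \<in> T & b \<in> T" if "a \<in> ?S" "b \<in> ?S" for a b
  proof (intro exI conjI)
    let ?Z = "\<Union>e\<in>E. {t. herm (a + t *s (b - a)) e = 0}"
    let ?f = "%t. a + t *s (b - a)"
    have "finite ?Z" using assms that by (intro finite_UN_I affine_zero_finite) auto
    then have "connected (UNIV - ?Z)" by (rule connected_open_delete_finite[OF open_UNIV connected_UNIV, rotated]) simp
    then show "connected (?f ` (UNIV - ?Z))"
      by (rule connected_continuous_image[rotated]) (intro continuous_intros bounded_bilinear.continuous_on[OF bounded_bilinear_smult])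
    show "?f ` (UNIV - ?Z) <= ?S" by auto
    show "a \<in> ?f ` (UNIV - ?Z)" using that by (intro image_eqI[of _ _ 0]) auto
    show "b \<in> ?f ` (UNIV - ?Z)" using that by (intro image_eqI[of _ _ 1]) auto
  qed
  note ex = this
  show ?thesis
  proof (rule connected_iff_connected_component[THEN iffD2], intro ballI)
    fix a b assume "a \<in> ?S" "b \<in> ?S"
    from ex[OF this] show "connected_component ?S a b" unfolding connected_component_def .
  qed
qed

lemma open_hyperplane_complement: "open {z :: 'k::finite V. herm z e ~= 0}"
  by (rule open_Collect_neq) (intro continuous_intros bounded_bilinear.continuous_on[OF bounded_bilinear_herm])+

text \<open>By Pythagoras the projection of \<open>e\<close> to the line of \<open>z\<close> is
  nearer to \<open>e\<close> than 0 is. It serves as the representative of this line in the ball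
  where a developing map is constructed first.\<close>

lemma projection_in_ball:
  fixes z e :: "'k::finite V"
  assumes "herm z e ~= 0" shows "(herm e z / herm z z) *s z \<in> ball e (norm e)"
proof -
  let ?p = "(herm e z / herm z z) *s z"
  have z: "z ~= 0" using assms by (auto simp: herm_simps)
  have o: "herm (e - ?p) ?p = 0" using z cnj_herm[of e z] by (simp add: herm_simps cnj_herm)
  have "herm e e = herm (e - ?p) (e - ?p) + herm ?p ?p"
  proof -
    have "herm e e = herm ((e - ?p) + ?p) ((e - ?p) + ?p)" by simp
    also have "... = herm (e - ?p) (e - ?p) + herm (e - ?p) ?p + (cnj (herm (e - ?p) ?p) + herm ?p ?p)"
      unfolding cnj_herm by (simp only: herm_add add_ac)
    finally show ?thesis unfolding o by simp
  qed
  then have "(norm e)\<^sup>2 = (norm (e - ?p))\<^sup>2 + (norm ?p)\<^sup>2"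
    unfolding herm_self of_real_add[symmetric] of_real_eq_iff .
  moreover have "herm e z ~= 0" using assms cnj_herm[of z e] by auto
  then have "?p ~= 0" using z by simp
  then have "(norm ?p)\<^sup>2 > 0" by simp
  ultimately have "(norm (e - ?p))\<^sup>2 < (norm e)\<^sup>2" by linarith
  then have "norm (e - ?p) < norm e" by (rule power2_less_imp_less) simp
  then show ?thesis by (simp add: dist_norm)
qed

section \<open>Continuation to all nonzero vectors\<close>

context cp_manifold
begin

lemma dev_linear:
  fixes U :: "'n option V => 'n option V"
  assumes G: "dev D G" and U: "clinearv U" and iso: "!!z u v. hF (U z) (U u) (U v) = hF z u v"
  shows "dev (U -` D) (%z. G (U z))"
proof -
  have bU: "bounded_linear U" using clinearv_linear[OF U] by (simp add: linear_conv_bounded_linear)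
  have oU: "open (U -` W)" if "open W" for W
    by (rule open_vimage[OF that]) (rule linear_continuous_on[OF bU])
  have U0: "U 0 = 0" using clinearvD(2)[OF U, of 0 0] by simp
  show ?thesis
  proof (rule devI)
    show "0 \<notin> U -` D" using G U0 by (simp add: dev_def)
    show "smooth_into (U -` D) (%z. G (U z))" unfolding smooth_into_def
    proof (intro conjI oU devD(4)[OF G] ballI)
      fix z assume "z \<in> U -` D"
      then obtain c V where c: "c \<in> atlas M" "open V" "U z \<in> V" "V <= D" "G ` V <= fst c" "smooth_on (snd c o G) V"
        using devD(3)[OF G] unfolding smooth_into_def by auto
      have "smooth_on (%z. (snd c o G) (U z)) (U -` V)"
        by (rule smooth_on_compose[OF oU[OF c(2)] c(6) smooth_on_linear[OF bU oU[OF c(2)] smooth_on_id[OF oU[OF c(2)]]]]) auto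
      then show "EX c:atlas M. EX V. open V & z \<in> V & V <= U -` D & (%z. G (U z)) ` V <= fst c & smooth_on (snd c o (%z. G (U z))) V"
        using c oU by (intro bexI[OF _ c(1)] exI[of _ "U -` V"]) (auto simp: comp_def)
    qed
    fix z assume z: "z \<in> U -` D"
    then have zD: "U z \<in> D" by simp
    obtain c where c: "c \<in> atlas M" "G (U z) \<in> fst c" and h: "der (snd c o G) (fd (snd c o G) (U z)) (U z)"
      using dev_chart[OF G zD] by blast
    have "der (snd c o (%z. G (U z))) (%u. fd (snd c o G) (U z) (U u)) z"
      using has_derivative_compose[OF bounded_linear_imp_has_derivative[OF bU] h] by (simp add: comp_def)
    then have e: "fd (snd c o (%z. G (U z))) z = (%u. fd (snd c o G) (U z) (U u))" by (rule frechet_derivative_at[symmetric])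
    show "EX c:atlas M. G (U z) \<in> fst c & clinearv (fd (snd c o (%z. G (U z))) z) & (ALL u v. hh c (snd c (G (U z)))
        (fd (snd c o (%z. G (U z))) z u) (fd (snd c o (%z. G (U z))) z v) = hF z u v)"
      using devD(1,2)[OF G c(1) zD c(2)] U iso by (intro bexI[OF _ c(1)], unfold e) (auto simp: c(2) clinearv_def)
  qed
qed

text \<open>\<open>hF\<close> annihilates \<open>z\<close> and \<open>hh\<close> is positive, so the
  differential kills the direction of the line. Convexity keeps the path from \<open>z\<close> to
  \<open>a *s z\<close> inside the domain.\<close>

lemma dev_line_constant:
  assumes G: "dev D G" and D: "convex D" "z \<in> D" "a *s z \<in> D" shows "G (a *s z) = G z"
proof -
  define b where "b t = 1 + of_real t * (a - 1)" for t :: real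
  let ?\<gamma> = "%t. b t *s z"
  have \<gamma>D: "?\<gamma> t \<in> D" if "t \<in> {0..1}" for t
  proof -
    have "?\<gamma> t = (1 - t) *\<^sub>R z + t *\<^sub>R (a *s z)" by (simp add: b_def scaleR_vec_eq vec_eq_iff algebra_simps)
    then show ?thesis using D that convexD_alt by (metis atLeastAtMost_iff)
  qed
  have b': "der b (%s. of_real s * (a - 1)) t" for t
    unfolding b_def by (auto intro!: derivative_eq_intros)
  have \<gamma>': "der ?\<gamma> (%s. s *\<^sub>R ((a - 1) *s z)) t" for t
    by (rule has_derivative_eq_rhs[OF bounded_linear.has_derivative[OF bounded_bilinear.bounded_linear_left[OF bounded_bilinear_smult] b']])
      (simp only: scaleR_vec_eq vector_smult_assoc)
  have c\<gamma>: "continuous_on UNIV ?\<gamma>" by (intro continuous_at_imp_continuous_on ballI has_derivative_continuous[OF \<gamma>'])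
  have "G (?\<gamma> 0) = G (?\<gamma> 1)"
  proof (rule connected_equivalence_relation[where S="{0..1::real}" and R="%s t. G (?\<gamma> s) = G (?\<gamma> t)"])
    fix t :: real assume t: "t \<in> {0..1}"
    obtain c where c: "c \<in> atlas M" "G (?\<gamma> t) \<in> fst c" using dev_chart[OF G \<gamma>D[OF t]] by blast
    have oW: "open (D \<inter> G -` fst c)" by (rule smooth_into_open[OF devD(3)[OF G] openin_chart[OF c(1)]])
    have "open (?\<gamma> -` (D \<inter> G -` fst c))" by (rule open_vimage[OF oW c\<gamma>])
    then obtain e where e: "e > 0" "ball t e <= ?\<gamma> -` (D \<inter> G -` fst c)" using \<gamma>D[OF t] c(2) by (elim openE) auto
    have "G (?\<gamma> t) = G (?\<gamma> s)" if s: "s \<in> ball t e" for s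
    proof -
      have "der (%s. (snd c o G) (?\<gamma> s)) (%s. 0) r" if r: "r \<in> ball t e" for r
      proof -
        let ?w = "?\<gamma> r"
        have w: "?w \<in> D" "G ?w \<in> fst c" using e r by auto
        interpret P: tanno_pos "Xc c" "hh c" "Gc c" "f c" "th c" "S c" by (rule tp[OF c(1)])
        have x: "snd c (G ?w) \<in> Xc c" by (rule snd_in[OF c(1) w(2)])
        have w0: "b r ~= 0" using w(1) G by (auto simp: dev_def)
        have cl: "clinearv (fd (snd c o G) ?w)" by (rule devD(1)[OF G c(1) w])
        have "hh c (snd c (G ?w)) (fd (snd c o G) ?w ?w) (fd (snd c o G) ?w ?w) = 0" unfolding devD(2)[OF G c(1) w] hF_z ..
        then have 0: "fd (snd c o G) ?w ?w = 0" using P.h_pos[OF x, of "fd (snd c o G) ?w ?w"] by fastforce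
        have "z = inverse (b r) *s ?w" using w0 by simp
        then have z1: "fd (snd c o G) ?w z = 0" using clinearvD(2)[OF cl, of "inverse (b r)" ?w] 0 by simp
        have z: "fd (snd c o G) ?w (s *\<^sub>R ((a - 1) *s z)) = 0" for s
          by (simp only: scaleR_vec_eq clinearvD(2)[OF cl] z1 vector_smult_rzero)
        have wD: "?w \<in> D \<inter> G -` fst c" using w by simp
        show ?thesis using has_derivative_compose[OF \<gamma>' smooth_on_deriv[OF smooth_into_chart[OF devD(3)[OF G] c(1)] wD]] unfolding z .
      qed
      then have "(snd c o G) (?\<gamma> s) = (snd c o G) (?\<gamma> t)"
        using s e(1) by (intro has_derivative_zero_unique[of "ball t e" "%s. (snd c o G) (?\<gamma> s)", OF convex_ball]) (auto intro: has_derivative_at_withinI)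
      then have "snd c (G (?\<gamma> t)) = snd c (G (?\<gamma> s))" by simp
      then show ?thesis using inj_onD[OF inj_c[OF c(1)]] c(2) e(2) s by blast
    qed
    then show "EX T. openin (top_of_set {0..1}) T & t \<in> T & (ALL s:T. G (?\<gamma> t) = G (?\<gamma> s))"
      using t e(1) by (intro exI[of _ "{0..1} \<inter> ball t e"]) (auto intro: openin_open_Int)
  qed auto
  then show ?thesis by (simp add: b_def)
qed

lemma dev_continue:
  assumes r: "0 < r1"
  obtains \<rho> where "\<rho> > 0" "!!D G y. dev D G ==> convex D ==> y \<in> D ==> r1 <= norm y ==> norm y <= r2 ==>
    EX G'. dev (ball y \<rho>) G' & (ALL z:ball y \<rho> \<inter> D. G' z = G z)"
proof -
  from dev_uniform[OF r, of r2]
  obtain \<rho> where \<rho>: "\<rho> > 0" and u: "ALL m:TM. EX c:atlas M. m \<in> fst c & (ALL z L. r1 <= norm z & norm z <= r2 & clinearv L &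
     (ALL u v. hh c (snd c m) (L u) (L v) = hF z u v) --> (EX G. dev (ball z \<rho>) G & G z = m & fd (snd c o G) z = L))"
    by (elim exE conjE) (rule that)
  show ?thesis
  proof (rule that[OF \<rho>])
    fix D G y assume G: "dev D G" and D: "convex D" "y \<in> D" and y: "r1 <= norm y" "norm y <= r2"
    have "G y \<in> TM" using dev_chart[OF G D(2)] fst_subset by blast
    from bspec[OF u this] obtain c where c: "c \<in> atlas M" "G y \<in> fst c" and ex: "ALL z L. r1 <= norm z & norm z <= r2 & clinearv L &
      (ALL u v. hh c (snd c (G y)) (L u) (L v) = hF z u v) --> (EX G'. dev (ball z \<rho>) G' & G' z = G y & fd (snd c o G') z = L)" by (elim bexE conjE)
    obtain G' where G': "dev (ball y \<rho>) G'" "G' y = G y" "fd (snd c o G') y = fd (snd c o G) y"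
      using ex[rule_format, of y "fd (snd c o G) y"] y devD(1,2)[OF G c(1) D(2) c(2)] by auto
    let ?B = "ball y \<rho> \<inter> D"
    have o: "open ?B" "connected ?B" using devD(4)[OF G] D(1) by (auto intro!: convex_connected convex_Int)
    have "G' z = G z" if "z \<in> ?B" for z
      by (rule dev_unique[OF dev_subset[OF G'(1) o(1)] dev_subset[OF G o(1)] o _ c(1) _ G'(2,3) that]) (use D \<rho> c G'(2) in auto)
    then show "EX G'. dev (ball y \<rho>) G' & (ALL z:?B. G' z = G z)" using G'(1) by blast
  qed
qed

text \<open>Concentric balls are convex, so continuation to larger radii meets no monodromy. It can
  go on until the bounding sphere reaches 0, at radius \<open>norm e\<close>.\<close>

lemma dev_ball:
  assumes G0: "dev (ball e s0) G0" and s0: "s0 > 0" "s0 <= norm e"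
  shows "EX G. dev (ball e (norm e)) G & (ALL z:ball e s0. G z = G0 z)"
proof -
  define Q where "Q s G \<longleftrightarrow> dev (ball e s) G & (ALL z:ball e s0. G z = G0 z)" for s G
  define T where "T = {s. s0 <= s & s <= norm e & (EX G. Q s G)}"
  have T0: "s0 \<in> T" using s0 G0 by (auto simp: T_def Q_def)
  have bdd: "bdd_above T" by (rule bdd_aboveI[of _ "norm e"]) (simp add: T_def)
  define s' where "s' = Sup T"
  have s': "s' <= norm e" "s0 <= s'" unfolding s'_def using T0 bdd by (auto intro!: cSup_least cSup_upper simp: T_def)
  have "s' = norm e"
  proof (rule ccontr)
    assume "s' ~= norm e"
    then have r1: "norm e - s' > 0" using s' by simp
    obtain \<rho> where \<rho>: "\<rho> > 0" and cont: "!!D G y. dev D G ==> convex D ==> y \<in> D ==> norm e - s' <= norm y ==> norm y <= 2 * norm e ==>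
      EX G'. dev (ball y \<rho>) G' & (ALL z:ball y \<rho> \<inter> D. G' z = G z)"
      by (rule dev_continue[OF r1, where ?r2.0="2 * norm e"]) (rule that)
    obtain s where s: "s \<in> T" "s' - \<rho> / 8 < s" using less_cSupE[of "s' - \<rho> / 8" T] T0 \<rho> unfolding s'_def by auto
    then obtain G where G: "dev (ball e s) G" "ALL z:ball e s0. G z = G0 z" and se: "s0 <= s" "s <= norm e" by (auto simp: T_def Q_def)
    have ss: "s <= s'" unfolding s'_def by (rule cSup_upper[OF s(1) bdd])
    \<comment> \<open>The balls considered stay at distance at least \<open>norm e - s'\<close> from
      0, so \<open>dev_continue\<close> provides one radius \<open>\<rho>\<close> for all their
      points.\<close>
    have "norm e - s' <= norm y & norm y <= 2 * norm e" if "y \<in> ball e s" for y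
    proof -
      have "norm (e - y) < s" using that by (simp add: dist_norm)
      then show ?thesis using norm_triangle_ineq2[of e y] norm_triangle_ineq2[of y e] ss se by (simp add: norm_minus_commute)
    qed
    then have "ALL y:ball e s. EX G'. dev (ball y \<rho>) G' & (ALL z:ball y \<rho> \<inter> ball e s. G' z = G z)"
      using cont[OF G(1) convex_ball] by blast
    then obtain H where H: "!!y. y \<in> ball e s ==> dev (ball y \<rho>) (H y)" "!!y z. y \<in> ball e s ==> z \<in> ball y \<rho> \<inter> ball e s ==> H y z = G z" by metis
    \<comment> \<open>If two quarter balls meet, each centre lies in the full ball around the other.
      The intersection of the full balls then meets \<open>ball e s\<close>, where both maps equal
      \<open>G\<close>, and it is connected.\<close>
    have "EX G'. dev (\<Union>y\<in>ball e s. ball y (\<rho> / 4)) G' & (ALL y:ball e s. ALL z:ball y (\<rho> / 4). G' z = H y z)"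
    proof (rule dev_glue)
      show "dev (ball y (\<rho> / 4)) (H y)" if "y \<in> ball e s" for y by (rule dev_subset[OF H(1)[OF that]]) (use \<rho> in auto)
      fix y y' z assume y: "y \<in> ball e s" "y' \<in> ball e s" "z \<in> ball y (\<rho> / 4)" "z \<in> ball y' (\<rho> / 4)"
      let ?B = "ball y \<rho> \<inter> ball y' \<rho>"
      have "dist y y' <= dist y z + dist y' z" by (metis dist_commute dist_triangle)
      then have "y' \<in> ?B \<inter> ball e s" using y \<rho> by simp
      then have ne: "?B \<inter> ball e s ~= {}" by blast
      have zB: "z \<in> ?B" using y(3,4) \<rho> by simp
      have B: "open ?B" "connected ?B" by (auto intro!: convex_connected convex_Int)
      show "H y z = H y' z"
      proof (rule dev_agree[where V="?B \<inter> ball e s", OF dev_subset[OF H(1)[OF y(1)] B(1)] dev_subset[OF H(1)[OF y(2)] B(1)] B(2) _ _ ne _ zB])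
        show "H y w = H y' w" if "w \<in> ?B \<inter> ball e s" for w using H(2)[OF y(1), of w] H(2)[OF y(2), of w] that by simp
      qed auto
    qed
    then obtain G' where G': "dev (\<Union>y\<in>ball e s. ball y (\<rho> / 4)) G'" "!!y z. y \<in> ball e s ==> z \<in> ball y (\<rho> / 4) ==> G' z = H y z" by blast
    have sub: "ball e (s + \<rho> / 8) <= (\<Union>y\<in>ball e s. ball y (\<rho> / 4))"
    proof
      fix z assume z: "z \<in> ball e (s + \<rho> / 8)"
      show "z \<in> (\<Union>y\<in>ball e s. ball y (\<rho> / 4))"
      proof (cases "z \<in> ball e s")
        case True
        then show ?thesis using \<rho> by (intro UN_I[of z]) simp_all
      next
        case False
        define n where "n = norm (z - e)"
        have n: "s <= n" "n < s + \<rho> / 8" "n > 0" using z False s0 se by (auto simp: n_def dist_norm norm_minus_commute)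
        \<comment> \<open>The point \<open>z\<close> is moved radially to distance
          \<open>s - \<rho> / 16\<close> from \<open>e\<close>, or to \<open>e\<close> itself if
          this is negative. This is a shift by less than \<open>\<rho> / 4\<close>.\<close>
        define t where "t = max 0 (s - \<rho> / 16) / n"
        define y where "y = e + t *\<^sub>R (z - e)"
        have t: "t * n = max 0 (s - \<rho> / 16)" "t >= 0" using n by (simp_all add: t_def)
        have "norm (y - e) = t * n" using t(2) by (simp add: y_def n_def)
        then have "y \<in> ball e s" using t s0 se \<rho> by (simp add: dist_norm norm_minus_commute max_def split: if_splits)
        moreover have "z \<in> ball y (\<rho> / 4)"
        proof -
          have "z - y = (1 - t) *\<^sub>R (z - e)" by (simp add: y_def algebra_simps)
          then have "norm (z - y) = \<bar>1 - t\<bar> * \<bar>n\<bar>" by (simp add: n_def)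
          also have "... = \<bar>n - t * n\<bar>" by (simp only: abs_mult[symmetric] left_diff_distrib mult_1)
          also have "... < \<rho> / 4" unfolding t using n \<rho> by (simp add: max_def)
          finally show ?thesis by (simp add: dist_norm norm_minus_commute)
        qed
        ultimately show ?thesis by blast
      qed
    qed
    define s2 where "s2 = min (norm e) (s + \<rho> / 8)"
    have s2: "s' < s2" "s2 <= norm e" "s2 <= s + \<rho> / 8" using s(2) r1 by (auto simp: s2_def)
    have "ball e s2 <= ball e (s + \<rho> / 8)" using s2(3) by auto
    then have "dev (ball e s2) G'" by (intro dev_subset[OF G'(1)]) (use sub in auto)
    moreover have "G' z = G0 z" if z: "z \<in> ball e s0" for z
    proof -
      have ze: "z \<in> ball e s" using z se by simp
      show ?thesis using G'(2)[OF ze, of z] H(2)[OF ze, of z] G(2) ze z \<rho> by simp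
    qed
    ultimately have "s2 \<in> T" using s2 s' by (auto simp: T_def Q_def)
    then have "s2 <= s'" unfolding s'_def by (rule cSup_upper[OF _ bdd])
    then show False using s2 by simp
  qed
  define H where "H s = (SOME G. Q s G)" for s
  have H: "dev (ball e s) (H s)" "z \<in> ball e s0 ==> H s z = G0 z" if "s \<in> T" for s z
    using someI_ex[of "Q s"] that unfolding H_def T_def Q_def by auto
  have "EX G. dev (\<Union>s\<in>T. ball e s) G & (ALL s:T. ALL z:ball e s. G z = H s z)"
  proof (rule dev_glue[OF H(1)])
    fix s t z assume s: "s \<in> T" "t \<in> T" "z \<in> ball e s" "z \<in> ball e t"
    have st: "s0 <= s" "s0 <= t" using s by (auto simp: T_def)
    let ?B = "ball e s \<inter> ball e t"
    have B: "open ?B" "connected ?B" by (auto intro!: convex_connected convex_Int)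
    have zB: "z \<in> ?B" using s by simp
    show "H s z = H t z"
    proof (rule dev_agree[where V="ball e s0", OF dev_subset[OF H(1)[OF s(1)] B(1)] dev_subset[OF H(1)[OF s(2)] B(1)] B(2) open_ball _ _ _ zB])
      show "H s w = H t w" if "w \<in> ball e s0" for w using H(2)[OF s(1) that] H(2)[OF s(2) that] by simp
    qed (use st s0 in auto)
  qed
  then obtain G where G: "dev (\<Union>s\<in>T. ball e s) G" "!!s z. s \<in> T ==> z \<in> ball e s ==> G z = H s z" by blast
  have "ball e (norm e) <= (\<Union>s\<in>T. ball e s)"
  proof
    fix z assume "z \<in> ball e (norm e)"
    then have "dist e z < Sup T" using \<open>s' = norm e\<close> by (simp add: s'_def)
    then obtain s where "s \<in> T" "dist e z < s" using less_cSupE[of "dist e z" T] T0 by auto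
    then show "z \<in> (\<Union>s\<in>T. ball e s)" by auto
  qed
  then show ?thesis using dev_subset[OF G(1)] G(2)[OF T0] H(2)[OF T0] by (intro exI[of _ G]) auto
qed

end

lemma (in tanno_pos) orthonormal_frame:
  assumes x: "x \<in> X" shows "EX b :: 'n => 'n V. ALL i j. h x (b i) (b j) = (if i = j then 1 else 0)"
proof -
  have "EX b. ALL i:A. ALL j:A. h x (b i) (b j) = (if i = j then 1 else 0)" if "finite A" for A :: "'n set"
    using that
  proof induction
    case (insert k A)
    then obtain b where b: "ALL i:A. ALL j:A. h x (b i) (b j) = (if i = j then 1 else 0)" by blast
    \<comment> \<open>Component \<open>k\<close> of \<open>L\<close> is always 0, so
      \<open>L\<close> is not onto and hence not injective. Its kernel contains a vector orthogonal
      to the frame found so far.\<close>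
    define L where "L v = (\<chi> i. if i \<in> A then h x v (b i) else 0)" for v
    have lL: "linear L" unfolding L_def by (rule linearI) (simp_all add: vec_eq_iff h_simps[OF x] scaleR_vec_eq)
    have "~ surj L"
    proof
      assume "surj L"
      then obtain v where "axis k 1 = L v" by (rule surjE)
      then have "axis k (1::complex) $ k = L v $ k" by simp
      then show False using insert(2) by (simp add: L_def)
    qed
    then have "~ inj L" using linear_injective_imp_surjective[OF lL] by auto
    then obtain v where v: "v ~= 0" "L v = 0" unfolding linear_injective_0[OF lL] by blast
    have vb: "h x v (b i) = 0" if "i \<in> A" for i using arg_cong[OF v(2), of "%u. u $ i"] that by (simp add: L_def)
    define q where "q = Re (h x v v)"
    have q: "q > 0" "h x v v = of_real q" using h_pos[OF x v(1)] h_real[OF x, of v] by (simp_all add: q_def complex_eq_iff)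
    define w where "w = of_real (1 / sqrt q) *s v"
    have "1 / sqrt q * (1 / sqrt q * q) = 1" using q(1) by (simp add: field_simps)
    then have ww: "h x w w = 1" unfolding w_def h_scale[OF x] h_scale2[OF x] q(2) complex_cnj_complex_of_real of_real_mult[symmetric] by simp
    have wb: "h x w (b i) = 0" "h x (b i) w = 0" if "i \<in> A" for i
      using vb[OF that] cnj_h[OF x, of v "b i"] by (simp_all add: w_def h_simps[OF x])
    show ?case
      by (rule exI[of _ "b(k := w)"]) (use b ww wb insert(2) in auto)
  qed simp
  from this[of UNIV] show ?thesis by auto
qed

lemma ball_herm: "z \<in> ball e (norm e) ==> herm z e ~= 0"
proof
  assume "z \<in> ball e (norm e)" "herm z e = 0"
  then have "norm (e - z) < norm e" "e \<bullet> z = 0" using Re_herm[of z e] by (simp_all add: dist_norm inner_commute)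
  moreover from this have "(norm (e - z))\<^sup>2 = (norm e)\<^sup>2 + (norm z)\<^sup>2"
    by (simp add: power2_norm_eq_inner inner_diff_left inner_diff_right inner_commute)
  ultimately show False using power_strict_mono[of "norm (e - z)" "norm e" 2] by simp
qed

context cp_manifold
begin

definition "Dh e = {z :: 'n option V. herm z e ~= 0}"
definition "homogeneous G \<longleftrightarrow> (ALL a z. a ~= 0 --> G (a *s z) = G (z :: 'n option V))"

lemma dev_initial:
  assumes "TM ~= {}"
  shows "EX e \<rho> G. e ~= 0 & \<rho> > 0 & \<rho> <= norm e & dev (ball e \<rho>) G"
proof -
  obtain m where m: "m \<in> TM" using assms by blast
  from dev_uniform[of 1 1, OF zero_less_one]
  obtain \<rho> where \<rho>: "\<rho> > 0" and u: "ALL m:TM. EX c:atlas M. m \<in> fst c & (ALL z L. 1 <= norm z & norm z <= 1 & clinearv L &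
     (ALL u v. hh c (snd c m) (L u) (L v) = hF z u v) --> (EX G. dev (ball z \<rho>) G & G z = m & fd (snd c o G) z = L))"
    by (elim exE conjE) (rule that)
  obtain c where c: "c \<in> atlas M" "m \<in> fst c" and ex: "ALL z L. 1 <= norm z & norm z <= 1 & clinearv L &
     (ALL u v. hh c (snd c m) (L u) (L v) = hF z u v) --> (EX G. dev (ball z \<rho>) G & G z = m & fd (snd c o G) z = L)"
    using bspec[OF u m] by (elim bexE conjE)
  interpret P: tanno_pos "Xc c" "hh c" "Gc c" "f c" "th c" "S c" by (rule tp[OF c(1)])
  let ?x = "snd c m" let ?e = "axis None 1 :: 'n option V"
  have x: "?x \<in> Xc c" by (rule snd_in[OF c])
  obtain b :: "'n => 'n V" where b: "!!i j. hh c ?x (b i) (b j) = (if i = j then 1 else 0)" using P.orthonormal_frame[OF x] by blast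
  \<comment> \<open>At \<open>axis None 1\<close> the form \<open>hF\<close> is the standard form in
    the other coordinates, so an orthonormal frame yields an isometric differential.\<close>
  define L where "L u = (\<Sum>j\<in>UNIV. u $ Some j *s b j)" for u :: "'n option V"
  have cl: "clinearv L" by (simp add: clinearv_def L_def vec_eq_iff sum.distrib sum_distrib_left algebra_simps)
  have La: "L ?e = 0" "L (axis (Some i) 1) = b i" for i
    by (simp_all add: L_def vec_eq_iff axis_def if_distrib if_distribR cong: if_cong)
  have he: "herm ?e ?e = 1" by (simp only: herm_axis axis_nth complex_cnj_one)
  have "hh c ?x (L (axis i 1)) (L (axis j 1)) = hF ?e (axis i 1) (axis j 1)" for i j
  proof (cases "i = None | j = None")
    case True
    then show ?thesis by (auto simp: La hF_z P.h_zero[OF x])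
  next
    case False
    then obtain i' j' where ij: "i = Some i'" "j = Some j'" by auto
    have "herm (axis i 1) ?e = 0" unfolding herm_axis(2) ij by (simp add: axis_def)
    moreover have "herm (axis i (1::complex)) (axis j 1) = (if i' = j' then 1 else 0)" unfolding herm_axis(2) ij by (simp add: axis_def)
    ultimately show ?thesis unfolding hF_def he by (simp add: ij La b)
  qed
  then have iso: "hh c ?x (L u) (L v) = hF ?e u v" for u v
    by (rule sesquilinear_eqI[where B="%u v. hh c ?x (L u) (L v)" and B'="hF ?e", OF _ hF_clinear(1) _ hF_clinear(2), rotated 2])
      (simp_all only: clinear_def clinearvD[OF cl] P.h_simps[OF x] complex_cnj_add complex_cnj_mult complex_cnj_cnj simp_thms)
  have "(norm ?e)\<^sup>2 = 1" using he unfolding herm_self by (simp flip: of_real_power)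
  then have ne: "norm ?e = 1" by (simp add: power2_eq_1_iff)
  then obtain G where G: "dev (ball ?e \<rho>) G" using ex[rule_format, of ?e L] cl iso by auto
  have "dev (ball ?e (min \<rho> 1)) G" by (rule dev_subset[OF G]) auto
  then show ?thesis using \<rho> ne by (intro exI[of _ ?e] exI[of _ "min \<rho> 1"] exI[of _ G]) auto
qed

text \<open>Each line outside the hyperplane orthogonal to \<open>e\<close> meets the ball, and
  \<open>G\<close> is constant on the part inside. So \<open>G\<close> extends to the cone by
  homogeneity.\<close>

lemma dev_cone:
  assumes G: "dev (ball e (norm e)) G" and e: "e ~= 0"
  shows "EX G'. dev (Dh e) G' & (ALL z:ball e (norm e). G' z = G z) & homogeneous G'"
proof -
  define p where "p z = herm e z / herm z z" for z :: "'n option V"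
  define G' where "G' z = G (p z *s z)" for z
  have pb: "p z *s z \<in> ball e (norm e)" if "herm z e ~= 0" for z unfolding p_def by (rule projection_in_ball[OF that])
  have p0: "p z ~= 0" if "herm z e ~= 0" for z using ball_herm[OF pb[OF that]] by (auto simp: herm_simps)
  have "G' (a *s z) = G' z" if "a ~= 0" for a z
  proof -
    have "p (a *s z) * a = p z" using that by (cases "z = 0") (simp_all add: p_def herm_simps)
    then show ?thesis by (simp add: G'_def)
  qed
  moreover have "G' z = G z" if z: "z \<in> ball e (norm e)" for z
    unfolding G'_def by (rule dev_line_constant[OF G convex_ball z pb[OF ball_herm[OF z]]])
  moreover have "dev (Dh e) G'"
  proof (rule dev_cong)
    show "open (Dh e)" unfolding Dh_def by (rule open_hyperplane_complement)
    fix z0 assume "z0 \<in> Dh e"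
    then have z0: "herm z0 e ~= 0" by (simp add: Dh_def)
    \<comment> \<open>The factor \<open>p z\<close> is not holomorphic in \<open>z\<close>. Near
      \<open>z0\<close> it may be replaced by the constant \<open>p z0\<close>, since both multiples
      of \<open>z\<close> lie in the ball and on one line.\<close>
    let ?a = "p z0" let ?U = "%z. ?a *s z"
    have dv: "dev (?U -` ball e (norm e)) (%z. G (?U z))"
      by (rule dev_linear[OF G]) (simp_all add: clinearv_def vec_eq_iff algebra_simps hF_homogeneous[OF p0[OF z0]])
    have "G' z = G (?U z)" if z: "z \<in> ?U -` ball e (norm e)" for z
    proof -
      have U: "?U z \<in> ball e (norm e)" using z by simp
      have ze: "herm z e ~= 0" using ball_herm[OF U] by (auto simp: herm_simps)
      have "(p z / ?a) *s ?U z = p z *s z" using p0[OF z0] by simp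
      then show ?thesis unfolding G'_def using dev_line_constant[OF G convex_ball U, of "p z / ?a"] pb[OF ze] p0[OF z0] by simp
    qed
    then show "EX V G''. open V & z0 \<in> V & dev V G'' & (ALL w:V. G' w = G'' w)"
      using dv devD(4)[OF dv] pb[OF z0] by (intro exI[of _ "?U -` ball e (norm e)"] exI[of _ "%z. G (?U z)"]) simp
  qed
  ultimately show ?thesis unfolding homogeneous_def by blast
qed

text \<open>Each \<open>H e\<close> coincides with \<open>G0\<close> on the part of its cone inside
  \<open>Dh e0\<close>. Two of them therefore agree on an open subset of the connected overlap of
  their cones, hence on the whole overlap.\<close>

lemma dev_global:
  assumes ne: "TM ~= {}"
  shows "EX G. dev (- {0}) G & homogeneous G"
proof -
  obtain e0 \<rho> G1 where e0: "e0 ~= 0" and "\<rho> > 0" "\<rho> <= norm e0" "dev (ball e0 \<rho>) G1" using dev_initial[OF ne] by blast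
  then obtain G2 where "dev (ball e0 (norm e0)) G2" using dev_ball by blast
  from dev_cone[OF this e0] obtain G0 where G0: "dev (Dh e0) G0" by blast
  have con: "connected (Dh e \<inter> Dh e')" for e e'
    using connected_hyperplane_complement[of "{e, e'}"] by (simp add: Dh_def Collect_conj_eq)
  have op: "open (Dh e)" for e unfolding Dh_def by (rule open_hyperplane_complement)
  have "EX H. dev (Dh e) H & homogeneous H & (ALL z:Dh e \<inter> Dh e0. H z = G0 z)" if e: "e \<in> Dh e0" for e
  proof -
    have en: "e ~= 0" using e by (auto simp: Dh_def herm_simps)
    obtain s where s: "s > 0" "ball e s <= Dh e0" by (rule openE[OF op e])
    define s' where "s' = min s (norm e)"
    have s': "s' > 0" "s' <= norm e" "ball e s' <= Dh e0" using s en by (auto simp: s'_def)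
    obtain K where K: "dev (ball e (norm e)) K" "ALL z:ball e s'. K z = G0 z"
      using dev_ball[OF dev_subset[OF G0 open_ball s'(3)] s'(1,2)] by blast
    obtain H where H: "dev (Dh e) H" "ALL z:ball e (norm e). H z = K z" "homogeneous H" using dev_cone[OF K(1) en] by blast
    have "H z = G0 z" if z: "z \<in> Dh e \<inter> Dh e0" for z
    proof (rule dev_agree[OF dev_subset[OF H(1)] dev_subset[OF G0] con _ _ _ _ z])
      show "ball e s' <= Dh e \<inter> Dh e0" using s' ball_herm[of _ e] by (auto simp: Dh_def)
      show "H w = G0 w" if "w \<in> ball e s'" for w using H(2) K(2) that s'(2) by simp
    qed (use op s' in auto)
    then show ?thesis using H by blast
  qed
  then obtain H where H: "!!e. e \<in> Dh e0 ==> dev (Dh e) (H e) & homogeneous (H e) & (ALL z:Dh e \<inter> Dh e0. H e z = G0 z)" by metis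
  have "EX G. dev (\<Union>e\<in>Dh e0. Dh e) G & (ALL e:Dh e0. ALL z:Dh e. G z = H e z)"
  proof (rule dev_glue)
    fix e e' z assume e: "e \<in> Dh e0" "e' \<in> Dh e0" and z: "z \<in> Dh e" "z \<in> Dh e'"
    let ?V = "Dh e \<inter> Dh e' \<inter> Dh e0"
    \<comment> \<open>The complex line from \<open>z\<close> to \<open>e0\<close> meets each of the
      three hyperplanes in finitely many points, so some point of it lies in all three
      cones.\<close>
    let ?Z = "%e. {t. herm (z + t *s (e0 - z)) e = 0}"
    have "finite (?Z e)" "finite (?Z e')" "finite (?Z e0)"
      by (rule affine_zero_finite; use z e0 in \<open>simp add: Dh_def\<close>)+
    then have fin: "finite (?Z e \<union> ?Z e' \<union> ?Z e0)" by simp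
    from ex_new_if_finite[OF infinite_UNIV_char_0 fin] obtain t where "t \<notin> ?Z e \<union> ?Z e' \<union> ?Z e0" by (elim exE)
    then have "z + t *s (e0 - z) \<in> ?V" by (simp add: Dh_def)
    then have ne: "?V ~= {}" by blast
    show "H e z = H e' z"
    proof (rule dev_agree[where D="Dh e \<inter> Dh e'" and V="?V", OF dev_subset dev_subset con _ _ ne])
      show "dev (Dh e) (H e)" "dev (Dh e') (H e')" using H e by blast+
      show "H e w = H e' w" if "w \<in> ?V" for w using H[OF e(1)] H[OF e(2)] that by simp
    qed (use op z in auto)
  qed (use H in blast)
  then obtain G where G: "dev (\<Union>e\<in>Dh e0. Dh e) G" "!!e z. e \<in> Dh e0 ==> z \<in> Dh e ==> G z = H e z" by blast
  have cover: "EX e:Dh e0. z \<in> Dh e" if z: "z ~= 0" for z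
  proof (cases "herm z e0 = 0")
    case True
    then have "herm e0 z = 0" using cnj_herm[of z e0] by simp
    \<comment> \<open>If \<open>z\<close> is orthogonal to \<open>e0\<close>, then
      \<open>e0 + z\<close> is orthogonal to neither of them.\<close>
    then show ?thesis using True z e0 by (intro bexI[of _ "e0 + z"]) (simp_all add: Dh_def herm_add)
  next
    case False
    then show ?thesis using e0 by (intro bexI[of _ e0]) (simp_all add: Dh_def)
  qed
  have "dev (- {0}) G" by (rule dev_subset[OF G(1)]) (use cover in auto)
  moreover have "G (a *s z) = G z" if a: "a ~= 0" for a z
  proof (cases "z = 0")
    case False
    obtain e where e: "e \<in> Dh e0" "z \<in> Dh e" using cover[OF False] by blast
    then have "a *s z \<in> Dh e" using a by (simp add: Dh_def herm_scale)
    then show ?thesis using G(2)[OF e(1)] e H[OF e(1)] a by (simp add: homogeneous_def)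
  qed simp
  ultimately show ?thesis unfolding homogeneous_def by blast
qed

end

text \<open>The maximum \<open>m\<close> on the sphere is an eigenvalue of the hermitian part of
  \<open>U\<close>, so \<open>U v\<close> plus the preimage \<open>y\<close> of \<open>v\<close>
  equals \<open>2 m v\<close>. Thus \<open>U\<close> satisfies a quadratic equation on
  \<open>v\<close>, which splits over \<complex>.\<close>

lemma unitary_eigenvector:
  fixes U :: "'k::finite V => 'k V"
  assumes U: "clinearv U" and iso: "!!u v. herm (U u) (U v) = herm u v"
  shows "EX v a. v ~= 0 & U v = a *s v"
proof -
  have lU: "linear U" by (rule clinearv_linear[OF U])
  have "inj U" unfolding linear_injective_0[OF lU] by (metis iso herm_self_0)
  then have sU: "surj U" by (rule linear_injective_imp_surjective[OF lU]) simp
  let ?K = "sphere (0 :: 'k V) 1"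
  have "continuous_on ?K (%v. Re (herm (U v) v))"
    by (intro continuous_intros bounded_bilinear.continuous_on[OF bounded_bilinear_herm] linear_continuous_on)
      (use lU in "simp add: linear_conv_bounded_linear")
  then obtain v where v: "v \<in> ?K" and max: "!!w. w \<in> ?K ==> Re (herm (U w) w) <= Re (herm (U v) v)"
    using continuous_attains_sup[of ?K "%v. Re (herm (U v) v)"] by auto
  define m where "m = Re (herm (U v) v)"
  have v0: "v ~= 0" and vv: "herm v v = 1" using v by (auto simp: herm_self)
  have le: "Re (herm (U w) w) <= m * Re (herm w w)" for w
  proof (cases "w = 0")
    case False
    define e where "e = of_real (inverse (norm w)) *s w"
    have eK: "e \<in> ?K" using False by (simp add: e_def norm_smult norm_inverse)
    have we: "of_real (norm w) *s e = w" using False by (simp add: e_def)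
    have s: "herm (U (of_real t *s e)) (of_real t *s e) = of_real (t\<^sup>2) * herm (U e) e" for t
      by (simp add: clinearvD(2)[OF U] herm_scale power2_eq_square)
    have "Re (herm (U w) w) = (norm w)\<^sup>2 * Re (herm (U e) e)" using s[of "norm w"] unfolding we by simp
    also have "... <= (norm w)\<^sup>2 * m" using max[OF eK] by (simp add: m_def mult_left_mono)
    finally show ?thesis by (simp add: herm_self mult.commute)
  qed (simp add: herm_zero)
  obtain y where y: "v = U y" using sU by (rule surjE)
  have "Re (herm (U v + y - of_real (2 * m) *s v) w) / 2 = 0" for w
  proof (rule linear_coefficient_zero)
    fix t :: real
    let ?w = "v + of_real t *s w"
    have e: "herm (U ?w) ?w = herm (U v) v + of_real t * (herm (U v) w + herm w y) + of_real (t\<^sup>2) * herm (U w) w"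
    proof -
      have "herm (U w) v = herm w y" unfolding y iso ..
      then show ?thesis by (simp add: clinearvD[OF U] herm_add herm_scale power2_eq_square algebra_simps)
    qed
    have f: "herm ?w ?w = herm v v + of_real t * (herm v w + herm w v) + of_real (t\<^sup>2) * herm w w"
      by (simp add: herm_add herm_scale power2_eq_square algebra_simps)
    have c: "Re (herm w y) = Re (herm y w)" "Re (herm w v) = Re (herm v w)" by (simp_all add: Re_herm inner_commute)
    have "m + t * (Re (herm (U v) w) + Re (herm y w)) + t\<^sup>2 * Re (herm (U w) w) <= m * (1 + t * (2 * Re (herm v w)) + t\<^sup>2 * Re (herm w w))"
      using le[of ?w] unfolding e f by (simp add: vv c m_def)
    moreover have "2 * t * (X / 2) = t * X" for X :: real by simp
    ultimately show "2 * t * (Re (herm (U v + y - of_real (2 * m) *s v) w) / 2) + t\<^sup>2 * (Re (herm (U w) w) - m * Re (herm w w)) <= 0"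
      by (simp only: herm_add herm_diff herm_scale) (simp add: algebra_simps)
  qed
  then have "Re (herm (U v + y - of_real (2 * m) *s v) (U v + y - of_real (2 * m) *s v)) = 0" by simp
  then have "U v + y - of_real (2 * m) *s v = 0" by (simp add: herm_self)
  then have "U (U v) + U y - U (of_real (2 * m) *s v) = 0" by (metis linear_0[OF lU] linear_add[OF lU] linear_diff[OF lU])
  then have UU: "U (U v) = of_real (2 * m) *s U v - v" by (simp add: y[symmetric] clinearvD(2)[OF U] algebra_simps)
  \<comment> \<open>\<open>a\<close> and \<open>b\<close> are the roots of this equation, with sum
    \<open>2 * m\<close> and product 1. Unless \<open>v\<close> is an eigenvector for
    \<open>b\<close>, the vector \<open>U v - b *s v\<close> is one for \<open>a\<close>.\<close>
  define a where "a = of_real m + csqrt (of_real (m\<^sup>2 - 1))"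
  define b where "b = of_real (2 * m) - a"
  have ab: "a * b = 1"
  proof -
    have "a * b = (of_real m)\<^sup>2 - (csqrt (of_real (m\<^sup>2 - 1)))\<^sup>2" by (simp add: a_def b_def power2_eq_square algebra_simps)
    then show ?thesis by simp
  qed
  show ?thesis
  proof (cases "U v = b *s v")
    case False
    let ?w = "U v - b *s v"
    have "U ?w = of_real (2 * m) *s U v - v - b *s U v" by (simp add: linear_diff[OF lU] UU clinearvD(2)[OF U])
    also have "... = a *s U v - (a * b) *s v" unfolding ab by (simp add: b_def vec_eq_iff algebra_simps)
    also have "... = a *s ?w" by (simp add: vec_eq_iff algebra_simps)
    finally show ?thesis using False by (intro exI[of _ ?w] exI[of _ a]) simp
  qed (use v0 in blast)
qed

section \<open>The global developing map is a bijection modulo scalars\<close>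

context cp_manifold
begin

context
  fixes G :: "'n option V => 'm"
  assumes G: "dev (- {0}) G" and hom: "homogeneous G"
begin

lemma G_scale: "a ~= 0 ==> G (a *s z) = G z" using hom by (simp add: homogeneous_def)

lemma G_kernel:
  assumes c: "c \<in> atlas M" and z: "z ~= 0" "G z \<in> fst c"
  shows "fd (snd c o G) z u = 0 \<longleftrightarrow> (EX a. u = a *s z)"
proof -
  interpret P: tanno_pos "Xc c" "hh c" "Gc c" "f c" "th c" "S c" by (rule tp[OF c])
  have x: "snd c (G z) \<in> Xc c" by (rule snd_in[OF c z(2)])
  have zD: "z \<in> - {0}" using z by simp
  note iso = devD(2)[OF G c zD z(2)]
  show ?thesis
  proof
    assume "fd (snd c o G) z u = 0"
    then have "hF z u u = 0" using iso[of u u] by (simp add: P.h_zero[OF x])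
    then show "EX a. u = a *s z" using hF_degenerate[OF z(1), of u] by auto
  next
    assume "EX a. u = a *s z"
    then obtain a where a: "u = a *s z" by blast
    have "hF z u u = 0" unfolding a hF_simps hF_z by simp
    then show "fd (snd c o G) z u = 0" using iso[of u u] P.h_pos[OF x, of "fd (snd c o G) z u"] by fastforce
  qed
qed

lemma G_open: "open U ==> 0 \<notin> U ==> openin (mtop M) (G ` U)"
proof (subst openin_subopen, intro ballI)
  fix m assume U: "open U" "0 \<notin> U" and "m \<in> G ` U"
  then obtain z where z: "z \<in> U" "m = G z" by blast
  have zD: "z \<in> - {0}" using U(2) z(1) by auto
  obtain c where c: "c \<in> atlas M" "G z \<in> fst c" and h: "der (snd c o G) (fd (snd c o G) z) z" using dev_chart[OF G zD] by blast
  let ?F = "snd c o G" let ?D = "- {0} \<inter> G -` fst c"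
  have oD: "open ?D" by (rule smooth_into_open[OF devD(3)[OF G] openin_chart[OF c(1)]])
  have sF: "smooth_on ?F ?D" by (rule smooth_into_chart[OF devD(3)[OF G] c(1)])
  obtain g' where g': "linear g'" "fd ?F z o g' = id"
    using linear_surjective_right_inverse[OF has_derivative_linear[OF h] dev_rigid(2)[OF G c(1) zD c(2)]] by blast
  have sub: "?D \<inter> U <= ?D" by blast
  have zi: "z \<in> interior (?D \<inter> U)" unfolding interior_open[OF open_Int[OF oD U(1)]] using z(1) zD c(2) by blast
  have "?F z \<in> interior (?F ` (?D \<inter> U))"
    by (rule sussmann_open_mapping[OF oD smooth_on_continuous[OF sF] _ h _ g'(2) sub zi]) (use zD c(2) g'(1) in "auto simp: linear_conv_bounded_linear")
  then obtain W where W: "open W" "?F z \<in> W" "W <= ?F ` (?D \<inter> U)" by (auto simp: interior_def)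
  have "W <= Xc c" using W(3) snd_in[OF c(1)] by auto
  then have "openin (mtop M) (pt c ` W)" using openin_pt[OF c(1) W(1)] by blast
  moreover have "m \<in> pt c ` W" using W(2) pt_snd[OF c] z(2) by force
  moreover have "pt c ` W <= G ` U" using W(3) pt_snd[OF c(1)] by fastforce
  ultimately show "EX T. openin (mtop M) T & m \<in> T & T <= G ` U" by blast
qed

text \<open>The image is open, and by homogeneity it is the image of the compact unit sphere, hence
  closed; the manifold is connected.\<close>

lemma G_surj: "G ` (- {0}) = TM"
proof -
  have op: "openin (mtop M) (G ` (- {0}))" by (rule G_open) auto
  have "G ` (- {0}) = G ` sphere 0 1"
  proof
    show "G ` (- {0}) <= G ` sphere 0 1"
    proof
      fix m assume "m \<in> G ` (- {0})"
      then obtain z where z: "z ~= 0" "m = G z" by blast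
      then have "m = G (of_real (inverse (norm z)) *s z)" by (subst G_scale) simp_all
      moreover have "of_real (inverse (norm z)) *s z \<in> sphere 0 1" using z by (simp add: norm_smult norm_inverse)
      ultimately show "m \<in> G ` sphere 0 1" by blast
    qed
  qed auto
  moreover have "compactin (top_of_set (- {0})) (sphere (0 :: 'n option V) 1)"
    by (simp add: compactin_subtopology)
  then have "compactin (mtop M) (G ` sphere 0 1)" by (rule image_compactin[OF _ smooth_into_continuous[OF devD(3)[OF G]]])
  ultimately have "closedin (mtop M) (G ` (- {0}))" using compactin_imp_closedin[OF Hausdorff_M] by simp
  then have "G ` (- {0}) = {} | G ` (- {0}) = TM" using conn op unfolding connected_space_clopen_in by blast
  moreover have "axis None 1 \<in> - {0 :: 'n option V}" by (simp add: axis_eq_0_iff)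
  ultimately show ?thesis by blast
qed

text \<open>Let \<open>v\<close> be an eigenvector with eigenvalue \<open>a\<close>. Both
  \<open>U\<close> and multiplication by \<open>a\<close> preserve \<open>G\<close> and send
  \<open>v\<close> to \<open>a *s v\<close>, so the differential of \<open>G\<close> there kills
  \<open>U u - a *s u\<close>. This vector is thus a multiple of \<open>v\<close>; by unitarity it
  is also orthogonal to \<open>v\<close>, so it is 0.\<close>

lemma G_symmetry_scalar:
  assumes U: "clinearv U" and iso: "!!u v. herm (U u) (U v) = herm u v" and inv: "!!z. z ~= 0 ==> G (U z) = G z"
  shows "EX a. ALL u. U u = a *s u"
proof -
  obtain v a where v: "v ~= 0" "U v = a *s v" using unitary_eigenvector[OF U iso] by blast
  have "herm v v = a * cnj a * herm v v" using iso[of v v] unfolding v(2) by (simp add: herm_scale mult.commute)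
  then have a: "a * cnj a = 1" using v(1) by (simp add: mult.commute)
  then have a0: "a ~= 0" by auto
  have av: "a *s v ~= 0" using v a0 by simp
  have zD: "v \<in> - {0}" "a *s v \<in> - {0}" using v(1) av by auto
  obtain c where c: "c \<in> atlas M" "G v \<in> fst c" and hv: "der (snd c o G) (fd (snd c o G) v) v" using dev_chart[OF G zD(1)] by blast
  let ?F = "snd c o G"
  have c': "G (a *s v) \<in> fst c" using G_scale[OF a0] c by simp
  have h: "der ?F (fd ?F (a *s v)) (a *s v)"
    by (rule smooth_on_deriv[OF smooth_into_chart[OF devD(3)[OF G] c(1)]]) (use zD c' in simp)
  have e: "fd ?F (a *s v) (L u) = fd ?F v u" if L: "clinearv L" "L v = a *s v" "!!z. z ~= 0 ==> G (L z) = G z" for L u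
  proof -
    have hL: "der L L v" using clinearv_linear[OF L(1)] by (intro bounded_linear_imp_has_derivative) (simp add: linear_conv_bounded_linear)
    have "der (%z. ?F (L z)) (%u. fd ?F (a *s v) (L u)) v" by (rule has_derivative_compose[OF hL]) (simp only: L(2) h)
    then have "der ?F (%u. fd ?F (a *s v) (L u)) v"
      by (rule der_cong[where s="- {0}"]) (use L(3) v(1) in auto)
    from fun_cong[OF has_derivative_unique[OF this hv]] show ?thesis .
  qed
  have cs: "clinearv ((*s) a)" by (simp add: clinearv_def vec_eq_iff algebra_simps)
  have cl: "clinearv (fd ?F (a *s v))" by (rule devD(1)[OF G c(1) zD(2) c'])
  have "U u = a *s u" for u
  proof -
    let ?w = "U u - a *s u"
    have "fd ?F (a *s v) (U u) = fd ?F v u" by (rule e[OF U v(2) inv])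
    moreover have "fd ?F (a *s v) (a *s u) = fd ?F v u" by (rule e[OF cs refl G_scale[OF a0]])
    ultimately have "fd ?F (a *s v) (U u) = fd ?F (a *s v) (a *s u)" by simp
    then have "fd ?F (a *s v) ?w = 0" by (simp add: linear_diff[OF clinearv_linear[OF cl]])
    then obtain b where b: "?w = b *s (a *s v)" using G_kernel[OF c(1) av c'] by blast
    have "herm ?w (U v) = herm (U u) (U v) - a * herm u (a *s v)" by (simp only: herm_diff herm_scale(1) v(2))
    also have "... = herm u v - a * (cnj a * herm u v)" by (simp only: iso herm_scale(2))
    also have "... = 0" using a by (simp add: mult.assoc[symmetric])
    finally have "herm ?w ?w = 0" unfolding v(2) by (subst (2) b) (simp only: herm_scale mult_zero_right)
    then show ?thesis by simp
  qed
  then show ?thesis by blast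
qed

text \<open>The maps \<open>\<Phi> p\<close> and \<open>\<Phi> q\<close> identify the vector space
  with the tangent space plus \<complex>, with the standard form corresponding to \<open>hh\<close>
  plus the standard form of \<complex>. So \<open>U\<close> is unitary and takes \<open>p\<close> to
  \<open>q\<close>. \<open>G\<close> composed with \<open>U\<close> has the same value and
  differential at \<open>p\<close> as \<open>G\<close>, hence equals \<open>G\<close>, and
  \<open>U\<close> is a scalar.\<close>

lemma G_injective_unit:
  assumes pq: "norm p = 1" "norm q = 1" and eq: "G p = G q" shows "EX a. q = a *s p"
proof -
  have p0: "p \<in> - {0}" "q \<in> - {0}" using pq by auto
  obtain c where c: "c \<in> atlas M" "G p \<in> fst c" using dev_chart[OF G p0(1)] by blast
  then have c': "G q \<in> fst c" using eq by simp
  let ?F = "snd c o G"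
  define \<Phi> where "\<Phi> z u = (fd ?F z u, herm u z)" for z u
  note rp = dev_rigid(3,4)[OF G c(1) p0(1) c(2)] and rq = dev_rigid(3,4)[OF G c(1) p0(2) c']
  have lp: "linear (\<Phi> p)" "linear (\<Phi> q)" "inj (\<Phi> q)" using rp rq unfolding \<Phi>_def by auto
  have sq: "surj (\<Phi> q)" by (rule linear_injective_imp_surjective[OF lp(2,3)]) (simp add: dim_UNIV)
  define U where "U u = inv (\<Phi> q) (\<Phi> p u)" for u
  have \<Phi>U: "\<Phi> q (U u) = \<Phi> p u" for u unfolding U_def by (rule surj_f_inv_f[OF sq])
  have cl: "clinearv (fd ?F p)" "clinearv (fd ?F q)" by (rule devD(1)[OF G c(1) p0(1) c(2)], rule devD(1)[OF G c(1) p0(2) c'])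
  have U1: "fd ?F q (U u) = fd ?F p u" "herm (U u) q = herm u p" for u using \<Phi>U[of u] by (simp_all add: \<Phi>_def)
  have cU: "clinearv U" unfolding clinearv_def
    by (intro conjI allI; rule injD[OF lp(3)]; simp add: \<Phi>_def clinearvD[OF cl(1)] clinearvD[OF cl(2)] herm_simps U1)
  have N: "herm p p = 1" "herm q q = 1" using pq by (simp_all add: herm_self)
  have iso: "herm (U u) (U v) = herm u v" for u v
  proof -
    have "hF q (U u) (U v) = hF p u v"
      unfolding devD(2)[OF G c(1) p0(1) c(2), symmetric] devD(2)[OF G c(1) p0(2) c', symmetric] U1 eq ..
    then show ?thesis using arg_cong[OF U1(2)[of v], of cnj] U1(2)[of u] by (simp add: hF_def N cnj_herm)
  qed
  have iso2: "hF (U z) (U u) (U v) = hF z u v" for z u v by (simp add: hF_def iso)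
  have Up: "U p = q"
  proof (rule injD[OF lp(3)])
    have "fd ?F p p = 0" "fd ?F q q = 0"
      using G_kernel[OF c(1) _ c(2), of p] G_kernel[OF c(1) _ c', of q] p0 by (auto intro: exI[of _ 1])
    then show "\<Phi> q (U p) = \<Phi> q q" unfolding \<Phi>U by (simp add: \<Phi>_def N)
  qed
  have U0: "U z ~= 0" if "z ~= 0" for z using iso[of z z] that by (auto simp: herm_zero)
  have GU: "dev (- {0}) (%z. G (U z))" by (rule dev_subset[OF dev_linear[OF G cU iso2]]) (use U0 in auto)
  have hU: "der U U p" using clinearv_linear[OF cU] by (intro bounded_linear_imp_has_derivative) (simp add: linear_conv_bounded_linear)
  have hq: "der ?F (fd ?F q) q"
    by (rule smooth_on_deriv[OF smooth_into_chart[OF devD(3)[OF G] c(1)]]) (use p0 c' in simp)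
  have "der (%z. ?F (U z)) (%u. fd ?F q (U u)) p" by (rule has_derivative_compose[OF hU]) (simp only: Up hq)
  then have "der (snd c o (%z. G (U z))) (fd ?F p) p" unfolding U1 by (simp add: comp_def)
  then have d: "fd ?F p = fd (snd c o (%z. G (U z))) p" by (rule frechet_derivative_at)
  have cn: "connected (- {0 :: 'n option V})" by (rule connected_punctured_universe) simp
  have "G z = G (U z)" if "z ~= 0" for z
    by (rule dev_unique[OF G GU _ cn p0(1) c _ d]) (use that Up eq in auto)
  then obtain a where "ALL u. U u = a *s u" using G_symmetry_scalar[OF cU iso] by metis
  then show ?thesis using Up by auto
qed

lemma G_injective:
  assumes z: "z ~= 0" "y ~= 0" and eq: "G z = G y" shows "cline z = cline y"
proof -
  let ?n = "%z. of_real (inverse (norm z)) *s z :: 'n option V"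
  have "G (?n z) = G (?n y)" using eq z by (simp add: G_scale)
  then obtain a where a: "?n y = a *s ?n z"
    using G_injective_unit[of "?n z" "?n y"] z by (auto simp: norm_smult norm_inverse)
  have a0: "a ~= 0" using a z by auto
  define b where "b = of_real (norm y) * (a * of_real (inverse (norm z)))"
  have b: "y = b *s z" "b ~= 0"
  proof -
    have "y = of_real (norm y) *s ?n y" using z by simp
    also have "... = b *s z" unfolding a b_def by (simp only: vector_smult_assoc mult.assoc)
    finally show "y = b *s z" .
    show "b ~= 0" using a0 z by (simp add: b_def)
  qed
  show ?thesis unfolding cline_def
  proof (intro equalityI image_subsetI)
    fix c
    have "c *s z = (c * inverse b) *s y" "c *s y = (c * b) *s z" using b by (simp_all add: vector_smult_assoc)
    then show "c *s z \<in> range (%a. a *s y)" "c *s y \<in> range (%a. a *s z)" by auto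
  qed
qed

end

end

section \<open>The isomorphism with projective space\<close>

lemma smooth_inverse:
  fixes f g :: "'a::euclidean_space => 'a"
  assumes A: "open A" and f: "smooth_on f A" and inj: "!!x. x \<in> A ==> inj (fd f x)" and gf: "!!x. x \<in> A ==> g (f x) = x"
  shows "smooth_on g (f ` A)" and "x \<in> A ==> fd f x (fd g (f x) v) = v"
proof -
  note h = smooth_on_deriv[OF f]
  note lin = has_derivative_linear[OF h]
  have e: "fd f x (inv (fd f x) v) = v" if "x \<in> A" for x v
    by (rule surj_f_inv_f[OF linear_injective_imp_surjective[OF lin[OF that] inj[OF that]]]) simp
  have hd: "der g (inv (fd f x)) (f x)" if "x \<in> A" for x
    by (rule has_derivative_inverse_strong[OF A that smooth_on_continuous[OF f] gf h[OF that]]) (auto simp: e[OF that])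
  show "x \<in> A ==> fd f x (fd g (f x) v) = v" using e frechet_derivative_at[OF hd] by metis
  have oA: "open (f ` A)"
    by (rule invariance_of_domain[OF smooth_on_continuous[OF f] A inj_on_inverseI[of A g]]) (rule gf)
  \<comment> \<open>The derivative of the inverse at \<open>f x\<close> is the inverse of the
    derivative of \<open>f\<close> at \<open>x\<close>. This is a total equation for
    \<open>g\<close> with right-hand side depending on the value of \<open>g\<close> alone, smooth
    by \<open>Ck_on_linear_solve\<close>.\<close>
  define w where "w p = inv (fd f (snd p))" for p :: "'a \<times> 'a"
  have oT: "open ((UNIV :: 'a set) \<times> A)" using A by (simp add: open_Times)
  have sd: "smooth_on (%p. fd f (snd p) u) ((UNIV :: 'a set) \<times> A)" for u
    by (rule smooth_on_compose[OF oT smooth_on_frechet[OF f] smooth_on_linear[OF bounded_linear_snd oT smooth_on_id[OF oT]]]) auto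
  have sw: "smooth_on (%p. w p v) (UNIV \<times> A)" for v
    unfolding smooth_on_def
    by (rule allI, rule Ck_on_linear_solve[where F="%p. fd f (snd p)" and l="%p. v", OF oT _ _ smooth_onD[OF sd] smooth_onD[OF smooth_on_const]])
      (auto simp: w_def e lin inj)
  have "Ck_on k g (f ` A)" for k
    by (rule Ck_on_total_differential[where w=w and T="UNIV \<times> A", OF oA sw]) (auto simp: w_def gf hd)
  then show "smooth_on g (f ` A)" by (simp add: smooth_on_def)
qed

text \<open>The inverse of the affine chart for \<open>t = 1\<close>, its differential for
  \<open>t = 0\<close>. As in \<open>cp_index\<close>, coordinate \<open>None\<close> takes over the
  entry of the missing index \<open>the i\<close>; for \<open>i = None\<close> the first branch has
  already handled it.\<close>

definition sec :: "'n::finite option => complex => 'n V => 'n option V" where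
  "sec i t x = (\<chi> k. if k = i then t else case k of None => x $ the i | Some j => x $ j)"

lemma cp_index_ne: "cp_index i j ~= i" by (auto simp: cp_index_def)
lemma cp_index_surj: "k ~= i ==> EX j. k = cp_index i j"
  by (cases k) (auto simp: cp_index_def intro: exI[of _ "the i"])
lemma cp_index_inj: "inj (cp_index i)" by (auto simp: inj_def cp_index_def split: if_splits)

lemma sec_nth: "sec i t x $ i = t" "sec i t x $ cp_index i j = x $ j"
  by (auto simp: sec_def cp_index_def)
lemma sec_eqI: "z $ i = t ==> (!!j. z $ cp_index i j = x $ j) ==> sec i t x = z"
  by (metis cp_index_surj sec_nth vec_eq_iff)
lemma sec_add: "sec i (s + t) (x + y) = sec i s x + sec i t y" and sec_scale: "sec i (a * t) (a *s x) = a *s sec i t x"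
  by (rule sec_eqI; simp add: sec_nth)+

lemma herm_sec: "herm (sec i s x) (sec i t y) = s * cnj t + herm x y"
proof -
  have U: "UNIV = insert i (range (cp_index i))" using cp_index_surj by blast
  have "i \<notin> range (cp_index i)" using cp_index_ne by (metis rangeE)
  then show ?thesis unfolding herm_def[of "sec i s x"] U by (simp add: sum.reindex[OF cp_index_inj] sec_nth herm_def)
qed

lemma sec_clinearv: "clinearv (sec i 0)"
  using sec_add[of i 0 0] sec_scale[of i _ 0] by (simp add: clinearv_def)
lemma sec_deriv: "der (sec i 1) (sec i 0) x"
proof -
  have "bounded_linear (sec i 0)" using clinearv_linear[OF sec_clinearv] by (simp add: linear_conv_bounded_linear)
  from has_derivative_add[OF has_derivative_const[of "sec i 1 0"] bounded_linear_imp_has_derivative[OF this]]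
  show ?thesis by (simp add: sec_add[symmetric])
qed
lemma sec_smooth: "smooth_on (sec i 1) UNIV"
proof -
  have "bounded_linear (sec i 0)" using clinearv_linear[OF sec_clinearv] by (simp add: linear_conv_bounded_linear)
  from smooth_on_add[OF open_UNIV smooth_on_const[of "sec i 1 0"] smooth_on_linear[OF this open_UNIV smooth_on_id[OF open_UNIV]]]
  show ?thesis by (simp add: sec_add[symmetric])
qed
lemma sec_0: "sec i 1 x ~= 0" using sec_nth(1)[of i 1 x] by auto

lemma cline_self: "z \<in> cline z" unfolding cline_def by (rule range_eqI[of _ _ 1]) simp
lemma cline_eqD: "cline y = cline z ==> y ~= 0 ==> EX a. a ~= 0 & y = a *s z"
  using cline_self[of y] by (auto simp: cline_def)
lemma cline_scale: "a ~= 0 ==> cline (a *s z) = cline z"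
proof (unfold cline_def, intro equalityI image_subsetI)
  fix b assume "a ~= 0"
  then have "b *s (a *s z) = (b * a) *s z" "b *s z = (b * inverse a) *s (a *s z)" by (simp_all add: vector_smult_assoc)
  then show "b *s (a *s z) \<in> range (%a. a *s z)" "b *s z \<in> range (%b. b *s (a *s z))" by (blast intro: range_eqI)+
qed

lemma cp_chart_sec:
  shows "snd (cp_chart i) (cline (sec i 1 x)) = x" and "cline (sec i 1 x) \<in> fst (cp_chart i)"
  by (simp add: cp_chart_cline sec_nth vec_eq_iff) (auto simp: cp_chart_def sec_nth)
lemma cline_sec: "z $ i ~= 0 ==> EX x. cline z = cline (sec i 1 x)"
proof
  assume z: "z $ i ~= 0"
  have "sec i 1 (\<chi> j. inverse (z $ i) * z $ cp_index i j) = inverse (z $ i) *s z" by (rule sec_eqI) (simp_all add: z)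
  then show "cline z = cline (sec i 1 (\<chi> j. inverse (z $ i) * z $ cp_index i j))" using z by (simp add: cline_scale)
qed
lemma cp_chart_fst: "fst (cp_chart i) = range (%x. cline (sec i 1 x))"
proof (intro equalityI subsetI)
  fix L assume "L \<in> fst (cp_chart i)"
  then obtain z where "z $ i ~= 0" "L = cline z" by (auto simp: cp_chart_def)
  then show "L \<in> range (%x. cline (sec i 1 x))" using cline_sec by blast
qed (use cp_chart_sec(2) in blast)
lemma cp_chart_inv: "inv_into (fst (cp_chart i)) (snd (cp_chart i)) x = cline (sec i 1 x)"
  by (rule inv_into_f_eq) (auto simp: cp_chart_fst inj_on_def cp_chart_sec)

lemma openin_cp: "openin cp_topology U \<longleftrightarrow> U <= cline ` (- {0}) & open {z. z ~= 0 & cline z \<in> U}"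
  unfolding cp_topology_def topology_inverse'[OF istopology_cp] ..
lemma topspace_cp: "topspace cp_topology = cline ` (- {0})"
proof -
  have e: "{z. z ~= 0 & cline z \<in> cline ` (- {0})} = - {0}" by auto
  have "openin cp_topology (cline ` (- {0}))" unfolding openin_cp e by (intro conjI subset_refl open_Compl closed_singleton)
  then show ?thesis using openin_subset openin_cp[THEN iffD1, OF openin_topspace] by blast
qed

context cp_manifold
begin

text \<open>In affine charts the inverse map \<open>f'\<close> is \<open>G\<close> on the section
  \<open>sec i 1\<close>; its representatives \<open>\<Psi>\<close> are smooth with injective
  complex linear differential. Those of \<open>f\<close> are treated as their inverses. The factor
  \<open>1 / \<kappa>\<close> undoes the scaling in \<open>hh\<close>.\<close>

lemma kaehler_isomorphic_CP:
  assumes G: "dev (- {0}) G" and hom: "homogeneous G"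
  shows "kaehler_isomorphic M g CP (%c x u v. 1 / \<kappa> * fubini_study c x u v)"
proof -
  define f where "f m = cline (SOME z. z ~= 0 & G z = m)" for m
  define f' where "f' L = G (SOME z. z ~= 0 & cline z = L)" for L
  note si = devD(3)[OF G]
  have f: "f (G z) = cline z" if "z ~= 0" for z
    using someI[of "%y. y ~= 0 & G y = G z" z] that G_injective[OF G hom] unfolding f_def by blast
  have f': "f' (cline z) = G z" if "z ~= 0" for z
  proof -
    let ?y = "SOME y. y ~= 0 & cline y = cline z"
    have "?y ~= 0 & cline ?y = cline z" by (rule someI[of _ z]) (use that in simp)
    then obtain a where a: "a ~= 0" "?y = a *s z" using cline_eqD by blast
    show ?thesis unfolding f'_def a(2) by (rule G_scale[OF G hom a(1)])
  qed
  have top: "EX z. z ~= 0 & m = G z" if "m \<in> TM" for m using that G_surj[OF G hom] by blast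
  have Gtop: "G z \<in> TM" if "z ~= 0" for z using that G_surj[OF G hom] by blast
  have cf: "continuous_map (mtop M) cp_topology f"
    unfolding continuous_map_def
  proof (intro conjI allI impI)
    show "f \<in> TM \<rightarrow> topspace cp_topology" using top f by (force simp: topspace_cp)
    fix U :: "('n option V) set set" assume U: "openin cp_topology U"
    have "{m \<in> TM. f m \<in> U} = G ` {z. z ~= 0 & cline z \<in> U}"
      using top f Gtop by (auto simp: image_iff) metis
    moreover have "openin (mtop M) (G ` {z. z ~= 0 & cline z \<in> U})" by (rule G_open[OF G hom]) (use U in "auto simp: openin_cp")
    ultimately show "openin (mtop M) {m \<in> TM. f m \<in> U}" by simp
  qed
  have cf': "continuous_map cp_topology (mtop M) f'"
    unfolding continuous_map_def
  proof (intro conjI allI impI)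
    show "f' \<in> topspace cp_topology \<rightarrow> TM" using f' Gtop by (force simp: topspace_cp)
    fix W assume W: "openin (mtop M) W"
    have "{z. z ~= 0 & cline z \<in> {L \<in> topspace cp_topology. f' L \<in> W}} = - {0} \<inter> G -` W" using f' by (auto simp: topspace_cp)
    then show "openin cp_topology {L \<in> topspace cp_topology. f' L \<in> W}"
      using smooth_into_open[OF si W] by (auto simp: openin_cp topspace_cp)
  qed
  have hm: "homeomorphic_maps (mtop M) cp_topology f f'"
    unfolding homeomorphic_maps_def using cf cf' top f f' by (fastforce simp: topspace_cp)
  define A where "A i c = {x. G (sec i 1 x) \<in> fst c}" for i and c :: "('m, 'n) chart"
  define \<Psi> where "\<Psi> i c x = snd c (G (sec i 1 x))" for i x and c :: "('m, 'n) chart"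
  have rep': "chart_rep f' (cp_chart i) c = \<Psi> i c" for i c
    by (simp add: chart_rep_def fun_eq_iff cp_chart_inv f' sec_0 \<Psi>_def)
  have dom': "chart_rep_dom f' (cp_chart i) c = A i c" for i c
    unfolding chart_rep_dom_def cp_chart_fst A_def by (force simp: cp_chart_sec f' sec_0 image_iff)
  have dom: "chart_rep_dom f c (cp_chart i) = \<Psi> i c ` A i c" if c: "c \<in> atlas M" for i c
  proof (intro equalityI subsetI)
    fix y assume "y \<in> chart_rep_dom f c (cp_chart i)"
    then obtain m x where m: "m \<in> fst c" "y = snd c m" "f m = cline (sec i 1 x)" by (auto simp: chart_rep_dom_def cp_chart_fst)
    obtain z where z: "z ~= 0" "m = G z" using top m(1) fst_subset[OF c] by blast
    then have "m = G (sec i 1 x)" using f[OF z(1)] f'[OF z(1)] f'[OF sec_0[of i x]] m(3) by simp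
    then show "y \<in> \<Psi> i c ` A i c" using m by (auto simp: A_def \<Psi>_def)
  next
    fix y assume "y \<in> \<Psi> i c ` A i c"
    then obtain x where "G (sec i 1 x) \<in> fst c" "y = snd c (G (sec i 1 x))" by (auto simp: A_def \<Psi>_def)
    then show "y \<in> chart_rep_dom f c (cp_chart i)" by (auto simp: chart_rep_dom_def f sec_0 cp_chart_sec)
  qed
  have inv: "chart_rep f c (cp_chart i) (\<Psi> i c x) = x" if "c \<in> atlas M" "x \<in> A i c" for c i x
    using that pt_snd[OF that(1)] by (simp add: chart_rep_def \<Psi>_def A_def f sec_0 cp_chart_sec)
  have loc: "open (A i c) & smooth_on (\<Psi> i c) (A i c) & (ALL x:A i c. clinearv (fd (\<Psi> i c) x) & inj (fd (\<Psi> i c) x) &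
      (ALL a b. g c (\<Psi> i c x) (fd (\<Psi> i c) x a) (fd (\<Psi> i c) x b) = 1 / \<kappa> * fubini_study (cp_chart i) x a b))" if c: "c \<in> atlas M" for i c
  proof (intro conjI ballI allI)
    let ?D = "- {0} \<inter> G -` fst c" and ?F = "snd c o G"
    have sF: "smooth_on ?F ?D" by (rule smooth_into_chart[OF si c])
    have AD: "A i c = sec i 1 -` ?D" using sec_0 by (auto simp: A_def)
    have "continuous_on UNIV (sec i 1)" by (rule smooth_on_continuous[OF sec_smooth])
    then show o: "open (A i c)" unfolding AD by (rule open_vimage[OF smooth_into_open[OF si openin_chart[OF c]]])
    have "smooth_on (%x. ?F (sec i 1 x)) (A i c)"
      by (rule smooth_on_compose[OF o sF smooth_on_subset[OF sec_smooth]]) (auto simp: AD)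
    then show "smooth_on (\<Psi> i c) (A i c)" by (simp add: \<Psi>_def[abs_def])
    fix x assume x: "x \<in> A i c"
    let ?z = "sec i 1 x"
    have z: "?z \<in> - {0}" "G ?z \<in> fst c" "?z ~= 0" using x sec_0 by (auto simp: A_def)
    have "der (%x. ?F (sec i 1 x)) (%u. fd ?F ?z (sec i 0 u)) x"
      by (rule has_derivative_compose[OF sec_deriv smooth_on_deriv[OF sF]]) (use z in simp)
    then have "der (\<Psi> i c) (%u. fd ?F ?z (sec i 0 u)) x" by (simp add: \<Psi>_def[abs_def])
    then have e: "fd (\<Psi> i c) x = (%u. fd ?F ?z (sec i 0 u))" by (rule frechet_derivative_at[symmetric])
    note cl = devD(1)[OF G c z(1,2)]
    show cl': "clinearv (fd (\<Psi> i c) x)" unfolding e clinearv_def by (simp add: clinearvD[OF cl] clinearvD[OF sec_clinearv])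
    show "inj (fd (\<Psi> i c) x)" unfolding linear_injective_0[OF clinearv_linear[OF cl']] unfolding e
    proof (intro allI impI)
      fix u assume "fd ?F ?z (sec i 0 u) = 0"
      then obtain a where a: "sec i 0 u = a *s ?z" using G_kernel[OF G hom c z(3,2)] by blast
      have "a = 0" using arg_cong[OF a, of "%w. w $ i"] by (simp add: sec_nth)
      then have "sec i 0 u $ cp_index i j = 0" for j unfolding a by simp
      then show "u = 0" by (simp add: sec_nth vec_eq_iff)
    qed
    fix a b
    define N where "N = 1 + (norm x)\<^sup>2"
    have hz: "herm ?z ?z = of_real N" by (simp add: herm_sec herm_self[of x] N_def)
    have N: "N > 0" using zero_le_power2[of "norm x"] unfolding N_def by linarith
    have d: "p / N - q / N\<^sup>2 = (N * p - q) / N\<^sup>2" for p q using N by (simp add: field_simps power2_eq_square)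
    have "\<kappa> * g c (\<Psi> i c x) (fd (\<Psi> i c) x a) (fd (\<Psi> i c) x b) = Re (hh c (snd c (G ?z)) (fd ?F ?z (sec i 0 a)) (fd ?F ?z (sec i 0 b)))"
      unfolding e by (simp add: hh_def hc_Re[OF c] \<Psi>_def)
    also have "... = Re (hF ?z (sec i 0 a) (sec i 0 b))" by (simp only: devD(2)[OF G c z(1,2)])
    also have "hF ?z (sec i 0 a) (sec i 0 b) = herm a b / of_real N - herm a x * herm x b / of_real (N\<^sup>2)"
      by (simp only: hF_def hz) (simp add: herm_sec)
    also have "Re ... = Re (herm a b) / N - Re (herm a x * herm x b) / N\<^sup>2"
      by (simp only: minus_complex.sel Re_divide_of_real)
    also have "... = fubini_study (cp_chart i) x a b" unfolding fubini_study_def N_def[symmetric] by (rule d)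
    finally show "g c (\<Psi> i c x) (fd (\<Psi> i c) x a) (fd (\<Psi> i c) x b) = 1 / \<kappa> * fubini_study (cp_chart i) x a b"
      using k by (simp add: field_simps)
  qed
  note loc = bspec[OF loc[THEN conjunct2, THEN conjunct2]] loc[THEN conjunct1] loc[THEN conjunct2, THEN conjunct1]
  have Q: "fd (\<Psi> i c) x (fd (chart_rep f c (cp_chart i)) (\<Psi> i c x) v) = v" if c: "c \<in> atlas M" and "x \<in> A i c" for c i x v
    by (rule smooth_inverse(2)[OF loc(2,3)[OF c]]) (use that loc(1)[OF c] inv in auto)
  have sf: "smooth_on (chart_rep f c (cp_chart i)) (\<Psi> i c ` A i c)" if c: "c \<in> atlas M" for c i
    by (rule smooth_inverse(1)[OF loc(2,3)[OF c]]) (use c loc(1)[OF c] inv in auto)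
  show ?thesis unfolding kaehler_isomorphic_def
  proof (intro exI conjI)
    show "homeomorphic_maps (mtop M) (mtop CP) f f'" using hm by (simp add: CP_def)
    show "smooth_map M CP f" using cf sf by (auto simp: smooth_map_def CP_def dom)
    show "smooth_map CP M f'" using cf' loc(3) by (auto simp: smooth_map_def CP_def dom' rep')
    show "ALL c:atlas M. ALL d:atlas CP. J_linear_on (chart_rep f c d) (chart_rep_dom f c d)"
    proof (intro ballI)
      fix c d assume c: "c \<in> atlas M" and "d \<in> atlas (CP :: (('n option V) set, 'n) charted)"
      then obtain i where d: "d = cp_chart i" by (auto simp: CP_def)
      show "J_linear_on (chart_rep f c d) (chart_rep_dom f c d)" unfolding J_linear_on_def d dom[OF c]
      proof (intro ballI allI)
        fix y v assume "y \<in> \<Psi> i c ` A i c"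
        then obtain x where x: "x \<in> A i c" "y = \<Psi> i c x" by blast
        note l = loc(1)[OF c x(1)]
        show "fd (chart_rep f c (cp_chart i)) y (J v) = J (fd (chart_rep f c (cp_chart i)) y v)"
          by (rule injD[OF conjunct1[OF conjunct2[OF l]]]) (simp add: x(2) J_def clinearvD[OF conjunct1[OF l]] Q[OF c x(1)])
      qed
    qed
    show "isometric f M g CP (%c x u v. 1 / \<kappa> * fubini_study c x u v)" unfolding isometric_def
    proof (intro ballI allI)
      fix c d y u v assume c: "c \<in> atlas M" and "d \<in> atlas (CP :: (('n option V) set, 'n) charted)" and y: "y \<in> chart_rep_dom f c d"
      then obtain i where d: "d = cp_chart i" by (auto simp: CP_def)
      obtain x where x: "x \<in> A i c" "y = \<Psi> i c x" using y unfolding d dom[OF c] by blast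
      show "1 / \<kappa> * fubini_study d (chart_rep f c d y) (fd (chart_rep f c d) y u) (fd (chart_rep f c d) y v) = g c y u v"
        unfolding d x(2) inv[OF c x(1)] using loc(1)[OF c x(1)] Q[OF c x(1)] by metis
    qed
  qed
qed

end

theorem theorem5:
  fixes M :: "('m, 'n::finite) charted" and g h :: "('m, 'n) metric"
  assumes "complex_manifold M"
    and "compact_space (mtop M)"
    and "connected_space (mtop M)"
    and "CARD('n) \<ge> 2"
    and "kaehler_einstein M g"
    and "kaehler_einstein M h"
    and "c_projectively_equivalent M g h"
    and "\<not> (\<exists>k. k \<noteq> 0 \<and>
              kaehler_isomorphic M g (CP :: (_, 'n) charted) (\<lambda>c x u v. k * fubini_study c x u v))"
  shows "affinely_equivalent M g h"
proof -
  interpret kaehler_pair M g h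
    using assms by (auto intro!: kaehler_pair.intro kaehler_manifold.intro cmanifold.intro kaehler_manifold_axioms.intro
      kaehler_pair_axioms.intro simp: kaehler_einstein_def)
  obtain f th S \<kappa> where T: "tanno_manifold M g f th S \<kappa>"
    and aff: "(ALL c:atlas M. ALL x:chart_image c. ALL v. th c x v = 0) --> affinely_equivalent M g h"
    using tanno_manifold_ex[OF assms(5,6)] by blast
  interpret T: tanno_manifold M g f th S \<kappa> by (rule T)
  show ?thesis
  proof (rule ccontr)
    assume "~ affinely_equivalent M g h"
    then have nt: "~ (ALL c:atlas M. ALL x:chart_image c. ALL v. th c x v = 0)" using aff by blast
    then have k: "\<kappa> ~= 0" and pos: "\<And>c x u. c \<in> atlas M \<Longrightarrow> x \<in> chart_image c \<Longrightarrow> u ~= 0 \<Longrightarrow> \<kappa> * g c x u u > 0"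
      using T.positive_or_trivial[OF assms(2,3)] by blast+
    interpret C: cp_manifold M g f th S \<kappa>
      by unfold_locales (rule assms(2,3) k pos T.constant_curvature[OF assms(2,3) k pos nt]; assumption?)+
    have "topspace (mtop M) ~= {}" using nt A.pt_top by fastforce
    then obtain G where "C.dev (- {0}) G" "C.homogeneous G" using C.dev_global by blast
    then have "kaehler_isomorphic M g CP (\<lambda>c x u v. 1 / \<kappa> * fubini_study c x u v)" by (rule C.kaehler_isomorphic_CP)
    then show False using assms(8) k by (metis divide_eq_0_iff zero_neq_one)
  qed
qed

end
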